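(* Let $\rho$ be a genuine irreducible smooth representation of $\widetilde{T^1}$ with central character $\chi$, primitive mod $m$ ($m\ge 1$), and let $\chi_k$, $0\le k<\underline{n}$, be all the possible extensions of $\chi$ to $A^1$. Put $V_k=\mathrm{Ind}_{\widetilde{B^1}\cap\widetilde{K^1}}^{\widetilde{K^1}}\chi_k$. Then $$\mathrm{Res}_{\widetilde{K^1}}\mathrm{Ind}_{\widetilde{B^1}}^{\widetilde{G^1}}\rho\;\cong\;\bigoplus_{k=0}^{\underline{n}-1}V_k^{K^1_m}\;\oplus\;\bigoplus_{l>m}\left(\widetilde{W}^+_{0,l}\oplus\widetilde{W}^-_{0,l}\right)^{\oplus\underline{n}},$$ where, for every $l>m$, $\widetilde W^+_{0,l}$ and $\widetilde W^-_{0,l}$ are two inequivalent irreducible representations of $\widetilde{K^1}$ of the same dimension, and $\widetilde W^+_{0,l}\oplus\widetilde W^-_{0,l}\cong V_0^{K^1_l}/V_0^{K^1_{l-1}}$. The representations $V_k^{K^1_m}$, $0\le k<\underline{n}$, are irreducible and mutually inequivalent, except when $m=1$ and for some $0\le k<\underline{n}$ the restriction $\chi_k|_{T^1\cap K^1}$ is a quadratic character. In this exceptional case, up to relabelling (i.e. taking this $\chi_k$ as the base extension $\chi_0$), we can assume that $\chi_0|_{T^1\cap K^1}$ is a quadratic character, and we are in one of the following situations: (1) If $4\nmid n$, then $V_k^{K^1_1}$ is reducible if and only if $k=0$, in which case it decomposes into two irreducible constituents. Moreover, for $i\ne k$, $V_i^{K^1_1}\cong V_k^{K^1_1}$ exactly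 when $i+k=\underline{n}$. (2) If $4\mid n$, then $V_k^{K^1_1}$ is reducible if and only if $k=0$ or $k=\frac n4$, in which case it decomposes into two irreducible constituents. Moreover, for $i\neq k$, $V_i^{K^1_1}\cong V_k^{K^1_1}$ exactly when $i+k=\underline{n}$.
   Context: Let $\mathbb F$ be a non-Archimedean local field with ring of integers $\mathcal O$, maximal ideal $\mathfrak p$, residue field $\kappa=\mathcal O/\mathfrak p$ of cardinality $q$, fixed uniformizer $\varpi$ and valuation $\mathrm{val}$. Let $n\ge 2$ be an integer with $n\mid q-1$; $\mathbb F$ contains the group $\mu_n$ of $n$-th roots of unity (identified by reduction with the $n$-th roots of unity in $\kappa^\times$). Put $\underline n=n$ if $n$ is odd, $\underline n=n/2$ if $n$ is even. The $n$-th Hilbert symbol $(\cdot,\cdot)_n:\mathbb F^\times\times\mathbb F^\times\to\mu_n$ is $(a,b)_n=\overline c^{(q-1)/n}$, $c=(-1)^{\mathrm{val}(a)\mathrm{val}(b)}a^{\mathrm{val}(b)}/b^{\mathrm{val}(a)}$, $\overline c$ the image of $c$ in $\kappa^\times$. $G^1=\mathrm{SL}_2(\mathbb F)$; $B^1$ is the upper triangular Borel subgroup, $N^1$ its unipotent radical, $T^1$ the diagonal torus, $K^1=\mathrm{SL}_2(\mathcal O)$, $K^1_j=\{g\in K^1: g\equiv I_2 \bmod \mathfrak p^j\}$ for $j\ge1$. The covering group $\widetilde{G^1}$ is the set $G^1\times\mu_n$ with multiplication $(g_1,\zeta_1)(g_2,\zeta_2)=(g_1g_2,\beta(g_1,g_2)\zeta_1\zeta_2)$,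 where $\beta(g_1,g_2)=\left(\frac{X(g_1g_2)}{X(g_1)},\frac{X(g_1g_2)}{X(g_2)}\right)_n$ and $X\begin{pmatrix}a&b\\c&d\end{pmatrix}=c$ if $c\ne0$, $=d$ otherwise. For a subgroup $H\le G^1$, $\widetilde H$ is its full inverse image in $\widetilde{G^1}$. Write $\mathrm{dg}(t)=\mathrm{diag}(t,t^{-1})$. The subgroups $N^1$, $K^1_j$ ($j\ge 1$), $T^1\cap K^1$, $B^1\cap K^1$ are identified with subgroups of $\widetilde{G^1}$ via $h\mapsto(h,1)$; $\widetilde{B^1}=\widetilde{T^1}\ltimes N^1$. Fix a faithful character $\epsilon:\mu_n\to\mathbb C^\times$; "genuine" means $\mu_n$ acts by $\epsilon$. One has $Z(\widetilde{T^1})=\{(\mathrm{dg}(t),\zeta): t\in(\mathbb F^{\times})^{\underline n},\zeta\in\mu_n\}$, and $A^1=\{(\mathrm{dg}(a),\zeta): a\in\mathbb F^\times,\ \underline n\mid\mathrm{val}(a),\ \zeta\in\mu_n\}$ is a maximal abelian subgroup of $\widetilde{T^1}$. For a genuine smooth character $\chi$ of $Z(\widetilde{T^1})$ there is a unique irreducible representation $\rho$ of $\widetilde{T^1}$ with central character $\chi$, namely $\rho\cong\mathrm{Ind}_{A^1}^{\widetilde{T^1}}\chi_0$ for any extension $\chi_0$ of $\chi$ to $A^1$; $\rho$ is extended trivially over $N^1$ to $\widetilde{B^1}$. Fix $\chi_0$; with $\vartheta(a)=(\varpi,a)_n$, the extensions of $\chi$ to $A^1$ are labelled by $\chi_i(\mathrm{dg}(a\varpi^{\underline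 n r}),\zeta)=\chi_0(\mathrm{dg}(a\varpi^{\underline n r}),\vartheta(a)^{2i}\zeta)$ for $a\in\mathcal O^\times$, $r\in\mathbb Z$, $\zeta\in\mu_n$, $0\le i<\underline n$. Also write $\chi_i$ for its restriction to $\widetilde{T^1}\cap\widetilde{K^1}$, extended trivially on $N^1\cap K^1$ to $\widetilde{B^1}\cap\widetilde{K^1}$. The character $\chi$ is primitive mod $m$ if $m$ is the smallest strictly positive integer such that $\chi$ is trivial on $Z(\widetilde{T^1})\cap K^1_m$. $\mathrm{Ind}$ denotes smooth non-normalized induction, and $V^{K^1_l}$ the space of $K^1_l$-fixed vectors (a $\widetilde{K^1}$-representation, as $K^1_l$ is normal). A quadratic character means a character whose square is trivial (the trivial character is allowed).
   Formalization: Odd residual characteristic is assumed (for even q the splitting into two equal-dimensional W± fails); outside the exceptional case, inequivalence is not claimed for pairs i≠k with m=1, 4|n and χ_iχ_k=1 on T¹∩K¹, where V_i and V_k at level 1 are in fact isomorphic. *)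

theory Defs
  imports
    "HOL-Analysis.Determinants"
    "HOL-Algebra.Group"
    "HOL-Library.Function_Algebras"
    "HOL-Library.Set_Algebras"
    "HOL-Library.Product_Plus"
begin

section \<open>Complex vector spaces\<close>

class complex_vector = ab_group_add +
  fixes scaleC :: "complex \<Rightarrow> 'a \<Rightarrow> 'a"  (infixr "*\<^sub>C" 75)
  assumes scaleC_add_right: "c *\<^sub>C (x + y) = c *\<^sub>C x + c *\<^sub>C y"
    and scaleC_add_left: "(c + d) *\<^sub>C x = c *\<^sub>C x + d *\<^sub>C x"
    and scaleC_scaleC: "c *\<^sub>C d *\<^sub>C x = (c * d) *\<^sub>C x"
    and scaleC_one: "1 *\<^sub>C x = x"

interpretation complex_vector: vector_space "scaleC :: complex \<Rightarrow> 'a \<Rightarrow> 'a::complex_vector"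
  by unfold_locales (simp_all add: scaleC_add_right scaleC_add_left scaleC_scaleC scaleC_one)

instantiation complex :: complex_vector
begin
definition scaleC_complex :: "complex \<Rightarrow> complex \<Rightarrow> complex"
  where "scaleC_complex c x = c * x"
instance
  by standard (simp_all add: scaleC_complex_def algebra_simps)
end

instantiation "fun" :: (type, complex_vector) complex_vector
begin
definition scaleC_fun :: "complex \<Rightarrow> ('a \<Rightarrow> 'b) \<Rightarrow> 'a \<Rightarrow> 'b"
  where "scaleC_fun c f = (\<lambda>x. c *\<^sub>C f x)"
instance
  by standard
    (simp_all add: scaleC_fun_def fun_eq_iff scaleC_add_right scaleC_add_left
      scaleC_scaleC scaleC_one)
end

instantiation prod :: (complex_vector, complex_vector) complex_vector
begin
definition scaleC_prod :: "complex \<Rightarrow> 'a \<times> 'b \<Rightarrow> 'a \<times> 'b"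
  where "scaleC_prod c p = (c *\<^sub>C fst p, c *\<^sub>C snd p)"
instance
  by standard
    (simp_all add: scaleC_prod_def prod_eq_iff scaleC_add_right scaleC_add_left
      scaleC_scaleC scaleC_one)
end


section \<open>Representations\<close>

text \<open>A representation of a group \<open>G\<close> lives on a linear subspace \<open>rspace R\<close> of a complex vector
  space type; \<open>ract R g\<close> is only meaningful for \<open>g \<in> carrier G\<close> and on \<open>rspace R\<close>.  Restriction
  to a subgroup therefore does not change \<open>R\<close>, only the group it is considered over.\<close>

record ('g, 'v) rep =
  rspace :: "'v set"
  ract :: "'g \<Rightarrow> 'v \<Rightarrow> 'v"

definition representation :: "('g, 'm) monoid_scheme \<Rightarrow> ('g, 'v::complex_vector) rep \<Rightarrow> bool" where
  "representation G R \<longleftrightarrow>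
     complex_vector.subspace (rspace R) \<and>
     (\<forall>g\<in>carrier G. \<forall>x\<in>rspace R. ract R g x \<in> rspace R) \<and>
     (\<forall>g\<in>carrier G. \<forall>x\<in>rspace R. \<forall>y\<in>rspace R. ract R g (x + y) = ract R g x + ract R g y) \<and>
     (\<forall>g\<in>carrier G. \<forall>c. \<forall>x\<in>rspace R. ract R g (c *\<^sub>C x) = c *\<^sub>C ract R g x) \<and>
     (\<forall>x\<in>rspace R. ract R \<one>\<^bsub>G\<^esub> x = x) \<and>
     (\<forall>g\<in>carrier G. \<forall>h\<in>carrier G. \<forall>x\<in>rspace R. ract R (g \<otimes>\<^bsub>G\<^esub> h) x = ract R g (ract R h x))"

definition reducible :: "('g, 'm) monoid_scheme \<Rightarrow> ('g, 'v::complex_vector) rep \<Rightarrow> bool" where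
  "reducible G R \<longleftrightarrow>
     (\<exists>U. complex_vector.subspace U \<and> U \<subseteq> rspace R \<and>
          (\<forall>g\<in>carrier G. \<forall>x\<in>U. ract R g x \<in> U) \<and> U \<noteq> {0} \<and> U \<noteq> rspace R)"

definition irreducible_rep :: "('g, 'm) monoid_scheme \<Rightarrow> ('g, 'v::complex_vector) rep \<Rightarrow> bool" where
  "irreducible_rep G R \<longleftrightarrow> representation G R \<and> rspace R \<noteq> {0} \<and> \<not> reducible G R"

definition rep_iso ::
  "('g, 'm) monoid_scheme \<Rightarrow> ('g, 'v::complex_vector) rep \<Rightarrow> ('g, 'w::complex_vector) rep \<Rightarrow> bool" where
  "rep_iso G R S \<longleftrightarrow>
     (\<exists>\<phi>. bij_betw \<phi> (rspace R) (rspace S) \<and>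
          (\<forall>x\<in>rspace R. \<forall>y\<in>rspace R. \<phi> (x + y) = \<phi> x + \<phi> y) \<and>
          (\<forall>c. \<forall>x\<in>rspace R. \<phi> (c *\<^sub>C x) = c *\<^sub>C \<phi> x) \<and>
          (\<forall>g\<in>carrier G. \<forall>x\<in>rspace R. \<phi> (ract R g x) = ract S g (\<phi> x)))"

text \<open>\<open>R\<close> is isomorphic to the quotient of \<open>S\<close> by its subrepresentation \<open>U\<close>.  The points of the
  quotient are the cosets \<open>v +o U\<close>; sum, scalar multiple and translate of cosets are given by
  representatives.\<close>

definition rep_iso_quotient ::
  "('g, 'm) monoid_scheme \<Rightarrow> ('g, 'v::complex_vector) rep \<Rightarrow> ('g, 'w::complex_vector) rep \<Rightarrow>
     'w set \<Rightarrow> bool" where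
  "rep_iso_quotient G R S U \<longleftrightarrow>
     (\<exists>\<phi>. bij_betw \<phi> (rspace R) ((\<lambda>v. v +o U) ` rspace S) \<and>
          (\<forall>x\<in>rspace R. \<forall>y\<in>rspace R. \<forall>v\<in>rspace S. \<forall>w\<in>rspace S.
             \<phi> x = v +o U \<longrightarrow> \<phi> y = w +o U \<longrightarrow> \<phi> (x + y) = (v + w) +o U) \<and>
          (\<forall>c. \<forall>x\<in>rspace R. \<forall>v\<in>rspace S.
             \<phi> x = v +o U \<longrightarrow> \<phi> (c *\<^sub>C x) = (c *\<^sub>C v) +o U) \<and>
          (\<forall>g\<in>carrier G. \<forall>x\<in>rspace R. \<forall>v\<in>rspace S.
             \<phi> x = v +o U \<longrightarrow> \<phi> (ract R g x) = ract S g v +o U))"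

definition rep_sum ::
  "('g, 'v::complex_vector) rep \<Rightarrow> ('g, 'w::complex_vector) rep \<Rightarrow> ('g, 'v \<times> 'w) rep"
  (infixr "\<oplus>\<^sub>R" 65) where
  "R \<oplus>\<^sub>R S = \<lparr>rspace = rspace R \<times> rspace S, ract = (\<lambda>g (x, y). (ract R g x, ract S g y))\<rparr>"

definition rep_dsum :: "'i set \<Rightarrow> ('i \<Rightarrow> ('g, 'v::complex_vector) rep) \<Rightarrow> ('g, 'i \<Rightarrow> 'v) rep" where
  "rep_dsum I R =
     \<lparr>rspace = {f. (\<forall>i\<in>I. f i \<in> rspace (R i)) \<and> (\<forall>i. i \<notin> I \<longrightarrow> f i = 0) \<and> finite {i. f i \<noteq> 0}},
      ract = (\<lambda>g f i. if i \<in> I then ract (R i) g (f i) else 0)\<rparr>"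

definition rep_fixed :: "('g, 'v::complex_vector) rep \<Rightarrow> 'g set \<Rightarrow> ('g, 'v) rep" where
  "rep_fixed R S = R\<lparr>rspace := {x \<in> rspace R. \<forall>s\<in>S. ract R s x = x}\<rparr>"

definition char_rep :: "('g \<Rightarrow> complex) \<Rightarrow> ('g, complex) rep" where
  "char_rep \<psi> = \<lparr>rspace = UNIV, ract = (\<lambda>g z. \<psi> g * z)\<rparr>"

definition group_char :: "('g, 'm) monoid_scheme \<Rightarrow> ('g \<Rightarrow> complex) \<Rightarrow> bool" where
  "group_char G \<psi> \<longleftrightarrow>
     (\<forall>x\<in>carrier G. \<psi> x \<noteq> 0) \<and>
     (\<forall>x\<in>carrier G. \<forall>y\<in>carrier G. \<psi> (x \<otimes>\<^bsub>G\<^esub> y) = \<psi> x * \<psi> y)"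

definition group_center :: "('g, 'm) monoid_scheme \<Rightarrow> 'g set" where
  "group_center G = {z \<in> carrier G. \<forall>x\<in>carrier G. z \<otimes>\<^bsub>G\<^esub> x = x \<otimes>\<^bsub>G\<^esub> z}"


section \<open>Non-Archimedean local fields\<close>

text \<open>The value of the valuation at \<open>0\<close> is irrelevant: \<open>fpow v j\<close> is the \<open>j\<close>-th power
  of the maximal ideal, so \<open>fpow v 0\<close> is the ring of integers and \<open>fpow v 1\<close> its maximal ideal.\<close>

definition fpow :: "('a::field \<Rightarrow> int) \<Rightarrow> int \<Rightarrow> 'a set" where
  "fpow v j = {x. x = 0 \<or> j \<le> v x}"

definition residue_field :: "('a::field \<Rightarrow> int) \<Rightarrow> 'a set set" where
  "residue_field v = (\<lambda>x. x +o fpow v 1) ` fpow v 0"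

abbreviation residue_card :: "('a::field \<Rightarrow> int) \<Rightarrow> nat" where
  "residue_card v \<equiv> card (residue_field v)"

locale nonarch_local_field =
  fixes v :: "'a::field \<Rightarrow> int"
  assumes val_mult: "x \<noteq> 0 \<Longrightarrow> y \<noteq> 0 \<Longrightarrow> v (x * y) = v x + v y"
    and val_add: "x \<noteq> 0 \<Longrightarrow> y \<noteq> 0 \<Longrightarrow> x + y \<noteq> 0 \<Longrightarrow> min (v x) (v y) \<le> v (x + y)"
    and val_surj: "\<exists>x. x \<noteq> 0 \<and> v x = 1"
    and val_complete: "\<forall>s :: nat \<Rightarrow> 'a.
          (\<forall>N. \<exists>M. \<forall>i\<ge>M. \<forall>j\<ge>M. s i - s j \<in> fpow v N) \<longrightarrow>
          (\<exists>L. \<forall>N. \<exists>M. \<forall>i\<ge>M. s i - L \<in> fpow v N)"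
    and finite_residue_field: "finite (residue_field v)"

definition mu :: "nat \<Rightarrow> 'a::field set" where
  "mu n = {z. z ^ n = 1}"

definition nbar :: "nat \<Rightarrow> nat" where
  "nbar n = (if odd n then n else n div 2)"

text \<open>The Hilbert symbol with values in the \<open>n\<close>-th roots of unity of the field itself, i.e. the
  unique root of unity whose reduction is the stated element of the residue field.\<close>

definition hilbert :: "('a::field \<Rightarrow> int) \<Rightarrow> nat \<Rightarrow> 'a \<Rightarrow> 'a \<Rightarrow> 'a" where
  "hilbert v n a b =
     (let c = (- 1) powi (v a * v b) * a powi v b / b powi v a
      in THE z. z \<in> mu n \<and> z - c ^ ((residue_card v - 1) div n) \<in> fpow v 1)"


section \<open>The covering group\<close>

type_synonym 'a cov = "('a^2^2) \<times> 'a"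

definition SL2 :: "('a::field^2^2) set" where
  "SL2 = {g. det g = 1}"

definition B1 :: "('a::field^2^2) set" where
  "B1 = {g \<in> SL2. g $ 2 $ 1 = 0}"

definition T1 :: "('a::field^2^2) set" where
  "T1 = {g \<in> SL2. g $ 1 $ 2 = 0 \<and> g $ 2 $ 1 = 0}"

definition K1 :: "('a::field \<Rightarrow> int) \<Rightarrow> ('a^2^2) set" where
  "K1 v = {g \<in> SL2. \<forall>i k. g $ i $ k \<in> fpow v 0}"

definition Kc :: "('a::field \<Rightarrow> int) \<Rightarrow> nat \<Rightarrow> ('a^2^2) set" where
  "Kc v j = {g \<in> K1 v. \<forall>i k. (g - mat 1) $ i $ k \<in> fpow v (int j)}"

definition dg :: "'a::field \<Rightarrow> 'a^2^2" where
  "dg t = vector [vector [t, 0], vector [0, inverse t]]"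

definition Xf :: "'a::field^2^2 \<Rightarrow> 'a" where
  "Xf g = (if g $ 2 $ 1 \<noteq> 0 then g $ 2 $ 1 else g $ 2 $ 2)"

definition cocycle :: "('a::field \<Rightarrow> int) \<Rightarrow> nat \<Rightarrow> 'a^2^2 \<Rightarrow> 'a^2^2 \<Rightarrow> 'a" where
  "cocycle v n g h = hilbert v n (Xf (g ** h) / Xf g) (Xf (g ** h) / Xf h)"

text \<open>\<open>tilde v n H\<close> is the full inverse image of \<open>H \<subseteq> SL2\<close> in the covering group
  \<open>tilde v n SL2\<close>.\<close>

definition tilde :: "('a::field \<Rightarrow> int) \<Rightarrow> nat \<Rightarrow> ('a^2^2) set \<Rightarrow> 'a cov monoid" where
  "tilde v n H =
     \<lparr>carrier = H \<times> mu n,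
      mult = (\<lambda>(g, z) (h, w). (g ** h, cocycle v n g h * z * w)),
      one = (mat 1, 1)\<rparr>"

definition A1 :: "('a::field \<Rightarrow> int) \<Rightarrow> nat \<Rightarrow> 'a cov set" where
  "A1 v n = {(dg a, z) | a z. a \<noteq> 0 \<and> int (nbar n) dvd v a \<and> z \<in> mu n}"

text \<open>The projection from the inverse image of the Borel subgroup to that of the torus.  For \<open>g\<close>
  upper triangular with diagonal entry \<open>a\<close> and \<open>u\<close> its unipotent part,
  \<open>(g, z) = (dg a, z) (u, 1)\<close> in the cover, because the cocycle takes the value \<open>1\<close> on \<open>(dg a, u)\<close>.
  Extending trivially over the unipotent radical is composing with this projection.\<close>

definition torus_part :: "'a::field cov \<Rightarrow> 'a cov" where
  "torus_part = (\<lambda>(g, z). (dg (g $ 1 $ 1), z))"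

definition inflate :: "('a::field cov, 'v::complex_vector) rep \<Rightarrow> ('a cov, 'v) rep" where
  "inflate R = R\<lparr>ract := (\<lambda>b. ract R (torus_part b))\<rparr>"

definition faithful_char :: "nat \<Rightarrow> ('a::field \<Rightarrow> complex) \<Rightarrow> bool" where
  "faithful_char n \<epsilon> \<longleftrightarrow>
     (\<forall>z\<in>mu n. \<epsilon> z \<noteq> 0) \<and> (\<forall>z\<in>mu n. \<forall>w\<in>mu n. \<epsilon> (z * w) = \<epsilon> z * \<epsilon> w) \<and> inj_on \<epsilon> (mu n)"

definition genuine ::
  "nat \<Rightarrow> ('a::field \<Rightarrow> complex) \<Rightarrow> ('a cov, 'v::complex_vector) rep \<Rightarrow> bool" where
  "genuine n \<epsilon> R \<longleftrightarrow> (\<forall>z\<in>mu n. \<forall>x\<in>rspace R. ract R (mat 1, z) x = \<epsilon> z *\<^sub>C x)"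

text \<open>The subgroups \<open>{(k, 1) | k \<in> Kc v j}\<close>, \<open>j \<ge> 1\<close>, form a neighbourhood basis of the identity in
  the covering group, so these are the usual openness conditions on stabilisers.\<close>

definition smooth_rep ::
  "('a::field \<Rightarrow> int) \<Rightarrow> ('a^2^2) set \<Rightarrow> ('a cov, 'v::complex_vector) rep \<Rightarrow> bool" where
  "smooth_rep v H R \<longleftrightarrow> (\<forall>x\<in>rspace R. \<exists>j\<ge>1. \<forall>k\<in>H \<inter> Kc v j. ract R (k, 1) x = x)"

text \<open>Smooth non-normalized induction to \<open>tilde v n G\<close> from \<open>tilde v n H\<close>, acting by right
  translation.  Functions on the group are extended by \<open>0\<close> to the whole type.\<close>

definition ind ::
  "('a::field \<Rightarrow> int) \<Rightarrow> nat \<Rightarrow> ('a^2^2) set \<Rightarrow> ('a^2^2) set \<Rightarrow>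
     ('a cov, 'v::complex_vector) rep \<Rightarrow> ('a cov, 'a cov \<Rightarrow> 'v) rep" where
  "ind v n G H \<sigma> =
     \<lparr>rspace = {f.
        (\<forall>x. x \<notin> carrier (tilde v n G) \<longrightarrow> f x = 0) \<and>
        (\<forall>x\<in>carrier (tilde v n G). f x \<in> rspace \<sigma>) \<and>
        (\<forall>h\<in>carrier (tilde v n H). \<forall>x\<in>carrier (tilde v n G).
           f (h \<otimes>\<^bsub>tilde v n G\<^esub> x) = ract \<sigma> h (f x)) \<and>
        (\<exists>j\<ge>1. \<forall>k\<in>G \<inter> Kc v j. \<forall>x\<in>carrier (tilde v n G).
           f (x \<otimes>\<^bsub>tilde v n G\<^esub> (k, 1)) = f x)},
      ract = (\<lambda>g f x. if x \<in> carrier (tilde v n G) then f (x \<otimes>\<^bsub>tilde v n G\<^esub> g) else 0)\<rparr>"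


section \<open>Characters of the maximal abelian subgroup and their induced representations\<close>

definition has_central_char ::
  "('a::field \<Rightarrow> int) \<Rightarrow> nat \<Rightarrow> ('a cov, 'v::complex_vector) rep \<Rightarrow>
     ('a cov \<Rightarrow> complex) \<Rightarrow> bool" where
  "has_central_char v n R chi \<longleftrightarrow>
     (\<forall>z\<in>group_center (tilde v n T1). \<forall>x\<in>rspace R. ract R z x = chi z *\<^sub>C x)"

definition trivial_on_level ::
  "('a::field \<Rightarrow> int) \<Rightarrow> nat \<Rightarrow> ('a cov \<Rightarrow> complex) \<Rightarrow> nat \<Rightarrow> bool" where
  "trivial_on_level v n chi j \<longleftrightarrow>
     (\<forall>k\<in>Kc v j. (k, 1) \<in> group_center (tilde v n T1) \<longrightarrow> chi (k, 1) = 1)"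

definition primitive_mod ::
  "('a::field \<Rightarrow> int) \<Rightarrow> nat \<Rightarrow> ('a cov \<Rightarrow> complex) \<Rightarrow> nat \<Rightarrow> bool" where
  "primitive_mod v n chi m \<longleftrightarrow>
     m \<ge> 1 \<and> trivial_on_level v n chi m \<and> (\<forall>j. 1 \<le> j \<and> j < m \<longrightarrow> \<not> trivial_on_level v n chi j)"

definition extends_to_A1 ::
  "('a::field \<Rightarrow> int) \<Rightarrow> nat \<Rightarrow> ('a cov \<Rightarrow> complex) \<Rightarrow> ('a cov \<Rightarrow> complex) \<Rightarrow> bool" where
  "extends_to_A1 v n chi chi0 \<longleftrightarrow>
     group_char ((tilde v n T1)\<lparr>carrier := A1 v n\<rparr>) chi0 \<and>
     (\<forall>z\<in>group_center (tilde v n T1). chi0 z = chi z)"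

text \<open>The \<open>i\<close>-th extension relative to the base extension \<open>chi0\<close>.  For \<open>g = dg t\<close>, where
  \<open>nbar n\<close> divides \<open>v t\<close>, the unit \<open>a\<close> with \<open>t = a * \<pi> ^ (nbar n * r)\<close> is \<open>t / \<pi> powi v t\<close>.\<close>

definition char_ext ::
  "('a::field \<Rightarrow> int) \<Rightarrow> 'a \<Rightarrow> nat \<Rightarrow> ('a cov \<Rightarrow> complex) \<Rightarrow> nat \<Rightarrow> 'a cov \<Rightarrow> complex" where
  "char_ext v \<pi> n chi0 i =
     (\<lambda>(g, z). let t = g $ 1 $ 1; a = t / \<pi> powi v t
               in chi0 (g, hilbert v n \<pi> a ^ (2 * i) * z))"

definition V_ind ::
  "('a::field \<Rightarrow> int) \<Rightarrow> nat \<Rightarrow> ('a cov \<Rightarrow> complex) \<Rightarrow>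
     ('a cov, 'a cov \<Rightarrow> complex) rep" where
  "V_ind v n \<psi> = ind v n (K1 v) (B1 \<inter> K1 v) (inflate (char_rep \<psi>))"

definition V_fixed ::
  "('a::field \<Rightarrow> int) \<Rightarrow> nat \<Rightarrow> ('a cov \<Rightarrow> complex) \<Rightarrow> nat \<Rightarrow>
     ('a cov, 'a cov \<Rightarrow> complex) rep" where
  "V_fixed v n \<psi> l = rep_fixed (V_ind v n \<psi>) ((\<lambda>k. (k, 1)) ` Kc v l)"

definition quadratic_on_units ::
  "('a::field \<Rightarrow> int) \<Rightarrow> ('a cov \<Rightarrow> complex) \<Rightarrow> bool" where
  "quadratic_on_units v \<psi> \<longleftrightarrow> (\<forall>h\<in>T1 \<inter> K1 v. \<psi> (h, 1) ^ 2 = 1)"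

definition inverse_on_units ::
  "('a::field \<Rightarrow> int) \<Rightarrow> ('a cov \<Rightarrow> complex) \<Rightarrow> ('a cov \<Rightarrow> complex) \<Rightarrow> bool" where
  "inverse_on_units v \<phi> \<psi> \<longleftrightarrow> (\<forall>h\<in>T1 \<inter> K1 v. \<phi> (h, 1) * \<psi> (h, 1) = 1)"

definition two_irreducible_constituents ::
  "('g, 'm) monoid_scheme \<Rightarrow> ('g, 'v::complex_vector) rep \<Rightarrow> bool" where
  "two_irreducible_constituents G R \<longleftrightarrow>
     (\<exists>(P :: ('g, 'v) rep) (Q :: ('g, 'v) rep). irreducible_rep G P \<and> irreducible_rep G Q \<and> rep_iso G R (P \<oplus>\<^sub>R Q))"

end

theory Submission
  imports Defs "HOL-Computational_Algebra.Polynomial"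
begin

text \<open>
  Over \<open>K1\<close> the cocycle splits, so each \<open>V\<^sub>k\<close> becomes a space of functions on \<open>K1\<close> that transform on the
  left under the Borel subgroup through the restriction of \<open>\<chi>\<^sub>k\<close> to the units. The Iwasawa decomposition,
  together with the decomposition of \<open>\<rho>\<close> into eigenlines of the integral torus with characters \<open>\<chi>\<^sub>k\<close>,
  identifies the restricted induced representation with the sum of the \<open>V\<^sub>k\<close>.

  Each \<open>V\<^sub>k\<close> is filtered by its level subspaces. The complement of level \<open>l - 1\<close> in level \<open>l\<close> is acted on by
  left convolution with functions on the last layer \<open>p\<^sup>l\<^sup>-\<^sup>1 / p\<^sup>l\<close> of the opposite unipotent group. Convolution
  with the quadratic character squares to a nonzero scalar, and its two eigenspaces are the summands of
  the layer; conjugation by a diagonal matrix with nonsquare unit entry exchanges them. Convolution with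
  \<open>\<theta>\<^sup>-\<^sup>k\<close> carries the layers of \<open>V\<^sub>0\<close> to those of \<open>V\<^sub>k\<close>, because \<open>\<chi>\<^sub>k = \<chi>\<^sub>0 \<theta>\<^sup>2\<^sup>k\<close> on units.

  Irreducibility always follows from the same criterion: every nonzero stable subspace contains a Borel
  eigenvector, obtained by averaging, and in the space at hand that eigenvector is unique up to scalars.
  At level one uniqueness fails exactly for quadratic characters, where the standard intertwining
  operator satisfies a quadratic equation with two distinct roots.
\<close>

text \<open>Passing \<open>dg t\<close> through \<open>nl y\<close> scales y by the square of t. A
  Borel eigenvector of the new layer is therefore given on the last layer by three numbers, its
  values at zero, on square and on nonsquare residue units. The vanishing layer sum and the
  eigenvalue equation leave one of them free, the value at the identity; this is the uniqueness that
  the criterion needs. Odd residue cardinality makes 2 a unit, so squares have index two and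
  first-order square roots exist.

  Averages are finite sums over representatives, \<open>reps\<close> for the residue field and
  \<open>level_reps\<close> for \<open>K1 v\<close> modulo a level. Representatives are not closed
  under the operations, so each change of variables is made for functions that depend on classes
  only.

  On units the product of the i-th and k-th characters depends on i + k modulo \<open>nb\<close>.
  The special cases thus hinge on halving modulo \<open>nb\<close>, which is even exactly when 4
  divides n: then a quadratic member has a second one next to it, and mutually inverse members can
  exist without any quadratic one.\<close>

context nonarch_local_field
begin

section \<open>Valuation, powers of the maximal ideal p, units\<close>

lemma val_one [simp]: "v 1 = 0"
  using val_mult[of 1 1] by simp

lemma val_minus [simp]: "v (- x) = v x"
proof (cases "x = 0")
  case False
  have "v (-1) = 0" using val_mult[of "-1" "-1"] by simp
  then show ?thesis using val_mult[of "-1" x] False by simp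
qed simp

lemma val_inverse: "x \<noteq> 0 \<Longrightarrow> v (inverse x) = - v x"
  using val_mult[of x "inverse x"] by simp

lemma val_divide: "x \<noteq> 0 \<Longrightarrow> y \<noteq> 0 \<Longrightarrow> v (x / y) = v x - v y"
  by (simp add: divide_inverse val_mult val_inverse)

lemma val_power: "x \<noteq> 0 \<Longrightarrow> v (x ^ k) = int k * v x"
  by (induction k) (auto simp: val_mult algebra_simps)

lemma val_powi: "x \<noteq> 0 \<Longrightarrow> v (x powi k) = k * v x"
  by (auto simp: power_int_def val_power val_inverse)

lemma fpow_0 [simp]: "0 \<in> fpow v j"
  by (simp add: fpow_def)

lemma fpow_add: "x \<in> fpow v j \<Longrightarrow> y \<in> fpow v j \<Longrightarrow> x + y \<in> fpow v j"
  using val_add[of x y] by (cases "x = 0"; cases "y = 0"; cases "x + y = 0") (auto simp: fpow_def)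

lemma fpow_minus [simp]: "- x \<in> fpow v j \<longleftrightarrow> x \<in> fpow v j"
  by (auto simp: fpow_def)

lemma fpow_diff: "x \<in> fpow v j \<Longrightarrow> y \<in> fpow v j \<Longrightarrow> x - y \<in> fpow v j"
  using fpow_add[of x j "- y"] by simp

lemma fpow_diff_commute: "x - y \<in> fpow v j \<longleftrightarrow> y - x \<in> fpow v j"
  using fpow_minus[of "x - y" j] by simp

lemma fpow_mult: "x \<in> fpow v i \<Longrightarrow> y \<in> fpow v j \<Longrightarrow> x * y \<in> fpow v (i + j)"
  by (cases "x = 0 \<or> y = 0") (auto simp: fpow_def val_mult)

lemma fpow_mono: "x \<in> fpow v i \<Longrightarrow> j \<le> i \<Longrightarrow> x \<in> fpow v j"
  by (auto simp: fpow_def)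

lemma fpow_mult_le: "x \<in> fpow v i \<Longrightarrow> y \<in> fpow v j \<Longrightarrow> k \<le> i + j \<Longrightarrow> x * y \<in> fpow v k"
  using fpow_mult fpow_mono by blast

lemma fpow_mult_left: "x \<in> fpow v 0 \<Longrightarrow> y \<in> fpow v j \<Longrightarrow> x * y \<in> fpow v j"
  using fpow_mult_le[of x 0 y j j] by simp

lemma fpow_mult_right: "x \<in> fpow v j \<Longrightarrow> y \<in> fpow v 0 \<Longrightarrow> x * y \<in> fpow v j"
  using fpow_mult_le[of x j y 0 j] by simp

lemma one_in_fpow_0 [simp]: "1 \<in> fpow v 0"
  by (simp add: fpow_def)

lemma fpow_power: "x \<in> fpow v 0 \<Longrightarrow> x ^ k \<in> fpow v 0"
  by (induction k) (auto intro: fpow_mult_left)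

lemma of_nat_in_fpow_0 [simp]: "of_nat k \<in> fpow v 0"
  by (induction k) (auto intro: fpow_add)

lemma numeral_in_fpow_0 [simp]: "numeral k \<in> fpow v 0"
  using of_nat_in_fpow_0[of "numeral k"] by simp

lemma fpow_sum: "(\<And>i. i \<in> A \<Longrightarrow> f i \<in> fpow v j) \<Longrightarrow> sum f A \<in> fpow v j"
  by (induction A rule: infinite_finite_induct) (auto intro: fpow_add)

lemma fpow_trans: "x - y \<in> fpow v j \<Longrightarrow> y - z \<in> fpow v j \<Longrightarrow> x - z \<in> fpow v j"
  using fpow_add[of "x - y" j "y - z"] by simp

lemma fpow_cong_mult:
  assumes "x - x' \<in> fpow v j" "y - y' \<in> fpow v j" "x' \<in> fpow v 0" "y \<in> fpow v 0"
  shows "x * y - x' * y' \<in> fpow v j"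
proof -
  have "x * y - x' * y' = (x - x') * y + x' * (y - y')" by (simp add: algebra_simps)
  then show ?thesis using assms by (auto intro: fpow_add fpow_mult_left fpow_mult_right)
qed

lemma fpow_cong_power:
  assumes "x - y \<in> fpow v j" "x \<in> fpow v 0" "y \<in> fpow v 0"
  shows "x ^ k - y ^ k \<in> fpow v j"
  by (induction k) (use assms in \<open>auto intro: fpow_cong_mult fpow_power\<close>)

lemma fpow_prime:
  assumes "x * y \<in> fpow v 1" "x \<in> fpow v 0" "y \<in> fpow v 0" shows "x \<in> fpow v 1 \<or> y \<in> fpow v 1"
  using assms by (cases "x = 0 \<or> y = 0") (auto simp: fpow_def val_mult)

definition runit :: "'a \<Rightarrow> bool" where "runit x \<longleftrightarrow> x \<noteq> 0 \<and> v x = 0"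

lemma runit_iff: "runit x \<longleftrightarrow> x \<in> fpow v 0 \<and> x \<notin> fpow v 1"
  by (auto simp: runit_def fpow_def)

lemma runit_fpow: "runit x \<Longrightarrow> x \<in> fpow v 0" by (simp add: runit_iff)
lemma runit_nz: "runit x \<Longrightarrow> x \<noteq> 0" by (simp add: runit_def)
lemma runit_one [simp]: "runit 1" by (simp add: runit_def)
lemma runit_mult: "runit x \<Longrightarrow> runit y \<Longrightarrow> runit (x * y)" by (simp add: runit_def val_mult)
lemma runit_inverse: "runit x \<Longrightarrow> runit (inverse x)" by (simp add: runit_def val_inverse)
lemma runit_divide: "runit x \<Longrightarrow> runit y \<Longrightarrow> runit (x / y)" by (simp add: runit_def val_divide)
lemma runit_power: "runit x \<Longrightarrow> runit (x ^ k)" by (simp add: runit_def val_power)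
lemma runit_minus [simp]: "runit (- x) \<longleftrightarrow> runit x" by (simp add: runit_def)

lemma runit_cong: "runit x \<Longrightarrow> x - y \<in> fpow v 1 \<Longrightarrow> runit y"
proof -
  assume a: "runit x" "x - y \<in> fpow v 1"
  have "y = x - (x - y)" by simp
  then have "y \<in> fpow v 0" using a fpow_diff fpow_mono[of "x - y" 1 0] runit_fpow by (metis zero_le_one)
  moreover have "y \<notin> fpow v 1" using a fpow_add[of "x - y" 1 y] by (auto simp: runit_iff)
  ultimately show ?thesis by (simp add: runit_iff)
qed

lemma runit_one_plus: "x \<in> fpow v 1 \<Longrightarrow> runit (1 + x)"
  using runit_cong[of 1 "1 + x"] by simp

lemma fpow_unit_cancel: "runit c \<Longrightarrow> c * x \<in> fpow v j \<longleftrightarrow> x \<in> fpow v j"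
  by (cases "x = 0") (auto simp: runit_def fpow_def val_mult)

lemma fpow_divide_unit: "runit c \<Longrightarrow> x / c \<in> fpow v j \<longleftrightarrow> x \<in> fpow v j"
  by (cases "x = 0") (auto simp: runit_def fpow_def val_divide)

lemma inverse_cong:
  assumes "runit x" "runit y" "x - y \<in> fpow v j" shows "inverse x - inverse y \<in> fpow v j"
proof -
  have "x * y * (inverse x - inverse y) = - (x - y)"
    using assms by (simp add: field_simps runit_nz)
  then show ?thesis using fpow_unit_cancel[of "x * y"] assms runit_mult by (metis fpow_minus)
qed

section \<open>Representatives of the residue field and sums over them\<close>

definition reps :: "'a set" where "reps = (\<lambda>C. SOME x. x \<in> C) ` residue_field v"

lemma residue_mem: "y \<in> x +o fpow v 1 \<longleftrightarrow> y - x \<in> fpow v 1"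
  by (auto simp: elt_set_plus_def) (metis add.commute diff_add_cancel)

lemma residue_eq: "x +o fpow v 1 = y +o fpow v 1 \<longleftrightarrow> x - y \<in> fpow v 1"
proof
  assume "x +o fpow v 1 = y +o fpow v 1"
  then show "x - y \<in> fpow v 1" using residue_mem[of x x] residue_mem[of x y] by simp
next
  assume "x - y \<in> fpow v 1"
  then show "x +o fpow v 1 = y +o fpow v 1"
    unfolding set_eq_iff residue_mem by (meson fpow_trans fpow_diff_commute)
qed

lemma rep_choice: "C \<in> residue_field v \<Longrightarrow> (SOME x. x \<in> C) \<in> C"
proof -
  assume "C \<in> residue_field v"
  then obtain x where "C = x +o fpow v 1" by (auto simp: residue_field_def)
  then have "x \<in> C" by (simp add: residue_mem)
  then show ?thesis by (rule someI)
qed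

lemma rep_choice_eq: "C \<in> residue_field v \<Longrightarrow> C = (SOME x. x \<in> C) +o fpow v 1"
proof -
  assume C: "C \<in> residue_field v"
  then obtain x where x: "C = x +o fpow v 1" by (auto simp: residue_field_def)
  have "(SOME x. x \<in> C) \<in> x +o fpow v 1" using rep_choice[OF C] x by simp
  then have "x - (SOME x. x \<in> C) \<in> fpow v 1" by (simp only: residue_mem fpow_diff_commute)
  then show ?thesis using x residue_eq by blast
qed

lemma reps_fpow: "r \<in> reps \<Longrightarrow> r \<in> fpow v 0"
proof -
  assume "r \<in> reps"
  then obtain C where C: "C \<in> residue_field v" "r \<in> C" using rep_choice by (auto simp: reps_def)
  then obtain x where x: "x \<in> fpow v 0" "r - x \<in> fpow v 1" by (auto simp: residue_field_def residue_mem)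
  then show ?thesis using fpow_add[of "r - x" 0 x] fpow_mono[of "r - x" 1 0] by simp
qed

lemma reps_ex: "x \<in> fpow v 0 \<Longrightarrow> \<exists>r\<in>reps. x - r \<in> fpow v 1"
proof -
  assume "x \<in> fpow v 0"
  then have C: "x +o fpow v 1 \<in> residue_field v" by (simp add: residue_field_def)
  have "x - (SOME y. y \<in> x +o fpow v 1) \<in> fpow v 1"
    using rep_choice[OF C] fpow_diff_commute unfolding residue_mem by blast
  then show ?thesis using C unfolding reps_def by blast
qed

lemma reps_unique: "r \<in> reps \<Longrightarrow> s \<in> reps \<Longrightarrow> r - s \<in> fpow v 1 \<Longrightarrow> r = s"
proof -
  assume "r \<in> reps" "s \<in> reps" "r - s \<in> fpow v 1"
  then obtain C D where "C \<in> residue_field v" "D \<in> residue_field v" "r = (SOME x. x \<in> C)"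
    "s = (SOME x. x \<in> D)" "r +o fpow v 1 = s +o fpow v 1"
    by (auto simp: reps_def residue_eq)
  then show ?thesis using rep_choice_eq by metis
qed

lemma finite_reps [simp]: "finite reps"
  by (simp add: reps_def finite_residue_field)

lemma card_reps: "card reps = residue_card v"
proof -
  have "inj_on (\<lambda>C. SOME x. x \<in> C) (residue_field v)"
    by (rule inj_on_inverseI[where g = "\<lambda>x. x +o fpow v 1"]) (simp flip: rep_choice_eq)
  then show ?thesis unfolding reps_def by (rule card_image)
qed

definition rep :: "'a \<Rightarrow> 'a" where "rep x = (SOME r. r \<in> reps \<and> x - r \<in> fpow v 1)"

lemma rep: "x \<in> fpow v 0 \<Longrightarrow> rep x \<in> reps" "x \<in> fpow v 0 \<Longrightarrow> x - rep x \<in> fpow v 1"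
proof -
  assume "x \<in> fpow v 0"
  then have "\<exists>r. r \<in> reps \<and> x - r \<in> fpow v 1" using reps_ex by blast
  from someI_ex[OF this] show "rep x \<in> reps" "x - rep x \<in> fpow v 1" by (simp_all add: rep_def)
qed

lemma rep_eq: "r \<in> reps \<Longrightarrow> x - r \<in> fpow v 1 \<Longrightarrow> rep x = r"
proof -
  assume a: "r \<in> reps" "x - r \<in> fpow v 1"
  then have "x \<in> fpow v 0" using fpow_add[of "x - r" 0 r] fpow_mono[of "x - r" 1 0] reps_fpow by simp
  then show ?thesis using a rep reps_unique[of "rep x" r] by (metis fpow_diff_commute fpow_trans)
qed

text \<open>An injective map of the finite set \<open>reps\<close> into itself is a permutation, so
  surjectivity of \<open>h\<close> on residue classes never has to be checked.\<close>

lemma bij_betw_rep: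
  assumes h: "\<And>x. x \<in> fpow v 0 \<Longrightarrow> h x \<in> fpow v 0"
    and inj: "\<And>x y. x \<in> fpow v 0 \<Longrightarrow> y \<in> fpow v 0 \<Longrightarrow> h x - h y \<in> fpow v 1 \<Longrightarrow> x - y \<in> fpow v 1"
  shows "bij_betw (\<lambda>r. rep (h r)) reps reps"
proof -
  have "inj_on (\<lambda>r. rep (h r)) reps"
  proof (rule inj_onI)
    fix r s assume a: "r \<in> reps" "s \<in> reps" "rep (h r) = rep (h s)"
    then have "h r - h s \<in> fpow v 1"
      using rep(2)[OF h[OF reps_fpow], of r] rep(2)[OF h[OF reps_fpow], of s]
      by (metis fpow_diff_commute fpow_trans)
    then show "r = s" using inj a reps_unique reps_fpow by blast
  qed
  moreover have "(\<lambda>r. rep (h r)) ` reps \<subseteq> reps" using h rep(1) reps_fpow by blast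
  ultimately show ?thesis by (simp add: bij_betw_def endo_inj_surj)
qed

text \<open>Functions on the integers that descend to the residue field. They stay functions on the
  field, so that arguments can be shifted and scaled there.\<close>

definition residue_invariant :: "('a \<Rightarrow> 'b) \<Rightarrow> bool" where
  "residue_invariant \<phi> \<longleftrightarrow> (\<forall>x\<in>fpow v 0. \<forall>y\<in>fpow v 0. x - y \<in> fpow v 1 \<longrightarrow> \<phi> x = \<phi> y)"

lemma pinvD: "residue_invariant \<phi> \<Longrightarrow> x \<in> fpow v 0 \<Longrightarrow> y \<in> fpow v 0 \<Longrightarrow> x - y \<in> fpow v 1 \<Longrightarrow> \<phi> x = \<phi> y"
  unfolding residue_invariant_def by blast

text \<open>In general \<open>h r\<close> is no chosen representative. Invariance replaces it by
  \<open>rep (h r)\<close>, and these values permute \<open>reps\<close>.\<close>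

lemma sum_reps_reindex:
  fixes \<phi> :: "'a \<Rightarrow> 'b::comm_monoid_add"
  assumes "residue_invariant \<phi>"
    and h: "\<And>x. x \<in> fpow v 0 \<Longrightarrow> h x \<in> fpow v 0"
    and inj: "\<And>x y. x \<in> fpow v 0 \<Longrightarrow> y \<in> fpow v 0 \<Longrightarrow> h x - h y \<in> fpow v 1 \<Longrightarrow> x - y \<in> fpow v 1"
  shows "(\<Sum>r\<in>reps. \<phi> (h r)) = (\<Sum>r\<in>reps. \<phi> r)"
proof -
  have "(\<Sum>r\<in>reps. \<phi> (h r)) = (\<Sum>r\<in>reps. \<phi> (rep (h r)))"
    by (intro sum.cong pinvD[OF assms(1)] refl rep h reps_fpow)
  also have "\<dots> = (\<Sum>r\<in>reps. \<phi> r)"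
    by (rule sum.reindex_bij_betw[OF bij_betw_rep[OF h inj]])
  finally show ?thesis .
qed

lemma sum_reps_shift:
  fixes \<phi> :: "'a \<Rightarrow> 'b::comm_monoid_add"
  assumes "residue_invariant \<phi>" "c \<in> fpow v 0"
  shows "(\<Sum>r\<in>reps. \<phi> (r + c)) = (\<Sum>r\<in>reps. \<phi> r)"
  by (rule sum_reps_reindex) (use assms in \<open>auto intro: fpow_add\<close>)

lemma sum_reps_scale:
  fixes \<phi> :: "'a \<Rightarrow> 'b::comm_monoid_add"
  assumes "residue_invariant \<phi>" "runit c"
  shows "(\<Sum>r\<in>reps. \<phi> (c * r)) = (\<Sum>r\<in>reps. \<phi> r)"
proof (rule sum_reps_reindex[OF assms(1)])
  show "c * x \<in> fpow v 0" if "x \<in> fpow v 0" for x using that assms by (simp add: fpow_unit_cancel)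
  show "x - y \<in> fpow v 1" if "c * x - c * y \<in> fpow v 1" for x y
    using that fpow_unit_cancel[OF assms(2), of "x - y"] by (simp add: algebra_simps)
qed

text \<open>Translation by 1 permutes the residue classes, so the sum of all r + 1 and the sum of
  all r agree modulo p; their difference is the number of classes.\<close>

lemma residue_card_in_fpow: "of_nat (residue_card v) \<in> fpow v 1"
proof -
  have "bij_betw (\<lambda>r. rep (r + 1)) reps reps"
    by (rule bij_betw_rep) (auto intro: fpow_add)
  then have "(\<Sum>r\<in>reps. rep (r + 1)) = \<Sum>reps" by (rule sum.reindex_bij_betw)
  then have "(\<Sum>r\<in>reps. (r + 1) - rep (r + 1)) = of_nat (card reps)"
    by (simp add: sum_subtractf sum.distrib)
  moreover have "(\<Sum>r\<in>reps. (r + 1) - rep (r + 1)) \<in> fpow v 1"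
    by (intro fpow_sum rep(2) fpow_add reps_fpow one_in_fpow_0)
  ultimately show ?thesis by (simp add: card_reps)
qed

definition ureps :: "'a set" where "ureps = {r \<in> reps. runit r}"

lemma finite_ureps [simp]: "finite ureps" by (simp add: ureps_def)

lemma reps_split: "\<exists>z. z \<in> fpow v 1 \<and> reps = insert z ureps \<and> z \<notin> ureps"
proof -
  obtain z where z: "z \<in> reps" "z \<in> fpow v 1" using reps_ex[of 0] by auto
  have "r = z" if "r \<in> reps" "\<not> runit r" for r
    using that z reps_unique reps_fpow by (metis runit_iff fpow_diff)
  moreover have "\<not> runit z" using z by (simp add: runit_iff)
  ultimately have "reps = insert z ureps" "z \<notin> ureps" using z unfolding ureps_def by blast+
  then show ?thesis using z by blast
qed

lemma card_ureps: "card ureps = residue_card v - 1"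
proof -
  obtain z where z: "reps = insert z ureps" "z \<notin> ureps" using reps_split by blast
  then have "card reps = Suc (card ureps)" by simp
  then show ?thesis by (simp add: card_reps)
qed

lemma residue_card_ge2: "residue_card v \<ge> 2"
proof -
  obtain z o' where "z \<in> reps" "o' \<in> reps" "0 - z \<in> fpow v 1" "1 - o' \<in> fpow v 1"
    using reps_ex[of 0] reps_ex[of 1] by auto
  moreover have "(1::'a) \<notin> fpow v 1" using runit_one runit_iff by blast
  ultimately have "z \<noteq> o'" by (metis fpow_diff cancel_comm_monoid_add_class.diff_cancel diff_add_cancel diff_diff_eq2 diff_0 fpow_minus fpow_trans fpow_diff_commute diff_zero)
  then have "card {z, o'} \<le> card reps" using \<open>z \<in> reps\<close> \<open>o' \<in> reps\<close> by (intro card_mono) auto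
  then show ?thesis using \<open>z \<noteq> o'\<close> by (simp add: card_reps)
qed

lemma bij_betw_scale_ureps:
  assumes "runit c" shows "bij_betw (\<lambda>r. rep (c * r)) ureps ureps"
proof -
  have c: "c * r \<in> fpow v 0" if "r \<in> ureps" for r
    using that assms runit_mult runit_fpow by (auto simp: ureps_def)
  have "inj_on (\<lambda>r. rep (c * r)) ureps"
  proof (rule inj_onI)
    fix r s assume a: "r \<in> ureps" "s \<in> ureps" "rep (c * r) = rep (c * s)"
    then have "c * r - c * s \<in> fpow v 1"
      using rep(2)[OF c, of r] rep(2)[OF c, of s] by (metis fpow_diff_commute fpow_trans)
    then have "r - s \<in> fpow v 1" using fpow_unit_cancel[OF assms, of "r - s"] by (simp add: algebra_simps)
    then show "r = s" using reps_unique a by (auto simp: ureps_def)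
  qed
  moreover have "rep (c * r) \<in> ureps" if "r \<in> ureps" for r
    using runit_cong[OF runit_mult[OF assms] rep(2)[OF c[OF that]]] rep(1)[OF c[OF that]] that
    by (simp add: ureps_def)
  ultimately show ?thesis by (simp add: bij_betw_def endo_inj_surj image_subset_iff)
qed

section \<open>Powers, polynomial roots and roots of unity modulo p\<close>

lemma fpow_cong_prod:
  assumes "\<And>i. i \<in> A \<Longrightarrow> f i - g i \<in> fpow v j \<and> f i \<in> fpow v 0 \<and> g i \<in> fpow v 0"
  shows "prod f A - prod g A \<in> fpow v j \<and> prod f A \<in> fpow v 0 \<and> prod g A \<in> fpow v 0"
  using assms
  by (induction A rule: infinite_finite_induct) (auto intro!: fpow_cong_mult intro: fpow_mult_left)

text \<open>Multiplication by c permutes the residue units, so their product is unchanged modulo p;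
  being a unit, it can be cancelled.\<close>

lemma fermat: assumes "runit c" shows "c ^ (residue_card v - 1) - 1 \<in> fpow v 1"
proof -
  have c: "c * r \<in> fpow v 0" if "r \<in> ureps" for r
    using that assms runit_mult runit_fpow by (auto simp: ureps_def)
  have "(\<Prod>r\<in>ureps. c * r) - (\<Prod>r\<in>ureps. rep (c * r)) \<in> fpow v 1"
    using c rep reps_fpow by (intro fpow_cong_prod[THEN conjunct1]) auto
  also have "(\<Prod>r\<in>ureps. rep (c * r)) = \<Prod>ureps"
    by (rule prod.reindex_bij_betw[OF bij_betw_scale_ureps[OF assms]])
  finally have *: "\<Prod>ureps * (c ^ card ureps - 1) \<in> fpow v 1"
    by (simp add: prod.distrib algebra_simps)
  have "runit (\<Prod>A)" if "A \<subseteq> ureps" for A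
    using that by (induction A rule: infinite_finite_induct) (auto intro: runit_mult simp: ureps_def)
  then have "runit (\<Prod>ureps)" by blast
  with * show ?thesis by (simp add: fpow_unit_cancel card_ureps)
qed

text \<open>The bound on the number of roots over the residue field, stated with pairwise
  incongruent integral elements. Dividing off one root by \<open>synthetic_div\<close> leaves a
  quotient that is again integral and monic, and at every other root the factor s - r is a
  unit.\<close>

lemma card_roots_le:
  fixes p :: "'a poly"
  assumes "finite S" "S \<subseteq> fpow v 0" "\<And>r s. r \<in> S \<Longrightarrow> s \<in> S \<Longrightarrow> r - s \<in> fpow v 1 \<Longrightarrow> r = s"
    "\<And>i. coeff p i \<in> fpow v 0" "lead_coeff p = 1" "\<And>s. s \<in> S \<Longrightarrow> poly p s \<in> fpow v 1"
  shows "card S \<le> degree p"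
  using assms
proof (induction "degree p" arbitrary: p S)
  case 0
  then have "p = [:1:]" by (metis degree_0_id)
  then have "(1::'a) \<in> fpow v 1" if "s \<in> S" for s using 0(7)[OF that] by simp
  then have "S = {}" using runit_one runit_iff by blast
  then show ?case by simp
next
  case (Suc d)
  show ?case
  proof (cases "S = {}")
    case False
    then obtain r where r: "r \<in> S" by blast
    define Q where "Q = synthetic_div p r"
    have pQ: "p + smult r Q = pCons (poly p r) Q"
      unfolding Q_def by (rule synthetic_div_correct)
    have coQ: "coeff Q i = coeff p (Suc i) + r * coeff Q (Suc i)" for i
      using arg_cong[OF pQ, of "\<lambda>f. coeff f (Suc i)"] by simp
    have dQ: "degree Q = d" using Suc(2) by (simp add: Q_def degree_synthetic_div)
    have rO: "r \<in> fpow v 0" using r Suc(4) by blast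
    \<comment> \<open>The recursion \<open>coQ\<close> expresses each coefficient of the quotient
      through the next higher one, so integrality is propagated from degree \<open>d\<close>
      downwards.\<close>
    have Qint: "coeff Q i \<in> fpow v 0" for i
    proof (cases "i \<le> d")
      case True
      then show ?thesis
      proof (induction rule: inc_induct)
        case base
        then show ?case using coQ[of d] coeff_eq_0[of Q "Suc d"] dQ Suc(6) by simp
      next
        case (step k)
        then show ?case using coQ[of k] Suc(6) rO by (auto intro: fpow_add fpow_mult_left)
      qed
    next
      case False then show ?thesis using coeff_eq_0[of Q i] dQ by simp
    qed
    have lQ: "lead_coeff Q = 1"
      using coQ[of d] coeff_eq_0[of Q "Suc d"] dQ Suc(7) Suc(2) by simp
    have root: "poly Q s \<in> fpow v 1" if "s \<in> S - {r}" for s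
    proof -
      have "poly p s - poly p r = (s - r) * poly Q s"
        using arg_cong[OF pQ, of "\<lambda>f. poly f s"] by (simp add: algebra_simps)
      then have "(s - r) * poly Q s \<in> fpow v 1" using Suc(8) that r fpow_diff by fastforce
      moreover have "s - r \<in> fpow v 0" using that Suc(4) rO fpow_diff by blast
      moreover have "s - r \<notin> fpow v 1" using that r Suc(5) by blast
      ultimately show ?thesis using runit_iff[of "s - r"] fpow_unit_cancel by blast
    qed
    have "card (S - {r}) \<le> degree Q"
      by (rule Suc(1)) (use dQ Suc Qint lQ root in auto)
    then show ?thesis using r Suc dQ by (simp add: card_Diff_singleton)
  qed simp
qed

text \<open>Otherwise all q - 1 residue units would be roots of X^N - 1, more than its degree. This
  replaces cyclicity of the residue units: only the exact order of \<open>theta\<close> is derived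
  from it.\<close>

lemma ex_unit_power_nontrivial:
  assumes "0 < N" "N < residue_card v - 1"
  shows "\<exists>x. runit x \<and> x ^ N - 1 \<notin> fpow v 1"
proof (rule ccontr)
  assume "\<not> ?thesis"
  then have H: "\<And>x. runit x \<Longrightarrow> x ^ N - 1 \<in> fpow v 1" by blast
  define p :: "'a poly" where "p = monom 1 N - 1"
  have dp: "degree p = N"
    unfolding p_def diff_conv_add_uminus using assms
    by (subst degree_add_eq_left) (auto simp: degree_monom_eq)
  have "card ureps \<le> degree p"
  proof (rule card_roots_le)
    show "ureps \<subseteq> fpow v 0" using reps_fpow by (auto simp: ureps_def)
    show "lead_coeff p = 1" using dp assms by (simp add: p_def)
    show "coeff p i \<in> fpow v 0" for i by (auto simp: p_def intro!: fpow_diff)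
    show "poly p s \<in> fpow v 1" if "s \<in> ureps" for s
      using that H by (auto simp: p_def ureps_def poly_monom)
  qed (auto simp: ureps_def intro: reps_unique)
  then show False using assms dp by (simp add: card_ureps)
qed

text \<open>The cofactor of x - y in x^q - y^q is congruent to q x^(q-1) modulo p, and q itself lies
  in p. So each q-th power gains one digit of precision.\<close>

lemma power_residue_card_cong:
  assumes "x - y \<in> fpow v j" "j \<ge> 1" "x \<in> fpow v 0" "y \<in> fpow v 0"
  shows "x ^ residue_card v - y ^ residue_card v \<in> fpow v (j + 1)"
proof -
  let ?q = "residue_card v"
  have xy: "x - y \<in> fpow v 1" using assms fpow_mono by blast
  have "(\<Sum>i<?q. y ^ (?q - Suc i) * x ^ i) - of_nat ?q * x ^ (?q - 1) \<in> fpow v 1"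
  proof -
    have "y ^ (?q - Suc i) * x ^ i - x ^ (?q - 1) \<in> fpow v 1" if "i < ?q" for i
    proof -
      have "?q - 1 = (?q - Suc i) + i" using that by simp
      then have "y ^ (?q - Suc i) * x ^ i - x ^ (?q - 1) = (y ^ (?q - Suc i) - x ^ (?q - Suc i)) * x ^ i"
        by (simp add: power_add algebra_simps)
      then show ?thesis using xy assms
        by (auto intro!: fpow_mult_right fpow_cong_power fpow_power simp: fpow_diff_commute[of y])
    qed
    then have "(\<Sum>i<?q. y ^ (?q - Suc i) * x ^ i - x ^ (?q - 1)) \<in> fpow v 1" by (intro fpow_sum) auto
    then show ?thesis by (simp add: sum_subtractf)
  qed
  moreover have "of_nat ?q * x ^ (?q - 1) \<in> fpow v 1"
    using residue_card_in_fpow assms by (auto intro: fpow_mult_right fpow_power)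
  ultimately have "(\<Sum>i<?q. y ^ (?q - Suc i) * x ^ i) \<in> fpow v 1"
    using fpow_add by fastforce
  then show ?thesis unfolding power_diff_sumr2 by (rule fpow_mult[OF assms(1)])
qed

lemma fpow_all_zero: "(\<And>N. x \<in> fpow v (int N)) \<Longrightarrow> x = 0"
proof (rule ccontr)
  assume "\<And>N. x \<in> fpow v (int N)" "x \<noteq> 0"
  then have "int (nat (v x) + 1) \<le> v x" by (metis (mono_tags) fpow_def mem_Collect_eq)
  then show False by linarith
qed

text \<open>The limit of the sequence u, u^q, u^(q^2), ... is the Teichmueller lift of u.\<close>
lemma root_of_unity_lift:
  assumes "n dvd residue_card v - 1" "u \<in> fpow v 0" "u ^ n - 1 \<in> fpow v 1"
  shows "\<exists>z. z ^ n = 1 \<and> z - u \<in> fpow v 1"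
proof -
  let ?q = "residue_card v"
  define s where "s k = u ^ (?q ^ k)" for k
  have sO: "s k \<in> fpow v 0" for k using assms by (simp add: s_def fpow_power)
  have sS: "s (Suc k) = s k ^ ?q" for k by (simp add: s_def power_mult[symmetric] mult.commute)
  obtain d where d: "?q - 1 = n * d" using assms(1) by blast
  have "u ^ (?q - 1) - 1 \<in> fpow v 1"
    using fpow_cong_power[OF assms(3), of d] assms(2) unfolding d by (simp add: power_mult fpow_power)
  then have "u * (u ^ (?q - 1) - 1) \<in> fpow v 1" using assms by (auto intro: fpow_mult_left)
  then have uq: "u ^ ?q - u \<in> fpow v 1"
    using residue_card_ge2 by (simp add: algebra_simps flip: power_Suc)
  have step: "s (Suc k) - s k \<in> fpow v (int k + 1)" for k
  proof (induction k)
    case 0 then show ?case using uq by (simp add: s_def)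
  next
    case (Suc k)
    have "s (Suc k) ^ ?q - s k ^ ?q \<in> fpow v (int k + 1 + 1)"
      by (rule power_residue_card_cong[OF Suc]) (use sO in auto)
    then show ?case by (simp add: sS add.commute)
  qed
  have diff: "s (M + d) - s M \<in> fpow v (int M + 1)" for M d
  proof (induction d)
    case (Suc d)
    have "s (Suc (M + d)) - s (M + d) \<in> fpow v (int M + 1)"
      using step[of "M + d"] fpow_mono by force
    then show ?case using Suc fpow_trans by simp
  qed simp
  have diff': "s i - s M \<in> fpow v (int M + 1)" if "M \<le> i" for i M
    using diff[of M "i - M"] that by simp
  have "\<exists>M. \<forall>i\<ge>M. \<forall>j\<ge>M. s i - s j \<in> fpow v N" for N
  proof (intro exI allI impI)
    fix i j assume "nat N \<le> i" "nat N \<le> j"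
    then have "s i - s j \<in> fpow v (int (nat N) + 1)" using diff' fpow_trans fpow_diff_commute by metis
    then show "s i - s j \<in> fpow v N" using fpow_mono by force
  qed
  then obtain L where L: "\<And>N. \<exists>M. \<forall>i\<ge>M. s i - L \<in> fpow v N" using val_complete by blast
  obtain M where "s (max M 0) - L \<in> fpow v 1" using L[of 1] by (metis max.cobounded1)
  moreover have "s (max M 0) - u \<in> fpow v 1" using diff'[of 0 "max M 0"] by (simp add: s_def)
  ultimately have Lu: "L - u \<in> fpow v 1" using fpow_trans fpow_diff_commute by blast
  have LO: "L \<in> fpow v 0" using Lu fpow_add[of "L - u" 0 u] assms fpow_mono[of "L - u" 1 0] by simp
  \<comment> \<open>The n-th powers approach 1 by the same gain of precision, so the limit is an
    exact n-th root of unity.\<close>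
  have sn: "s k ^ n - 1 \<in> fpow v (int k + 1)" for k
  proof (induction k)
    case 0 then show ?case using assms by (simp add: s_def)
  next
    case (Suc k)
    have "(s k ^ n) ^ ?q - 1 ^ ?q \<in> fpow v (int k + 1 + 1)"
      using Suc sO fpow_power by (intro power_residue_card_cong) auto
    then show ?case by (simp add: sS add.commute flip: power_mult) (simp add: mult.commute)
  qed
  have "L ^ n - 1 \<in> fpow v (int N)" for N
  proof -
    obtain M where M: "\<forall>i\<ge>M. s i - L \<in> fpow v (int N)" using L by blast
    have "s (max M N) ^ n - L ^ n \<in> fpow v (int N)"
      using M sO LO by (intro fpow_cong_power) auto
    moreover have "s (max M N) ^ n - 1 \<in> fpow v (int N)"
      using fpow_mono[OF sn[of "max M N"], of "int N"] by simp
    ultimately show ?thesis using fpow_trans fpow_diff_commute by blast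
  qed
  then have "L ^ n = 1" using fpow_all_zero[of "L ^ n - 1"] by simp
  then show ?thesis using Lu by blast
qed

text \<open>The product of n with its cofactor is q - 1, which is congruent to -1.\<close>

lemma of_nat_dvd_unit:
  assumes "n dvd residue_card v - 1" shows "runit (of_nat n)"
proof -
  obtain d where d: "residue_card v - 1 = n * d" using assms by blast
  have "of_nat n * of_nat d = (of_nat (residue_card v) - 1 :: 'a)"
    using residue_card_ge2 by (simp add: of_nat_diff flip: of_nat_mult d)
  moreover have "runit (of_nat (residue_card v) - 1 :: 'a)"
    using runit_one_plus[of "- of_nat (residue_card v)"] residue_card_in_fpow
    by (metis runit_minus fpow_minus minus_diff_eq diff_conv_add_uminus)
  ultimately have "of_nat n * of_nat d \<notin> fpow v 1" by (simp add: runit_iff)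
  then show ?thesis by (auto simp: runit_iff intro: fpow_mult_right)
qed

lemma mu_fpow: "z \<in> mu n \<Longrightarrow> n > 0 \<Longrightarrow> runit z"
proof -
  assume a: "z \<in> mu n" "n > 0"
  then have "z \<noteq> 0" by (auto simp: mu_def power_0_left)
  then have "int n * v z = 0" using val_power[of z n] a by (simp add: mu_def)
  then show ?thesis using a \<open>z \<noteq> 0\<close> by (simp add: runit_def)
qed

text \<open>The derivative n z^(n-1) of X^n - 1 is a unit, so reduction separates its roots. Here
  \<open>S\<close> is the cofactor of z - w in z^n - w^n and is congruent to that derivative; as a
  unit it cannot annihilate a nonzero z - w.\<close>

lemma mu_unique:
  assumes "n dvd residue_card v - 1" "z \<in> mu n" "w \<in> mu n" "z - w \<in> fpow v 1" shows "z = w"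
proof -
  have n0: "n > 0" using of_nat_dvd_unit[OF assms(1)] by (cases n) (auto simp: runit_def)
  have zO: "runit z" "runit w" using mu_fpow assms n0 by auto
  define S where "S = (\<Sum>i<n. w ^ (n - Suc i) * z ^ i)"
  have "S - of_nat n * z ^ (n - 1) \<in> fpow v 1"
  proof -
    have "w ^ (n - Suc i) * z ^ i - z ^ (n - 1) \<in> fpow v 1" if "i < n" for i
    proof -
      have "n - 1 = (n - Suc i) + i" using that by simp
      then have "w ^ (n - Suc i) * z ^ i - z ^ (n - 1) = (w ^ (n - Suc i) - z ^ (n - Suc i)) * z ^ i"
        by (simp add: power_add algebra_simps)
      then show ?thesis using assms(4) zO runit_fpow
        by (auto intro!: fpow_mult_right fpow_cong_power fpow_power simp: fpow_diff_commute[of w])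
    qed
    then have "(\<Sum>i<n. w ^ (n - Suc i) * z ^ i - z ^ (n - 1)) \<in> fpow v 1" by (intro fpow_sum) auto
    then show ?thesis by (simp add: sum_subtractf S_def)
  qed
  moreover have "runit (of_nat n * z ^ (n - 1))"
    using of_nat_dvd_unit[OF assms(1)] zO runit_mult runit_power by blast
  ultimately have "runit S" using runit_cong fpow_diff_commute by blast
  moreover have "(z - w) * S = 0"
    using assms power_diff_sumr2[of z n w] by (simp add: S_def mu_def)
  ultimately show ?thesis using runit_nz by auto
qed

end

section \<open>The tame Hilbert symbol\<close>

locale tame_field = nonarch_local_field v for v :: "'a::field \<Rightarrow> int" +
  fixes n :: nat and \<pi> :: 'a
  assumes odd_q: "odd (residue_card v)"
    and pi_nz: "\<pi> \<noteq> 0" and val_pi: "v \<pi> = 1"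
    and n_ge2: "n \<ge> 2" and n_dvd: "n dvd residue_card v - 1"
begin

abbreviation hil where "hil \<equiv> hilbert v n"

definition tame :: "'a \<Rightarrow> 'a \<Rightarrow> 'a" where
  "tame a b = (- 1) powi (v a * v b) * a powi v b / b powi v a"

abbreviation tame_exp :: nat where "tame_exp \<equiv> (residue_card v - 1) div n"

lemma runit_tame: "a \<noteq> 0 \<Longrightarrow> b \<noteq> 0 \<Longrightarrow> runit (tame a b)"
proof -
  assume ab: "a \<noteq> 0" "b \<noteq> 0"
  have "v ((- 1) powi (v a * v b)) = 0" using val_powi[of "-1" "v a * v b"] by simp
  then show ?thesis using ab by (simp add: tame_def runit_def val_mult val_divide val_powi)
qed

lemma hil: assumes "a \<noteq> 0" "b \<noteq> 0"
  shows "hil a b \<in> mu n" "hil a b - tame a b ^ tame_exp \<in> fpow v 1"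
proof -
  define u where "u = tame a b ^ tame_exp"
  have r: "runit u" using runit_tame[OF assms] by (simp add: u_def runit_power)
  have "u ^ n = tame a b ^ (residue_card v - 1)"
    using n_dvd by (simp add: u_def flip: power_mult)
  then have "u ^ n - 1 \<in> fpow v 1" using fermat[OF runit_tame[OF assms]] by simp
  then obtain z where z: "z ^ n = 1" "z - u \<in> fpow v 1"
    using root_of_unity_lift[OF n_dvd runit_fpow[OF r]] by blast
  have "\<exists>!z. z \<in> mu n \<and> z - u \<in> fpow v 1"
  proof (rule ex1I[of _ z])
    show "z \<in> mu n \<and> z - u \<in> fpow v 1" using z by (simp add: mu_def)
    show "w = z" if "w \<in> mu n \<and> w - u \<in> fpow v 1" for w
      using that z mu_unique[OF n_dvd] by (metis (mono_tags) fpow_diff_commute fpow_trans mem_Collect_eq mu_def)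
  qed
  from theI'[OF this] show "hil a b \<in> mu n" "hil a b - tame a b ^ tame_exp \<in> fpow v 1"
    by (simp_all add: hilbert_def tame_def u_def Let_def)
qed

lemma hil_eqI: assumes "a \<noteq> 0" "b \<noteq> 0" "z \<in> mu n" "z - tame a b ^ tame_exp \<in> fpow v 1"
  shows "hil a b = z"
  using hil[OF assms(1,2)] assms mu_unique[OF n_dvd] fpow_trans fpow_diff_commute by metis

lemma mu_mult: "z \<in> mu n \<Longrightarrow> w \<in> mu n \<Longrightarrow> z * w \<in> mu n" for z :: 'a
  by (simp add: mu_def power_mult_distrib)

lemma one_in_mu [simp]: "1 \<in> mu n" by (simp add: mu_def)

lemma mu_inverse: "z \<in> mu n \<Longrightarrow> inverse z \<in> mu n" for z :: 'a
  by (simp add: mu_def power_inverse)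

lemma mu_power: "z \<in> mu n \<Longrightarrow> z ^ k \<in> mu n" for z :: 'a
  by (induction k) (auto intro: mu_mult)

lemma mu_nz: "z \<in> mu n \<Longrightarrow> z \<noteq> 0" for z :: 'a
  using mu_fpow[of z n] n_ge2 runit_nz by auto

lemma hil_nz: "a \<noteq> 0 \<Longrightarrow> b \<noteq> 0 \<Longrightarrow> hil a b \<noteq> 0"
  using hil(1) mu_nz by blast

text \<open>Reduces multiplicative laws of the symbol to identities between tame symbols, which are
  elements of the field itself: a root of unity in \<open>mu n\<close> is known once its class
  modulo p is.\<close>

lemma hil_mult_aux:
  assumes "a \<noteq> 0" "b \<noteq> 0" "a' \<noteq> 0" "b' \<noteq> 0" "tame a'' b'' = tame a b * tame a' b'" "a'' \<noteq> 0" "b'' \<noteq> 0"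
  shows "hil a'' b'' = hil a b * hil a' b'"
proof (rule hil_eqI)
  show "hil a b * hil a' b' - tame a'' b'' ^ tame_exp \<in> fpow v 1"
    unfolding assms(5) power_mult_distrib
    by (rule fpow_cong_mult)
      (use assms hil(2) runit_fpow[OF mu_fpow[OF hil(1)]] runit_tame runit_power runit_fpow n_ge2 in auto)
qed (use assms hil mu_mult in auto)

lemma hil_mult_left: "a \<noteq> 0 \<Longrightarrow> a' \<noteq> 0 \<Longrightarrow> b \<noteq> 0 \<Longrightarrow> hil (a * a') b = hil a b * hil a' b"
  by (rule hil_mult_aux)
    (auto simp: tame_def val_mult power_int_mult_distrib distrib_right power_int_add divide_simps)

lemma hil_mult_right: "a \<noteq> 0 \<Longrightarrow> b' \<noteq> 0 \<Longrightarrow> b \<noteq> 0 \<Longrightarrow> hil a (b * b') = hil a b * hil a b'"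
  by (rule hil_mult_aux)
    (auto simp: tame_def val_mult power_int_mult_distrib distrib_left power_int_add divide_simps)

lemma hil_eq1I: "a \<noteq> 0 \<Longrightarrow> b \<noteq> 0 \<Longrightarrow> tame a b - 1 \<in> fpow v 1 \<Longrightarrow> hil a b = 1"
proof -
  assume a: "a \<noteq> 0" "b \<noteq> 0" "tame a b - 1 \<in> fpow v 1"
  have "tame a b ^ tame_exp - 1 ^ tame_exp \<in> fpow v 1"
    using a by (intro fpow_cong_power) (auto simp: runit_tame runit_fpow)
  then show ?thesis using a by (intro hil_eqI) (auto simp: fpow_diff_commute)
qed

lemma hil_swap: "a \<noteq> 0 \<Longrightarrow> b \<noteq> 0 \<Longrightarrow> hil a b * hil b a = 1"
proof -
  assume ab: "a \<noteq> 0" "b \<noteq> 0"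
  have "hil 1 1 = hil a b * hil b a"
    using ab power_int_minus_one_mult_self[of "v a * v b", where 'a = 'a]
    by (intro hil_mult_aux) (auto simp: tame_def mult.commute[of "v b"] divide_simps)
  moreover have "hil 1 1 = 1" by (rule hil_eq1I) (auto simp: tame_def)
  ultimately show ?thesis by simp
qed

lemma hil_one_left [simp]: "b \<noteq> 0 \<Longrightarrow> hil 1 b = 1" by (rule hil_eq1I) (auto simp: tame_def)
lemma hil_one_right [simp]: "b \<noteq> 0 \<Longrightarrow> hil b 1 = 1" by (rule hil_eq1I) (auto simp: tame_def)

lemma hil_divide_left: "a \<noteq> 0 \<Longrightarrow> b \<noteq> 0 \<Longrightarrow> c \<noteq> 0 \<Longrightarrow> hil (a / b) c = hil a c * hil c b"
  using hil_mult_left[of "a / b" b c] hil_swap[of b c] by (simp add: mult.assoc)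

lemma hil_divide_right: "a \<noteq> 0 \<Longrightarrow> b \<noteq> 0 \<Longrightarrow> c \<noteq> 0 \<Longrightarrow> hil c (a / b) = hil c a * hil b c"
  using hil_mult_right[of c b "a / b"] hil_swap[of c b] by (simp add: mult.assoc)

text \<open>The sign in the tame symbol is made for this relation: \<open>v a * v a\<close> and
  \<open>v a\<close> have the same parity, so it cancels the sign in the power of -a.\<close>

lemma hil_neg_self: "a \<noteq> 0 \<Longrightarrow> hil a (- a) = 1"
proof (rule hil_eq1I)
  assume a: "a \<noteq> 0"
  have "(- a) powi v a = (-1) powi v a * a powi v a"
    using power_int_mult_distrib[of "-1" a "v a"] by simp
  moreover have "(- 1 :: 'a) powi (v a * v a) = (-1) powi v a"
    by (simp add: power_int_minus_left)
  ultimately have "tame a (- a) = 1" using a by (simp add: tame_def)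
  then show "tame a (- a) - 1 \<in> fpow v 1" by simp
qed auto

lemma hil_minus_one: "a \<noteq> 0 \<Longrightarrow> hil (- 1) a = hil a a" "a \<noteq> 0 \<Longrightarrow> hil a (- 1) = hil a a"
proof -
  assume a: "a \<noteq> 0"
  have 1: "hil a (- 1) * hil a a = 1" using hil_neg_self[OF a] hil_mult_right[of a a "-1"] a by simp
  have 2: "hil a (- 1) * hil (- 1) a = 1" using hil_swap a by simp
  have 3: "hil a a * hil a a = 1" using hil_swap a by simp
  show "hil (- 1) a = hil a a" "hil a (- 1) = hil a a" using 1 2 3 by (metis mult_cancel_left mult_cancel_right hil_nz a)+
qed

lemma hil_minus_left: "a \<noteq> 0 \<Longrightarrow> b \<noteq> 0 \<Longrightarrow> hil (- a) b = hil b b * hil a b"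
  using hil_mult_left[of "-1" a b] by (simp add: hil_minus_one)

lemma hil_minus_right: "a \<noteq> 0 \<Longrightarrow> b \<noteq> 0 \<Longrightarrow> hil b (- a) = hil b b * hil b a"
  using hil_mult_right[of b a "-1"] by (simp add: hil_minus_one)

lemma powi_cong_one: "runit x \<Longrightarrow> x - 1 \<in> fpow v 1 \<Longrightarrow> x powi k - 1 \<in> fpow v 1"
proof -
  assume x: "runit x" "x - 1 \<in> fpow v 1"
  have *: "y ^ j - 1 \<in> fpow v 1" if "runit y" "y - 1 \<in> fpow v 1" for y j
    using fpow_cong_power[of y 1 1 j] that runit_fpow by simp
  have "inverse x - inverse 1 \<in> fpow v 1" using x by (intro inverse_cong) auto
  then show ?thesis using * x runit_inverse by (simp add: power_int_def power_inverse[symmetric])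
qed

lemma hil_principal_left: "x - 1 \<in> fpow v 1 \<Longrightarrow> b \<noteq> 0 \<Longrightarrow> hil x b = 1"
proof -
  assume a: "x - 1 \<in> fpow v 1" "b \<noteq> 0"
  then have "runit x" using runit_one_plus[of "x - 1"] by simp
  then show ?thesis using a powi_cong_one[of x] by (intro hil_eq1I) (auto simp: tame_def runit_def)
qed

lemma hil_principal_right: "x - 1 \<in> fpow v 1 \<Longrightarrow> b \<noteq> 0 \<Longrightarrow> hil b x = 1"
  using hil_principal_left[of x b] hil_swap[of b x] by (cases "x = 0") (auto simp: runit_iff[of 1, simplified])

lemma hil_units: "runit a \<Longrightarrow> runit b \<Longrightarrow> hil a b = 1"
  by (rule hil_eq1I) (auto simp: tame_def runit_def)

text \<open>If \<open>v a\<close> is not negative, then either \<open>a\<close> or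
  \<open>1 - a\<close> makes the other one a principal unit, or both are units; each time the symbol
  is trivial.\<close>

lemma hil_steinberg: assumes "a \<noteq> 0" "a \<noteq> 1" shows "hil a (1 - a) = 1"
proof -
  consider "v a > 0" | "v a = 0" "v (1 - a) = 0" | "v a = 0" "v (1 - a) > 0" | "v a < 0"
    using val_add[of 1 "- a"] assms by force
  then show ?thesis
  proof cases
    case 1 then show ?thesis using assms by (intro hil_principal_right) (auto simp: fpow_def)
  next
    case 2 then show ?thesis using assms by (intro hil_units) (auto simp: runit_def)
  next
    case 3 then show ?thesis using assms
      by (intro hil_principal_left) (auto simp: fpow_def simp flip: val_minus[of "1 - a"])
  next
    case 4
    \<comment> \<open>For negative valuation, 1 - a is -a times the principal unit 1 - 1/a, and
      \<open>hil_neg_self\<close> handles the factor -a.\<close>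
    have "1 - inverse a - 1 \<in> fpow v 1" using 4 assms by (simp add: fpow_def val_inverse)
    then have "hil (inverse a) (1 - inverse a) = 1" "1 - inverse a \<noteq> 0"
      using assms by (auto intro!: hil_principal_right)
    moreover have "1 - a = (1 - inverse a) * (- a)" using assms by (simp add: algebra_simps)
    moreover have "hil (inverse a) b * hil a b = 1" if "b \<noteq> 0" for b
      using hil_mult_left[of "inverse a" a b] assms that by simp
    ultimately show ?thesis
      using assms hil_mult_right[of a "- a" "1 - inverse a"] hil_neg_self[of a]
      by (metis mult_1 mult.right_neutral neg_equal_0_iff_equal)
  qed
qed

lemma hil_self_square: "a \<noteq> 0 \<Longrightarrow> hil a a * hil a a = 1" by (rule hil_swap)

lemmas hil_expand = hil_mult_left hil_mult_right hil_divide_left hil_divide_right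
  hil_minus_left hil_minus_right

text \<open>The Steinberg relation enters through the Pluecker relation \<open>p * r = s * y + x * w\<close>.\<close>
lemma hil_pluecker:
  assumes nz: "x \<noteq> 0" "y \<noteq> 0" "w \<noteq> 0" "p \<noteq> 0" "r \<noteq> 0" "s \<noteq> 0" and rel: "s * y = p * r - x * w"
  shows "hil (p/x) (p/y) * hil (s/p) (s/w) = hil (s/x) (s/r) * hil (r/y) (r/w)"
proof -
  have e: "1 - (s * y) / (p * r) = (x * w) / (p * r)" using nz by (simp add: field_simps rel)
  have "(s * y) / (p * r) \<noteq> 1" using e nz by auto
  then have st: "hil ((s * y) / (p * r)) ((x * w) / (p * r)) = 1"
    using hil_steinberg[of "(s * y) / (p * r)"] nz e by simp
  have sw: "hil p y * hil y p = 1" "hil x p * hil p x = 1" "hil x y * hil y x = 1"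
    "hil s w * hil w s = 1" "hil s p * hil p s = 1" "hil p w * hil w p = 1"
    "hil p p * hil p p = 1" "hil r p * hil p r = 1"
    using hil_swap nz by auto
  \<comment> \<open>The trivial Steinberg symbol is multiplied in; after expansion the surplus
    consists of pairs of mutually inverse symbols.\<close>
  have "hil (p/x) (p/y) * hil (s/p) (s/w) =
    hil (p/x) (p/y) * hil (s/p) (s/w) * hil ((s * y) / (p * r)) ((x * w) / (p * r))" by (simp add: st)
  also have "\<dots> = (hil p y * hil y p) * (hil x p * hil p x) * (hil x y * hil y x) * (hil s w * hil w s)
     * (hil s p * hil p s) * (hil p w * hil w p) * (hil p p * hil p p) * (hil r p * hil p r)
     * (hil (s/x) (s/r) * hil (r/y) (r/w))"
    using nz by (simp add: hil_expand mult_ac)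
  also have "\<dots> = hil (s/x) (s/r) * hil (r/y) (r/w)" by (simp only: sw mult_1)
  finally show ?thesis .
qed

end

section \<open>Two by two matrices and the function \<open>Xf\<close>\<close>

definition mat2 :: "'b \<Rightarrow> 'b \<Rightarrow> 'b \<Rightarrow> 'b \<Rightarrow> 'b::field^2^2" where
  "mat2 a b c d = vector [vector [a, b], vector [c, d]]"

lemma mat2_nth [simp]: "mat2 a b c d $ 1 $ 1 = a" "mat2 a b c d $ 1 $ 2 = b"
  "mat2 a b c d $ 2 $ 1 = c" "mat2 a b c d $ 2 $ 2 = d"
  by (simp_all add: mat2_def)

lemma mat2_eqI: "g$1$1 = h$1$1 \<Longrightarrow> g$1$2 = h$1$2 \<Longrightarrow> g$2$1 = h$2$1 \<Longrightarrow> g$2$2 = h$2$2 \<Longrightarrow> g = (h :: 'b^2^2)"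
  by (auto simp: vec_eq_iff forall_2)

lemma mat2_cases: obtains a b c d where "g = mat2 a b c d"
  by (rule that[of "g$1$1" "g$1$2" "g$2$1" "g$2$2"]) (rule mat2_eqI; simp)

lemma mat2_mult [simp]: "mat2 a b c d ** mat2 a' b' c' d' =
    mat2 (a * a' + b * c') (a * b' + b * d') (c * a' + d * c') (c * b' + d * d')"
  by (rule mat2_eqI) (simp_all add: matrix_matrix_mult_def sum_2)

lemma mat2_eq_iff [simp]: "mat2 a b c d = mat2 a' b' c' d' \<longleftrightarrow> a = a' \<and> b = b' \<and> c = c' \<and> d = d'"
  by (metis mat2_nth)

lemma mat_1_mat2: "mat 1 = mat2 1 0 0 1"
  by (rule mat2_eqI) (simp_all add: mat_def)

lemma dg_mat2: "dg t = mat2 t 0 0 (inverse t)" by (simp add: dg_def mat2_def)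

lemma mat2_SL2 [simp]: "mat2 a b c d \<in> SL2 \<longleftrightarrow> a * d - b * c = 1"
  by (simp add: SL2_def det_2)

text \<open>On \<open>SL2\<close> this is the inverse. Its entries are entries of g up to sign, so
  integrality and congruences pass to it at sight.\<close>

definition adj2 :: "'b::field^2^2 \<Rightarrow> 'b^2^2" where
  "adj2 g = mat2 (g$2$2) (- (g$1$2)) (- (g$2$1)) (g$1$1)"

lemma adj2_mat2 [simp]: "adj2 (mat2 a b c d) = mat2 d (- b) (- c) a" by (simp add: adj2_def)

lemma adj2: "g \<in> SL2 \<Longrightarrow> g ** adj2 g = mat 1" "g \<in> SL2 \<Longrightarrow> adj2 g ** g = mat 1"
  "g \<in> SL2 \<Longrightarrow> adj2 g \<in> SL2"
  by (cases rule: mat2_cases[of g]; simp add: mat_1_mat2 algebra_simps)+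

lemma SL2_mult: "g \<in> SL2 \<Longrightarrow> h \<in> SL2 \<Longrightarrow> g ** h \<in> SL2"
  by (simp add: SL2_def det_mul)

lemma SL2_one: "mat 1 \<in> SL2" by (simp add: SL2_def)

lemma Xf_mat2: "Xf (mat2 a b c d) = (if c \<noteq> 0 then c else d)" by (simp add: Xf_def)

lemma Xf_nz: "g \<in> SL2 \<Longrightarrow> Xf g \<noteq> 0"
  by (cases rule: mat2_cases[of g]) (auto simp: Xf_mat2)

lemma Xf_upper_left: "g \<in> SL2 \<Longrightarrow> g$2$1 = 0 \<Longrightarrow> Xf (g ** h) = Xf g * Xf h"
  by (cases rule: mat2_cases[of g]; cases rule: mat2_cases[of h]) (auto simp: Xf_mat2)

lemma Xf_upper_right: "g$2$1 \<noteq> 0 \<Longrightarrow> k \<in> SL2 \<Longrightarrow> k$2$1 = 0 \<Longrightarrow> Xf (g ** k) = Xf g / Xf k"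
proof (cases rule: mat2_cases[of g], cases rule: mat2_cases[of k])
  fix a b c d a' b' c' d' assume "g$2$1 \<noteq> 0" "k \<in> SL2" "k$2$1 = 0"
    and G: "g = mat2 a b c d" and K: "k = mat2 a' b' c' d'"
  then have z: "c \<noteq> 0" "c' = 0" and 1: "a' * d' = 1" by auto
  then have "a' \<noteq> 0" "d' \<noteq> 0" "a' = 1 / d'" by (auto simp: eq_divide_eq)
  then show ?thesis using z by (simp add: G K Xf_mat2)
qed

text \<open>When the lower left entry of a product cancels, the determinant of \<open>h\<close>
  still ties the lower left entry of \<open>g\<close> to the other two values. Together with the two
  rules for upper triangular factors this covers all degenerate cases of the cocycle
  identity.\<close>

lemma Xf_mult_upper:
  assumes "g \<in> SL2" "h \<in> SL2" "(g ** h)$2$1 = 0" "h$2$1 \<noteq> 0" shows "Xf g = - (Xf (g ** h) * Xf h)"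
proof -
  obtain a b c d where h: "h = mat2 a b c d" using mat2_cases .
  obtain a' b' c' d' where g: "g = mat2 a' b' c' d'" using mat2_cases .
  have r: "c' * a + d' * c = 0" "a * d - b * c = 1" using assms by (auto simp: h g)
  have "c' = c' * (a * d - b * c)" by (simp add: r)
  also have "\<dots> = (c' * a + d' * c) * d - (c' * b + d' * d) * c" by (simp add: algebra_simps)
  finally have "c' = - ((c' * b + d' * d) * c)" by (simp add: r)
  moreover have "c' \<noteq> 0" using r assms by (auto simp: g h)
  ultimately show ?thesis using assms by (simp add: g h Xf_mat2)
qed

section \<open>The cocycle identity and the splitting over the maximal compact subgroup\<close>

context tame_field
begin

abbreviation coc where "coc \<equiv> cocycle v n"

text \<open>Only six values of \<open>Xf\<close> occur, at the three factors and their partial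
  products. If all of them are lower left entries, they satisfy a Pluecker relation and the
  Steinberg relation applies. In every degenerate case some of the six are monomials in the others,
  and bimultiplicativity with antisymmetry suffices.\<close>

lemma cocycle_identity:
  assumes g: "g \<in> SL2" and h: "h \<in> SL2" and k: "k \<in> SL2"
  shows "coc g h * coc (g ** h) k = coc g (h ** k) * coc h k"
proof -
  define x y w p r s where "x = Xf g" "y = Xf h" "w = Xf k" "p = Xf (g ** h)" "r = Xf (h ** k)" "s = Xf (g ** (h ** k))"
  note defs = this
  have nz: "x \<noteq> 0" "y \<noteq> 0" "w \<noteq> 0" "p \<noteq> 0" "r \<noteq> 0" "s \<noteq> 0"
    using assms by (auto simp: defs Xf_nz SL2_mult)
  note sw = hil_swap[OF nz(1) nz(2)] hil_swap[OF nz(1) nz(3)] hil_swap[OF nz(1) nz(4)]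
   hil_swap[OF nz(1) nz(5)] hil_swap[OF nz(1) nz(6)] hil_swap[OF nz(2) nz(3)] hil_swap[OF nz(2) nz(4)]
   hil_swap[OF nz(2) nz(5)] hil_swap[OF nz(2) nz(6)] hil_swap[OF nz(3) nz(4)] hil_swap[OF nz(3) nz(5)]
   hil_swap[OF nz(3) nz(6)] hil_swap[OF nz(4) nz(5)] hil_swap[OF nz(4) nz(6)] hil_swap[OF nz(5) nz(6)]
   hil_self_square[OF nz(1)] hil_self_square[OF nz(2)] hil_self_square[OF nz(3)]
   hil_self_square[OF nz(4)] hil_self_square[OF nz(5)] hil_self_square[OF nz(6)]
  have "hil (p/x) (p/y) * hil (s/p) (s/w) = hil (s/x) (s/r) * hil (r/y) (r/w)"
  proof -
    consider "g$2$1 = 0" | "g$2$1 \<noteq> 0" "h$2$1 = 0" "k$2$1 = 0" | "h$2$1 \<noteq> 0" "k$2$1 = 0" "(g ** h)$2$1 = 0"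
      | "h$2$1 \<noteq> 0" "k$2$1 = 0" "(g ** h)$2$1 \<noteq> 0"
      | "g$2$1 \<noteq> 0" "k$2$1 \<noteq> 0" "h$2$1 = 0" | "h$2$1 \<noteq> 0" "k$2$1 \<noteq> 0" "(g ** h)$2$1 = 0"
      | "g$2$1 \<noteq> 0" "h$2$1 \<noteq> 0" "k$2$1 \<noteq> 0" "(h ** k)$2$1 = 0"
      | "k$2$1 \<noteq> 0" "(h ** k)$2$1 \<noteq> 0" "(g ** (h ** k))$2$1 = 0"
      | "g$2$1 \<noteq> 0" "h$2$1 \<noteq> 0" "k$2$1 \<noteq> 0" "(g ** h)$2$1 \<noteq> 0" "(h ** k)$2$1 \<noteq> 0" "(g ** (h ** k))$2$1 \<noteq> 0"
      by blast
    then show ?thesis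
    proof cases
      case 1
      have e: "p = x * y" "s = x * r" using 1 g Xf_upper_left defs by auto
      show ?thesis unfolding e using nz sw by (simp add: hil_expand mult_ac)
    next
      case 2
      have gh: "(g ** h)$2$1 \<noteq> 0" using 2 h Xf_nz[of h]
        by (cases rule: mat2_cases[of g]; cases rule: mat2_cases[of h]) auto
      have e: "p = x / y" "r = y * w" "s = p / w"
        using 2 h k gh Xf_upper_left Xf_upper_right[of g h] Xf_upper_right[of "g ** h" k] defs
        by (auto simp: matrix_mul_assoc)
      show ?thesis unfolding e using nz sw by (simp add: hil_expand) algebra
    next
      case 3
      have e: "x = - (p * y)" "s = p * w" "r = y / w"
        using 3 g h k Xf_upper_left[of "g ** h" k] Xf_upper_right[of h k] Xf_mult_upper[of g h] SL2_mult defs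
        by (auto simp: matrix_mul_assoc)
      show ?thesis unfolding e using nz sw by (simp add: hil_expand) algebra
    next
      case 4
      have e: "s = p / w" "r = y / w"
        using 4 g h k Xf_upper_right[of "g ** h" k] Xf_upper_right[of h k] SL2_mult defs
        by (auto simp: matrix_mul_assoc)
      show ?thesis unfolding e using nz sw by (simp add: hil_expand) algebra
    next
      case 5
      have e: "p = x / y" "r = y * w"
        using 5 g h k Xf_upper_right[of g h] Xf_upper_left[of h k] defs by auto
      show ?thesis unfolding e using nz sw by (simp add: hil_expand)
    next
      case 6
      have e: "x = - (p * y)" "s = p * w"
        using 6 g h k Xf_upper_left[of "g ** h" k] Xf_mult_upper[of g h] SL2_mult defs
        by (auto simp: matrix_mul_assoc)
      show ?thesis unfolding e using nz sw by (simp add: hil_expand) algebra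
    next
      case 7
      have e: "y = - (r * w)" "s = x / r"
        using 7 g h k Xf_upper_right[of g "h ** k"] Xf_mult_upper[of h k] SL2_mult defs by auto
      show ?thesis unfolding e using nz sw by (simp add: hil_expand) algebra
    next
      case 8
      have e: "x = - (s * r)" "p = - (s * w)"
        using 8 g h k Xf_mult_upper[of g "h ** k"] Xf_mult_upper[of "g ** h" k] SL2_mult defs
        by (auto simp: matrix_mul_assoc)
      show ?thesis unfolding e using nz sw by (simp add: hil_expand) algebra
    next
      case 9
      obtain a b c d where H: "h = mat2 a b c d" using mat2_cases .
      obtain a' b' c' d' where G: "g = mat2 a' b' c' d'" using mat2_cases .
      obtain a'' b'' c'' d'' where K: "k = mat2 a'' b'' c'' d''" using mat2_cases .
      \<comment> \<open>A polynomial identity in the twelve entries; the determinant of the middle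
        factor appears as the coefficient of the last term.\<close>
      have "s * y = p * r - x * w * (a * d - b * c)"
        using 9 unfolding defs by (simp add: G H K Xf_mat2 algebra_simps)
      then have "s * y = p * r - x * w" using h by (simp add: H)
      then show ?thesis by (rule hil_pluecker[OF nz])
    qed
  qed
  then show ?thesis by (simp add: cocycle_def defs matrix_mul_assoc mult.commute)
qed

lemma SL2_K1: "g \<in> K1 v \<Longrightarrow> g \<in> SL2" by (simp add: K1_def)

lemma K1_mat2: "mat2 a b c d \<in> K1 v \<longleftrightarrow>
    a * d - b * c = 1 \<and> a \<in> fpow v 0 \<and> b \<in> fpow v 0 \<and> c \<in> fpow v 0 \<and> d \<in> fpow v 0"
  by (auto simp: K1_def forall_2)

lemma K1_mult: "g \<in> K1 v \<Longrightarrow> h \<in> K1 v \<Longrightarrow> g ** h \<in> K1 v"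
  using SL2_mult[of g h]
  by (cases rule: mat2_cases[of g]; cases rule: mat2_cases[of h])
    (auto simp: K1_def forall_2 intro: fpow_add fpow_mult_left)

lemma K1_one: "mat 1 \<in> K1 v" by (simp add: mat_1_mat2 K1_mat2)

lemma K1_adj2: "g \<in> K1 v \<Longrightarrow> adj2 g \<in> K1 v"
  by (cases rule: mat2_cases[of g]) (auto simp: K1_mat2 algebra_simps)

definition nu :: "'a \<Rightarrow> 'a^2^2" where "nu x = mat2 1 x 0 1"
definition nl :: "'a \<Rightarrow> 'a^2^2" where "nl x = mat2 1 0 x 1"
definition weyl :: "'a^2^2" where "weyl = mat2 0 1 (-1) 0"

lemma nu_K1 [simp]: "nu x \<in> K1 v \<longleftrightarrow> x \<in> fpow v 0" by (simp add: nu_def K1_mat2)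
lemma nl_K1 [simp]: "nl x \<in> K1 v \<longleftrightarrow> x \<in> fpow v 0" by (simp add: nl_def K1_mat2)
lemma weyl_K1 [simp]: "weyl \<in> K1 v" by (simp add: weyl_def K1_mat2)
lemma dg_K1: "runit t \<Longrightarrow> dg t \<in> K1 v"
  by (simp add: dg_mat2 K1_mat2 runit_fpow runit_inverse runit_nz)

lemma K1_bottom_unit: "mat2 a b c d \<in> K1 v \<Longrightarrow> c \<in> fpow v 1 \<Longrightarrow> runit d"
proof -
  assume a: "mat2 a b c d \<in> K1 v" "c \<in> fpow v 1"
  then have "b * c \<in> fpow v 1" "a * d = 1 + b * c" by (auto simp: K1_mat2 fpow_mult_left algebra_simps)
  then have "runit (a * d)" using runit_one_plus by simp
  then show "runit d" using a by (auto simp: K1_mat2 runit_iff intro: fpow_mult_left)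
qed

text \<open>Kubota's splitting of the cocycle over \<open>K1\<close>; it is trivial on \<open>Kc v j\<close> for \<open>j \<ge> 1\<close> and on the integral
  Borel subgroup.\<close>
definition splitting :: "'a^2^2 \<Rightarrow> 'a" where
  "splitting k = (if k$2$1 \<noteq> 0 \<and> k$2$1 \<in> fpow v 1 then hil (k$2$1) (k$2$2) else 1)"

lemma splitting_mat2: "splitting (mat2 a b c d) = (if c \<noteq> 0 \<and> c \<in> fpow v 1 then hil c d else 1)"
  by (simp add: splitting_def)

lemma splitting_mu: "k \<in> K1 v \<Longrightarrow> splitting k \<in> mu n"
  by (cases rule: mat2_cases[of k]) (auto simp: splitting_mat2 dest: K1_bottom_unit intro!: hil runit_nz)

text \<open>The set of these \<open>h\<close> is closed under products, so the splitting has to be verified on generators of \<open>K1\<close> only.\<close>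
definition splits_at :: "'a^2^2 \<Rightarrow> bool" where
  "splits_at h \<longleftrightarrow> (\<forall>g\<in>K1 v. splitting (g ** h) = coc g h * splitting g * splitting h)"

lemma splits_at_mult:
  assumes "h \<in> K1 v" "k \<in> K1 v" "splits_at h" "splits_at k" shows "splits_at (h ** k)"
  unfolding splits_at_def
proof
  fix g assume g: "g \<in> K1 v"
  have 1: "splitting (h ** k) = coc h k * splitting h * splitting k" using assms by (simp add: splits_at_def)
  have "splitting (g ** h ** k) = coc (g ** h) k * splitting (g ** h) * splitting k"
    using assms K1_mult[OF g] by (simp add: splits_at_def)
  also have "\<dots> = (coc g h * coc (g ** h) k) * splitting g * splitting h * splitting k"
    using assms g by (simp add: splits_at_def)
  also have "\<dots> = coc g (h ** k) * splitting g * splitting (h ** k)"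
    using 1 cocycle_identity[of g h k] assms g by (simp add: SL2_K1)
  finally show "splitting (g ** (h ** k)) = coc g (h ** k) * splitting g * splitting (h ** k)"
    by (simp add: matrix_mul_assoc)
qed

lemma splits_at_nu: "x \<in> fpow v 0 \<Longrightarrow> splits_at (nu x)"
  unfolding splits_at_def
proof
  fix g assume x: "x \<in> fpow v 0" and g: "g \<in> K1 v"
  obtain a b c d where G: "g = mat2 a b c d" using mat2_cases .
  have nz: "Xf g \<noteq> 0" using g by (simp add: Xf_nz SL2_K1)
  have X: "Xf (g ** nu x) = Xf g" by (simp add: G nu_def Xf_mat2)
  have c: "coc g (nu x) = 1" using nz by (simp add: cocycle_def X) (simp add: nu_def Xf_mat2)
  have "hil c (d + c * x) = hil c d" if "c \<noteq> 0" "c \<in> fpow v 1"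
  proof -
    have d: "runit d" using K1_bottom_unit g that G by blast
    have "(d + c * x) / d - 1 = c * x / d" using runit_nz[OF d] by (simp add: field_simps)
    then have "(d + c * x) / d - 1 \<in> fpow v 1" using that x d by (simp add: fpow_divide_unit fpow_mult_right)
    then have e: "hil c ((d + c * x) / d) = 1" using that by (intro hil_principal_right)
    have "runit (d + c * x)" using runit_cong[OF d, of "d + c * x"] that x by (simp add: fpow_mult_right)
    then show ?thesis using hil_mult_right[of c "(d + c * x) / d" d] e that runit_nz[OF d] runit_nz by auto
  qed
  then show "splitting (g ** nu x) = coc g (nu x) * splitting g * splitting (nu x)"
    unfolding c by (auto simp: G nu_def splitting_mat2 add.commute)
qed

text \<open>Symbols of two units are trivial, so only \<open>hil t c\<close> remains of the cocycle,
  and the same factor separates the new splitting value from the old one.\<close>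

lemma splits_at_dg: "runit t \<Longrightarrow> splits_at (dg t)"
  unfolding splits_at_def
proof
  fix g assume t: "runit t" and g: "g \<in> K1 v"
  obtain a b c d where G: "g = mat2 a b c d" using mat2_cases .
  have t0: "t \<noteq> 0" using t runit_nz by blast
  have gd: "g ** dg t = mat2 (a * t) (b / t) (c * t) (d / t)" by (simp add: G dg_mat2 divide_inverse)
  have Xd: "Xf (dg t) = inverse t" by (simp add: dg_mat2 Xf_mat2)
  have s1: "splitting (dg t) = 1" by (simp add: dg_mat2 splitting_mat2)
  have tt: "hil t t = 1" using t by (simp add: hil_units)
  show "splitting (g ** dg t) = coc g (dg t) * splitting g * splitting (dg t)"
  proof (cases "c = 0")
    case True
    then have "d \<noteq> 0" using g by (auto simp: G K1_mat2)
    then have "coc g (dg t) = hil (1 / t) d" using True t0 unfolding cocycle_def gd Xd by (simp add: G Xf_mat2)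
    also have "\<dots> = 1"
      using True g K1_bottom_unit[of a b c d] t by (intro hil_units) (auto simp: G intro: runit_divide)
    finally show ?thesis using True s1 unfolding gd by (simp add: G splitting_mat2)
  next
    case c: False
    have "c * t / inverse t = c * t * t" by (simp add: divide_inverse)
    then have "coc g (dg t) = hil t (c * t * t)"
      using c t0 unfolding cocycle_def gd Xd by (simp add: G Xf_mat2)
    also have "\<dots> = hil t c" using c t0 tt by (simp add: hil_expand)
    finally have C: "coc g (dg t) = hil t c" .
    show ?thesis
    proof (cases "c \<in> fpow v 1")
      case True
      then have d: "runit d" using K1_bottom_unit g G by blast
      have "hil (c * t) (d / t) = hil t c * hil c d"
        using c t0 d runit_nz[OF d] t tt by (simp add: hil_expand hil_units)
      then show ?thesis using True c t0 t C s1 unfolding gd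
        by (simp add: G splitting_mat2 fpow_unit_cancel mult.commute[of c])
    next
      case False
      then have "runit c" using g by (simp add: G K1_mat2 runit_iff)
      then show ?thesis using False c t0 t C s1 unfolding gd
        by (simp add: G splitting_mat2 fpow_unit_cancel mult.commute[of c] hil_units)
    qed
  qed
qed

text \<open>The lower row (c, d) becomes (-d, c), and at most one of c and d is a nonunit. If it is
  c, the cocycle value \<open>hil d c\<close> cancels the old splitting value; if it is d, it
  produces the new one.\<close>

lemma splits_at_weyl: "splits_at weyl"
  unfolding splits_at_def
proof
  fix g assume g: "g \<in> K1 v"
  obtain a b c d where G: "g = mat2 a b c d" using mat2_cases .
  have gw: "g ** weyl = mat2 (- b) a (- d) c" by (simp add: G weyl_def)
  have Xw: "Xf weyl = -1" by (simp add: weyl_def Xf_mat2)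
  have s1: "splitting weyl = 1" using runit_one by (auto simp: weyl_def splitting_mat2 runit_iff)
  have du: "c \<in> fpow v 1 \<Longrightarrow> runit d" using K1_bottom_unit g G by blast
  have cu: "d \<in> fpow v 1 \<Longrightarrow> runit c"
    using K1_bottom_unit[of "- b" a "- d" c] K1_mult[OF g weyl_K1] unfolding gw by simp
  have O: "c \<in> fpow v 0" "d \<in> fpow v 0" using g by (auto simp: G K1_mat2)
  consider "c = 0" | "d = 0" | "c \<noteq> 0" "d \<noteq> 0" by blast
  then show "splitting (g ** weyl) = coc g weyl * splitting g * splitting weyl"
  proof cases
    case 1
    then have d: "runit d" using du by simp
    have "coc g weyl = hil (- 1) d" using 1 runit_nz[OF d] unfolding cocycle_def gw Xw by (simp add: G Xf_mat2)
    moreover have "hil (- 1) d = 1" using d by (simp add: hil_units)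
    ultimately show ?thesis using 1 d s1 unfolding gw by (simp add: G splitting_mat2 runit_iff)
  next
    case 2
    then have c: "runit c" using cu by simp
    have "coc g weyl = 1" using 2 runit_nz[OF c] unfolding cocycle_def gw Xw by (simp add: G Xf_mat2)
    then show ?thesis using 2 c s1 unfolding gw by (simp add: G splitting_mat2 runit_iff)
  next
    case 3
    have "coc g weyl = hil (- d / c) d" using 3 unfolding cocycle_def gw Xw by (simp add: G Xf_mat2)
    also have "\<dots> = hil d c"
      using 3 hil_self_square[of d] by (simp add: hil_expand)
    finally have C: "coc g weyl = hil d c" .
    consider "c \<in> fpow v 1" | "d \<in> fpow v 1" "c \<notin> fpow v 1" | "c \<notin> fpow v 1" "d \<notin> fpow v 1" by blast
    then show ?thesis
    proof cases
      case 1
      then show ?thesis using 3 du hil_swap[of d c] C s1 unfolding gw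
        by (simp add: G splitting_mat2 runit_iff)
    next
      case 2
      then have "runit c" using cu by simp
      then show ?thesis using 3 2 C s1 unfolding gw by (simp add: G splitting_mat2 hil_minus_left hil_units)
    next
      case 3
      then have "runit c" "runit d" using O by (auto simp: runit_iff)
      then show ?thesis using 3 C s1 unfolding gw by (simp add: G splitting_mat2 hil_units)
    qed
  qed
qed

lemma bruhat: "c \<noteq> 0 \<Longrightarrow> a * d - b * c = 1 \<Longrightarrow> mat2 a b c d = nu (a / c) ** weyl ** dg (- c) ** nu (d / c)"
  by (simp add: nu_def weyl_def dg_mat2 field_simps)

text \<open>A unit in the lower left corner puts \<open>h\<close> into the big Bruhat cell with
  integral factors, all of which are generators treated above. Otherwise the lower right entry is a
  unit, and \<open>h ** weyl\<close> is of the first kind.\<close>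

lemma splitting_mult:
  assumes "g \<in> K1 v" "h \<in> K1 v" shows "splitting (g ** h) = coc g h * splitting g * splitting h"
proof -
  have unit: "splits_at (mat2 a b c d)" if "mat2 a b c d \<in> K1 v" "runit c" for a b c d
  proof -
    have "a / c \<in> fpow v 0" "d / c \<in> fpow v 0" using that by (auto simp: K1_mat2 fpow_divide_unit)
    then show ?thesis
      using that bruhat[of c a d b] runit_nz[OF that(2)]
      by (auto simp: K1_mat2 intro!: splits_at_mult K1_mult splits_at_nu splits_at_weyl splits_at_dg dg_K1)
  qed
  have "splits_at h"
  proof -
    obtain a b c d where H: "h = mat2 a b c d" using mat2_cases .
    show ?thesis
    proof (cases "runit c")
      case False
      then have "c \<in> fpow v 1" using assms by (simp add: H K1_mat2 runit_iff)
      then have d: "runit d" using K1_bottom_unit assms H by blast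
      have hw: "h ** weyl = mat2 (- b) a (- d) c" by (simp add: H weyl_def)
      have w2: "weyl ** dg (-1) \<in> K1 v" "splits_at (weyl ** dg (-1))"
        by (auto intro!: splits_at_mult K1_mult splits_at_weyl splits_at_dg dg_K1)
      \<comment> \<open>The square of \<open>weyl\<close> is -1, so \<open>weyl ** dg (-1)\<close>
        is its inverse.\<close>
      have "h = (h ** weyl) ** (weyl ** dg (-1))" by (simp add: H weyl_def dg_mat2)
      moreover have "splits_at (h ** weyl)" using unit d assms K1_mult[OF assms(2) weyl_K1] by (simp add: hw)
      ultimately show ?thesis using splits_at_mult[OF K1_mult[OF assms(2) weyl_K1] w2(1)] w2 by metis
    qed (use unit assms H in blast)
  qed
  then show ?thesis using assms by (simp add: splits_at_def)
qed

lemma splitting_upper: "k$2$1 = 0 \<Longrightarrow> splitting k = 1" by (simp add: splitting_def)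

lemma splitting_Kc: "k \<in> Kc v l \<Longrightarrow> l \<ge> 1 \<Longrightarrow> splitting k = 1"
proof -
  assume k: "k \<in> Kc v l" "l \<ge> 1"
  have "(k - mat 1) $ 2 $ 2 \<in> fpow v (int l)" "(k - mat 1) $ 2 $ 1 \<in> fpow v (int l)" using k by (auto simp: Kc_def)
  then have "k$2$2 - 1 \<in> fpow v (int l)" by (simp add: mat_def)
  then have "k$2$2 - 1 \<in> fpow v 1" using fpow_mono k by force
  then show ?thesis by (auto simp: splitting_def hil_principal_right)
qed

text \<open>Here the parity of the residue cardinality enters: q lies in p and is odd, so 2 in p
  would put 1 into p.\<close>

lemma two_unit: "runit 2"
proof -
  obtain k where k: "residue_card v = 2 * k + 1" using odd_q by (elim oddE)
  have "(2::'a) \<notin> fpow v 1"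
  proof
    assume "(2::'a) \<in> fpow v 1"
    then have "2 * of_nat k \<in> fpow v 1" by (simp add: fpow_mult_right)
    then have "of_nat (residue_card v) - 2 * of_nat k \<in> fpow v 1" using residue_card_in_fpow fpow_diff by blast
    then show False using runit_one by (simp add: k runit_iff)
  qed
  then show ?thesis by (simp add: runit_iff)
qed

subsection \<open>Reduction modulo powers of the maximal ideal\<close>

definition gcong :: "nat \<Rightarrow> 'a^2^2 \<Rightarrow> 'a^2^2 \<Rightarrow> bool" where
  "gcong l g h \<longleftrightarrow> (\<forall>i k. g$i$k - h$i$k \<in> fpow v (int l))"

lemma gcong_mat2: "gcong l (mat2 a b c d) (mat2 a' b' c' d') \<longleftrightarrow>
    a - a' \<in> fpow v (int l) \<and> b - b' \<in> fpow v (int l) \<and> c - c' \<in> fpow v (int l) \<and> d - d' \<in> fpow v (int l)"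
  by (auto simp: gcong_def forall_2)

lemma gcong_refl [simp]: "gcong l g g" by (simp add: gcong_def)
lemma gcong_sym: "gcong l g h \<longleftrightarrow> gcong l h g" by (simp add: gcong_def fpow_diff_commute)
lemma gcong_trans: "gcong l g h \<Longrightarrow> gcong l h k \<Longrightarrow> gcong l g k"
  unfolding gcong_def using fpow_trans by blast

lemma gcong_mult:
  assumes "gcong l g g'" "gcong l h h'" "g' \<in> K1 v" "h \<in> K1 v" shows "gcong l (g ** h) (g' ** h')"
  using assms
  by (cases rule: mat2_cases[of g]; cases rule: mat2_cases[of h]; cases rule: mat2_cases[of g'];
      cases rule: mat2_cases[of h'])
    (auto simp: gcong_mat2 K1_mat2 add_diff_add intro!: fpow_add fpow_cong_mult)

lemma gcong_mult_left_iff: "b \<in> K1 v \<Longrightarrow> g \<in> K1 v \<Longrightarrow> h \<in> K1 v \<Longrightarrow> gcong l (b ** g) (b ** h) \<longleftrightarrow> gcong l g h"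
proof -
  assume a: "b \<in> K1 v" "g \<in> K1 v" "h \<in> K1 v"
  have "gcong l (adj2 b ** (b ** g)) (adj2 b ** (b ** h))" if "gcong l (b ** g) (b ** h)"
    using that a by (auto intro!: gcong_mult K1_mult K1_adj2)
  then show ?thesis using a gcong_mult[of l b b g h] by (auto simp: matrix_mul_assoc adj2 SL2_K1)
qed

lemma gcong_mult_right_iff: "b \<in> K1 v \<Longrightarrow> g \<in> K1 v \<Longrightarrow> h \<in> K1 v \<Longrightarrow> gcong l (g ** b) (h ** b) \<longleftrightarrow> gcong l g h"
proof -
  assume a: "b \<in> K1 v" "g \<in> K1 v" "h \<in> K1 v"
  have "gcong l (g ** b ** adj2 b) (h ** b ** adj2 b)" if "gcong l (g ** b) (h ** b)"
    using that a by (auto intro!: gcong_mult K1_mult K1_adj2)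
  then show ?thesis using a gcong_mult[of l g h b b] by (auto simp: adj2 SL2_K1 simp flip: matrix_mul_assoc)
qed

lemma Kc_iff: "k \<in> Kc v l \<longleftrightarrow> k \<in> K1 v \<and> gcong l k (mat 1)"
  by (simp add: Kc_def gcong_def)

lemma Kc_mono: "k \<in> Kc v l \<Longrightarrow> j \<le> l \<Longrightarrow> k \<in> Kc v j"
  by (auto simp: Kc_def intro: fpow_mono[of _ "int l"])

lemma Kc_conj: "k \<in> Kc v l \<Longrightarrow> g \<in> K1 v \<Longrightarrow> adj2 g ** k ** g \<in> Kc v l"
  unfolding Kc_iff using gcong_mult[of l "adj2 g ** k" "adj2 g ** mat 1" g g]
    gcong_mult[of l "adj2 g" "adj2 g" k "mat 1"]
  by (auto simp: K1_adj2 K1_mult adj2 SL2_K1)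

lemma nl_Kc: "x \<in> fpow v (int l) \<Longrightarrow> nl x \<in> Kc v l"
  using fpow_mono[of x "int l" 0] by (simp add: Kc_iff) (simp add: nl_def mat_1_mat2 gcong_mat2)

text \<open>One more digit of the expansion in the uniformizer splits each class into finitely many.
  The result is phrased as a classifying map, which can be applied to matrices entry by
  entry.\<close>

lemma finite_reduction:
  "\<exists>\<alpha>::'a \<Rightarrow> 'a. finite (\<alpha> ` fpow v 0) \<and> (\<forall>x\<in>fpow v 0. \<forall>y\<in>fpow v 0. \<alpha> x = \<alpha> y \<longleftrightarrow> x - y \<in> fpow v (int l))"
proof -
  have "\<exists>A. finite A \<and> (\<forall>x\<in>fpow v 0. \<exists>a\<in>A. x - a \<in> fpow v (int l))"
  proof (induction l)
    case 0
    then show ?case by (intro exI[of _ "{0}"]) auto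
  next
    case (Suc l)
    then obtain A where A: "finite A" "\<And>x. x \<in> fpow v 0 \<Longrightarrow> \<exists>a\<in>A. x - a \<in> fpow v (int l)" by blast
    let ?B = "(\<lambda>(a, r). a + r * \<pi> ^ l) ` (A \<times> reps)"
    have "\<exists>b\<in>?B. x - b \<in> fpow v (int (Suc l))" if x: "x \<in> fpow v 0" for x
    proof -
      obtain a where a: "a \<in> A" "x - a \<in> fpow v (int l)" using A x by blast
      have O: "(x - a) / \<pi> ^ l \<in> fpow v 0"
        using a pi_nz by (cases "x = a") (auto simp: fpow_def val_divide val_power val_pi)
      let ?r = "rep ((x - a) / \<pi> ^ l)"
      have "((x - a) / \<pi> ^ l - ?r) * \<pi> ^ l \<in> fpow v (1 + int l)"
        using rep(2)[OF O] pi_nz by (intro fpow_mult) (auto simp: fpow_def val_power val_pi)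
      moreover have "((x - a) / \<pi> ^ l - ?r) * \<pi> ^ l = x - (a + ?r * \<pi> ^ l)"
        using pi_nz by (simp add: left_diff_distrib[of _ ?r])
      ultimately have "x - (a + ?r * \<pi> ^ l) \<in> fpow v (int (Suc l))" by simp
      then show ?thesis using a rep(1)[OF O] by force
    qed
    then show ?case using A by (intro exI[of _ ?B]) auto
  qed
  then obtain A where A: "finite A" "\<And>x. x \<in> fpow v 0 \<Longrightarrow> \<exists>a\<in>A. x - a \<in> fpow v (int l)" by blast
  define \<alpha> where "\<alpha> x = (SOME a. a \<in> A \<and> x - a \<in> fpow v (int l))" for x
  have al: "\<alpha> x \<in> A \<and> x - \<alpha> x \<in> fpow v (int l)" if "x \<in> fpow v 0" for x
    unfolding \<alpha>_def by (rule someI_ex) (use A that in blast)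
  show ?thesis
  proof (intro exI[of _ \<alpha>] conjI ballI)
    show "finite (\<alpha> ` fpow v 0)" by (rule finite_subset[OF _ A(1)]) (use al in blast)
    fix x y assume xy: "x \<in> fpow v 0" "y \<in> fpow v 0"
    show "\<alpha> x = \<alpha> y \<longleftrightarrow> x - y \<in> fpow v (int l)"
    proof
      assume "\<alpha> x = \<alpha> y" then show "x - y \<in> fpow v (int l)" using al xy by (metis fpow_trans fpow_diff_commute)
    next
      assume "x - y \<in> fpow v (int l)"
      \<comment> \<open>Congruent arguments satisfy the same predicate, so \<open>SOME\<close>
        returns literally the same element for both.\<close>
      then have "(\<lambda>a. a \<in> A \<and> x - a \<in> fpow v (int l)) = (\<lambda>a. a \<in> A \<and> y - a \<in> fpow v (int l))"
        by (intro ext) (metis fpow_trans fpow_diff_commute)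
      then show "\<alpha> x = \<alpha> y" unfolding \<alpha>_def by (rule arg_cong)
    qed
  qed
qed

text \<open>The classes of the four entries take finitely many values on \<open>K1 v\<close>, and a
  section picks one matrix for each; the group SL2 over the quotient ring need not be
  formed.\<close>

lemma level_reps_ex: "\<exists>X. finite X \<and> X \<subseteq> K1 v \<and> (\<forall>g\<in>K1 v. \<exists>x\<in>X. gcong l g x) \<and>
    (\<forall>x\<in>X. \<forall>y\<in>X. gcong l x y \<longrightarrow> x = y)"
proof -
  obtain \<alpha> :: "'a \<Rightarrow> 'a" where al: "finite (\<alpha> ` fpow v 0)"
    "\<And>x y. x \<in> fpow v 0 \<Longrightarrow> y \<in> fpow v 0 \<Longrightarrow> \<alpha> x = \<alpha> y \<longleftrightarrow> x - y \<in> fpow v (int l)"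
    using finite_reduction by metis
  define t where "t g = (\<alpha> (g$1$1), \<alpha> (g$1$2), \<alpha> (g$2$1), \<alpha> (g$2$2))" for g :: "'a^2^2"
  have t: "t g = t h \<longleftrightarrow> gcong l g h" if "g \<in> K1 v" "h \<in> K1 v" for g h
    using that by (cases rule: mat2_cases[of g]; cases rule: mat2_cases[of h]) (simp add: t_def al(2) K1_mat2 gcong_mat2)
  let ?A = "\<alpha> ` fpow v 0"
  have "t ` K1 v \<subseteq> ?A \<times> ?A \<times> ?A \<times> ?A" by (auto simp: t_def K1_def)
  then have fin: "finite (t ` K1 v)" by (rule finite_subset) (use al in auto)
  have inv: "t (inv_into (K1 v) t \<tau>) = \<tau>" "inv_into (K1 v) t \<tau> \<in> K1 v" if "\<tau> \<in> t ` K1 v" for \<tau>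
    using that by (auto simp: f_inv_into_f inv_into_into)
  show ?thesis
  proof (intro exI[of _ "inv_into (K1 v) t ` t ` K1 v"] conjI ballI impI)
    fix g assume "g \<in> K1 v"
    then show "\<exists>x\<in>inv_into (K1 v) t ` t ` K1 v. gcong l g x" using inv t by (metis imageI)
  next
    fix x y assume "x \<in> inv_into (K1 v) t ` t ` K1 v" "y \<in> inv_into (K1 v) t ` t ` K1 v" "gcong l x y"
    then show "x = y" using inv t by (metis (no_types, opaque_lifting) imageE)
  next
    show "inv_into (K1 v) t ` t ` K1 v \<subseteq> K1 v" using inv by blast
  qed (use fin in auto)
qed

definition level_reps :: "nat \<Rightarrow> ('a^2^2) set" where
  "level_reps l = (SOME X. finite X \<and> X \<subseteq> K1 v \<and> (\<forall>g\<in>K1 v. \<exists>x\<in>X. gcong l g x) \<and>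
    (\<forall>x\<in>X. \<forall>y\<in>X. gcong l x y \<longrightarrow> x = y))"

lemma level_reps: "finite (level_reps l)" "level_reps l \<subseteq> K1 v" "g \<in> K1 v \<Longrightarrow> \<exists>x\<in>level_reps l. gcong l g x"
  "x \<in> level_reps l \<Longrightarrow> y \<in> level_reps l \<Longrightarrow> gcong l x y \<Longrightarrow> x = y"
  using someI_ex[OF level_reps_ex[of l]] unfolding level_reps_def[symmetric] by blast+

definition level_invariant :: "nat \<Rightarrow> ('a^2^2 \<Rightarrow> 'b) \<Rightarrow> bool" where
  "level_invariant l \<phi> \<longleftrightarrow> (\<forall>g\<in>K1 v. \<forall>h\<in>K1 v. gcong l g h \<longrightarrow> \<phi> g = \<phi> h)"

lemma sum_level_reps_reindex:
  fixes \<phi> :: "'a^2^2 \<Rightarrow> complex"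
  assumes \<phi>: "level_invariant l \<phi>" and f: "\<And>g. g \<in> K1 v \<Longrightarrow> f g \<in> K1 v"
    and inj: "\<And>g h. g \<in> K1 v \<Longrightarrow> h \<in> K1 v \<Longrightarrow> gcong l (f g) (f h) \<Longrightarrow> gcong l g h"
  shows "(\<Sum>x\<in>level_reps l. \<phi> (f x)) = (\<Sum>x\<in>level_reps l. \<phi> x)"
proof -
  define \<rho> where "\<rho> g = (SOME x. x \<in> level_reps l \<and> gcong l g x)" for g
  have \<rho>: "\<rho> g \<in> level_reps l \<and> gcong l g (\<rho> g)" if "g \<in> K1 v" for g
    unfolding \<rho>_def by (rule someI_ex) (use level_reps(3) that in blast)
  have KXK: "x \<in> K1 v" if "x \<in> level_reps l" for x using level_reps(2) that by blast
  have "inj_on (\<lambda>x. \<rho> (f x)) (level_reps l)"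
    by (rule inj_onI) (metis level_reps(4) KXK \<rho> f inj gcong_sym gcong_trans)
  moreover have "(\<lambda>x. \<rho> (f x)) ` level_reps l \<subseteq> level_reps l" using \<rho> f KXK by blast
  ultimately have bij: "bij_betw (\<lambda>x. \<rho> (f x)) (level_reps l) (level_reps l)" by (simp add: bij_betw_def endo_inj_surj level_reps(1))
  have "(\<Sum>x\<in>level_reps l. \<phi> (f x)) = (\<Sum>x\<in>level_reps l. \<phi> (\<rho> (f x)))"
  proof (rule sum.cong[OF refl])
    fix x assume x: "x \<in> level_reps l"
    show "\<phi> (f x) = \<phi> (\<rho> (f x))" using \<phi> \<rho> f KXK x unfolding level_invariant_def by blast
  qed
  also have "\<dots> = (\<Sum>x\<in>level_reps l. \<phi> x)" by (rule sum.reindex_bij_betw[OF bij])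
  finally show ?thesis .
qed

subsection \<open>The model of the principal series\<close>

text \<open>The number \<open>l\<close> only bounds the conductor from above. Outside the units the
  values carry no meaning.\<close>

definition unit_hom :: "('a \<Rightarrow> complex) \<Rightarrow> nat \<Rightarrow> bool" where
  "unit_hom u l \<longleftrightarrow> (\<forall>s t. runit s \<longrightarrow> runit t \<longrightarrow> u (s * t) = u s * u t) \<and> (\<forall>t. runit t \<longrightarrow> u t \<noteq> 0) \<and>
     (\<forall>t. t - 1 \<in> fpow v (int l) \<longrightarrow> u t = 1)"

lemma unit_hom_mult: "unit_hom u l \<Longrightarrow> runit s \<Longrightarrow> runit t \<Longrightarrow> u (s * t) = u s * u t" by (simp add: unit_hom_def)
lemma unit_hom_nz: "unit_hom u l \<Longrightarrow> runit s \<Longrightarrow> u s \<noteq> 0" by (simp add: unit_hom_def)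
lemma unit_hom_principal: "unit_hom u l \<Longrightarrow> t - 1 \<in> fpow v (int l) \<Longrightarrow> u t = 1" by (simp add: unit_hom_def)
lemma unit_hom_one: "unit_hom u l \<Longrightarrow> u 1 = 1" using unit_hom_principal[of u l 1] by simp

lemma unit_hom_mono: "unit_hom u l \<Longrightarrow> l \<le> l' \<Longrightarrow> unit_hom u l'"
  unfolding unit_hom_def by (meson fpow_mono of_nat_le_iff)

lemma unit_hom_inverse: "unit_hom u l \<Longrightarrow> runit t \<Longrightarrow> u (inverse t) = inverse (u t)"
  using unit_hom_mult[of u l t "inverse t"] unit_hom_one[of u l]
  by (simp add: runit_inverse runit_nz) (metis inverse_unique)

lemma unit_hom_cong:
  assumes "unit_hom u l" "runit s" "runit t" "s - t \<in> fpow v (int l)" shows "u s = u t"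
proof -
  have "s / t - 1 = (s - t) / t" using assms runit_nz by (simp add: diff_divide_distrib)
  then have "u (s / t) = 1" using assms by (intro unit_hom_principal) (auto simp: fpow_divide_unit)
  then show ?thesis using unit_hom_mult[of u l "s / t" t] assms by (simp add: runit_divide runit_nz)
qed

text \<open>For \<open>u\<close> the restriction of \<open>\<chi>\<^sub>k\<close> to the units, this is the space of \<open>K\<^sub>l\<close>-fixed vectors of \<open>V\<^sub>k\<close>,
  read along the section \<open>splitting\<close>.\<close>
definition level_space :: "('a \<Rightarrow> complex) \<Rightarrow> nat \<Rightarrow> ('a^2^2 \<Rightarrow> complex) set" where
  "level_space u l = {F. (\<forall>g. g \<notin> K1 v \<longrightarrow> F g = 0) \<and> (\<forall>g\<in>K1 v. \<forall>x\<in>fpow v 0. F (nu x ** g) = F g) \<and>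
     (\<forall>g\<in>K1 v. \<forall>t. runit t \<longrightarrow> F (dg t ** g) = u t * F g) \<and> (\<forall>g\<in>K1 v. \<forall>k\<in>Kc v l. F (g ** k) = F g)}"

lemma mpsD:
  assumes "F \<in> level_space u l"
  shows "g \<notin> K1 v \<Longrightarrow> F g = 0" "g \<in> K1 v \<Longrightarrow> x \<in> fpow v 0 \<Longrightarrow> F (nu x ** g) = F g"
    "g \<in> K1 v \<Longrightarrow> runit t \<Longrightarrow> F (dg t ** g) = u t * F g" "g \<in> K1 v \<Longrightarrow> k \<in> Kc v l \<Longrightarrow> F (g ** k) = F g"
  using assms by (auto simp: level_space_def)

lemma level_space_mono: "F \<in> level_space u l \<Longrightarrow> l \<le> l' \<Longrightarrow> F \<in> level_space u l'"
  using Kc_mono by (auto simp: level_space_def)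

lemma level_space_gcong: "F \<in> level_space u l \<Longrightarrow> g \<in> K1 v \<Longrightarrow> h \<in> K1 v \<Longrightarrow> gcong l g h \<Longrightarrow> F g = F h"
proof -
  assume a: "F \<in> level_space u l" "g \<in> K1 v" "h \<in> K1 v" "gcong l g h"
  have "gcong l (adj2 g ** h) (adj2 g ** g)" using a by (intro gcong_mult) (auto simp: gcong_sym K1_adj2)
  then have "adj2 g ** h \<in> Kc v l" using a by (simp add: Kc_iff adj2 SL2_K1 K1_mult K1_adj2)
  then have "F (g ** (adj2 g ** h)) = F g" using a mpsD(4) by blast
  then show ?thesis using a by (simp add: matrix_mul_assoc adj2 SL2_K1)
qed

lemma lower_decomp: "runit d \<Longrightarrow> a * d - b * c = 1 \<Longrightarrow> mat2 a b c d = nu (b / d) ** (dg (inverse d) ** nl (c / d))"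
proof -
  assume d: "runit d" "a * d - b * c = 1"
  then have "a * d = 1 + b * c" by (simp add: algebra_simps)
  then show ?thesis using runit_nz[OF d(1)] by (simp add: nu_def dg_mat2 nl_def field_simps)
qed

text \<open>A matrix of \<open>K1 v\<close> that is upper triangular modulo level \<open>l\<close>
  is an integral Borel element times a lower unipotent one in \<open>Kc v l\<close>. The latter
  moves to the right of \<open>g\<close> by conjugation, since \<open>Kc v l\<close> is normal, and
  is absorbed there.\<close>

lemma level_space_hecke:
  assumes F: "F \<in> level_space u l" and l: "l \<ge> 1" and h: "h \<in> K1 v" "h$2$1 \<in> fpow v (int l)" and g: "g \<in> K1 v"
  shows "F (h ** g) = u (inverse (h$2$2)) * F g"
proof -
  obtain a b c d where H: "h = mat2 a b c d" using mat2_cases .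
  have c: "c \<in> fpow v (int l)" "c \<in> fpow v 1" using h l fpow_mono[of c "int l" 1] by (auto simp: H)
  have d: "runit d" using K1_bottom_unit h c by (simp add: H)
  have cd: "c / d \<in> fpow v (int l)" using c d by (simp add: fpow_divide_unit)
  then have nlK: "nl (c / d) \<in> K1 v" using fpow_mono by simp
  have bd: "b / d \<in> fpow v 0" using h d by (simp add: H K1_mat2 fpow_divide_unit)
  have e: "h ** g = nu (b / d) ** (dg (inverse d) ** (nl (c / d) ** g))"
    using lower_decomp[OF d, of a b c] h by (simp add: H K1_mat2 flip: matrix_mul_assoc)
  have "F (h ** g) = u (inverse d) * F (nl (c / d) ** g)"
    unfolding e using d nlK g bd F by (simp add: mpsD K1_mult dg_K1 runit_inverse)
  also have "nl (c / d) ** g = g ** (adj2 g ** nl (c / d) ** g)" using g by (simp add: matrix_mul_assoc adj2 SL2_K1)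
  also have "F \<dots> = F g" using F g Kc_conj[OF nl_Kc[OF cd] g] mpsD(4) by blast
  finally show ?thesis by (simp add: H)
qed

definition Rt :: "'a^2^2 \<Rightarrow> ('a^2^2 \<Rightarrow> complex) \<Rightarrow> 'a^2^2 \<Rightarrow> complex" where
  "Rt k F = (\<lambda>g. if g \<in> K1 v then F (g ** k) else 0)"

definition stab :: "('a^2^2 \<Rightarrow> complex) set \<Rightarrow> bool" where
  "stab M \<longleftrightarrow> complex_vector.subspace M \<and> (\<forall>F\<in>M. \<forall>g. g \<notin> K1 v \<longrightarrow> F g = 0) \<and> (\<forall>k\<in>K1 v. \<forall>F\<in>M. Rt k F \<in> M)"

lemma scaleC_app [simp]: "(c *\<^sub>C F) g = c * F g" for F :: "'c \<Rightarrow> complex"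
  by (simp add: scaleC_fun_def scaleC_complex_def)

lemma sum_app: "(\<Sum>x\<in>A. f x) g = (\<Sum>x\<in>A. f x g)" for f :: "'d \<Rightarrow> 'c \<Rightarrow> complex"
  by (induction A rule: infinite_finite_induct) auto

lemma stab_0: "stab M \<Longrightarrow> 0 \<in> M" by (simp add: stab_def complex_vector.subspace_def)
lemma stab_add: "stab M \<Longrightarrow> F \<in> M \<Longrightarrow> G \<in> M \<Longrightarrow> F + G \<in> M" by (simp add: stab_def complex_vector.subspace_def)
lemma stab_scale: "stab M \<Longrightarrow> F \<in> M \<Longrightarrow> c *\<^sub>C F \<in> M" by (simp add: stab_def complex_vector.subspace_def)
lemma stab_Rt: "stab M \<Longrightarrow> F \<in> M \<Longrightarrow> k \<in> K1 v \<Longrightarrow> Rt k F \<in> M" by (simp add: stab_def)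
lemma stab_supp: "stab M \<Longrightarrow> F \<in> M \<Longrightarrow> g \<notin> K1 v \<Longrightarrow> F g = 0" by (simp add: stab_def)
lemma stab_diff: "stab M \<Longrightarrow> F \<in> M \<Longrightarrow> G \<in> M \<Longrightarrow> F - G \<in> M"
  by (simp add: stab_def complex_vector.subspace_diff)
lemma stab_sum: "stab M \<Longrightarrow> (\<And>x. x \<in> A \<Longrightarrow> f x \<in> M) \<Longrightarrow> sum f A \<in> M"
  by (simp add: stab_def complex_vector.subspace_sum)

lemma Rt_one: "(\<And>g. g \<notin> K1 v \<Longrightarrow> F g = 0) \<Longrightarrow> Rt (mat 1) F = F" by (auto simp: Rt_def)

lemma stab_level_space: "stab (level_space u l)"
proof -
  have "Rt k F \<in> level_space u l" if k: "k \<in> K1 v" and F: "F \<in> level_space u l" for k F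
  proof -
    have "F (g ** k' ** k) = F (g ** k)" if g: "g \<in> K1 v" and k': "k' \<in> Kc v l" for g k'
    proof -
      have "g ** k' ** k = (g ** (k ** adj2 k)) ** k' ** k" using adj2(1)[OF SL2_K1[OF k]] by simp
      also have "\<dots> = (g ** k) ** (adj2 k ** k' ** k)" by (simp only: matrix_mul_assoc)
      finally have "g ** k' ** k = (g ** k) ** (adj2 k ** k' ** k)" .
      then show ?thesis using mpsD(4)[OF F K1_mult[OF g k] Kc_conj[OF k' k]] by simp
    qed
    moreover have "k' \<in> K1 v" if "k' \<in> Kc v l" for k' using that by (simp add: Kc_iff)
    ultimately show ?thesis using k F
      by (auto simp: level_space_def Rt_def K1_mult dg_K1 simp flip: matrix_mul_assoc)
  qed
  moreover have "complex_vector.subspace (level_space u l)"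
    by (auto simp: complex_vector.subspace_def level_space_def distrib_left)
  ultimately show ?thesis by (auto simp: stab_def mpsD)
qed

text \<open>By Frobenius reciprocity such vectors of level \<open>l\<close> correspond to the
  homomorphisms out of \<open>level_space u l\<close>, with \<open>delta_fn u l\<close> below as the
  universal one. This is why their uniqueness controls irreducibility.\<close>

definition borel_eigen :: "('a \<Rightarrow> complex) \<Rightarrow> ('a^2^2 \<Rightarrow> complex) \<Rightarrow> bool" where
  "borel_eigen u F \<longleftrightarrow> (\<forall>x\<in>fpow v 0. Rt (nu x) F = F) \<and> (\<forall>t. runit t \<longrightarrow> Rt (dg t) F = u t *\<^sub>C F)"

lemma borel_eigen_nu: "borel_eigen u F \<Longrightarrow> g \<in> K1 v \<Longrightarrow> x \<in> fpow v 0 \<Longrightarrow> F (g ** nu x) = F g"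
proof -
  assume "borel_eigen u F" "g \<in> K1 v" "x \<in> fpow v 0"
  then have "Rt (nu x) F g = F g" by (simp add: borel_eigen_def)
  then show ?thesis using \<open>g \<in> K1 v\<close> by (simp add: Rt_def)
qed

lemma borel_eigen_dg: "borel_eigen u F \<Longrightarrow> g \<in> K1 v \<Longrightarrow> runit t \<Longrightarrow> F (g ** dg t) = u t * F g"
proof -
  assume "borel_eigen u F" "g \<in> K1 v" "runit t"
  then have "Rt (dg t) F g = u t * F g" by (simp add: borel_eigen_def)
  then show ?thesis using \<open>g \<in> K1 v\<close> by (simp add: Rt_def)
qed

text \<open>Averaging over the Borel subgroup modulo level \<open>l\<close>.\<close>
lemma ex_borel_eigen:
  assumes u: "unit_hom u l" and l: "l \<ge> 1" and M: "stab M" "M \<subseteq> level_space u l" and F: "F \<in> M" "F \<noteq> 0"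
  shows "\<exists>G\<in>M. borel_eigen u G \<and> G (mat 1) \<noteq> 0"
proof -
  obtain g0 where g0: "F g0 \<noteq> 0" using F by (auto simp: fun_eq_iff)
  then have g0K: "g0 \<in> K1 v" using stab_supp M F by blast
  \<comment> \<open>Translation moves a nonzero value to the identity, where the average is
    evaluated at the end.\<close>
  define F1 where "F1 = Rt g0 F"
  have F1: "F1 \<in> M" using M F g0K by (simp add: F1_def stab_Rt)
  then have F1m: "F1 \<in> level_space u l" using M by blast
  have F11: "F1 (mat 1) \<noteq> 0" using g0 by (simp add: F1_def Rt_def K1_one)
  \<comment> \<open>The weight is supported on matrices upper triangular modulo level
    \<open>l\<close> and undoes the factor \<open>u (inverse d)\<close> of
    \<open>level_space_hecke\<close>. So the surviving terms at the identity are all equal and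
    cannot cancel.\<close>
  define wt where "wt x = (if x$2$1 \<in> fpow v (int l) then u (x$2$2) else 0)" for x :: "'a^2^2"
  have unit22: "runit (x$2$2)" if "x \<in> K1 v" "x$2$1 \<in> fpow v (int l)" for x
    using that l K1_bottom_unit fpow_mono[of "x$2$1" "int l" 1] by (cases rule: mat2_cases[of x]) auto
  have wt_level_invariant: "wt x = wt y" if xy: "x \<in> K1 v" "y \<in> K1 v" "gcong l x y" for x y
  proof -
    have 1: "x$2$1 - y$2$1 \<in> fpow v (int l)" "x$2$2 - y$2$2 \<in> fpow v (int l)" using xy by (auto simp: gcong_def)
    have "x$2$1 \<in> fpow v (int l) \<longleftrightarrow> y$2$1 \<in> fpow v (int l)"
      using 1 fpow_add[of "x$2$1 - y$2$1" "int l" "y$2$1"] fpow_diff[of "x$2$1" "int l" "x$2$1 - y$2$1"] by auto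
    then show ?thesis using unit_hom_cong[OF u] unit22 xy 1 by (auto simp: wt_def)
  qed
  define G where "G = (\<Sum>x\<in>level_reps l. wt x *\<^sub>C Rt x F1)"
  have KXK: "x \<in> K1 v" if "x \<in> level_reps l" for x using level_reps(2) that by blast
  have GM: "G \<in> M" unfolding G_def using M F1 KXK by (intro stab_sum stab_scale stab_Rt) auto
  have Gv: "G g = (\<Sum>x\<in>level_reps l. wt x * F1 (g ** x))" if "g \<in> K1 v" for g
    using that by (simp add: G_def sum_app Rt_def)
  have Gb: "G (g ** b) = u (b$1$1) * G g" if g: "g \<in> K1 v" and b: "b \<in> K1 v" "b$2$1 = 0" for g b
  proof -
    have b11: "runit (b$1$1)" using b K1_bottom_unit[of "b$2$2" "- b$1$2" 0 "b$1$1"]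
      by (cases rule: mat2_cases[of b]) (simp add: K1_mat2 mult.commute)
    define \<phi> where "\<phi> y = wt (adj2 b ** y) * F1 (g ** y)" for y
    have wtb: "wt (adj2 b ** y) = u (b$1$1) * wt y" if y: "y \<in> K1 v" for y
    proof -
      obtain a0 b0 c0 d0 where B: "b = mat2 a0 b0 c0 d0" using mat2_cases .
      have "wt (adj2 b ** y) = (if a0 * y$2$1 \<in> fpow v (int l) then u (a0 * y$2$2) else 0)"
        using b by (cases rule: mat2_cases[of y]) (simp add: wt_def B)
      then show ?thesis using b11 unit_hom_mult[OF u] unit22[OF y] by (simp add: B fpow_unit_cancel wt_def)
    qed
    have \<phi>: "level_invariant l \<phi>" unfolding level_invariant_def \<phi>_def
    proof (intro ballI impI)
      fix x y assume xy: "x \<in> K1 v" "y \<in> K1 v" "gcong l x y"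
      have "F1 (g ** x) = F1 (g ** y)" using level_space_gcong[OF F1m] xy g by (simp add: K1_mult gcong_mult_left_iff)
      then show "wt (adj2 b ** x) * F1 (g ** x) = wt (adj2 b ** y) * F1 (g ** y)"
        using wt_level_invariant[OF xy] xy by (simp add: wtb)
    qed
    have "G (g ** b) = (\<Sum>x\<in>level_reps l. wt x * F1 (g ** b ** x))" using Gv K1_mult[OF g b(1)] by simp
    also have "\<dots> = (\<Sum>x\<in>level_reps l. \<phi> (b ** x))"
      using adj2(2)[OF SL2_K1[OF b(1)]] by (simp add: \<phi>_def matrix_mul_assoc)
    also have "\<dots> = (\<Sum>x\<in>level_reps l. \<phi> x)"
      using b by (intro sum_level_reps_reindex[OF \<phi>]) (auto simp: K1_mult gcong_mult_left_iff)
    also have "\<dots> = u (b$1$1) * G g"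
      unfolding Gv[OF g] sum_distrib_left \<phi>_def using wtb KXK by (intro sum.cong) auto
    finally show ?thesis .
  qed
  have "borel_eigen u G"
    unfolding borel_eigen_def
  proof (intro conjI ballI allI impI ext)
    fix x g assume "x \<in> fpow v 0"
    then show "Rt (nu x) G g = G g" using Gb[of g "nu x"] stab_supp[OF M(1) GM] unit_hom_one[OF u]
      by (simp add: Rt_def) (simp add: nu_def)
  next
    fix t g assume "runit t"
    then show "Rt (dg t) G g = (u t *\<^sub>C G) g" using Gb[of g "dg t"] stab_supp[OF M(1) GM] dg_K1[of t]
      by (simp add: Rt_def) (simp add: dg_mat2)
  qed
  moreover have "G (mat 1) \<noteq> 0"
  proof -
    have "G (mat 1) = (\<Sum>x\<in>level_reps l. if x$2$1 \<in> fpow v (int l) then F1 (mat 1) else 0)"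
      unfolding Gv[OF K1_one]
    proof (rule sum.cong[OF refl])
      fix x assume x: "x \<in> level_reps l"
      have "wt x * F1 x = F1 (mat 1)" if c: "x$2$1 \<in> fpow v (int l)"
        using level_space_hecke[OF F1m l KXK[OF x] c K1_one] unit22[OF KXK[OF x] c] c unit_hom_nz[OF u] unit_hom_inverse[OF u]
        by (simp add: wt_def)
      then show "wt x * F1 (mat 1 ** x) = (if x$2$1 \<in> fpow v (int l) then F1 (mat 1) else 0)"
        by (simp add: wt_def)
    qed
    also have "\<dots> = of_nat (card {x \<in> level_reps l. x$2$1 \<in> fpow v (int l)}) * F1 (mat 1)"
      using level_reps(1) by (simp add: sum.If_cases Collect_conj_eq Int_commute)
    finally have "G (mat 1) = of_nat (card {x \<in> level_reps l. x$2$1 \<in> fpow v (int l)}) * F1 (mat 1)" .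
    moreover obtain x where "x \<in> level_reps l" "gcong l (mat 1) x" using level_reps(3)[OF K1_one] by blast
    then have "x \<in> {x \<in> level_reps l. x$2$1 \<in> fpow v (int l)}"
      by (cases rule: mat2_cases[of x]) (auto simp: mat_1_mat2 gcong_mat2)
    ultimately show ?thesis using F11 level_reps(1) by auto
  qed
  ultimately show ?thesis using GM by blast
qed

text \<open>The vector of level \<open>l\<close> concentrated on the coset of the identity and equal
  to 1 there; its other values are forced by \<open>level_space_hecke\<close>.\<close>

definition delta_fn :: "('a \<Rightarrow> complex) \<Rightarrow> nat \<Rightarrow> 'a^2^2 \<Rightarrow> complex" where
  "delta_fn u l = (\<lambda>g. if g \<in> K1 v \<and> g$2$1 \<in> fpow v (int l) then u (inverse (g$2$2)) else 0)"

lemma delta_fn_level_space: assumes u: "unit_hom u l" and l: "l \<ge> 1" shows "delta_fn u l \<in> level_space u l" "borel_eigen u (delta_fn u l)"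
proof -
  have unit22: "runit (x$2$2)" if "x \<in> K1 v" "x$2$1 \<in> fpow v (int l)" for x
    using that l K1_bottom_unit fpow_mono[of "x$2$1" "int l" 1] by (cases rule: mat2_cases[of x]) auto
  have 1: "delta_fn u l (nu x ** g) = delta_fn u l g" if "g \<in> K1 v" "x \<in> fpow v 0" for g x
  proof -
    have "(nu x ** g)$2$1 = g$2$1" "(nu x ** g)$2$2 = g$2$2"
      by (cases rule: mat2_cases[of g]; simp add: nu_def)+
    then show ?thesis using that K1_mult[of "nu x" g] by (simp add: delta_fn_def)
  qed
  have 2: "delta_fn u l (dg t ** g) = u t * delta_fn u l g" if g: "g \<in> K1 v" and t: "runit t" for g t
  proof -
    have "(dg t ** g)$2$1 = inverse t * g$2$1" "(dg t ** g)$2$2 = inverse t * g$2$2"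
      by (cases rule: mat2_cases[of g]; simp add: dg_mat2)+
    then show ?thesis using K1_mult[OF dg_K1[OF t] g] g t unit22[OF g] unit_hom_mult[OF u t runit_inverse]
      by (simp add: delta_fn_def fpow_unit_cancel runit_inverse)
  qed
  have 3: "delta_fn u l h = delta_fn u l g" if g: "g \<in> K1 v" and h: "h \<in> K1 v" and gh: "gcong l h g" for g h
  proof -
    have 1: "h$2$1 - g$2$1 \<in> fpow v (int l)" "h$2$2 - g$2$2 \<in> fpow v (int l)" using gh by (auto simp: gcong_def)
    have "h$2$1 \<in> fpow v (int l) \<longleftrightarrow> g$2$1 \<in> fpow v (int l)"
      using 1 fpow_add[of "h$2$1 - g$2$1" "int l" "g$2$1"] fpow_diff[of "h$2$1" "int l" "h$2$1 - g$2$1"] by auto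
    then show ?thesis using g h 1 unit22[of g] unit22[of h] unit_hom_cong[OF u]
      by (auto simp: delta_fn_def intro!: unit_hom_cong[OF u] inverse_cong runit_inverse)
  qed
  have 4: "delta_fn u l (g ** k) = delta_fn u l g" if "g \<in> K1 v" "k \<in> Kc v l" for g k
    using 3[of g "g ** k"] that gcong_mult[of l g g k "mat 1"] by (simp add: Kc_iff K1_mult)
  show "delta_fn u l \<in> level_space u l" using 1 2 4 by (auto simp: level_space_def) (simp add: delta_fn_def)
  have 5: "delta_fn u l (g ** nu x) = delta_fn u l g" if g: "g \<in> K1 v" and x: "x \<in> fpow v 0" for g x
  proof -
    obtain a b c d where G: "g = mat2 a b c d" using mat2_cases .
    have "u (inverse (c * x + d)) = u (inverse d)" if c: "c \<in> fpow v (int l)"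
    proof -
      have d: "runit d" using unit22[OF g] c by (simp add: G)
      have "runit (c * x + d)"
        using unit22[OF K1_mult[OF g, of "nu x"]] x c by (simp add: fpow_mult_right) (simp add: G nu_def)
      then show ?thesis using d c x by (auto intro!: unit_hom_cong[OF u] inverse_cong runit_inverse fpow_mult_right)
    qed
    then show ?thesis using K1_mult[OF g, of "nu x"] g x by (simp add: delta_fn_def) (simp add: G nu_def)
  qed
  have 6: "delta_fn u l (g ** dg t) = u t * delta_fn u l g" if g: "g \<in> K1 v" and t: "runit t" for g t
  proof -
    have "(g ** dg t)$2$1 = t * g$2$1" "(g ** dg t)$2$2 = inverse t * g$2$2"
      by (cases rule: mat2_cases[of g]; simp add: dg_mat2)+
    then show ?thesis using K1_mult[OF g dg_K1[OF t]] g t unit22[OF g] unit_hom_mult[OF u t runit_inverse]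
      by (simp add: delta_fn_def fpow_unit_cancel)
  qed
  show "borel_eigen u (delta_fn u l)" unfolding borel_eigen_def using 5 6 by (auto simp: Rt_def fun_eq_iff) (auto simp: delta_fn_def)
qed

text \<open>Weight the translate belonging to x by \<open>F x\<close>. At g only those x contribute
  for which \<open>g ** adj2 x\<close> is upper triangular modulo level \<open>l\<close>, each
  contributes \<open>F g\<close>, and \<open>N\<close> is their number.\<close>

lemma delta_fn_cyclic:
  assumes u: "unit_hom u l" and l: "l \<ge> 1" and F: "F \<in> level_space u l"
  shows "\<exists>a. F = (\<Sum>x\<in>level_reps l. a x *\<^sub>C Rt (adj2 x) (delta_fn u l))"
proof -
  define \<phi> :: "'a^2^2 \<Rightarrow> complex" where "\<phi> y = (if (adj2 y)$2$1 \<in> fpow v (int l) then 1 else 0)" for y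
  define N where "N = (\<Sum>x\<in>level_reps l. \<phi> x)"
  have \<phi>: "level_invariant l \<phi>" unfolding level_invariant_def
  proof (intro ballI impI)
    fix g h :: "'a^2^2" assume "gcong l g h"
    then have 1: "g$2$1 - h$2$1 \<in> fpow v (int l)" by (auto simp: gcong_def)
    have "g$2$1 \<in> fpow v (int l) \<longleftrightarrow> h$2$1 \<in> fpow v (int l)"
      using 1 fpow_add[of "g$2$1 - h$2$1" "int l" "h$2$1"] fpow_diff[of "g$2$1" "int l" "g$2$1 - h$2$1"] by auto
    then show "\<phi> g = \<phi> h" by (simp add: \<phi>_def adj2_def)
  qed
  have KXK: "x \<in> K1 v" if "x \<in> level_reps l" for x using level_reps(2) that by blast
  have N0: "N \<noteq> 0"
  proof -
    obtain x where x: "x \<in> level_reps l" "gcong l (mat 1) x" using level_reps(3)[OF K1_one] by blast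
    then have "x \<in> {x \<in> level_reps l. (adj2 x)$2$1 \<in> fpow v (int l)}"
      by (cases rule: mat2_cases[of x]) (auto simp: mat_1_mat2 gcong_mat2)
    moreover have "N = of_nat (card {x \<in> level_reps l. (adj2 x)$2$1 \<in> fpow v (int l)})"
      using level_reps(1) by (simp add: N_def \<phi>_def sum.If_cases Collect_conj_eq Int_commute)
    ultimately show ?thesis using level_reps(1) by auto
  qed
  have "F g = (\<Sum>x\<in>level_reps l. (F x / N) *\<^sub>C Rt (adj2 x) (delta_fn u l)) g" for g
  proof (cases "g \<in> K1 v")
    case g: True
    have "(\<Sum>x\<in>level_reps l. (F x / N) *\<^sub>C Rt (adj2 x) (delta_fn u l)) g = (\<Sum>x\<in>level_reps l. F x / N * delta_fn u l (g ** adj2 x))"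
      using g by (simp add: sum_app Rt_def)
    also have "\<dots> = (\<Sum>x\<in>level_reps l. F g / N * \<phi> (x ** adj2 g))"
    proof (rule sum.cong[OF refl])
      fix x assume "x \<in> level_reps l"
      then have x: "x \<in> K1 v" using KXK by blast
      have h: "g ** adj2 x \<in> K1 v" using g x by (simp add: K1_mult K1_adj2)
      have e: "adj2 (x ** adj2 g) = g ** adj2 x"
        by (cases rule: mat2_cases[of g]; cases rule: mat2_cases[of x]) (simp add: algebra_simps)
      have "F x * delta_fn u l (g ** adj2 x) = F g" if c: "(g ** adj2 x)$2$1 \<in> fpow v (int l)"
        using level_space_hecke[OF F l h c x] h c adj2(2)[OF SL2_K1[OF x]]
        by (simp add: delta_fn_def matrix_mul_assoc[symmetric])
      moreover have "delta_fn u l (g ** adj2 x) = 0" if c: "(g ** adj2 x)$2$1 \<notin> fpow v (int l)"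
        using c by (simp add: delta_fn_def)
      ultimately show "F x / N * delta_fn u l (g ** adj2 x) = F g / N * \<phi> (x ** adj2 g)"
        unfolding \<phi>_def e by auto
    qed
    also have "\<dots> = F g / N * (\<Sum>x\<in>level_reps l. \<phi> (x ** adj2 g))" by (simp add: sum_distrib_left)
    also have "(\<Sum>x\<in>level_reps l. \<phi> (x ** adj2 g)) = N"
      unfolding N_def using g by (intro sum_level_reps_reindex[OF \<phi>]) (auto simp: K1_mult K1_adj2 gcong_mult_right_iff)
    finally have e: "(\<Sum>x\<in>level_reps l. (F x / N) *\<^sub>C Rt (adj2 x) (delta_fn u l)) g = F g / N * N" .
    show ?thesis unfolding e using N0 by simp
  qed (use mpsD(1)[OF F] in \<open>simp add: sum_app Rt_def\<close>)
  then show ?thesis by (intro exI[of _ "\<lambda>x. F x / N"]) (rule ext)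
qed

definition equivariant :: "('a^2^2 \<Rightarrow> complex) set \<Rightarrow> (('a^2^2 \<Rightarrow> complex) \<Rightarrow> ('a^2^2 \<Rightarrow> complex)) \<Rightarrow> bool" where
  "equivariant M \<phi> \<longleftrightarrow> (\<forall>x\<in>M. \<forall>y\<in>M. \<phi> (x + y) = \<phi> x + \<phi> y) \<and> (\<forall>c. \<forall>x\<in>M. \<phi> (c *\<^sub>C x) = c *\<^sub>C \<phi> x) \<and>
     (\<forall>k\<in>K1 v. \<forall>x\<in>M. \<phi> (Rt k x) = Rt k (\<phi> x))"

lemma equivariant_add: "equivariant M \<phi> \<Longrightarrow> x \<in> M \<Longrightarrow> y \<in> M \<Longrightarrow> \<phi> (x + y) = \<phi> x + \<phi> y"
  unfolding equivariant_def by blast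
lemma equivariant_scale: "equivariant M \<phi> \<Longrightarrow> x \<in> M \<Longrightarrow> \<phi> (c *\<^sub>C x) = c *\<^sub>C \<phi> x"
  unfolding equivariant_def by blast
lemma equivariant_Rt: "equivariant M \<phi> \<Longrightarrow> x \<in> M \<Longrightarrow> k \<in> K1 v \<Longrightarrow> \<phi> (Rt k x) = Rt k (\<phi> x)"
  unfolding equivariant_def by blast

lemma equivariant_0: "equivariant M \<phi> \<Longrightarrow> stab M \<Longrightarrow> \<phi> 0 = 0"
  using stab_0[of M] unfolding equivariant_def by (metis complex_vector.scale_zero_left)

lemma equivariant_comb:
  assumes "equivariant M \<phi>" "stab M" "e \<in> M" "\<And>x. x \<in> X \<Longrightarrow> \<kappa> x \<in> K1 v"
  shows "\<phi> (\<Sum>x\<in>X. a x *\<^sub>C Rt (\<kappa> x) e) = (\<Sum>x\<in>X. a x *\<^sub>C Rt (\<kappa> x) (\<phi> e))"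
  using assms(4)
proof (induction X rule: infinite_finite_induct)
  case (insert x X)
  have M: "(\<Sum>x\<in>X. a x *\<^sub>C Rt (\<kappa> x) e) \<in> M" "a x *\<^sub>C Rt (\<kappa> x) e \<in> M" "Rt (\<kappa> x) e \<in> M"
    using insert assms by (auto intro!: stab_sum stab_scale stab_Rt)
  have "\<phi> (\<Sum>x\<in>X. a x *\<^sub>C Rt (\<kappa> x) e) = (\<Sum>x\<in>X. a x *\<^sub>C Rt (\<kappa> x) (\<phi> e))"
    using insert by blast
  moreover have "\<phi> (Rt (\<kappa> x) e) = Rt (\<kappa> x) (\<phi> e)" using insert assms equivariant_Rt by blast
  ultimately show ?case
    unfolding sum.insert[OF insert(1,2)] equivariant_add[OF assms(1) M(2,1)] equivariant_scale[OF assms(1) M(3)]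
    by simp
qed (use equivariant_0 assms in auto)

lemma equivariant_borel_eigen: "equivariant M \<phi> \<Longrightarrow> e \<in> M \<Longrightarrow> borel_eigen u e \<Longrightarrow> borel_eigen u (\<phi> e)"
  unfolding borel_eigen_def equivariant_def by (metis dg_K1 nu_K1)

lemma borel_eigen_comb: "borel_eigen u F \<Longrightarrow> borel_eigen u G \<Longrightarrow> borel_eigen u (a *\<^sub>C F - b *\<^sub>C G)"
proof -
  have "Rt k (a *\<^sub>C F - b *\<^sub>C G) = a *\<^sub>C Rt k F - b *\<^sub>C Rt k G" for k by (auto simp: Rt_def fun_eq_iff)
  then show "borel_eigen u F \<Longrightarrow> borel_eigen u G \<Longrightarrow> borel_eigen u (a *\<^sub>C F - b *\<^sub>C G)"
    by (simp add: borel_eigen_def complex_vector.scale_right_diff_distrib scaleC_scaleC mult.commute)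
qed

definition irr_model :: "('a^2^2 \<Rightarrow> complex) set \<Rightarrow> bool" where
  "irr_model M \<longleftrightarrow> stab M \<and> M \<noteq> {0} \<and> (\<forall>U. stab U \<longrightarrow> U \<subseteq> M \<longrightarrow> U \<noteq> {0} \<longrightarrow> U = M)"

lemma scaleC_solve: "a *\<^sub>C x - b *\<^sub>C y = 0 \<Longrightarrow> a \<noteq> 0 \<Longrightarrow> x = (inverse a * b) *\<^sub>C y"
  for x y :: "'c \<Rightarrow> complex"
  by (auto simp: fun_eq_iff field_simps)

text \<open>A nonzero vector fixed by the Borel subgroup up to the inducing character is unique up to
  scalars in \<open>U0\<close> (last assumption), every nonzero invariant subspace contains one, and the
  projection of \<open>delta_fn\<close> is a cyclic one.\<close>
lemma irreducibility_criterion: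
  assumes u: "unit_hom u l" and l: "l \<ge> 1" and pr: "equivariant (level_space u l) pr" "\<And>F. F \<in> level_space u l \<Longrightarrow> pr F \<in> U0"
    "\<And>F. F \<in> U0 \<Longrightarrow> pr F = F" and U0: "stab U0" "U0 \<subseteq> level_space u l" "U0 \<noteq> {0}"
    and star: "\<And>D. D \<in> U0 \<Longrightarrow> borel_eigen u D \<Longrightarrow> D (mat 1) = 0 \<Longrightarrow> D = 0"
  shows "irr_model U0"
  unfolding irr_model_def
proof (intro conjI allI impI)
  fix U assume U: "stab U" "U \<subseteq> U0" "U \<noteq> {0}"
  then obtain F where "F \<in> U" "F \<noteq> 0" using stab_0 by blast
  then obtain G where G: "G \<in> U" "borel_eigen u G" "G (mat 1) \<noteq> 0" using ex_borel_eigen[OF u l U(1)] U U0 by blast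
  define e where "e = pr (delta_fn u l)"
  have d: "delta_fn u l \<in> level_space u l" "borel_eigen u (delta_fn u l)" using delta_fn_level_space u l by auto
  have e: "e \<in> U0" "borel_eigen u e" using pr equivariant_borel_eigen d by (auto simp: e_def)
  \<comment> \<open>This combination is again a Borel eigenvector, and it vanishes at the identity
    by design.\<close>
  have "G (mat 1) *\<^sub>C e - e (mat 1) *\<^sub>C G = 0"
  proof (rule star)
    show "G (mat 1) *\<^sub>C e - e (mat 1) *\<^sub>C G \<in> U0" using e G U U0 by (auto intro!: stab_diff stab_scale)
  qed (use borel_eigen_comb e G in auto)
  then have "e = (inverse (G (mat 1)) * e (mat 1)) *\<^sub>C G" using G(3) by (rule scaleC_solve)
  then have eU: "e \<in> U" using G U by (metis stab_scale)
  show "U = U0"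
  proof
    show "U0 \<subseteq> U"
    proof
      fix F assume F: "F \<in> U0"
      then obtain a where a: "F = (\<Sum>x\<in>level_reps l. a x *\<^sub>C Rt (adj2 x) (delta_fn u l))" using delta_fn_cyclic[OF u l] U0 by blast
      have KXK: "adj2 x \<in> K1 v" if "x \<in> level_reps l" for x using level_reps(2) K1_adj2 that by blast
      have "pr F = (\<Sum>x\<in>level_reps l. a x *\<^sub>C Rt (adj2 x) e)"
        unfolding a e_def using pr stab_level_space d KXK by (intro equivariant_comb) auto
      also have "\<dots> \<in> U" using U eU KXK by (intro stab_sum stab_scale stab_Rt) auto
      finally show "F \<in> U" using pr F by simp
    qed
  qed (use U in blast)
qed (use U0 in auto)

text \<open>A form of Schur's lemma: \<open>\<phi>\<close> after \<open>pr1\<close> and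
  \<open>pr2\<close> both send the cyclic vector to Borel eigenvectors of \<open>U2\<close>. These
  are proportional, hence so are the two maps, and \<open>pr2\<close> kills
  \<open>U1\<close>.\<close>

lemma hom_zero_crit:
  assumes u: "unit_hom u l" and l: "l \<ge> 1"
    and pr1: "equivariant (level_space u l) pr1" "\<And>F. F \<in> level_space u l \<Longrightarrow> pr1 F \<in> U1" "\<And>F. F \<in> U1 \<Longrightarrow> pr1 F = F"
    and pr2: "equivariant (level_space u l) pr2" "\<And>F. F \<in> level_space u l \<Longrightarrow> pr2 F \<in> U2" "\<And>F. F \<in> U1 \<Longrightarrow> pr2 F = 0"
    and U: "stab U1" "U1 \<subseteq> level_space u l" "stab U2"
    and star: "\<And>D. D \<in> U2 \<Longrightarrow> borel_eigen u D \<Longrightarrow> D (mat 1) = 0 \<Longrightarrow> D = 0"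
    and e2: "pr2 (delta_fn u l) (mat 1) \<noteq> 0"
    and \<phi>: "equivariant U1 \<phi>" "\<And>F. F \<in> U1 \<Longrightarrow> \<phi> F \<in> U2" and F: "F \<in> U1"
  shows "\<phi> F = 0"
proof -
  have d: "delta_fn u l \<in> level_space u l" "borel_eigen u (delta_fn u l)" using delta_fn_level_space u l by auto
  define e where "e = pr2 (delta_fn u l)"
  define f where "f = \<phi> (pr1 (delta_fn u l))"
  have ef: "e \<in> U2" "borel_eigen u e" "f \<in> U2" "borel_eigen u f"
    using pr1 pr2 d \<phi> equivariant_borel_eigen by (auto simp: e_def f_def)
  have "e (mat 1) *\<^sub>C f - f (mat 1) *\<^sub>C e = 0"
  proof (rule star)
    show "e (mat 1) *\<^sub>C f - f (mat 1) *\<^sub>C e \<in> U2" using ef U by (auto intro!: stab_diff stab_scale)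
  qed (use borel_eigen_comb ef in auto)
  then have fe: "f = (inverse (e (mat 1)) * f (mat 1)) *\<^sub>C e"
    by (rule scaleC_solve) (use e2 in \<open>simp add: e_def\<close>)
  obtain a where a: "F = (\<Sum>x\<in>level_reps l. a x *\<^sub>C Rt (adj2 x) (delta_fn u l))" using delta_fn_cyclic[OF u l] U F by blast
  have KXK: "adj2 x \<in> K1 v" if "x \<in> level_reps l" for x using level_reps(2) K1_adj2 that by blast
  have "F = (\<Sum>x\<in>level_reps l. a x *\<^sub>C Rt (adj2 x) (pr1 (delta_fn u l)))"
    using equivariant_comb[OF pr1(1) stab_level_space d(1) KXK, where a = a] a pr1(3)[OF F] by simp
  then have "\<phi> F = (\<Sum>x\<in>level_reps l. a x *\<^sub>C Rt (adj2 x) f)"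
    using equivariant_comb[OF \<phi>(1) U(1) pr1(2)[OF d(1)] KXK, where a = a] by (simp add: f_def)
  also have "\<dots> = (\<Sum>x\<in>level_reps l. (inverse (e (mat 1)) * f (mat 1)) *\<^sub>C (a x *\<^sub>C Rt (adj2 x) e))"
    by (intro sum.cong refl, subst fe) (auto simp: Rt_def fun_eq_iff)
  also have "\<dots> = (inverse (e (mat 1)) * f (mat 1)) *\<^sub>C (\<Sum>x\<in>level_reps l. a x *\<^sub>C Rt (adj2 x) e)"
    by (simp add: complex_vector.scale_sum_right)
  also have "(\<Sum>x\<in>level_reps l. a x *\<^sub>C Rt (adj2 x) e) = pr2 F"
    using equivariant_comb[OF pr2(1) stab_level_space d(1) KXK, where a = a] a by (simp add: e_def)
  finally show ?thesis unfolding pr2(3)[OF F] complex_vector.scale_zero_right .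
qed

lemma weyl_dg: "runit t \<Longrightarrow> weyl ** dg t = dg (inverse t) ** weyl" by (simp add: weyl_def dg_mat2)

text \<open>Modulo the Borel on the left and its unipotent radical on the right, \<open>K1 v\<close>
  is represented by the \<open>nl x\<close> with x in p and by \<open>weyl\<close>: a nonunit lower
  left entry gives the former, a unit gives the big cell.\<close>

lemma level_space_vanish:
  assumes F: "F \<in> level_space u l" and N: "\<And>g x. g \<in> K1 v \<Longrightarrow> x \<in> fpow v 0 \<Longrightarrow> F (g ** nu x) = F g"
    and nl: "\<And>x. x \<in> fpow v 1 \<Longrightarrow> F (nl x) = 0" and w: "F weyl = 0"
  shows "F = 0"
proof
  fix g :: "'a^2^2"
  obtain a b c d where G: "g = mat2 a b c d" using mat2_cases .
  show "F g = 0 g"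
  proof (cases "g \<in> K1 v")
    case K: True
    show ?thesis
    proof (cases "c \<in> fpow v 1")
      case True
      then have d: "runit d" using K1_bottom_unit K G by blast
      have "b / d \<in> fpow v 0" "c / d \<in> fpow v 1" "a * d - b * c = 1"
        using K d True by (auto simp: G K1_mat2 fpow_divide_unit)
      then show ?thesis using lower_decomp[OF d] F nl[of "c / d"] d fpow_mono[of "c / d" 1 0]
        by (simp add: G mpsD K1_mult dg_K1 runit_inverse)
    next
      case False
      then have c: "runit c" using K by (simp add: G K1_mat2 runit_iff)
      have O: "a / c \<in> fpow v 0" "d / c \<in> fpow v 0" and r: "a * d - b * c = 1"
        using K c by (auto simp: G K1_mat2 fpow_divide_unit)
      have "g = nu (a / c) ** (dg (inverse (- c)) ** (weyl ** nu (d / c)))"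
        using bruhat[OF runit_nz[OF c] r] c weyl_dg[of "- c"] by (simp add: G matrix_mul_assoc) (simp flip: matrix_mul_assoc)
      then have "F g = u (inverse (- c)) * F (weyl ** nu (d / c))"
        using O c F by (simp add: mpsD K1_mult dg_K1 runit_inverse)
      then show ?thesis using N[OF weyl_K1 O(2)] w by simp
    qed
  qed (use mpsD(1)[OF F] in simp)
qed

text \<open>A torus element at the identity can be read from the left or from the right, at the Weyl
  element likewise after inversion. A nonzero value forces the two characters to agree, respectively
  to be inverse to each other.\<close>

lemma level_space_one_zero:
  assumes F: "F \<in> level_space u l" and B: "borel_eigen u' F" and t: "runit t" "u t \<noteq> u' t" shows "F (mat 1) = 0"
  using borel_eigen_dg[OF B K1_one t(1)] mpsD(3)[OF F K1_one t(1)] t by simp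

lemma level_space_weyl_zero:
  assumes u: "unit_hom u l" and F: "F \<in> level_space u l" and B: "borel_eigen u' F" and t: "runit t" "u t * u' t \<noteq> 1" shows "F weyl = 0"
proof -
  have "u' t * F weyl = inverse (u t) * F weyl"
    using borel_eigen_dg[OF B weyl_K1 t(1)] mpsD(3)[OF F weyl_K1 runit_inverse[OF t(1)]]
    by (simp only: weyl_dg[OF t(1)] unit_hom_inverse[OF u t(1)])
  then have "u t * u' t * F weyl = u t * inverse (u t) * F weyl" by (simp add: mult.assoc)
  then have "u t * u' t * F weyl = F weyl" using unit_hom_nz[OF u t(1)] by simp
  then show ?thesis using t by (simp only: mult_cancel_right2 simp_thms)
qed

text \<open>Conductor exactly \<open>m\<close>, except that \<open>m = 1\<close> also admits the
  trivial character. This matches \<open>primitive_mod\<close>, where levels start at 1.\<close>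

definition primitive_hom :: "('a \<Rightarrow> complex) \<Rightarrow> nat \<Rightarrow> bool" where
  "primitive_hom u m \<longleftrightarrow> unit_hom u m \<and> (m \<ge> 2 \<longrightarrow> (\<exists>y\<in>fpow v (int m - 1). u (1 + y) \<noteq> 1))"

text \<open>Invariance under \<open>nu (y / x)\<close> at the point \<open>nl x\<close> amounts to
  multiplication by \<open>u (inverse (1 + y))\<close>, and primitivity offers a y for which this is
  not 1. The quotient y / x is integral because x has valuation below \<open>m\<close>.\<close>

lemma level_space_nl_zero:
  assumes u: "primitive_hom u m" and F: "F \<in> level_space u m" and m: "m \<ge> 1"
    and N: "\<And>g x. g \<in> K1 v \<Longrightarrow> x \<in> fpow v 0 \<Longrightarrow> F (g ** nu x) = F g"
    and x: "x \<in> fpow v 1" "x \<notin> fpow v (int m)"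
  shows "F (nl x) = 0"
proof -
  have x0: "x \<noteq> 0" "1 \<le> v x" "v x < int m" using x by (auto simp: fpow_def)
  then have "m \<ge> 2" by linarith
  then obtain y where y: "y \<in> fpow v (int m - 1)" "u (1 + y) \<noteq> 1" using u by (auto simp: primitive_hom_def)
  have uc: "unit_hom u m" using u by (simp add: primitive_hom_def)
  have w: "y / x \<in> fpow v 0" using y x0 by (cases "y = 0") (auto simp: fpow_def val_divide)
  have xO: "x \<in> fpow v 0" using x fpow_mono by force
  \<comment> \<open>The conjugate of \<open>nu (y / x)\<close> by \<open>nl x\<close>. Its lower
    left entry lies in p^m, so \<open>level_space_hecke\<close> applies to it.\<close>
  define h where "h = mat2 (1 - y) (y / x) (- (x * y)) (1 + y)"
  have e: "nl x ** nu (y / x) = h ** nl x" using x0 by (simp add: nl_def nu_def h_def algebra_simps)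
  have yP: "y \<in> fpow v 1" using y fpow_mono[of y "int m - 1" 1] \<open>m \<ge> 2\<close> by simp
  have xy: "x * y \<in> fpow v (int m)" using fpow_mult[OF x(1) y(1)] by simp
  have hK: "h \<in> K1 v" using w xO yP x0 fpow_mono[of y 1 0]
    by (simp add: h_def K1_mat2 algebra_simps) (auto intro: fpow_add fpow_diff fpow_mult_left)
  have "F (nl x) = F (nl x ** nu (y / x))" using N[OF _ w] xO by simp
  also have "\<dots> = u (inverse (1 + y)) * F (nl x)"
    unfolding e using level_space_hecke[OF F m hK] xy xO by (simp add: h_def)
  also have "u (inverse (1 + y)) = inverse (u (1 + y))" by (rule unit_hom_inverse[OF uc runit_one_plus[OF yP]])
  finally have "u (1 + y) * F (nl x) = F (nl x)"
    using unit_hom_nz[OF uc runit_one_plus[OF yP]] by (simp add: field_simps)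
  then show ?thesis using y by simp
qed

lemma level_space_borel_eigen_zero:
  assumes u: "primitive_hom u m" and F: "F \<in> level_space u m" and m: "m \<ge> 1" and B: "borel_eigen u' F"
    and w: "F weyl = 0" and 1: "F (mat 1) = 0"
  shows "F = 0"
proof (rule level_space_vanish[OF F])
  fix x assume x: "x \<in> fpow v 1"
  show "F (nl x) = 0"
  proof (cases "x \<in> fpow v (int m)")
    case True
    then show ?thesis using mpsD(4)[OF F K1_one nl_Kc[OF True]] 1 by simp
  next
    case False
    then show ?thesis using level_space_nl_zero[OF u F m borel_eigen_nu[OF B] x] by simp
  qed
qed (use borel_eigen_nu[OF B] w in auto)

text \<open>For m at least 2, 1 + y/2 is a square root of 1 + y modulo p^m when y lies in p^(m-1).
  So no character with the same values on principal units can be inverse to \<open>u\<close>, and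
  all special cases are confined to m = 1.\<close>

lemma primitive_hom_square:
  assumes u: "primitive_hom u m" and m: "m \<ge> 2" and u': "\<And>t. t - 1 \<in> fpow v 1 \<Longrightarrow> u' t = u t"
  shows "\<exists>t. runit t \<and> u t * u' t \<noteq> 1"
proof -
  obtain y where y: "y \<in> fpow v (int m - 1)" "u (1 + y) \<noteq> 1" using u m by (auto simp: primitive_hom_def)
  have uc: "unit_hom u m" using u by (simp add: primitive_hom_def)
  have yP: "y \<in> fpow v 1" using y fpow_mono[of y "int m - 1" 1] m by simp
  define t where "t = 1 + y / 2"
  have y2: "y / 2 \<in> fpow v (int m - 1)" "y / 2 \<in> fpow v 1" using y yP two_unit by (auto simp: fpow_divide_unit)
  have rt: "runit t" using y2 by (simp add: t_def runit_one_plus)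
  have "t * t - (1 + y) = (y / 2) * (y / 2)"
    using runit_nz[OF two_unit] by (simp add: t_def algebra_simps)
  also have "\<dots> \<in> fpow v (int m)" by (rule fpow_mult_le[OF y2(1) y2(1)]) (use m in linarith)
  finally have "u (t * t) = u (1 + y)"
    using rt yP by (intro unit_hom_cong[OF uc]) (auto simp: runit_mult runit_one_plus)
  then have "u t * u t \<noteq> 1" using y unit_hom_mult[OF uc rt rt] by simp
  moreover have "u' t = u t" using y2 by (intro u') (simp add: t_def)
  ultimately show ?thesis using rt by auto
qed

text \<open>If \<open>u\<close> is not quadratic, Borel eigenvectors vanish at the Weyl element, so
  the value at the identity determines them. The criterion then applies with the identity map as
  projection.\<close>

lemma irr_level_space:
  assumes u: "primitive_hom u m" and m: "m \<ge> 1" and t: "runit t" "u t * u t \<noteq> 1"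
  shows "irr_model (level_space u m)"
proof -
  have uc: "unit_hom u m" using u by (simp add: primitive_hom_def)
  have "delta_fn u m (mat 1) = 1" using unit_hom_one[OF uc] by (simp add: delta_fn_def K1_one) (simp add: mat_1_mat2)
  then have "level_space u m \<noteq> {0}" using delta_fn_level_space(1)[OF uc m] by auto
  then show ?thesis
    using level_space_borel_eigen_zero[OF u _ m] level_space_weyl_zero[where u = u and u' = u, OF uc _ _ t]
    by (intro irreducibility_criterion[OF uc m, where pr = "\<lambda>F. F"]) (auto simp: equivariant_def stab_level_space)
qed

text \<open>The image of the cyclic vector is an eigenvector for \<open>u'\<close> inside the space
  for \<open>u\<close>. It vanishes at the identity because the characters differ and at the Weyl
  element because they are not inverse.\<close>

lemma level_space_hom_zero:
  assumes u: "primitive_hom u m" and u': "unit_hom u' m" and m: "m \<ge> 1" and t: "runit t" "u t * u' t \<noteq> 1"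
    and s: "runit s" "u s \<noteq> u' s" and \<phi>: "equivariant (level_space u' m) \<phi>" "\<And>F. F \<in> level_space u' m \<Longrightarrow> \<phi> F \<in> level_space u m"
    and F: "F \<in> level_space u' m"
  shows "\<phi> F = 0"
proof -
  have uc: "unit_hom u m" using u by (simp add: primitive_hom_def)
  have d: "delta_fn u' m \<in> level_space u' m" "borel_eigen u' (delta_fn u' m)" using delta_fn_level_space u' m by auto
  have B: "\<phi> (delta_fn u' m) \<in> level_space u m" "borel_eigen u' (\<phi> (delta_fn u' m))" using \<phi> d equivariant_borel_eigen by auto
  have "\<phi> (delta_fn u' m) = 0"
    using level_space_borel_eigen_zero[OF u B(1) m B(2)] level_space_weyl_zero[where u' = u', OF uc B t] level_space_one_zero[where u' = u', OF B s] by simp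
  moreover obtain a where a: "F = (\<Sum>x\<in>level_reps m. a x *\<^sub>C Rt (adj2 x) (delta_fn u' m))" using delta_fn_cyclic[OF u' m F] by blast
  moreover have "adj2 x \<in> K1 v" if "x \<in> level_reps m" for x using level_reps(2) K1_adj2 that by blast
  ultimately have "\<phi> F = (\<Sum>x\<in>level_reps m. a x *\<^sub>C Rt (adj2 x) 0)"
    using equivariant_comb[OF \<phi>(1) stab_level_space d(1), where X = "level_reps m" and \<kappa> = adj2 and a = a] by simp
  also have "\<dots> = 0" by (rule sum.neutral) (auto simp: Rt_def fun_eq_iff)
  finally show ?thesis .
qed

subsection \<open>Characters of the residue field\<close>

definition ext0 :: "('a \<Rightarrow> complex) \<Rightarrow> 'a \<Rightarrow> complex" where
  "ext0 \<eta> x = (if runit x then \<eta> x else 0)"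

lemma residue_invariant_ext0: "unit_hom \<eta> 1 \<Longrightarrow> residue_invariant (ext0 \<eta>)"
  unfolding residue_invariant_def ext0_def
  using unit_hom_cong[of \<eta> 1] runit_cong fpow_diff_commute by (metis of_nat_1)

lemma ext0_mult: "unit_hom \<eta> l \<Longrightarrow> x \<in> fpow v 0 \<Longrightarrow> runit t \<Longrightarrow> ext0 \<eta> (t * x) = \<eta> t * ext0 \<eta> x"
  using unit_hom_mult[of \<eta> l t x] fpow_unit_cancel[of t x] by (auto simp: ext0_def runit_iff)

lemma residue_invariant_mult: "residue_invariant f \<Longrightarrow> residue_invariant g \<Longrightarrow> residue_invariant (\<lambda>x. f x * g x)" for f :: "'a \<Rightarrow> complex"
  unfolding residue_invariant_def by metis

lemma residue_invariant_shift: "residue_invariant f \<Longrightarrow> c \<in> fpow v 0 \<Longrightarrow> residue_invariant (\<lambda>x. f (x + c))"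
  unfolding residue_invariant_def by (auto simp: fpow_add)

lemma sum_ext0: assumes "unit_hom \<eta> 1" "runit a" "\<eta> a \<noteq> 1" shows "(\<Sum>z\<in>reps. ext0 \<eta> z) = 0"
proof -
  have "(\<Sum>z\<in>reps. ext0 \<eta> z) = (\<Sum>z\<in>reps. ext0 \<eta> (a * z))"
    by (rule sum_reps_scale[symmetric, OF residue_invariant_ext0[OF assms(1)] assms(2)])
  also have "\<dots> = \<eta> a * (\<Sum>z\<in>reps. ext0 \<eta> z)"
    unfolding sum_distrib_left
    by (intro sum.cong refl ext0_mult[OF assms(1)]) (use assms reps_fpow in auto)
  finally show ?thesis using assms by simp
qed

text \<open>Exactly one representative is a nonunit. It need not be 0 itself, so invariance is used
  to evaluate at 0.\<close>

lemma sum_nonunits: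
  fixes \<phi> :: "'a \<Rightarrow> complex"
  assumes "residue_invariant \<phi>" shows "(\<Sum>z\<in>reps. if runit z then 0 else \<phi> z) = \<phi> 0"
proof -
  obtain z where z: "z \<in> fpow v 1" "reps = insert z ureps" "z \<notin> ureps" using reps_split by blast
  have "(\<Sum>z\<in>reps. if runit z then 0 else \<phi> z) = \<phi> z + (\<Sum>z\<in>ureps. if runit z then 0 else \<phi> z)"
    using z by (simp add: runit_iff)
  also have "(\<Sum>z\<in>ureps. if runit z then 0 else \<phi> z) = 0" by (rule sum.neutral) (auto simp: ureps_def)
  also have "\<phi> z = \<phi> 0" using pinvD[OF assms, of z 0] z fpow_mono by force
  finally show ?thesis by simp
qed

lemma sum_units: "(\<Sum>z\<in>reps. if runit z then c else 0) = (of_nat (residue_card v) - 1) * (c :: complex)"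
proof -
  obtain z where z: "z \<in> fpow v 1" "reps = insert z ureps" "z \<notin> ureps" using reps_split by blast
  have "(\<Sum>z\<in>reps. if runit z then c else 0) = (\<Sum>z\<in>ureps. c)"
  proof -
    have "(\<Sum>z\<in>ureps. if runit z then c else 0) = (\<Sum>z\<in>ureps. c)" by (rule sum.cong) (auto simp: ureps_def)
    then show ?thesis using z by (simp add: runit_iff[of z])
  qed
  then show ?thesis using residue_card_ge2 by (simp add: card_ureps of_nat_diff)
qed

text \<open>The value on units is constant by scaling and determined by the total over \<open>w\<close> being \<open>0\<close>.\<close>
lemma jacobi:
  assumes \<eta>: "unit_hom \<eta> 1" and \<eta>': "unit_hom \<eta>' 1" and inv: "\<And>t. runit t \<Longrightarrow> \<eta>' t = inverse (\<eta> t)"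
    and a: "runit a" "\<eta> a \<noteq> 1" and w: "w \<in> fpow v 0"
  shows "(\<Sum>z\<in>reps. ext0 \<eta> z * ext0 \<eta>' (w - z)) =
    \<eta> (- 1) * ((if runit w then 0 else of_nat (residue_card v)) - 1)"
proof -
  define J where "J w = (\<Sum>z\<in>reps. ext0 \<eta> z * ext0 \<eta>' (w - z))" for w
  have e0: "ext0 \<eta>' x = ext0 \<eta>' y" if "x \<in> fpow v 0" "y \<in> fpow v 0" "x - y \<in> fpow v 1" for x y
    using pinvD[OF residue_invariant_ext0[OF \<eta>']] that by blast
  have Jp: "J x = J y" if xy: "x \<in> fpow v 0" "y \<in> fpow v 0" "x - y \<in> fpow v 1" for x y
    unfolding J_def by (intro sum.cong refl arg_cong[where f = "(*) _"] e0) (use xy reps_fpow in \<open>auto intro: fpow_diff\<close>)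
  have Ju: "J s = J 1" if s: "runit s" for s
  proof -
    have p: "residue_invariant (\<lambda>z. ext0 \<eta> z * ext0 \<eta>' (s - z))"
      unfolding residue_invariant_def
    proof (intro ballI impI)
      fix x y assume xy: "x \<in> fpow v 0" "y \<in> fpow v 0" "x - y \<in> fpow v 1"
      have "s - x - (s - y) \<in> fpow v 1" using xy(3) fpow_minus[of "x - y"] by simp
      then have "ext0 \<eta>' (s - x) = ext0 \<eta>' (s - y)" using xy runit_fpow[OF s] by (intro e0) (auto intro: fpow_diff)
      then show "ext0 \<eta> x * ext0 \<eta>' (s - x) = ext0 \<eta> y * ext0 \<eta>' (s - y)"
        using pinvD[OF residue_invariant_ext0[OF \<eta>] xy] by simp
    qed
    have "J s = (\<Sum>z\<in>reps. ext0 \<eta> (s * z) * ext0 \<eta>' (s - s * z))"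
      unfolding J_def by (rule sum_reps_scale[symmetric, OF p s])
    also have "\<dots> = J 1"
      unfolding J_def
    proof (rule sum.cong[OF refl])
      fix z assume z: "z \<in> reps"
      have "ext0 \<eta>' (s - s * z) = \<eta>' s * ext0 \<eta>' (1 - z)"
        using ext0_mult[OF \<eta>' _ s, of "1 - z"] reps_fpow[OF z] by (simp add: right_diff_distrib fpow_diff)
      then show "ext0 \<eta> (s * z) * ext0 \<eta>' (s - s * z) = ext0 \<eta> z * ext0 \<eta>' (1 - z)"
        using ext0_mult[OF \<eta> _ s, of z] reps_fpow[OF z] inv[OF s] unit_hom_nz[OF \<eta> s] by simp
    qed
    finally show ?thesis .
  qed
  have J0: "J 0 = (of_nat (residue_card v) - 1) * \<eta> (- 1)"
  proof -
    have "ext0 \<eta> z * ext0 \<eta>' (0 - z) = (if runit z then \<eta> (- 1) else 0)" for z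
    proof (cases "runit z")
      case True
      have "\<eta>' (- z) = \<eta>' (-1) * \<eta>' z" using unit_hom_mult[OF \<eta>', of "-1" z] True by simp
      moreover have "\<eta>' (-1) = \<eta> (-1)"
        using inv[of "-1"] unit_hom_mult[OF \<eta>, of "-1" "-1"] unit_hom_one[OF \<eta>] by simp (metis inverse_unique)
      ultimately show ?thesis using True inv unit_hom_nz[OF \<eta> True] by (simp add: ext0_def)
    qed (simp add: ext0_def)
    then show ?thesis unfolding J_def by (simp add: sum_units)
  qed
  have "(\<Sum>w\<in>reps. J w) = (\<Sum>z\<in>reps. ext0 \<eta> z * (\<Sum>w\<in>reps. ext0 \<eta>' (w - z)))"
    unfolding J_def by (subst sum.swap) (simp add: sum_distrib_left)
  also have "\<dots> = (\<Sum>z\<in>reps. ext0 \<eta> z * (\<Sum>w\<in>reps. ext0 \<eta>' w))"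
    using sum_reps_shift[OF residue_invariant_ext0[OF \<eta>'], of "- z" for z] reps_fpow by simp
  also have "\<dots> = 0" using sum_ext0[OF \<eta> a] by (simp flip: sum_distrib_right)
  also have "(\<Sum>w\<in>reps. J w) = (\<Sum>w\<in>reps. (if runit w then J 1 else 0) + (if runit w then 0 else J w))"
  proof (rule sum.cong[OF refl])
    show "J w = (if runit w then J 1 else 0) + (if runit w then 0 else J w)" for w
      using Ju[of w] by (cases "runit w") auto
  qed
  also have "\<dots> = (of_nat (residue_card v) - 1) * J 1 + J 0"
  proof -
    have "residue_invariant J" unfolding residue_invariant_def using Jp by blast
    then show ?thesis unfolding sum.distrib sum_units by (simp add: sum_nonunits)
  qed
  finally have "(of_nat (residue_card v) - 1) * (J 1 + \<eta> (- 1)) = 0" by (simp add: J0 algebra_simps)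
  moreover have "of_nat (residue_card v) - (1::complex) \<noteq> 0" using residue_card_ge2 by (simp add: of_nat_eq_1_iff)
  ultimately have J1: "J 1 = - \<eta> (- 1)" by (simp add: add_eq_0_iff2)
  show ?thesis
  proof (cases "runit w")
    case True then show ?thesis using Ju[OF True] J1 by (simp add: J_def)
  next
    case False
    then have "J w = J 0" using Jp[of w 0] w by (simp add: runit_iff)
    then show ?thesis using False J0 by (simp add: J_def)
  qed
qed

text \<open>Read modulo p, so that the predicate depends on residue classes only and no lifting of
  square roots is involved.\<close>

definition unit_square :: "'a \<Rightarrow> bool" where "unit_square t \<longleftrightarrow> (\<exists>s. runit s \<and> t - s * s \<in> fpow v 1)"

lemma unit_square_cong: "unit_square x \<Longrightarrow> x - y \<in> fpow v 1 \<Longrightarrow> unit_square y"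
  unfolding unit_square_def using fpow_trans fpow_diff_commute by metis

lemma unit_square_mult: assumes "unit_square x" "unit_square y" "runit x" shows "unit_square (x * y)"
proof -
  obtain s t where st: "runit s" "x - s * s \<in> fpow v 1" "runit t" "y - t * t \<in> fpow v 1" using assms by (auto simp: unit_square_def)
  have "runit y" using runit_cong[of "t * t" y] st by (simp add: runit_mult fpow_diff_commute)
  then have "x * y - (s * s) * (t * t) \<in> fpow v 1"
    using st by (intro fpow_cong_mult) (auto simp: runit_fpow runit_mult)
  then show ?thesis using st unfolding unit_square_def by (intro exI[of _ "s * t"]) (simp add: runit_mult mult_ac)
qed

lemma unit_square_square: "runit s \<Longrightarrow> unit_square (s * s)" by (auto simp: unit_square_def)

lemma unit_square_inverse_mult: "runit s \<Longrightarrow> runit y \<Longrightarrow> unit_square (s * s * y) \<Longrightarrow> unit_square y"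
proof -
  assume a: "runit s" "runit y" "unit_square (s * s * y)"
  have "unit_square ((s * s * y) * (inverse s * inverse s))"
    by (rule unit_square_mult[OF a(3) unit_square_square[OF runit_inverse[OF a(1)]]]) (use a in \<open>simp add: runit_mult\<close>)
  then show ?thesis using runit_nz[OF a(1)] by (simp add: field_simps)
qed

abbreviation sqrep where "sqrep r \<equiv> rep (r * r)"

lemma sqrep: assumes "r \<in> ureps" shows "sqrep r \<in> ureps" "r * r - sqrep r \<in> fpow v 1"
proof -
  have r: "r \<in> fpow v 0" "runit r" using assms by (auto simp: ureps_def runit_fpow)
  then have "r * r \<in> fpow v 0" by (simp add: fpow_mult_left)
  then show "sqrep r \<in> ureps" "r * r - sqrep r \<in> fpow v 1"
    using rep runit_cong[OF runit_mult[OF r(2) r(2)]] by (auto simp: ureps_def)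
qed

lemma ureps_D: "r \<in> ureps \<Longrightarrow> runit r" "r \<in> ureps \<Longrightarrow> r \<in> fpow v 0" "r \<in> ureps \<Longrightarrow> r \<in> reps"
  by (auto simp: ureps_def runit_fpow)

lemma minus_not_cong: "runit r \<Longrightarrow> r - (- r) \<notin> fpow v 1"
  using fpow_unit_cancel[OF two_unit, of r 1] by (simp add: runit_iff)

lemma card_fiber_le: "card {r \<in> ureps. sqrep r = y} \<le> 2"
proof (cases "{r \<in> ureps. sqrep r = y} = {}")
  case False
  then obtain r0 where r0: "r0 \<in> ureps" "sqrep r0 = y" by blast
  have "r = r0 \<or> r = rep (- r0)" if r: "r \<in> ureps" "sqrep r = y" for r
  proof -
    have "r * r - r0 * r0 \<in> fpow v 1" using sqrep(2)[OF r(1)] sqrep(2)[OF r0(1)] r r0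
      by (metis fpow_trans fpow_diff_commute)
    then have "(r - r0) * (r + r0) \<in> fpow v 1" by (simp add: algebra_simps)
    then have "r - r0 \<in> fpow v 1 \<or> r + r0 \<in> fpow v 1"
      using r r0 by (intro fpow_prime) (auto intro: fpow_add fpow_diff ureps_D)
    then show ?thesis
    proof
      assume "r + r0 \<in> fpow v 1"
      then have "- r0 - r \<in> fpow v 1" using fpow_minus[of "r + r0" 1] by (simp add: algebra_simps)
      then show ?thesis using rep_eq[of r "- r0"] r ureps_D by simp
    qed (use reps_unique r r0 ureps_D in blast)
  qed
  then have "{r \<in> ureps. sqrep r = y} \<subseteq> {r0, rep (- r0)}" by blast
  then have "card {r \<in> ureps. sqrep r = y} \<le> card {r0, rep (- r0)}" by (intro card_mono) auto
  also have "\<dots> \<le> 2" by (simp add: card_insert_if)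
  finally show ?thesis .
next
  case True
  then show ?thesis by (metis card.empty zero_le)
qed

lemma unit_square_iff: "r \<in> ureps \<Longrightarrow> unit_square r \<longleftrightarrow> r \<in> sqrep ` ureps"
proof
  assume r: "r \<in> ureps" "unit_square r"
  then obtain s where s: "runit s" "r - s * s \<in> fpow v 1" by (auto simp: unit_square_def)
  define s' where "s' = rep s"
  have s': "s' \<in> ureps" "s - s' \<in> fpow v 1"
    using rep[OF runit_fpow[OF s(1)]] runit_cong[OF s(1)] by (auto simp: s'_def ureps_def)
  have "s * s - s' * s' \<in> fpow v 1" using s' s by (intro fpow_cong_mult) (auto simp: runit_fpow ureps_D)
  then have "s' * s' - r \<in> fpow v 1" using s by (metis fpow_trans fpow_diff_commute)
  then have "sqrep s' = r" using r ureps_D by (intro rep_eq) auto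
  then show "r \<in> sqrep ` ureps" using s' by blast
next
  assume "r \<in> ureps" "r \<in> sqrep ` ureps"
  then obtain s where "s \<in> ureps" "r = sqrep s" by blast
  then show "unit_square r" using sqrep(2)[of s] ureps_D(1)[of s] fpow_diff_commute unfolding unit_square_def by blast
qed

text \<open>Otherwise squaring would be a surjective, hence injective map of the finite set of
  residue units; but it identifies 1 and -1, which are incongruent because 2 is a unit.\<close>

lemma ex_nonsquare: "\<exists>a. runit a \<and> \<not> unit_square a"
proof (rule ccontr)
  assume "\<not> ?thesis"
  then have "ureps \<subseteq> sqrep ` ureps" using unit_square_iff ureps_D by blast
  then have "sqrep ` ureps = ureps" using sqrep by blast
  then have inj: "inj_on sqrep ureps" using eq_card_imp_inj_on[of ureps sqrep] by simp
  have u: "rep x \<in> ureps" "x - rep x \<in> fpow v 1" if "runit x" for x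
    using rep[OF runit_fpow[OF that]] runit_cong[OF that] by (auto simp: ureps_def)
  have "rep x * rep x - 1 \<in> fpow v 1" if "x = 1 \<or> x = -1" for x
  proof -
    have x: "runit x" "x * x = 1" using that by auto
    have "x * x - rep x * rep x \<in> fpow v 1"
      using u[OF x(1)] x by (intro fpow_cong_mult) (auto simp: runit_fpow ureps_D)
    then show ?thesis using x by (simp add: fpow_diff_commute)
  qed
  then have "sqrep (rep 1) = sqrep (rep (-1))"
    using sqrep[OF u(1)[of 1]] sqrep[OF u(1)[of "-1"]] reps_unique ureps_D
    by (metis fpow_diff_commute fpow_trans runit_minus runit_one)
  then have e: "rep 1 = rep (-1)" by (rule inj_onD[OF inj _ u(1) u(1)]) simp_all
  have "1 - rep 1 \<in> fpow v 1" "rep 1 - (-1) \<in> fpow v 1"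
    using u(2)[of 1] u(2)[of "-1"] e fpow_diff_commute[of "-1" "rep (-1)"] by simp_all
  then have "1 - (- 1) \<in> fpow v 1" by (rule fpow_trans)
  then show False using minus_not_cong[of 1] by simp
qed

text \<open>The squares have index two: squares, a coset of them and a further class would be too many.\<close>
lemma unit_square_mult_nonsquares: assumes "runit a" "runit b" "\<not> unit_square a" "\<not> unit_square b" shows "unit_square (a * b)"
proof (rule ccontr)
  assume nab: "\<not> unit_square (a * b)"
  let ?Q = "sqrep ` ureps"
  let ?A = "(\<lambda>r. rep (a * r)) ` ?Q"
  have QU: "?Q \<subseteq> ureps" using sqrep by blast
  have inj: "inj_on (\<lambda>r. rep (a * r)) ureps" using bij_betw_scale_ureps[OF assms(1)] by (simp add: bij_betw_def)
  have AU: "?A \<subseteq> ureps" using bij_betw_scale_ureps[OF assms(1)] QU unfolding bij_betw_def by blast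
  have ar: "a * r - rep (a * r) \<in> fpow v 1" if "r \<in> ureps" for r
    using that assms by (intro rep runit_fpow runit_mult) (auto simp: ureps_D)
  have u: "rep x \<in> ureps" "x - rep x \<in> fpow v 1" if "runit x" for x
    using rep[OF runit_fpow[OF that]] runit_cong[OF that] by (auto simp: ureps_def)
  have "\<not> unit_square (rep (a * r))" if r: "r \<in> ?Q" for r
  proof
    assume "unit_square (rep (a * r))"
    then have 1: "unit_square (a * r)" using unit_square_cong ar QU r fpow_diff_commute by blast
    obtain s where s: "runit s" "r - s * s \<in> fpow v 1" using unit_square_iff r QU unfolding unit_square_def by blast
    have "a * r - a * (s * s) \<in> fpow v 1"
      using fpow_unit_cancel[OF assms(1), of "r - s * s"] s by (simp add: right_diff_distrib)
    then have "unit_square (a * (s * s))" using unit_square_cong[OF 1] by blast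
    then show False using unit_square_inverse_mult[OF s(1) assms(1)] assms by (simp add: mult_ac)
  qed
  then have "\<And>x. x \<in> ?A \<Longrightarrow> \<not> unit_square x" by blast
  moreover have "\<And>x. x \<in> ?Q \<Longrightarrow> unit_square x" using unit_square_iff QU by blast
  ultimately have disj: "?Q \<inter> ?A = {}" by (meson disjoint_iff)
  have "rep b \<notin> ?Q" using unit_square_iff[of "rep b"] u[OF assms(2)] unit_square_cong[of "rep b" b] assms
    by (auto simp: fpow_diff_commute)
  moreover have "rep b \<notin> ?A"
  proof
    assume "rep b \<in> ?A"
    then obtain r where r: "r \<in> ?Q" "rep b = rep (a * r)" by blast
    then obtain s where s: "runit s" "r - s * s \<in> fpow v 1" using unit_square_iff QU unfolding unit_square_def by blast
    have "b - a * r \<in> fpow v 1" using u[OF assms(2)] ar[of r] r QU by (metis fpow_trans fpow_diff_commute subsetD)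
    moreover have "a * r - a * (s * s) \<in> fpow v 1"
      using fpow_unit_cancel[OF assms(1), of "r - s * s"] s by (simp add: right_diff_distrib)
    ultimately have "b - a * (s * s) \<in> fpow v 1" using fpow_trans by blast
    then have "a * (b - a * (s * s)) \<in> fpow v 1" using fpow_unit_cancel assms by blast
    then have "a * b - (a * s) * (a * s) \<in> fpow v 1" by (simp add: algebra_simps)
    then show False using nab s assms unfolding unit_square_def by (metis runit_mult)
  qed
  ultimately have "card (insert (rep b) (?Q \<union> ?A)) = Suc (card ?Q + card ?A)"
    using disj by (subst card_insert_disjoint) (auto simp: card_Un_disjoint)
  moreover have "card (insert (rep b) (?Q \<union> ?A)) \<le> card ureps"
    using QU AU u[OF assms(2)] by (intro card_mono) auto
  moreover have "card ?A = card ?Q" using inj_on_subset[OF inj QU] by (rule card_image)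
  \<comment> \<open>Fibres of squaring have at most two elements, so the two disjoint copies of the
    squares already exhaust the units.\<close>
  moreover have "card ureps \<le> 2 * card ?Q"
  proof -
    have "card ureps = (\<Sum>y\<in>?Q. card {r \<in> ureps. sqrep r = y})"
      using sum.image_gen[of ureps "\<lambda>_. 1::nat" sqrep] by simp
    also have "\<dots> \<le> (\<Sum>y\<in>?Q. 2)" by (intro sum_mono card_fiber_le)
    finally show ?thesis by (simp add: mult.commute)
  qed
  ultimately show False by linarith
qed

text \<open>The quadratic residue symbol of the residue field; only its values on units are
  meaningful.\<close>

definition quad_char :: "'a \<Rightarrow> complex" where "quad_char t = (if unit_square t then 1 else - 1)"

lemma quad_char_mult: assumes "runit s" "runit t" shows "quad_char (s * t) = quad_char s * quad_char t"
proof -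
  have *: "\<not> unit_square (s * t)" if st: "unit_square s" "\<not> unit_square t" "runit s" "runit t" for s t
  proof
    assume "unit_square (s * t)"
    then have "unit_square (s * (s * t))" by (rule unit_square_mult[OF st(1) _ st(3)])
    then have "unit_square (s * s * t)" by (simp add: mult.assoc)
    then show False using unit_square_inverse_mult[of s t] st by blast
  qed
  show ?thesis using *[of s t] *[of t s] unit_square_mult[of s t] unit_square_mult_nonsquares[of s t] assms
    by (auto simp: quad_char_def mult.commute)
qed

lemma unit_hom_quad_char: "unit_hom quad_char 1"
  unfolding unit_hom_def
proof (intro conjI allI impI)
  show "quad_char t = 1" if "t - 1 \<in> fpow v (int 1)" for t
    using unit_square_cong[OF unit_square_square[OF runit_one], of t] that by (simp add: quad_char_def fpow_diff_commute)
  show "quad_char t \<noteq> 0" for t by (simp add: quad_char_def)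
qed (auto simp: quad_char_mult)

lemma quad_char_sq: "quad_char t * quad_char t = 1" by (simp add: quad_char_def)

lemma quad_char_inverse: "quad_char t = inverse (quad_char t)" by (simp add: quad_char_def)

lemma quad_char_eq: assumes "runit s" "runit z" "quad_char z = quad_char s" shows "\<exists>t. runit t \<and> z - s * (t * t) \<in> fpow v 1"
proof -
  have "quad_char (z * s) = 1" using quad_char_mult[of z s] assms quad_char_sq by simp
  then have "unit_square (z * s)" by (simp add: quad_char_def split: if_splits)
  then obtain x where x: "runit x" "z * s - x * x \<in> fpow v 1" by (auto simp: unit_square_def)
  have "z - s * ((x / s) * (x / s)) = (z * s - x * x) / s" using runit_nz[OF assms(1)] by (simp add: field_simps)
  then have "z - s * ((x / s) * (x / s)) \<in> fpow v 1" using x assms by (simp add: fpow_divide_unit)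
  then show ?thesis using x assms by (intro exI[of _ "x / s"]) (simp add: runit_divide)
qed

lemma ex_quad_char_minus: "\<exists>a. runit a \<and> quad_char a = - 1"
  using ex_nonsquare by (auto simp: quad_char_def)

subsection \<open>Convolution along the last unipotent layer\<close>

text \<open>Acting from the left, it commutes with \<open>Rt\<close> for every kernel. What needs
  care is left equivariance under the Borel, treated in
  \<open>layer_conv_level_space\<close>.\<close>

definition layer_conv :: "nat \<Rightarrow> ('a \<Rightarrow> complex) \<Rightarrow> ('a^2^2 \<Rightarrow> complex) \<Rightarrow> 'a^2^2 \<Rightarrow> complex" where
  "layer_conv l h F = (\<lambda>g. if g \<in> K1 v then \<Sum>z\<in>reps. h z * F (nl (z * \<pi> ^ (l - 1)) ** g) else 0)"

lemma pi_power_fpow: "z \<in> fpow v j \<Longrightarrow> z * \<pi> ^ k \<in> fpow v (j + int k)"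
  using pi_nz by (intro fpow_mult) (auto simp: fpow_def val_power val_pi)

lemma nl_add: "nl x ** nl y = nl (x + y)" by (simp add: nl_def)

lemma fib_K1: "z \<in> fpow v 0 \<Longrightarrow> g \<in> K1 v \<Longrightarrow> nl (z * \<pi> ^ k) ** g \<in> K1 v"
  using pi_power_fpow[of z 0 k] fpow_mono[of "z * \<pi> ^ k" "int k" 0] by (simp add: K1_mult)

lemma fib_residue_invariant:
  assumes F: "F \<in> level_space u l" and l: "l \<ge> 1" and g: "g \<in> K1 v"
  shows "residue_invariant (\<lambda>z. F (nl (z * \<pi> ^ (l - 1)) ** g))"
  unfolding residue_invariant_def
proof (intro ballI impI)
  fix x y assume xy: "x \<in> fpow v 0" "y \<in> fpow v 0" "x - y \<in> fpow v 1"
  have "(x - y) * \<pi> ^ (l - 1) \<in> fpow v (int l)" using pi_power_fpow[OF xy(3), of "l - 1"] l by simp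
  then have "gcong l (nl (x * \<pi> ^ (l - 1))) (nl (y * \<pi> ^ (l - 1)))"
    by (simp add: nl_def gcong_mat2 left_diff_distrib)
  moreover have "nl (x * \<pi> ^ (l - 1)) \<in> K1 v" "nl (y * \<pi> ^ (l - 1)) \<in> K1 v"
    using fib_K1[of x "mat 1" "l - 1"] fib_K1[of y "mat 1" "l - 1"] xy K1_one by auto
  ultimately show "F (nl (x * \<pi> ^ (l - 1)) ** g) = F (nl (y * \<pi> ^ (l - 1)) ** g)"
    using g by (intro level_space_gcong[OF F]) (auto intro: K1_mult gcong_mult)
qed

text \<open>The torus scales the layer by squares, which is how a kernel with the law
  \<open>hu\<close> turns \<open>u\<close> into \<open>u'\<close>. The unipotent radical passes
  through the layer up to a matrix with lower right entry in 1 + p^(l-1); this factor disappears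
  because the conductor of \<open>u\<close> is at most l - 1.\<close>

lemma layer_conv_level_space:
  assumes u: "unit_hom u (l - 1)" and l: "l \<ge> 2" and F: "F \<in> level_space u l" and h: "residue_invariant h"
    and hu: "\<And>t z. runit t \<Longrightarrow> z \<in> fpow v 0 \<Longrightarrow> u t * h z = u' t * h (t * t * z)"
  shows "layer_conv l h F \<in> level_space u' l"
proof -
  let ?p = "\<pi> ^ (l - 1)"
  have l1: "l \<ge> 1" using l by simp
  have zp: "z * ?p \<in> fpow v (int l - 1)" "z * ?p \<in> fpow v 0" if "z \<in> reps" for z
    using pi_power_fpow[OF reps_fpow[OF that], of "l - 1"] l fpow_mono[of "z * ?p" "int l - 1" 0] by auto
  have zK: "nl (z * ?p) \<in> K1 v" if "z \<in> reps" for z using zp[OF that] by simp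
  have A: "layer_conv l h F (nu x ** g) = layer_conv l h F g" if g: "g \<in> K1 v" and x: "x \<in> fpow v 0" for g x
  proof -
    have "F (nl (z * ?p) ** (nu x ** g)) = F (nl (z * ?p) ** g)" if z: "z \<in> reps" for z
    proof -
      define y where "y = z * ?p"
      have y: "y \<in> fpow v (int l - 1)" "y \<in> fpow v 0" "y \<in> fpow v 1"
        using zp[OF z] l fpow_mono[of y "int l - 1" 1] by (auto simp: y_def)
      \<comment> \<open>The conjugate of \<open>nu x\<close> by \<open>nl y\<close>. Its lower left
        entry lies in p^(2l-2), which is contained in p^l precisely because l is at least 2.\<close>
      define H where "H = mat2 (1 - y * x) x (- (y * (y * x))) (1 + y * x)"
      have e: "nl y ** nu x = H ** nl y" by (simp add: nl_def nu_def H_def algebra_simps)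
      have HK: "H \<in> K1 v" using x y by (auto simp: H_def K1_mat2 algebra_simps intro: fpow_add fpow_diff fpow_mult_left)
      have yx: "y * x \<in> fpow v (int l - 1)" using y x fpow_mult_right by blast
      have c: "H$2$1 \<in> fpow v (int l)" using fpow_mult_le[OF y(1) yx, of "int l"] l by (simp add: H_def)
      have "F (nl y ** (nu x ** g)) = F (H ** (nl y ** g))" by (simp add: matrix_mul_assoc e)
      also have "\<dots> = u (inverse (1 + y * x)) * F (nl y ** g)"
        using level_space_hecke[OF F l1 HK c, of "nl y ** g"] g y by (simp add: H_def K1_mult)
      also have "u (inverse (1 + y * x)) = 1"
      proof -
        have r: "runit (1 + y * x)" using y x by (intro runit_one_plus fpow_mult_right)
        have "u (1 + y * x) = 1" using yx l by (intro unit_hom_principal[OF u]) (simp add: of_nat_diff)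
        then show ?thesis using unit_hom_inverse[OF u r] by simp
      qed
      finally show ?thesis by (simp add: y_def)
    qed
    then show ?thesis using g x by (simp add: layer_conv_def K1_mult)
  qed
  have B: "layer_conv l h F (dg t ** g) = u' t * layer_conv l h F g" if g: "g \<in> K1 v" and t: "runit t" for g t
  proof -
    have tt: "runit (t * t)" using t runit_mult by blast
    have e: "nl y ** dg t = dg t ** nl (t * t * y)" for y using runit_nz[OF t] by (simp add: nl_def dg_mat2)
    have "layer_conv l h F (dg t ** g) = (\<Sum>z\<in>reps. h z * F (nl (z * ?p) ** (dg t ** g)))"
      using g t by (simp add: layer_conv_def K1_mult dg_K1)
    also have "\<dots> = (\<Sum>z\<in>reps. u' t * (h (t * t * z) * F (nl (t * t * z * ?p) ** g)))"
    proof (rule sum.cong[OF refl])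
      fix z assume z: "z \<in> reps"
      have "t * t * z \<in> fpow v 0" using tt reps_fpow[OF z] by (simp add: fpow_unit_cancel)
      then have "nl (t * t * z * ?p) ** g \<in> K1 v" using fib_K1 g by blast
      moreover have "nl (z * ?p) ** (dg t ** g) = dg t ** (nl (t * t * z * ?p) ** g)"
        by (simp add: matrix_mul_assoc e mult_ac)
      ultimately have "F (nl (z * ?p) ** (dg t ** g)) = u t * F (nl (t * t * z * ?p) ** g)"
        using mpsD(3)[OF F _ t] by simp
      then have "h z * F (nl (z * ?p) ** (dg t ** g)) = u t * h z * F (nl (t * t * z * ?p) ** g)" by simp
      then show "h z * F (nl (z * ?p) ** (dg t ** g)) = u' t * (h (t * t * z) * F (nl (t * t * z * ?p) ** g))"
        using hu[OF t reps_fpow[OF z]] by simp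
    qed
    also have "\<dots> = u' t * (\<Sum>z\<in>reps. h z * F (nl (z * ?p) ** g))"
      unfolding sum_distrib_left[symmetric]
      using sum_reps_scale[OF residue_invariant_mult[OF h fib_residue_invariant[OF F l1 g]] tt] by simp
    finally show ?thesis using g by (simp add: layer_conv_def)
  qed
  have C: "layer_conv l h F (g ** k) = layer_conv l h F g" if g: "g \<in> K1 v" and k: "k \<in> Kc v l" for g k
  proof -
    have "F (nl (z * ?p) ** (g ** k)) = F (nl (z * ?p) ** g)" if "z \<in> reps" for z
      using mpsD(4)[OF F K1_mult[OF zK[OF that] g] k] by (simp add: matrix_mul_assoc)
    then show ?thesis using g k by (simp add: layer_conv_def K1_mult Kc_iff)
  qed
  show ?thesis using A B C by (auto simp: level_space_def) (simp add: layer_conv_def)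
qed

lemma equivariant_layer_conv: "equivariant M (layer_conv l h)"
  unfolding equivariant_def
  by (auto simp: layer_conv_def fun_eq_iff Rt_def distrib_left sum.distrib sum_distrib_left mult_ac K1_mult fib_K1
      matrix_mul_assoc reps_fpow intro!: sum.cong)

text \<open>The group formed by the \<open>nl z\<close> is abelian, so the kernels act through a
  commutative algebra.\<close>

lemma layer_conv_commute: assumes "\<And>g. g \<notin> K1 v \<Longrightarrow> F g = 0" shows "layer_conv l h (layer_conv l h' F) = layer_conv l h' (layer_conv l h F)"
proof
  fix g
  show "layer_conv l h (layer_conv l h' F) g = layer_conv l h' (layer_conv l h F) g"
  proof (cases "g \<in> K1 v")
    case True
    have e: "layer_conv l h (layer_conv l h' F) g = (\<Sum>z\<in>reps. \<Sum>w\<in>reps. h z * (h' w * F (nl ((z + w) * \<pi> ^ (l - 1)) ** g)))" for h h'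
      using True by (simp add: layer_conv_def fib_K1 reps_fpow sum_distrib_left matrix_mul_assoc nl_add distrib_right add.commute)
    then show ?thesis unfolding e[of h h'] e[of h' h]
      by (subst sum.swap) (simp add: mult_ac add.commute)
  qed (simp add: layer_conv_def)
qed

lemma layer_conv_layer_conv:
  assumes F: "F \<in> level_space u l" and l: "l \<ge> 1" and h': "residue_invariant h'" and g: "g \<in> K1 v"
  shows "layer_conv l h (layer_conv l h' F) g = (\<Sum>w\<in>reps. (\<Sum>z\<in>reps. h z * h' (w - z)) * F (nl (w * \<pi> ^ (l - 1)) ** g))"
proof -
  let ?\<phi> = "\<lambda>w. F (nl (w * \<pi> ^ (l - 1)) ** g)"
  have "layer_conv l h (layer_conv l h' F) g = (\<Sum>z\<in>reps. h z * (\<Sum>w\<in>reps. h' w * ?\<phi> (w + z)))"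
    using g by (simp add: layer_conv_def fib_K1 reps_fpow matrix_mul_assoc nl_add distrib_right)
  also have "\<dots> = (\<Sum>z\<in>reps. h z * (\<Sum>w\<in>reps. h' (w - z) * ?\<phi> w))"
  proof (rule sum.cong[OF refl])
    fix z assume z: "z \<in> reps"
    have "residue_invariant (\<lambda>w. h' w * ?\<phi> (w + z))"
      using residue_invariant_mult[OF h' residue_invariant_shift[OF fib_residue_invariant[OF F l g]]] reps_fpow[OF z] by blast
    from sum_reps_shift[OF this, of "- z"]
    show "h z * (\<Sum>w\<in>reps. h' w * ?\<phi> (w + z)) = h z * (\<Sum>w\<in>reps. h' (w - z) * ?\<phi> w)"
      using reps_fpow[OF z] by simp
  qed
  also have "\<dots> = (\<Sum>w\<in>reps. (\<Sum>z\<in>reps. h z * h' (w - z)) * ?\<phi> w)"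
    unfolding sum_distrib_left sum_distrib_right by (subst sum.swap) (simp add: mult_ac)
  finally show ?thesis .
qed

abbreviation qc :: complex where "qc \<equiv> of_nat (residue_card v)"

lemma qc_nz: "qc \<noteq> 0" "qc - 1 \<noteq> 0"
  using residue_card_ge2 by (auto simp: of_nat_eq_1_iff)

lemma layer_conv_one_right:
  assumes F: "F \<in> level_space u l" and l: "l \<ge> 1" shows "layer_conv l h (layer_conv l (\<lambda>_. 1) F) = (\<Sum>z\<in>reps. h z) *\<^sub>C layer_conv l (\<lambda>_. 1) F"
proof
  fix g show "layer_conv l h (layer_conv l (\<lambda>_. 1) F) g = ((\<Sum>z\<in>reps. h z) *\<^sub>C layer_conv l (\<lambda>_. 1) F) g"
  proof (cases "g \<in> K1 v")
    case True
    have "residue_invariant (\<lambda>_::'a. 1::complex)" by (simp add: residue_invariant_def)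
    from layer_conv_layer_conv[OF F l this True] True show ?thesis by (simp add: layer_conv_def sum_distrib_left)
  qed (simp add: layer_conv_def)
qed

text \<open>By \<open>jacobi\<close> the product of the two kernels is, up to the sign
  \<open>\<eta> (- 1)\<close>, q times the unit mass at zero minus the constant 1. Where the layer
  sum vanishes, only a scalar is left.\<close>

lemma layer_conv_inverse:
  assumes F: "F \<in> level_space u l" and l: "l \<ge> 1"
    and \<eta>: "unit_hom \<eta> 1" "unit_hom \<eta>' 1" "\<And>t. runit t \<Longrightarrow> \<eta>' t = inverse (\<eta> t)" "runit a" "\<eta> a \<noteq> 1"
  shows "layer_conv l (ext0 \<eta>) (layer_conv l (ext0 \<eta>') F) = \<eta> (- 1) *\<^sub>C (qc *\<^sub>C F - layer_conv l (\<lambda>_. 1) F)"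
proof
  fix g show "layer_conv l (ext0 \<eta>) (layer_conv l (ext0 \<eta>') F) g = (\<eta> (- 1) *\<^sub>C (qc *\<^sub>C F - layer_conv l (\<lambda>_. 1) F)) g"
  proof (cases "g \<in> K1 v")
    case True
    let ?\<phi> = "\<lambda>w. F (nl (w * \<pi> ^ (l - 1)) ** g)"
    have "layer_conv l (ext0 \<eta>) (layer_conv l (ext0 \<eta>') F) g = (\<Sum>w\<in>reps. (\<eta> (- 1) * ((if runit w then 0 else qc) - 1)) * ?\<phi> w)"
      unfolding layer_conv_layer_conv[OF F l residue_invariant_ext0[OF \<eta>(2)] True] using jacobi[OF \<eta>] reps_fpow by simp
    also have "\<dots> = \<eta> (- 1) * (\<Sum>w\<in>reps. qc * (if runit w then 0 else ?\<phi> w) - ?\<phi> w)"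
      unfolding sum_distrib_left by (intro sum.cong) (auto simp: algebra_simps)
    also have "\<dots> = \<eta> (- 1) * (qc * ?\<phi> 0 - (\<Sum>w\<in>reps. ?\<phi> w))"
      unfolding sum_subtractf sum_distrib_left[symmetric] sum_nonunits[OF fib_residue_invariant[OF F l True]] ..
    also have "?\<phi> 0 = F g" by (simp add: nl_def flip: mat_1_mat2)
    finally show ?thesis using True by (simp add: layer_conv_def)
  qed (use mpsD(1)[OF F] in \<open>simp add: layer_conv_def\<close>)
qed

text \<open>Convolution with the constant \<open>1\<close> is \<open>q\<close> times a projection onto level \<open>l - 1\<close>, so its kernel is a
  complement of that level.\<close>
definition new_layer :: "('a \<Rightarrow> complex) \<Rightarrow> nat \<Rightarrow> ('a^2^2 \<Rightarrow> complex) set" where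
  "new_layer u l = {F \<in> level_space u l. layer_conv l (\<lambda>_. 1) F = 0}"

lemma equivariant_kernel_stab:
  assumes M: "stab M" and \<phi>: "equivariant M \<phi>" shows "stab {F \<in> M. \<phi> F = \<sigma> *\<^sub>C F}"
proof -
  have [simp]: "\<sigma> *\<^sub>C Rt k F = Rt k (\<sigma> *\<^sub>C F)" for k F by (auto simp: Rt_def fun_eq_iff)
  show ?thesis
    using M \<phi> equivariant_0[OF \<phi> M]
    unfolding stab_def complex_vector.subspace_def
    by (auto simp: equivariant_add equivariant_scale equivariant_Rt complex_vector.scale_right_distrib
        complex_vector.scale_left_commute)
qed

lemma stab_new_layer: "stab (new_layer u l)"
  using equivariant_kernel_stab[OF stab_level_space equivariant_layer_conv, of u l l "\<lambda>_. 1" 0] by (simp add: new_layer_def)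

lemma layer_conv_one_lower:
  assumes F: "F \<in> level_space u (l - 1)" and l: "l \<ge> 2" shows "layer_conv l (\<lambda>_. 1) F = qc *\<^sub>C F"
proof
  fix g show "layer_conv l (\<lambda>_. 1) F g = (qc *\<^sub>C F) g"
  proof (cases "g \<in> K1 v")
    case True
    have "F (nl (z * \<pi> ^ (l - 1)) ** g) = F g" if z: "z \<in> reps" for z
    proof -
      have "z * \<pi> ^ (l - 1) \<in> fpow v (int (l - 1))" using pi_power_fpow[OF reps_fpow[OF z], of "l - 1"] by simp
      then have "nl (z * \<pi> ^ (l - 1)) \<in> Kc v (l - 1)" by (rule nl_Kc)
      then have "gcong (l - 1) (nl (z * \<pi> ^ (l - 1)) ** g) (mat 1 ** g)"
        using True by (intro gcong_mult) (auto simp: Kc_iff K1_one)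
      then show ?thesis using level_space_gcong[OF F fib_K1[OF reps_fpow[OF z] True] True] by simp
    qed
    then show ?thesis using True by (simp add: layer_conv_def card_reps)
  qed (use mpsD(1)[OF F] in \<open>simp add: layer_conv_def\<close>)
qed

text \<open>An element of \<open>Kc v (l - 1)\<close> on the right is conjugated to the left of g
  and decomposed there. Its Borel part acts trivially, as \<open>u\<close> is trivial at level l -
  1, and its lower unipotent part merely shifts the summation variable.\<close>

lemma layer_conv_one_level_space_lower:
  assumes u: "unit_hom u (l - 1)" and l: "l \<ge> 2" and F: "F \<in> level_space u l" shows "layer_conv l (\<lambda>_. 1) F \<in> level_space u (l - 1)"
proof -
  let ?G = "layer_conv l (\<lambda>_. 1) F"
  have l1: "l \<ge> 1" using l by simp
  have G: "?G \<in> level_space u l" using u l F by (intro layer_conv_level_space[where u = u]) (auto simp: residue_invariant_def)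
  have "?G (g ** k) = ?G g" if g: "g \<in> K1 v" and k: "k \<in> Kc v (l - 1)" for g k
  proof -
    define k' where "k' = g ** k ** adj2 g"
    have k': "k' \<in> Kc v (l - 1)" using Kc_conj[OF k K1_adj2[OF g]]
      by (cases rule: mat2_cases[of g]) (simp add: k'_def)
    obtain a b c d where K: "k' = mat2 a b c d" using mat2_cases .
    have e: "g ** k = k' ** g" using adj2(2)[OF SL2_K1[OF g]] by (simp add: k'_def flip: matrix_mul_assoc)
    have c: "c \<in> fpow v (int (l - 1))" "d - 1 \<in> fpow v (int (l - 1))" "b \<in> fpow v (int (l - 1))" "a * d - b * c = 1"
      "mat2 a b c d \<in> K1 v"
      using k' by (auto simp: K Kc_iff mat_1_mat2 gcong_mat2 K1_mat2)
    have d: "runit d" using K1_bottom_unit[OF c(5)] c(1) fpow_mono[of c "int (l - 1)" 1] l by simp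
    define x where "x = c / d / \<pi> ^ (l - 1)"
    have cd: "c / d \<in> fpow v (int (l - 1))" using c d by (simp add: fpow_divide_unit)
    have x: "x \<in> fpow v 0" using cd pi_nz by (cases "c = 0") (auto simp: x_def fpow_def val_divide val_mult val_power val_pi runit_nz[OF d])
    have xc: "x * \<pi> ^ (l - 1) = c / d" using pi_nz by (simp add: x_def)
    have nlK: "nl (c / d) \<in> K1 v" using cd fpow_mono[of "c / d" "int (l - 1)" 0] by simp
    have "?G (g ** k) = ?G (nu (b / d) ** (dg (inverse d) ** (nl (c / d) ** g)))"
      unfolding e K using lower_decomp[OF d c(4)] by (simp add: matrix_mul_assoc)
    also have "\<dots> = u (inverse d) * ?G (nl (c / d) ** g)"
      using c d nlK g fpow_mono[of b "int (l - 1)" 0]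
      by (simp add: mpsD(2,3)[OF G] K1_mult dg_K1 runit_inverse fpow_divide_unit)
    also have "u (inverse d) = 1"
      using unit_hom_inverse[OF u d] unit_hom_principal[OF u c(2)] by simp
    also have "?G (nl (c / d) ** g) = (\<Sum>z\<in>reps. F (nl ((z + x) * \<pi> ^ (l - 1)) ** g))"
      using g nlK by (simp add: layer_conv_def K1_mult matrix_mul_assoc nl_add distrib_right flip: xc)
    also have "\<dots> = ?G g"
      using sum_reps_shift[OF fib_residue_invariant[OF F l1 g] x] g by (simp add: layer_conv_def)
    finally show ?thesis by simp
  qed
  then show ?thesis using G by (auto simp: level_space_def)
qed

lemma level_space_decomp:
  assumes u: "unit_hom u (l - 1)" and l: "l \<ge> 2" and F: "F \<in> level_space u l"
  shows "\<exists>A\<in>level_space u (l - 1). \<exists>B\<in>new_layer u l. F = A + B"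
proof -
  define A where "A = inverse qc *\<^sub>C layer_conv l (\<lambda>_. 1) F"
  have l1: "l \<ge> 1" using l by simp
  have A: "A \<in> level_space u (l - 1)" unfolding A_def by (rule stab_scale[OF stab_level_space layer_conv_one_level_space_lower[OF u l F]])
  then have Al: "A \<in> level_space u l" using level_space_mono by force
  have "layer_conv l (\<lambda>_. 1) A = layer_conv l (\<lambda>_. 1) F"
    using layer_conv_one_lower[OF A l] qc_nz by (simp add: A_def scaleC_scaleC scaleC_one)
  then have "layer_conv l (\<lambda>_. 1) (F - A) = 0"
    by (auto simp: layer_conv_def fun_eq_iff sum_subtractf right_diff_distrib split: if_splits)
  then have "F - A \<in> new_layer u l" using F Al stab_diff[OF stab_level_space] by (simp add: new_layer_def)
  then show ?thesis using A by (intro bexI[of _ A] bexI[of _ "F - A"]) auto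
qed

lemma new_layer_inter: "F \<in> new_layer u l \<Longrightarrow> F \<in> level_space u (l - 1) \<Longrightarrow> l \<ge> 2 \<Longrightarrow> F = 0"
proof -
  assume a: "F \<in> new_layer u l" "F \<in> level_space u (l - 1)" "l \<ge> 2"
  have "qc *\<^sub>C F = 0" using layer_conv_one_lower[OF a(2,3)] a(1) by (simp add: new_layer_def)
  then show "F = 0" using qc_nz by simp
qed

text \<open>Convolutions with mutually inverse nontrivial characters compose, in either order, to
  the scalar q times \<open>\<eta> (- 1)\<close> on new layers, so each inverts the other up to that
  scalar.\<close>

lemma layer_conv_iso:
  assumes u: "unit_hom u (l - 1)" "unit_hom u' (l - 1)" and l: "l \<ge> 2"
    and \<eta>: "unit_hom \<eta> 1" "unit_hom \<eta>' 1" "\<And>t. runit t \<Longrightarrow> \<eta>' t = inverse (\<eta> t)" "runit a" "\<eta> a \<noteq> 1"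
    and uu: "\<And>t. runit t \<Longrightarrow> u t = u' t * \<eta> (t * t)"
  shows "bij_betw (layer_conv l (ext0 \<eta>)) (new_layer u l) (new_layer u' l)"
proof -
  have l1: "l \<ge> 1" using l by simp
  have map: "layer_conv l (ext0 \<xi>) F \<in> new_layer w' l"
    if F: "F \<in> new_layer w l" and \<xi>: "unit_hom \<xi> 1" and w: "unit_hom w (l - 1)" and weyl: "\<And>t. runit t \<Longrightarrow> w t = w' t * \<xi> (t * t)" for F w w' \<xi>
  proof -
    have Fm: "F \<in> level_space w l" using F by (simp add: new_layer_def)
    have "layer_conv l (ext0 \<xi>) F \<in> level_space w' l"
      by (rule layer_conv_level_space[OF w l Fm residue_invariant_ext0[OF \<xi>]]) (simp add: weyl ext0_mult[OF \<xi>] runit_mult)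
    moreover have "layer_conv l (\<lambda>_. 1) (layer_conv l (ext0 \<xi>) F) = layer_conv l (ext0 \<xi>) (layer_conv l (\<lambda>_. 1) F)"
      by (rule layer_conv_commute) (use mpsD(1)[OF Fm] in blast)
    ultimately show ?thesis using F by (simp add: new_layer_def) (simp add: layer_conv_def fun_eq_iff)
  qed
  have comp: "layer_conv l (ext0 \<xi>) (layer_conv l (ext0 \<xi>') F) = (\<xi> (- 1) * qc) *\<^sub>C F"
    if "F \<in> new_layer w l" "unit_hom \<xi> 1" "unit_hom \<xi>' 1" "\<And>t. runit t \<Longrightarrow> \<xi>' t = inverse (\<xi> t)" "\<xi> a \<noteq> 1" for F w \<xi> \<xi>'
    using layer_conv_inverse[OF _ l1 that(2-4) \<eta>(4) that(5), of F w] that(1) by (simp add: new_layer_def scaleC_scaleC)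
  have \<eta>'a: "\<eta>' a \<noteq> 1" using \<eta> by (metis inverse_eq_1_iff)
  have inv': "\<eta> t = inverse (\<eta>' t)" if "runit t" for t using \<eta>(3)[OF that] by simp
  have uu': "u' t = u t * \<eta>' (t * t)" if "runit t" for t
    using uu[OF that] \<eta>(3)[of "t * t"] unit_hom_nz[OF \<eta>(1), of "t * t"] that runit_mult by simp
  have k: "\<eta>' (-1) * qc \<noteq> 0" "\<eta> (-1) * qc \<noteq> 0" using unit_hom_nz[OF \<eta>(1), of "-1"] unit_hom_nz[OF \<eta>(2), of "-1"] qc_nz by auto
  show ?thesis
  proof (rule bij_betwI[where g = "\<lambda>F. inverse (\<eta> (-1) * qc) *\<^sub>C layer_conv l (ext0 \<eta>') F"])
    show "layer_conv l (ext0 \<eta>) \<in> new_layer u l \<rightarrow> new_layer u' l" using map[OF _ \<eta>(1) u(1) uu] by blast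
    show "(\<lambda>F. inverse (\<eta> (-1) * qc) *\<^sub>C layer_conv l (ext0 \<eta>') F) \<in> new_layer u' l \<rightarrow> new_layer u l"
      using map[OF _ \<eta>(2) u(2) uu'] stab_scale[OF stab_new_layer] by blast
    have e: "\<eta>' (-1) = \<eta> (-1)"
      using \<eta>(3)[of "-1"] unit_hom_mult[OF \<eta>(1), of "-1" "-1"] unit_hom_one[OF \<eta>(1)] by simp (metis inverse_unique)
    show "inverse (\<eta> (-1) * qc) *\<^sub>C layer_conv l (ext0 \<eta>') (layer_conv l (ext0 \<eta>) F) = F" if "F \<in> new_layer u l" for F
      by (simp only: comp[OF that \<eta>(2,1) inv' \<eta>'a] e scaleC_scaleC left_inverse[OF k(2)] scaleC_one)
    show "layer_conv l (ext0 \<eta>) (inverse (\<eta> (-1) * qc) *\<^sub>C layer_conv l (ext0 \<eta>') F) = F" if "F \<in> new_layer u' l" for F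
      by (simp only: equivariant_scale[OF equivariant_layer_conv UNIV_I] comp[OF that \<eta>(1-3,5)] scaleC_scaleC
          left_inverse[OF k(2)] scaleC_one)
  qed
qed

lemma equivariant_id: "equivariant M (\<lambda>F. F)" by (simp add: equivariant_def)

lemma equivariant_subset: "equivariant UNIV \<phi> \<Longrightarrow> equivariant M \<phi>" by (auto simp: equivariant_def)

lemma equivariant_comp: "equivariant UNIV \<phi> \<Longrightarrow> equivariant UNIV \<psi> \<Longrightarrow> equivariant UNIV (\<lambda>F. \<phi> (\<psi> F))"
  by (simp add: equivariant_def)

lemma equivariant_lin:
  assumes "equivariant UNIV \<phi>" "equivariant UNIV \<psi>" shows "equivariant UNIV (\<lambda>F. a *\<^sub>C \<phi> F + b *\<^sub>C \<psi> F)"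
proof -
  have R: "Rt k (a *\<^sub>C F + b *\<^sub>C G) = a *\<^sub>C Rt k F + b *\<^sub>C Rt k G" for k F G by (auto simp: Rt_def fun_eq_iff)
  show ?thesis using assms unfolding equivariant_def R
    by (simp add: complex_vector.scale_right_distrib scaleC_scaleC mult.commute add_ac)
qed

subsection \<open>The two halves of a new layer\<close>

abbreviation layer_conv_quad_char where "layer_conv_quad_char l \<equiv> layer_conv l (ext0 quad_char)"

definition half_layer :: "('a \<Rightarrow> complex) \<Rightarrow> nat \<Rightarrow> complex \<Rightarrow> ('a^2^2 \<Rightarrow> complex) set" where
  "half_layer u l \<sigma> = {F \<in> new_layer u l. layer_conv_quad_char l F = \<sigma> *\<^sub>C F}"

lemma stab_half_layer: "stab (half_layer u l \<sigma>)"
  unfolding half_layer_def by (rule equivariant_kernel_stab[OF stab_new_layer equivariant_layer_conv])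

text \<open>First the layer average is subtracted, then (1 + S/\<sigma>)/2 is applied, S being the
  quadratic convolution with square \<sigma>^2 on the new layer. The leading coefficient 1 gives the
  inner term the shape that \<open>equivariant_lin\<close> expects.\<close>

definition half_proj :: "nat \<Rightarrow> complex \<Rightarrow> ('a^2^2 \<Rightarrow> complex) \<Rightarrow> 'a^2^2 \<Rightarrow> complex" where
  "half_proj l \<sigma> F = (let G = 1 *\<^sub>C F + (- inverse qc) *\<^sub>C layer_conv l (\<lambda>_. 1) F in (1/2) *\<^sub>C G + (inverse \<sigma> / 2) *\<^sub>C layer_conv_quad_char l G)"

lemma equivariant_half_proj: "equivariant M (half_proj l \<sigma>)"
proof -
  have G: "equivariant UNIV (\<lambda>F. 1 *\<^sub>C F + (- inverse qc) *\<^sub>C layer_conv l (\<lambda>_. 1) F)"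
    by (intro equivariant_lin equivariant_id equivariant_layer_conv)
  have "equivariant UNIV (\<lambda>F. (1/2) *\<^sub>C (1 *\<^sub>C F + (- inverse qc) *\<^sub>C layer_conv l (\<lambda>_. 1) F)
      + (inverse \<sigma> / 2) *\<^sub>C layer_conv_quad_char l (1 *\<^sub>C F + (- inverse qc) *\<^sub>C layer_conv l (\<lambda>_. 1) F))"
    by (rule equivariant_lin[OF G equivariant_comp[OF equivariant_layer_conv G]])
  then show ?thesis unfolding half_proj_def Let_def by (rule equivariant_subset)
qed

context
  fixes u :: "'a \<Rightarrow> complex" and l :: nat and \<sigma> :: complex
  assumes u: "unit_hom u (l - 1)" and l: "l \<ge> 2" and \<sigma>: "\<sigma> * \<sigma> = quad_char (- 1) * qc"
begin

lemma l1: "l \<ge> 1" using l by simp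
lemma ul: "unit_hom u l" using unit_hom_mono[OF u] by simp
lemma \<sigma>_nz: "\<sigma> \<noteq> 0" using \<sigma> qc_nz quad_char_sq[of "-1"] by auto

lemma layer_conv_quad_char_new_layer: "F \<in> new_layer u l \<Longrightarrow> layer_conv_quad_char l F \<in> new_layer u l"
proof -
  assume F: "F \<in> new_layer u l"
  then have Fm: "F \<in> level_space u l" by (simp add: new_layer_def)
  have "layer_conv_quad_char l F \<in> level_space u l"
    by (rule layer_conv_level_space[OF u l Fm residue_invariant_ext0[OF unit_hom_quad_char]])
      (simp add: ext0_mult[OF unit_hom_quad_char] runit_mult quad_char_mult quad_char_sq)
  moreover have "layer_conv l (\<lambda>_. 1) (layer_conv_quad_char l F) = layer_conv_quad_char l (layer_conv l (\<lambda>_. 1) F)"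
    by (rule layer_conv_commute) (use mpsD(1)[OF Fm] in blast)
  ultimately show ?thesis using F by (simp add: new_layer_def) (simp add: layer_conv_def fun_eq_iff)
qed

text \<open>A quadratic character is its own inverse, so \<open>layer_conv_inverse\<close> applies
  with both kernels equal. This is where the requirement on \<sigma> comes from.\<close>

lemma layer_conv_quad_char_layer_conv_quad_char: "F \<in> new_layer u l \<Longrightarrow> layer_conv_quad_char l (layer_conv_quad_char l F) = (\<sigma> * \<sigma>) *\<^sub>C F"
proof -
  assume F: "F \<in> new_layer u l"
  obtain a where a: "runit a" "quad_char a = - 1" using ex_quad_char_minus by blast
  have "layer_conv_quad_char l (layer_conv_quad_char l F) = quad_char (- 1) *\<^sub>C (qc *\<^sub>C F - layer_conv l (\<lambda>_. 1) F)"
    using F a by (intro layer_conv_inverse[OF _ l1 unit_hom_quad_char unit_hom_quad_char quad_char_inverse a(1)]) (auto simp: new_layer_def)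
  then show ?thesis using F by (simp add: new_layer_def \<sigma> scaleC_scaleC)
qed

lemma half_proj_new_layer: "F \<in> new_layer u l \<Longrightarrow> half_proj l \<tau> F = (1/2) *\<^sub>C F + (inverse \<tau> / 2) *\<^sub>C layer_conv_quad_char l F"
  by (simp add: half_proj_def new_layer_def scaleC_one)

lemma half_proj_id: "F \<in> half_layer u l \<sigma> \<Longrightarrow> half_proj l \<sigma> F = F"
  using \<sigma>_nz by (auto simp: half_layer_def half_proj_new_layer fun_eq_iff field_simps)

lemma half_proj_zero: "F \<in> half_layer u l (- \<sigma>) \<Longrightarrow> half_proj l \<sigma> F = 0"
  using \<sigma>_nz by (auto simp: half_layer_def half_proj_new_layer fun_eq_iff field_simps)

lemma half_proj_half_layer_new_layer: "F \<in> new_layer u l \<Longrightarrow> half_proj l \<sigma> F \<in> half_layer u l \<sigma>"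
proof -
  assume F: "F \<in> new_layer u l"
  let ?G = "(1/2) *\<^sub>C F + (inverse \<sigma> / 2) *\<^sub>C layer_conv_quad_char l F"
  have "?G \<in> new_layer u l" using F layer_conv_quad_char_new_layer by (intro stab_add[OF stab_new_layer] stab_scale[OF stab_new_layer])
  moreover have "layer_conv_quad_char l ?G = \<sigma> *\<^sub>C ?G"
  proof -
    have "layer_conv_quad_char l ?G = (1/2) *\<^sub>C layer_conv_quad_char l F + (inverse \<sigma> / 2) *\<^sub>C layer_conv_quad_char l (layer_conv_quad_char l F)"
      by (simp only: equivariant_add[OF equivariant_layer_conv UNIV_I UNIV_I] equivariant_scale[OF equivariant_layer_conv UNIV_I])
    then show ?thesis using layer_conv_quad_char_layer_conv_quad_char[OF F] \<sigma>_nz by (auto simp: fun_eq_iff field_simps)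
  qed
  ultimately show ?thesis by (simp add: half_proj_new_layer[OF F] half_layer_def)
qed

lemma half_proj_half_layer: "F \<in> level_space u l \<Longrightarrow> half_proj l \<sigma> F \<in> half_layer u l \<sigma>"
proof -
  assume F: "F \<in> level_space u l"
  define G where "G = 1 *\<^sub>C F + (- inverse qc) *\<^sub>C layer_conv l (\<lambda>_. 1) F"
  have c1: "layer_conv l (\<lambda>_. 1) F \<in> level_space u l" using level_space_mono[OF layer_conv_one_level_space_lower[OF u l F]] by simp
  have Gm: "G \<in> level_space u l" unfolding G_def using F c1 by (intro stab_add[OF stab_level_space] stab_scale[OF stab_level_space])
  have "layer_conv l (\<lambda>_. 1) G = 1 *\<^sub>C layer_conv l (\<lambda>_. 1) F + (- inverse qc) *\<^sub>C layer_conv l (\<lambda>_. 1) (layer_conv l (\<lambda>_. 1) F)"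
    by (simp only: G_def equivariant_add[OF equivariant_layer_conv UNIV_I UNIV_I] equivariant_scale[OF equivariant_layer_conv UNIV_I])
  also have "layer_conv l (\<lambda>_. 1) (layer_conv l (\<lambda>_. 1) F) = qc *\<^sub>C layer_conv l (\<lambda>_. 1) F"
    using layer_conv_one_right[OF F l1, of "\<lambda>_. 1"] by (simp add: card_reps)
  finally have "layer_conv l (\<lambda>_. 1) G = 0" using qc_nz by (auto simp: fun_eq_iff)
  then have G: "G \<in> new_layer u l" using Gm by (simp add: new_layer_def)
  have "half_proj l \<sigma> F = half_proj l \<sigma> G" unfolding half_proj_new_layer[OF G] by (simp add: half_proj_def G_def Let_def)
  then show ?thesis using half_proj_half_layer_new_layer[OF G] by simp
qed

lemma half_layer_subset: "half_layer u l \<tau> \<subseteq> level_space u l" by (auto simp: half_layer_def new_layer_def)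

text \<open>A Borel eigenvector in the new layer is supported on the fibre over the base point, where it is
  a function on the residue field invariant under squares.\<close>
lemma half_layer_star:
  assumes D: "D \<in> half_layer u l \<sigma>" and B: "borel_eigen u D" and D1: "D (mat 1) = 0" shows "D = 0"
proof -
  let ?p = "\<pi> ^ (l - 1)"
  have Dm: "D \<in> level_space u l" and c1: "layer_conv l (\<lambda>_. 1) D = 0" and cs: "layer_conv_quad_char l D = \<sigma> *\<^sub>C D"
    using D by (auto simp: half_layer_def new_layer_def)
  have sum0: "(\<Sum>z\<in>reps. D (nl (z * ?p) ** g)) = 0" if "g \<in> K1 v" for g
    using fun_cong[OF c1, of g] that by (simp add: layer_conv_def)
  have nldg: "nl y ** dg t = dg t ** nl (t * t * y)" if "runit t" for y t
    using runit_nz[OF that] by (simp add: nl_def dg_mat2)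
  \<comment> \<open>The torus element is evaluated once as a right eigenvalue and once by left
    equivariance. Both give the factor \<open>u t\<close>, so only the scaling by a square
    remains.\<close>
  have sq: "D (nl (t * t * y)) = D (nl y)" if t: "runit t" and y: "y \<in> fpow v 0" and e: "u t \<noteq> 0" for t y
  proof -
    have "t * t * y \<in> fpow v 0" using t y by (simp add: fpow_unit_cancel runit_mult)
    have "u t * D (nl y) = D (nl y ** dg t)" using borel_eigen_dg[OF B, of "nl y" t] t y by simp
    also have "\<dots> = u t * D (nl (t * t * y))"
      using mpsD(3)[OF Dm, of "nl (t * t * y)" t] t \<open>t * t * y \<in> fpow v 0\<close> by (simp add: nldg)
    finally show ?thesis using e by simp
  qed
  have sq': "D (nl (t * t * y)) = D (nl y)" if "runit t" "y \<in> fpow v 0" for t y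
    using sq[OF that] unit_hom_nz[OF u that(1)] by blast
  show ?thesis
  proof (rule level_space_vanish[OF Dm borel_eigen_nu[OF B]])
    \<comment> \<open>At the Weyl element the layer turns into the unipotent radical on the right,
      so the vanishing layer sum consists of q equal terms.\<close>
    have "D (nl (z * ?p) ** weyl) = D weyl" if z: "z \<in> reps" for z
    proof -
      have "nl (z * ?p) ** weyl = weyl ** nu (- (z * ?p))" by (simp add: nl_def weyl_def nu_def)
      moreover have "z * ?p \<in> fpow v 0" using pi_power_fpow[OF reps_fpow[OF z], of "l - 1"] fpow_mono by force
      ultimately show ?thesis using borel_eigen_nu[OF B weyl_K1] by simp
    qed
    then have "qc * D weyl = 0" using sum0[OF weyl_K1] by (simp add: card_reps)
    then show "D weyl = 0" using qc_nz by simp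
  next
    fix x assume x: "x \<in> fpow v 1"
    then have xO: "x \<in> fpow v 0" using fpow_mono by force
    show "D (nl x) = 0"
    proof (cases "x \<in> fpow v (int l - 1)")
      case False
      then have x0: "x \<noteq> 0" "1 \<le> v x" "v x \<le> int l - 2" using x by (auto simp: fpow_def)
      have "D (nl (z * ?p) ** nl x) = D (nl x)" if z: "z \<in> reps" for z
      proof -
        define y where "y = z * ?p"
        have y: "y \<in> fpow v (int l - 1)" using pi_power_fpow[OF reps_fpow[OF z], of "l - 1"] l by (simp add: y_def of_nat_diff)
        have v2: "v 2 = 0" "(2::'a) \<noteq> 0" using two_unit by (auto simp: runit_def)
        \<comment> \<open>A first-order square root: (1 + s)^2 x equals x + y + s y/2, and the error
          lies in p^l since s is in p. Thus D is constant along the layer through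
          \<open>nl x\<close>, and the layer sum kills it.\<close>
        define s where "s = y / (2 * x)"
        have s: "s \<in> fpow v 1" using y x0 v2 by (cases "y = 0") (auto simp: s_def fpow_def val_divide val_mult)
        have t: "runit (1 + s)" using s runit_one_plus by blast
        have "(1 + s) * (1 + s) * x - (x + y) = s * (y / 2)"
        proof -
          have "y = 2 * (s * x)" using x0 v2 by (simp add: s_def)
          then show ?thesis using v2 by (simp add: algebra_simps)
        qed
        moreover have "s * (y / 2) \<in> fpow v (int l)"
          using s y fpow_mult_le[of s 1 "y / 2" "int l - 1"] two_unit by (simp add: fpow_divide_unit)
        ultimately have "(1 + s) * (1 + s) * x - (x + y) \<in> fpow v (int l)" by metis
        moreover have "nl ((1 + s) * (1 + s) * x) \<in> K1 v" "nl (x + y) \<in> K1 v"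
          using t xO y fpow_mono[of y "int l - 1" 0] l by (auto simp: fpow_unit_cancel runit_mult intro: fpow_add)
        ultimately have "D (nl ((1 + s) * (1 + s) * x)) = D (nl (x + y))"
          by (intro level_space_gcong[OF Dm]) (auto simp: nl_def gcong_mat2)
        then show ?thesis using sq'[OF t xO] by (simp add: nl_add y_def add.commute)
      qed
      then have "qc * D (nl x) = 0" using sum0[of "nl x"] xO by (simp add: card_reps)
      then show ?thesis using qc_nz by simp
    next
      case True
      define \<phi> where "\<phi> = (\<lambda>z. D (nl (z * ?p)))"
      have \<phi>: "residue_invariant \<phi>" using fib_residue_invariant[OF Dm l1 K1_one] unfolding \<phi>_def matrix_mul_rid .
      have \<phi>0: "\<phi> 0 = 0" using D1 by (simp add: \<phi>_def nl_def flip: mat_1_mat2)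
      define z0 where "z0 = x / ?p"
      have z0: "z0 \<in> fpow v 0"
        using True pi_nz l by (cases "x = 0") (auto simp: z0_def fpow_def val_divide val_power val_pi of_nat_diff)
      have xz: "x = z0 * ?p" using pi_nz by (simp add: z0_def)
      have "\<phi> z0 = 0"
      proof (cases "runit z0")
        case False
        then show ?thesis using pinvD[OF \<phi> z0, of 0] z0 \<phi>0 by (simp add: runit_iff)
      next
        case z0u: True
        have \<phi>eq: "\<phi> z = \<phi> z0" if z: "runit z" "quad_char z = quad_char z0" for z
        proof -
          obtain t where t: "runit t" "z - z0 * (t * t) \<in> fpow v 1" using quad_char_eq[OF z0u z] by blast
          have "\<phi> z = \<phi> (t * t * z0)"
            using t z z0u by (intro pinvD[OF \<phi>]) (auto simp: runit_fpow runit_mult mult.commute)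
          also have "\<dots> = \<phi> z0" using sq'[OF t(1), of "z0 * ?p"] xO xz by (simp add: \<phi>_def mult.assoc)
          finally show ?thesis .
        qed
        have "(\<Sum>z\<in>reps. \<phi> z) = 0" using sum0[OF K1_one] by (simp add: \<phi>_def)
        moreover have "(\<Sum>z\<in>reps. ext0 quad_char z * \<phi> z) = 0"
          using fun_cong[OF cs, of "mat 1"] D1 by (simp add: layer_conv_def K1_one \<phi>_def)
        \<comment> \<open>Both sums vanish, the second because the eigenvalue equation at the
          identity reads \<sigma> times \<open>D (mat 1)\<close>. Adding them with the sign of z0
          leaves only the square class of z0.\<close>
        ultimately have "0 = (\<Sum>z\<in>reps. \<phi> z) + quad_char z0 * (\<Sum>z\<in>reps. ext0 quad_char z * \<phi> z)" by simp
        also have "\<dots> = (\<Sum>z\<in>reps. if runit z \<and> quad_char z = quad_char z0 then 2 * \<phi> z0 else 0)"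
          unfolding sum_distrib_left sum.distrib[symmetric]
        proof (rule sum.cong[OF refl])
          fix z assume z: "z \<in> reps"
          show "\<phi> z + quad_char z0 * (ext0 quad_char z * \<phi> z) = (if runit z \<and> quad_char z = quad_char z0 then 2 * \<phi> z0 else 0)"
          proof (cases "runit z")
            case True
            then show ?thesis using \<phi>eq[OF True] by (auto simp: ext0_def quad_char_def)
          next
            case False
            then have "\<phi> z = 0" using pinvD[OF \<phi> reps_fpow[OF z], of 0] reps_fpow[OF z] \<phi>0 by (simp add: runit_iff)
            then show ?thesis using False by simp
          qed
        qed
        also have "\<dots> = of_nat (card {z \<in> reps. runit z \<and> quad_char z = quad_char z0}) * (2 * \<phi> z0)"
          by (simp add: sum.If_cases Collect_conj_eq)
        finally have "of_nat (card {z \<in> reps. runit z \<and> quad_char z = quad_char z0}) * (2 * \<phi> z0) = 0" by simp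
        moreover have "rep z0 \<in> {z \<in> reps. runit z \<and> quad_char z = quad_char z0}"
          using rep[OF z0] runit_cong[OF z0u] unit_hom_cong[OF unit_hom_quad_char z0u, of "rep z0"] by auto
        then have "card {z \<in> reps. runit z \<and> quad_char z = quad_char z0} \<noteq> 0" by auto
        ultimately show ?thesis by simp
      qed
      then show ?thesis by (simp add: \<phi>_def xz)
    qed
  qed
qed

text \<open>Along the last layer \<open>delta_fn\<close> is the indicator of the zero class, which
  the kernel \<open>ext0 quad_char\<close> does not meet. So only the first half of the projection
  contributes, and the value is (1 - 1/q)/2.\<close>

lemma delta_fn_ne: "half_proj l \<sigma> (delta_fn u l) (mat 1) \<noteq> 0"
proof -
  have d: "delta_fn u l \<in> level_space u l" by (rule delta_fn_level_space(1)[OF ul l1])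
  have v: "delta_fn u l (nl (z * \<pi> ^ (l - 1))) = (if runit z then 0 else 1)" if z: "z \<in> reps" for z
  proof -
    have K: "nl (z * \<pi> ^ (l - 1)) \<in> K1 v" using fib_K1[OF reps_fpow[OF z] K1_one] by simp
    have "z * \<pi> ^ (l - 1) \<in> fpow v (int l) \<longleftrightarrow> z \<in> fpow v 1"
      using l pi_nz by (cases "z = 0") (auto simp: fpow_def val_mult val_power val_pi of_nat_diff)
    then show ?thesis using K reps_fpow[OF z] unit_hom_one[OF u] by (simp add: delta_fn_def runit_iff) (simp add: nl_def)
  qed
  have d1: "delta_fn u l (mat 1) = 1" using unit_hom_one[OF u] by (simp add: delta_fn_def K1_one) (simp add: mat_1_mat2)
  have c1: "layer_conv l (\<lambda>_. 1) (delta_fn u l) (mat 1) = 1"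
  proof -
    have "layer_conv l (\<lambda>_. 1) (delta_fn u l) (mat 1) = (\<Sum>z\<in>reps. if runit z then 0 else 1)"
      using v by (simp add: layer_conv_def K1_one)
    also have "\<dots> = 1" by (rule sum_nonunits) (simp add: residue_invariant_def)
    finally show ?thesis .
  qed
  have cs: "layer_conv_quad_char l (delta_fn u l) (mat 1) = 0"
    using v by (auto simp: layer_conv_def K1_one ext0_def intro!: sum.neutral)
  obtain a where a: "runit a" "quad_char a = - 1" using ex_quad_char_minus by blast
  have cs1: "layer_conv_quad_char l (layer_conv l (\<lambda>_. 1) (delta_fn u l)) = 0"
    using layer_conv_one_right[OF d l1, of "ext0 quad_char"] sum_ext0[OF unit_hom_quad_char a(1)] a by simp
  define G where "G = 1 *\<^sub>C delta_fn u l + (- inverse qc) *\<^sub>C layer_conv l (\<lambda>_. 1) (delta_fn u l)"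
  have "layer_conv_quad_char l G (mat 1) = 0"
    unfolding G_def equivariant_add[OF equivariant_layer_conv UNIV_I UNIV_I] equivariant_scale[OF equivariant_layer_conv UNIV_I] cs1
    using cs by simp
  moreover have "G (mat 1) = 1 - inverse qc" by (simp add: G_def d1 c1)
  ultimately have "half_proj l \<sigma> (delta_fn u l) (mat 1) = (1 - inverse qc) / 2"
    unfolding half_proj_def G_def[symmetric] Let_def by simp
  then show ?thesis using qc_nz by (auto simp: field_simps)
qed

lemma irr_half_layer: "irr_model (half_layer u l \<sigma>)"
proof (rule irreducibility_criterion[OF ul l1 equivariant_half_proj])
  show "half_layer u l \<sigma> \<noteq> {0}" using delta_fn_ne half_proj_half_layer[OF delta_fn_level_space(1)[OF ul l1]] by auto
qed (use half_proj_half_layer half_proj_id stab_half_layer half_layer_subset half_layer_star in auto)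

end

text \<open>The projection with sign -\<sigma> kills the half with sign \<sigma> but not the cyclic
  vector, which is the input of \<open>hom_zero_crit\<close>.\<close>

lemma half_layer_hom_zero:
  assumes u: "unit_hom u (l - 1)" and l: "l \<ge> 2" and \<sigma>: "\<sigma> * \<sigma> = quad_char (- 1) * qc"
    and \<phi>: "equivariant (half_layer u l \<sigma>) \<phi>" "\<And>F. F \<in> half_layer u l \<sigma> \<Longrightarrow> \<phi> F \<in> half_layer u l (- \<sigma>)" and F: "F \<in> half_layer u l \<sigma>"
  shows "\<phi> F = 0"
proof -
  have \<sigma>': "(- \<sigma>) * (- \<sigma>) = quad_char (- 1) * qc" using \<sigma> by simp
  note c = u l \<sigma> and c' = u l \<sigma>'
  show ?thesis
    by (rule hom_zero_crit[OF ul[OF c] l1[OF c] equivariant_half_proj half_proj_half_layer[OF c] half_proj_id[OF c]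
          equivariant_half_proj half_proj_half_layer[OF c'] _ stab_half_layer half_layer_subset[OF c] stab_half_layer half_layer_star[OF c'] delta_fn_ne[OF c'] \<phi> F])
      (use half_proj_zero[OF c'] in auto)
qed

lemma new_layer_decomp:
  assumes u: "unit_hom u (l - 1)" and l: "l \<ge> 2" and \<sigma>: "\<sigma> * \<sigma> = quad_char (- 1) * qc" and F: "F \<in> new_layer u l"
  shows "\<exists>A\<in>half_layer u l \<sigma>. \<exists>B\<in>half_layer u l (- \<sigma>). F = A + B"
proof -
  have \<sigma>': "(- \<sigma>) * (- \<sigma>) = quad_char (- 1) * qc" using \<sigma> by simp
  have "F = half_proj l \<sigma> F + half_proj l (- \<sigma>) F"
    using half_proj_new_layer[OF u l \<sigma> F] by (auto simp: fun_eq_iff)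
  then show ?thesis using half_proj_half_layer_new_layer[OF u l \<sigma> F] half_proj_half_layer_new_layer[OF u l \<sigma>' F] by blast
qed

lemma half_layer_inter: "\<sigma> \<noteq> 0 \<Longrightarrow> F \<in> half_layer u l \<sigma> \<Longrightarrow> F \<in> half_layer u l (- \<sigma>) \<Longrightarrow> F = 0"
proof -
  assume a: "\<sigma> \<noteq> 0" "F \<in> half_layer u l \<sigma>" "F \<in> half_layer u l (- \<sigma>)"
  then have "\<sigma> *\<^sub>C F = (- \<sigma>) *\<^sub>C F" by (simp add: half_layer_def)
  then show "F = 0" using a(1) by (auto simp: fun_eq_iff)
qed

text \<open>Conjugation by \<open>diag(1, 1/\<nu>)\<close>, which is inner only when \<open>\<nu>\<close> is a square.\<close>
definition conj_mat :: "'a \<Rightarrow> 'a^2^2 \<Rightarrow> 'a^2^2" where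
  "conj_mat \<nu> g = mat2 (g$1$1) (\<nu> * g$1$2) (g$2$1 / \<nu>) (g$2$2)"

lemma conj_mat_mat2 [simp]: "conj_mat \<nu> (mat2 a b c d) = mat2 a (\<nu> * b) (c / \<nu>) d" by (simp add: conj_mat_def)

lemma conj_mat_mult: "\<nu> \<noteq> 0 \<Longrightarrow> conj_mat \<nu> (g ** h) = conj_mat \<nu> g ** conj_mat \<nu> h"
  by (cases rule: mat2_cases[of g]; cases rule: mat2_cases[of h]) (simp add: field_simps)

lemma conj_mat_K1: "runit \<nu> \<Longrightarrow> g \<in> K1 v \<Longrightarrow> conj_mat \<nu> g \<in> K1 v"
  by (cases rule: mat2_cases[of g]) (auto simp: K1_mat2 fpow_unit_cancel fpow_divide_unit runit_nz)

lemma conj_mat_Kc: "runit \<nu> \<Longrightarrow> k \<in> Kc v l \<Longrightarrow> conj_mat \<nu> k \<in> Kc v l"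
  using conj_mat_K1[of \<nu> k]
  by (cases rule: mat2_cases[of k]) (auto simp: Kc_iff mat_1_mat2 gcong_mat2 fpow_unit_cancel fpow_divide_unit)

definition conj_fn :: "'a \<Rightarrow> ('a^2^2 \<Rightarrow> complex) \<Rightarrow> 'a^2^2 \<Rightarrow> complex" where
  "conj_fn \<nu> F = (\<lambda>g. if g \<in> K1 v then F (conj_mat \<nu> g) else 0)"

lemma conj_fn_level_space: assumes F: "F \<in> level_space u l" and \<nu>: "runit \<nu>" shows "conj_fn \<nu> F \<in> level_space u l"
proof -
  have n0: "\<nu> \<noteq> 0" using \<nu> runit_nz by blast
  have [simp]: "conj_mat \<nu> (nu x) = nu (\<nu> * x)" "conj_mat \<nu> (dg t) = dg t" for x t by (simp_all add: nu_def dg_mat2)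
  have "\<nu> * x \<in> fpow v 0" if "x \<in> fpow v 0" for x using that \<nu> by (simp add: fpow_unit_cancel)
  then show ?thesis using F \<nu>
    by (auto simp: level_space_def conj_fn_def K1_mult dg_K1 conj_mat_mult[OF n0] conj_mat_K1 Kc_iff[THEN iffD1] conj_mat_Kc)
qed

text \<open>In the layer coordinate \<open>conj_mat\<close> divides by \<nu>; substituting \<nu> z
  pulls the factor c out of the kernel. For \<open>quad_char\<close> and a nonsquare \<nu> this
  factor is -1 and exchanges the eigenspaces.\<close>

lemma layer_conv_conj_fn:
  assumes F: "F \<in> level_space u l" and l: "l \<ge> 1" and \<nu>: "runit \<nu>" and h: "residue_invariant h" "\<And>z. z \<in> fpow v 0 \<Longrightarrow> h (\<nu> * z) = c * h z"
  shows "layer_conv l h (conj_fn \<nu> F) = c *\<^sub>C conj_fn \<nu> (layer_conv l h F)"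
proof
  fix g show "layer_conv l h (conj_fn \<nu> F) g = (c *\<^sub>C conj_fn \<nu> (layer_conv l h F)) g"
  proof (cases "g \<in> K1 v")
    case True
    let ?p = "\<pi> ^ (l - 1)"
    have n0: "\<nu> \<noteq> 0" using \<nu> runit_nz by blast
    have K: "conj_mat \<nu> g \<in> K1 v" using conj_mat_K1[OF \<nu> True] .
    have cn: "conj_mat \<nu> (nl y) = nl (y / \<nu>)" for y by (simp add: nl_def)
    have "layer_conv l h (conj_fn \<nu> F) g = (\<Sum>z\<in>reps. h z * F (nl (z * ?p / \<nu>) ** conj_mat \<nu> g))"
      using True by (simp add: layer_conv_def conj_fn_def fib_K1 reps_fpow conj_mat_mult[OF n0] cn)
    also have "\<dots> = (\<Sum>z\<in>reps. h (\<nu> * z) * F (nl (\<nu> * z * ?p / \<nu>) ** conj_mat \<nu> g))"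
    proof (rule sum_reps_scale[symmetric, OF _ \<nu>])
      have "residue_invariant (\<lambda>z. F (nl ((z / \<nu>) * ?p) ** conj_mat \<nu> g))"
        unfolding residue_invariant_def
      proof (intro ballI impI)
        fix x y assume "x \<in> fpow v 0" "y \<in> fpow v 0" "x - y \<in> fpow v 1"
        then have "x / \<nu> \<in> fpow v 0" "y / \<nu> \<in> fpow v 0" "x / \<nu> - y / \<nu> \<in> fpow v 1"
          using \<nu> by (auto simp: fpow_divide_unit simp flip: diff_divide_distrib)
        then show "F (nl ((x / \<nu>) * ?p) ** conj_mat \<nu> g) = F (nl ((y / \<nu>) * ?p) ** conj_mat \<nu> g)"
          by (rule pinvD[OF fib_residue_invariant[OF F l K]])
      qed
      then show "residue_invariant (\<lambda>z. h z * F (nl (z * ?p / \<nu>) ** conj_mat \<nu> g))" using residue_invariant_mult[OF h(1)] by simp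
    qed
    also have "\<dots> = c * (\<Sum>z\<in>reps. h z * F (nl (z * ?p) ** conj_mat \<nu> g))"
      using h(2) reps_fpow n0 by (simp add: sum_distrib_left mult.assoc)
    finally show ?thesis using True K by (simp add: conj_fn_def layer_conv_def)
  qed (simp add: layer_conv_def conj_fn_def)
qed

lemma conj_fn_half_layer:
  assumes F: "F \<in> half_layer u l \<sigma>" and l: "l \<ge> 1" and \<nu>: "runit \<nu>" "quad_char \<nu> = - 1" shows "conj_fn \<nu> F \<in> half_layer u l (- \<sigma>)"
proof -
  have Fm: "F \<in> level_space u l" using F by (simp add: half_layer_def new_layer_def)
  have "layer_conv l (\<lambda>_. 1) (conj_fn \<nu> F) = 1 *\<^sub>C conj_fn \<nu> (layer_conv l (\<lambda>_. 1) F)"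
    by (rule layer_conv_conj_fn[OF Fm l \<nu>(1)]) (auto simp: residue_invariant_def)
  moreover have "layer_conv_quad_char l (conj_fn \<nu> F) = (- 1) *\<^sub>C conj_fn \<nu> (layer_conv_quad_char l F)"
    using ext0_mult[OF unit_hom_quad_char _ \<nu>(1)] \<nu> by (intro layer_conv_conj_fn[OF Fm l \<nu>(1) residue_invariant_ext0[OF unit_hom_quad_char]]) simp
  moreover have "conj_fn \<nu> 0 = 0" "conj_fn \<nu> (\<sigma> *\<^sub>C F) = \<sigma> *\<^sub>C conj_fn \<nu> F" by (auto simp: conj_fn_def fun_eq_iff)
  ultimately show ?thesis using F conj_fn_level_space[OF Fm \<nu>(1)] by (simp add: half_layer_def new_layer_def scaleC_one)
qed

lemma conj_fn_conj_fn: "runit \<nu> \<Longrightarrow> (\<And>g. g \<notin> K1 v \<Longrightarrow> F g = 0) \<Longrightarrow> conj_fn \<nu> (conj_fn (inverse \<nu>) F) = F"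
proof
  fix g :: "'a^2^2" assume a: "runit \<nu>" "\<And>g. g \<notin> K1 v \<Longrightarrow> F g = 0"
  have "conj_mat (inverse \<nu>) (conj_mat \<nu> g) = g" using runit_nz[OF a(1)] by (cases rule: mat2_cases[of g]) simp
  then show "conj_fn \<nu> (conj_fn (inverse \<nu>) F) g = F g" using a conj_mat_K1[of \<nu> g] by (auto simp: conj_fn_def)
qed

lemma bij_conj_fn: assumes l: "l \<ge> 1" and \<nu>: "runit \<nu>" "quad_char \<nu> = - 1" shows "bij_betw (conj_fn \<nu>) (half_layer u l \<sigma>) (half_layer u l (- \<sigma>))"
proof -
  have \<nu>': "runit (inverse \<nu>)" "quad_char (inverse \<nu>) = - 1"
    using \<nu> runit_inverse unit_hom_inverse[OF unit_hom_quad_char \<nu>(1)] by auto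
  have s: "F g = 0" if "F \<in> half_layer u l \<tau>" "g \<notin> K1 v" for F \<tau> g using that mpsD(1) by (auto simp: half_layer_def new_layer_def)
  show ?thesis
    by (rule bij_betwI[where g = "conj_fn (inverse \<nu>)"])
      (use conj_fn_half_layer[OF _ l \<nu>] conj_fn_half_layer[OF _ l \<nu>', of _ u "- \<sigma>"] conj_fn_conj_fn[OF \<nu>(1)] conj_fn_conj_fn[OF \<nu>'(1)] s in auto)
qed

subsection \<open>The intertwining operator of depth zero\<close>

definition intertwine :: "('a^2^2 \<Rightarrow> complex) \<Rightarrow> 'a^2^2 \<Rightarrow> complex" where
  "intertwine F = (\<lambda>g. if g \<in> K1 v then \<Sum>z\<in>reps. F (weyl ** nu z ** g) else 0)"

lemma equivariant_intertwine: "equivariant M intertwine"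
  unfolding equivariant_def
  by (auto simp: intertwine_def fun_eq_iff Rt_def sum.distrib sum_distrib_left K1_mult reps_fpow matrix_mul_assoc
      intro!: sum.cong)

lemma nu_add: "nu x ** nu y = nu (x + y)" by (simp add: nu_def add.commute)

lemma intertwine_residue_invariant: assumes F: "F \<in> level_space u 1" and g: "g \<in> K1 v" shows "residue_invariant (\<lambda>z. F (weyl ** nu z ** g))"
  unfolding residue_invariant_def
proof (intro ballI impI)
  fix x y assume xy: "x \<in> fpow v 0" "y \<in> fpow v 0" "x - y \<in> fpow v 1"
  then have "gcong 1 (nu x) (nu y)" by (simp add: nu_def gcong_mat2)
  then show "F (weyl ** nu x ** g) = F (weyl ** nu y ** g)"
    using xy g by (intro level_space_gcong[OF F]) (auto intro!: K1_mult gcong_mult)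
qed

lemma intertwine_level_space:
  assumes F: "F \<in> level_space u 1" and u: "unit_hom u 1" and u': "\<And>t. runit t \<Longrightarrow> u' t = inverse (u t)"
  shows "intertwine F \<in> level_space u' 1"
proof -
  have A: "intertwine F (nu x ** g) = intertwine F g" if g: "g \<in> K1 v" and x: "x \<in> fpow v 0" for g x
  proof -
    have "intertwine F (nu x ** g) = (\<Sum>z\<in>reps. F (weyl ** nu (z + x) ** g))"
      using g x by (simp add: intertwine_def K1_mult flip: nu_add) (simp add: matrix_mul_assoc)
    then show ?thesis using sum_reps_shift[OF intertwine_residue_invariant[OF F g] x] g by (simp add: intertwine_def)
  qed
  have B: "intertwine F (dg t ** g) = u' t * intertwine F g" if g: "g \<in> K1 v" and t: "runit t" for g t
  proof -
    define s where "s = inverse (t * t)"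
    have s: "runit s" using t by (simp add: s_def runit_mult runit_inverse)
    have e: "weyl ** nu z ** dg t = dg (inverse t) ** (weyl ** nu (s * z))" for z
      using runit_nz[OF t] by (simp add: weyl_def nu_def dg_mat2 s_def field_simps)
    have "F (weyl ** nu z ** (dg t ** g)) = inverse (u t) * F (weyl ** nu (s * z) ** g)" if z: "z \<in> reps" for z
    proof -
      have "weyl ** nu (s * z) ** g \<in> K1 v" using g s reps_fpow[OF z] by (simp add: K1_mult fpow_unit_cancel)
      from mpsD(3)[OF F this runit_inverse[OF t]]
      have "F (dg (inverse t) ** (weyl ** nu (s * z)) ** g) = inverse (u t) * F (weyl ** nu (s * z) ** g)"
        using unit_hom_inverse[OF u t] by (simp add: matrix_mul_assoc)
      moreover have "weyl ** nu z ** (dg t ** g) = dg (inverse t) ** (weyl ** nu (s * z)) ** g"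
        unfolding e[symmetric] by (simp add: matrix_mul_assoc)
      ultimately show ?thesis by simp
    qed
    then have "intertwine F (dg t ** g) = inverse (u t) * (\<Sum>z\<in>reps. F (weyl ** nu (s * z) ** g))"
      using g t by (simp add: intertwine_def K1_mult dg_K1 sum_distrib_left)
    then show ?thesis using sum_reps_scale[OF intertwine_residue_invariant[OF F g] s] g u'[OF t] by (simp add: intertwine_def)
  qed
  have C: "intertwine F (g ** k) = intertwine F g" if g: "g \<in> K1 v" and k: "k \<in> Kc v 1" for g k
  proof -
    have "F (weyl ** nu z ** (g ** k)) = F (weyl ** nu z ** g)" if "z \<in> reps" for z
      using mpsD(4)[OF F _ k, of "weyl ** nu z ** g"] reps_fpow[OF that] g by (simp add: matrix_mul_assoc K1_mult)
    then show ?thesis using g k by (simp add: intertwine_def K1_mult Kc_iff)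
  qed
  show ?thesis using A B C by (auto simp: level_space_def) (simp add: intertwine_def)
qed

text \<open>The linear coefficient of the quadratic relation for \<open>intertwine\<close>: a sum
  over residue units that is 0 for nontrivial \<open>u\<close> and q - 1 for trivial
  \<open>u\<close>.\<close>

definition intertwine_const :: "('a \<Rightarrow> complex) \<Rightarrow> complex" where
  "intertwine_const u = (\<Sum>z\<in>reps. ext0 (\<lambda>z. u (- inverse z)) z)"

text \<open>The quadratic relation of the Hecke algebra of SL2 over the residue field. The nonunit
  class of the variable w next to the first Weyl element gives q copies of \<open>u (- 1)\<close>
  times F; each unit class gives one multiple of \<open>intertwine F\<close>.\<close>

lemma intertwine_intertwine:
  assumes F: "F \<in> level_space u 1" and u: "unit_hom u 1"
  shows "intertwine (intertwine F) = (qc * u (- 1)) *\<^sub>C F + intertwine_const u *\<^sub>C intertwine F"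
proof
  fix g show "intertwine (intertwine F) g = ((qc * u (- 1)) *\<^sub>C F + intertwine_const u *\<^sub>C intertwine F) g"
  proof (cases "g \<in> K1 v")
    case g: True
    have inner: "(\<Sum>z\<in>reps. F (weyl ** nu w ** (weyl ** nu z ** g))) =
        (if runit w then u (- inverse w) * intertwine F g else 0) + (if runit w then 0 else qc * u (- 1) * F g)" if w: "w \<in> reps" for w
    proof (cases "runit w")
      case True
      have io: "- inverse w \<in> fpow v 0" "- inverse w \<noteq> 0" using True runit_inverse[OF True] by (auto simp: runit_fpow runit_nz)
      \<comment> \<open>For a unit w this product lies in the big cell again. The unipotent factor
        on its right merely shifts the variable z.\<close>
      have e: "weyl ** nu w ** weyl = nu (- inverse w) ** (dg (- inverse w) ** (weyl ** nu (- inverse w)))"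
        using runit_nz[OF True] by (simp add: weyl_def nu_def dg_mat2)
      have "F (weyl ** nu w ** (weyl ** nu z ** g)) = u (- inverse w) * F (weyl ** nu (z + - inverse w) ** g)" if z: "z \<in> reps" for z
      proof -
        have K: "weyl ** nu (z + - inverse w) ** g \<in> K1 v" using g io reps_fpow[OF z] by (intro K1_mult) (auto intro: fpow_diff)
        have "weyl ** nu w ** (weyl ** nu z ** g) = weyl ** nu w ** weyl ** nu z ** g" by (simp add: matrix_mul_assoc)
        also have "\<dots> = nu (- inverse w) ** (dg (- inverse w) ** (weyl ** (nu (- inverse w) ** nu z) ** g))"
          unfolding e by (simp add: matrix_mul_assoc)
        also have "nu (- inverse w) ** nu z = nu (z + - inverse w)" by (simp add: nu_add)
        finally show ?thesis using K io True by (simp add: mpsD(2,3)[OF F] K1_mult dg_K1 runit_inverse)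
      qed
      then have "(\<Sum>z\<in>reps. F (weyl ** nu w ** (weyl ** nu z ** g))) =
          u (- inverse w) * (\<Sum>z\<in>reps. F (weyl ** nu (z + - inverse w) ** g))" by (simp add: sum_distrib_left)
      also have "(\<Sum>z\<in>reps. F (weyl ** nu (z + - inverse w) ** g)) = intertwine F g"
        using sum_reps_shift[OF intertwine_residue_invariant[OF F g] io(1)] g by (simp add: intertwine_def)
      finally show ?thesis using True by simp
    next
      case False
      have "F (weyl ** nu w ** (weyl ** nu z ** g)) = u (- 1) * F g" if z: "z \<in> reps" for z
      proof -
        have K: "weyl ** nu z ** g \<in> K1 v" using g reps_fpow[OF z] by (simp add: K1_mult)
        have "F (weyl ** nu w ** (weyl ** nu z ** g)) = F (weyl ** nu 0 ** (weyl ** nu z ** g))"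
          using pinvD[OF intertwine_residue_invariant[OF F K], of w 0] reps_fpow[OF w] False by (simp add: runit_iff)
        also have "weyl ** nu 0 ** (weyl ** nu z ** g) = dg (- 1) ** (nu z ** g)"
        proof -
          have "weyl ** nu 0 ** weyl = dg (-1)" by (simp add: weyl_def nu_def dg_mat2)
          then show ?thesis by (metis matrix_mul_assoc)
        qed
        also have "F \<dots> = u (- 1) * F g" using g reps_fpow[OF z] by (simp add: mpsD(2,3)[OF F] K1_mult)
        finally show ?thesis .
      qed
      then show ?thesis using False by (simp add: card_reps)
    qed
    have "intertwine (intertwine F) g = (\<Sum>z\<in>reps. \<Sum>w\<in>reps. F (weyl ** nu w ** (weyl ** nu z ** g)))"
      using g by (simp add: intertwine_def K1_mult reps_fpow)
    also have "\<dots> = (\<Sum>w\<in>reps. \<Sum>z\<in>reps. F (weyl ** nu w ** (weyl ** nu z ** g)))" by (rule sum.swap)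
    also have "\<dots> = (\<Sum>w\<in>reps. (if runit w then u (- inverse w) * intertwine F g else 0) + (if runit w then 0 else qc * u (- 1) * F g))"
      using inner by simp
    also have "\<dots> = (\<Sum>w\<in>reps. ext0 (\<lambda>z. u (- inverse z)) w * intertwine F g) + qc * u (- 1) * F g"
      unfolding sum.distrib by (subst sum_nonunits) (auto simp: residue_invariant_def ext0_def intro!: sum.cong)
    finally show ?thesis by (simp add: intertwine_const_def flip: sum_distrib_right)
  qed (use mpsD(1)[OF F] in \<open>simp add: intertwine_def\<close>)
qed

lemma unit_hom_inv: "unit_hom u l \<Longrightarrow> unit_hom (\<lambda>t. inverse (u t)) l" by (simp add: unit_hom_def)

lemma intertwine_const_nontrivial: assumes u: "unit_hom u 1" and a: "runit a" "u a \<noteq> 1" shows "intertwine_const u = 0"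
proof -
  have "ext0 (\<lambda>z. u (- inverse z)) z = u (- 1) * ext0 (\<lambda>t. inverse (u t)) z" for z
  proof (cases "runit z")
    case True
    then have "u (- inverse z) = u (- 1) * inverse (u z)"
      using unit_hom_mult[OF u, of "-1" "inverse z"] unit_hom_inverse[OF u True] by (simp add: runit_inverse)
    then show ?thesis by (simp add: ext0_def)
  qed (simp add: ext0_def)
  then show ?thesis using sum_ext0[OF unit_hom_inv[OF u] a(1)] a by (simp add: intertwine_const_def flip: sum_distrib_left)
qed

text \<open>For a nontrivial character the linear term of the relation drops out, so the operators
  in the two directions are inverse up to the scalar q times \<open>u (- 1)\<close>.\<close>

lemma intertwine_iso:
  assumes u: "unit_hom u 1" "unit_hom u' 1" and inv: "\<And>t. runit t \<Longrightarrow> u' t = inverse (u t)" and a: "runit a" "u a \<noteq> 1"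
  shows "bij_betw intertwine (level_space u 1) (level_space u' 1)"
proof -
  have inv': "u t = inverse (u' t)" if "runit t" for t using inv[OF that] by simp
  have a': "u' a \<noteq> 1" using a inv by (metis inverse_eq_1_iff)
  define k where "k = qc * u (- 1)"
  have k0: "k \<noteq> 0" using qc_nz unit_hom_nz[OF u(1), of "-1"] by (simp add: k_def)
  have e: "u' (- 1) = u (- 1)"
    using inv[of "-1"] unit_hom_mult[OF u(1), of "-1" "-1"] unit_hom_one[OF u(1)] by simp (metis inverse_unique)
  have t1: "intertwine (intertwine F) = k *\<^sub>C F" if "F \<in> level_space u 1" for F
    using intertwine_intertwine[OF that u(1)] intertwine_const_nontrivial[OF u(1) a] by (simp add: k_def)
  have t2: "intertwine (intertwine F) = k *\<^sub>C F" if "F \<in> level_space u' 1" for F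
    using intertwine_intertwine[OF that u(2)] intertwine_const_nontrivial[OF u(2) a(1) a'] by (simp add: k_def e)
  show ?thesis
  proof (rule bij_betwI[where g = "\<lambda>F. inverse k *\<^sub>C intertwine F"])
    show "intertwine \<in> level_space u 1 \<rightarrow> level_space u' 1" using intertwine_level_space[OF _ u(1) inv] by blast
    show "(\<lambda>F. inverse k *\<^sub>C intertwine F) \<in> level_space u' 1 \<rightarrow> level_space u 1" using intertwine_level_space[OF _ u(2) inv'] stab_scale[OF stab_level_space] by blast
    show "inverse k *\<^sub>C intertwine (intertwine F) = F" if "F \<in> level_space u 1" for F
      by (simp only: t1[OF that] scaleC_scaleC left_inverse[OF k0] scaleC_one)
    show "intertwine (inverse k *\<^sub>C intertwine F) = F" if "F \<in> level_space u' 1" for F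
      by (simp only: equivariant_scale[OF equivariant_intertwine UNIV_I] t2[OF that] scaleC_scaleC left_inverse[OF k0] scaleC_one)
  qed
qed

definition intertwine_eigen :: "('a \<Rightarrow> complex) \<Rightarrow> complex \<Rightarrow> ('a^2^2 \<Rightarrow> complex) set" where
  "intertwine_eigen u \<alpha> = {F \<in> level_space u 1. intertwine F = \<alpha> *\<^sub>C F}"

lemma stab_intertwine_eigen: "stab (intertwine_eigen u \<alpha>)"
  unfolding intertwine_eigen_def by (rule equivariant_kernel_stab[OF stab_level_space equivariant_intertwine])

text \<open>For a Borel eigenvector D the value of \<open>intertwine D\<close> at the identity is q
  times \<open>D weyl\<close>. On an eigenspace \<open>D (mat 1) = 0\<close> therefore forces
  \<open>D weyl = 0\<close>, which restores the uniqueness that fails on the whole space. The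
  projection is the spectral one, (T - \<beta>)/(\<alpha> - \<beta>).\<close>

lemma irr_intertwine_eigen:
  assumes u: "unit_hom u 1" and uq: "\<And>t. runit t \<Longrightarrow> u t * u t = 1"
    and \<alpha>: "\<alpha> + \<beta> = intertwine_const u" "\<alpha> * \<beta> = - (qc * u (- 1))" "\<alpha> \<noteq> \<beta>"
  shows "irr_model (intertwine_eigen u \<alpha>)"
    "F \<in> level_space u 1 \<Longrightarrow> inverse (\<alpha> - \<beta>) *\<^sub>C intertwine F + (- \<beta> * inverse (\<alpha> - \<beta>)) *\<^sub>C F \<in> intertwine_eigen u \<alpha>"
proof -
  let ?pr = "\<lambda>F. inverse (\<alpha> - \<beta>) *\<^sub>C intertwine F + (- \<beta> * inverse (\<alpha> - \<beta>)) *\<^sub>C F"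
  have ui: "u t = inverse (u t)" if "runit t" for t using uq[OF that] inverse_unique[of "u t" "u t"] by simp
  have prE: "equivariant M ?pr" for M
    by (rule equivariant_subset) (intro equivariant_lin equivariant_intertwine equivariant_id)
  show pr: "?pr F \<in> intertwine_eigen u \<alpha>" if F: "F \<in> level_space u 1" for F
  proof -
    have "?pr F \<in> level_space u 1" using F intertwine_level_space[OF F u ui] by (intro stab_add[OF stab_level_space] stab_scale[OF stab_level_space])
    moreover have "intertwine (?pr F) = \<alpha> *\<^sub>C ?pr F"
    proof
      fix g
      have "intertwine (?pr F) g = (inverse (\<alpha> - \<beta>) *\<^sub>C intertwine (intertwine F) + (- \<beta> * inverse (\<alpha> - \<beta>)) *\<^sub>C intertwine F) g"
        by (simp only: equivariant_add[OF equivariant_intertwine UNIV_I UNIV_I] equivariant_scale[OF equivariant_intertwine UNIV_I])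
      also have "\<dots> = inverse (\<alpha> - \<beta>) * (- (\<alpha> * \<beta>) * F g + (\<alpha> + \<beta>) * intertwine F g) - \<beta> * inverse (\<alpha> - \<beta>) * intertwine F g"
        using intertwine_intertwine[OF F u] \<alpha> by simp
      also have "\<dots> = (\<alpha> *\<^sub>C ?pr F) g" by (simp add: algebra_simps)
      finally show "intertwine (?pr F) g = (\<alpha> *\<^sub>C ?pr F) g" .
    qed
    ultimately show ?thesis by (simp add: intertwine_eigen_def)
  qed
  have pc: "primitive_hom u 1" using u by (simp add: primitive_hom_def)
  have star: "D = 0" if D: "D \<in> intertwine_eigen u \<alpha>" "borel_eigen u D" "D (mat 1) = 0" for D
  proof -
    have Dm: "D \<in> level_space u 1" and e: "intertwine D = \<alpha> *\<^sub>C D" using D by (auto simp: intertwine_eigen_def)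
    have "intertwine D (mat 1) = qc * D weyl"
      using borel_eigen_nu[OF D(2) weyl_K1] reps_fpow by (simp add: intertwine_def K1_one card_reps)
    then have "D weyl = 0" using e D qc_nz by simp
    then show ?thesis using level_space_borel_eigen_zero[OF pc Dm _ D(2)] D by simp
  qed
  have d: "delta_fn u 1 \<in> level_space u 1" using delta_fn_level_space[OF u] by simp
  \<comment> \<open>Tested at the Weyl element, where \<open>delta_fn\<close> vanishes while its
    image under \<open>intertwine\<close> is the nonzero number \<open>u (- 1)\<close>.\<close>
  have "?pr (delta_fn u 1) weyl \<noteq> 0"
  proof -
    have m1: "(1::'a) \<notin> fpow v 1" using runit_one runit_iff by blast
    have "delta_fn u 1 (weyl ** nu z ** weyl) = (if runit z then 0 else u (- 1))" if z: "z \<in> reps" for z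
      using reps_fpow[OF z] K1_mult[OF K1_mult[OF weyl_K1, of "nu z"] weyl_K1]
      by (simp add: delta_fn_def runit_iff) (simp add: weyl_def nu_def)
    then have "intertwine (delta_fn u 1) weyl = u (- 1)"
      using sum_nonunits[of "\<lambda>_. u (- 1)"] by (simp add: intertwine_def residue_invariant_def)
    moreover have "delta_fn u 1 weyl = 0" using m1 by (simp add: delta_fn_def) (simp add: weyl_def)
    ultimately show ?thesis using unit_hom_nz[OF u, of "-1"] \<alpha> by simp
  qed
  then have "?pr (delta_fn u 1) \<noteq> 0" by (metis zero_fun_apply)
  then have "intertwine_eigen u \<alpha> \<noteq> {0}" using pr[OF d] by blast
  moreover have "?pr F = F" if "F \<in> intertwine_eigen u \<alpha>" for F
  proof
    fix g
    have "?pr F g = inverse (\<alpha> - \<beta>) * (\<alpha> * F g) - \<beta> * inverse (\<alpha> - \<beta>) * F g" using that by (simp add: intertwine_eigen_def)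
    also have "\<dots> = (inverse (\<alpha> - \<beta>) * (\<alpha> - \<beta>)) * F g" by (simp add: algebra_simps)
    finally show "?pr F g = F g" using \<alpha>(3) by simp
  qed
  ultimately show "irr_model (intertwine_eigen u \<alpha>)"
    using pr star by (intro irreducibility_criterion[OF u _ prE]) (auto simp: stab_intertwine_eigen, auto simp: intertwine_eigen_def)
qed

text \<open>For a nontrivial quadratic \<open>u\<close> the roots are the two square roots of q
  times \<open>u (- 1)\<close>. For trivial \<open>u\<close> they are q and -1, belonging to the
  constants and to the Steinberg part.\<close>

lemma quadratic_decomp:
  assumes u: "unit_hom u 1" and uq: "\<And>t. runit t \<Longrightarrow> u t * u t = 1"
  shows "\<exists>P Q. irr_model P \<and> irr_model Q \<and> P \<subseteq> level_space u 1 \<and> Q \<subseteq> level_space u 1 \<and> P \<inter> Q = {0} \<and>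
    (\<forall>F\<in>level_space u 1. \<exists>A\<in>P. \<exists>B\<in>Q. F = A + B)"
proof -
  have "\<exists>\<alpha> \<beta>. \<alpha> + \<beta> = intertwine_const u \<and> \<alpha> * \<beta> = - (qc * u (- 1)) \<and> \<alpha> \<noteq> \<beta>"
  proof (cases "\<exists>a. runit a \<and> u a \<noteq> 1")
    case True
    define s where "s = csqrt (qc * u (- 1))"
    have s: "s * s = qc * u (- 1)" using power2_csqrt[of "qc * u (- 1)"] by (simp add: s_def power2_eq_square)
    have "s \<noteq> 0" using s qc_nz unit_hom_nz[OF u, of "-1"] by auto
    then have "s \<noteq> - s" by simp
    then show ?thesis using True intertwine_const_nontrivial[OF u] s by (intro exI[of _ s] exI[of _ "- s"]) auto
  next
    case False
    then have u1: "u t = 1" if "runit t" for t using that by blast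
    have "ext0 (\<lambda>z. u (- inverse z)) z = (if runit z then 1 else 0)" for z
      using u1[of "- inverse z"] by (simp add: ext0_def runit_inverse)
    then have "intertwine_const u = qc - 1" by (simp add: intertwine_const_def sum_units)
    moreover have "qc \<noteq> - 1" by (metis of_nat_0_le_iff add_eq_0_iff of_nat_Suc of_nat_eq_0_iff nat.distinct(1) add.commute)
    ultimately show ?thesis using u1[of "-1"] by (intro exI[of _ qc] exI[of _ "-1"]) auto
  qed
  then obtain \<alpha> \<beta> where \<alpha>: "\<alpha> + \<beta> = intertwine_const u" "\<alpha> * \<beta> = - (qc * u (- 1))" "\<alpha> \<noteq> \<beta>" by blast
  have \<beta>: "\<beta> + \<alpha> = intertwine_const u" "\<beta> * \<alpha> = - (qc * u (- 1))" "\<beta> \<noteq> \<alpha>" using \<alpha> by (auto simp: ac_simps)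
  note A = irr_intertwine_eigen[OF u uq \<alpha>] and B = irr_intertwine_eigen[OF u uq \<beta>]
  show ?thesis
  proof (intro exI conjI ballI)
    show "irr_model (intertwine_eigen u \<alpha>)" "irr_model (intertwine_eigen u \<beta>)" using A(1) B(1) by auto
    show "intertwine_eigen u \<alpha> \<inter> intertwine_eigen u \<beta> = {0}"
    proof -
      have "F = 0" if "F \<in> intertwine_eigen u \<alpha>" "F \<in> intertwine_eigen u \<beta>" for F
      proof -
        have "\<alpha> *\<^sub>C F = \<beta> *\<^sub>C F" using that by (simp add: intertwine_eigen_def)
        then show ?thesis using \<alpha>(3) by (auto simp: fun_eq_iff)
      qed
      then show ?thesis using stab_0[OF stab_intertwine_eigen] by blast
    qed
    fix F assume F: "F \<in> level_space u 1"
    have "F = (inverse (\<alpha> - \<beta>) *\<^sub>C intertwine F + (- \<beta> * inverse (\<alpha> - \<beta>)) *\<^sub>C F) +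
        (inverse (\<beta> - \<alpha>) *\<^sub>C intertwine F + (- \<alpha> * inverse (\<beta> - \<alpha>)) *\<^sub>C F)"
    proof
      fix g
      have i: "inverse (\<beta> - \<alpha>) = - inverse (\<alpha> - \<beta>)" by (metis inverse_minus_eq minus_diff_eq)
      have "(\<alpha> - \<beta>) * inverse (\<alpha> - \<beta>) = 1" using \<alpha>(3) by simp
      then have "F g = (\<alpha> - \<beta>) * inverse (\<alpha> - \<beta>) * F g" by simp
      also have "\<dots> = ((inverse (\<alpha> - \<beta>) *\<^sub>C intertwine F + (- \<beta> * inverse (\<alpha> - \<beta>)) *\<^sub>C F) +
        (inverse (\<beta> - \<alpha>) *\<^sub>C intertwine F + (- \<alpha> * inverse (\<beta> - \<alpha>)) *\<^sub>C F)) g"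
        unfolding i by (simp add: algebra_simps)
      finally show "F g = \<dots>" .
    qed
    then show "\<exists>A\<in>intertwine_eigen u \<alpha>. \<exists>B\<in>intertwine_eigen u \<beta>. F = A + B" using A(2)[OF _ F] B(2)[OF _ F] by blast
  qed (auto simp: intertwine_eigen_def)
qed

end

subsection \<open>Homomorphisms of representations\<close>

definition rep_hom ::
  "('g, 'm) monoid_scheme \<Rightarrow> ('g, 'v::complex_vector) rep \<Rightarrow> ('g, 'w::complex_vector) rep \<Rightarrow> ('v \<Rightarrow> 'w) \<Rightarrow> bool" where
  "rep_hom G R S \<phi> \<longleftrightarrow> (\<forall>x\<in>rspace R. \<phi> x \<in> rspace S) \<and>
     (\<forall>x\<in>rspace R. \<forall>y\<in>rspace R. \<phi> (x + y) = \<phi> x + \<phi> y) \<and>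
     (\<forall>c. \<forall>x\<in>rspace R. \<phi> (c *\<^sub>C x) = c *\<^sub>C \<phi> x) \<and>
     (\<forall>g\<in>carrier G. \<forall>x\<in>rspace R. \<phi> (ract R g x) = ract S g (\<phi> x))"

text \<open>The fragment of \<open>representation\<close> that \<open>rep_iso_via\<close> consumes;
  it passes easily through sums. The last clause keeps supports finite in
  \<open>rep_dsum\<close>.\<close>

definition rep_closed :: "('g, 'm) monoid_scheme \<Rightarrow> ('g, 'v::complex_vector) rep \<Rightarrow> bool" where
  "rep_closed G R \<longleftrightarrow> complex_vector.subspace (rspace R) \<and> (\<forall>g\<in>carrier G. \<forall>x\<in>rspace R. ract R g x \<in> rspace R) \<and>
     (\<forall>g\<in>carrier G. ract R g 0 = 0)"

lemma rep_closed_sum: "rep_closed G R \<Longrightarrow> rep_closed G S \<Longrightarrow> rep_closed G (R \<oplus>\<^sub>R S)"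
  unfolding rep_closed_def rep_sum_def complex_vector.subspace_def
  by (auto simp: scaleC_prod_def zero_prod_def)

lemma rep_closed_dsum:
  assumes R: "\<And>i. i \<in> I \<Longrightarrow> rep_closed G (R i)" shows "rep_closed G (rep_dsum I R)"
proof -
  have s: "0 \<in> rspace (R i)" "x \<in> rspace (R i) \<Longrightarrow> y \<in> rspace (R i) \<Longrightarrow> x + y \<in> rspace (R i)"
    "x \<in> rspace (R i) \<Longrightarrow> c *\<^sub>C x \<in> rspace (R i)"
    "g \<in> carrier G \<Longrightarrow> x \<in> rspace (R i) \<Longrightarrow> ract (R i) g x \<in> rspace (R i)"
    "g \<in> carrier G \<Longrightarrow> ract (R i) g 0 = 0" if "i \<in> I" for i x y c g
    using R[OF that] by (auto simp: rep_closed_def complex_vector.subspace_def)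
  have fin: "finite {i. h i \<noteq> 0}" if "finite {i. f i \<noteq> 0}" "finite {i. f' i \<noteq> 0}" "\<And>i. f i = 0 \<Longrightarrow> f' i = 0 \<Longrightarrow> h i = 0"
    for f f' h :: "'a \<Rightarrow> 'd"
    by (rule finite_subset[of _ "{i. f i \<noteq> 0} \<union> {i. f' i \<noteq> 0}"]) (use that in auto)
  have mem: "x \<in> rspace (rep_dsum I R) \<longleftrightarrow>
      (\<forall>i\<in>I. x i \<in> rspace (R i)) \<and> (\<forall>i. i \<notin> I \<longrightarrow> x i = 0) \<and> finite {i. x i \<noteq> 0}" for x
    by (simp add: rep_dsum_def)
  have act: "ract (rep_dsum I R) g x = (\<lambda>i. if i \<in> I then ract (R i) g (x i) else 0)" for g x
    by (simp add: rep_dsum_def)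
  show ?thesis
    unfolding rep_closed_def complex_vector.subspace_def
  proof (intro conjI ballI allI)
    show "0 \<in> rspace (rep_dsum I R)" by (simp add: mem s)
  next
    fix x y assume xy: "x \<in> rspace (rep_dsum I R)" "y \<in> rspace (rep_dsum I R)"
    then have "finite {i. x i \<noteq> 0}" "finite {i. y i \<noteq> 0}" unfolding mem by blast+
    then have "finite {i. x i + y i \<noteq> 0}" by (rule fin) simp
    then show "x + y \<in> rspace (rep_dsum I R)" using xy by (auto simp: mem s)
  next
    fix c x assume x: "x \<in> rspace (rep_dsum I R)"
    then have fx: "finite {i. x i \<noteq> 0}" unfolding mem by blast
    have "finite {i. c *\<^sub>C x i \<noteq> 0}" by (rule fin[OF fx fx]) simp
    then show "c *\<^sub>C x \<in> rspace (rep_dsum I R)" using x by (auto simp: mem s scaleC_fun_def)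
  next
    fix g x assume g: "g \<in> carrier G" and x: "x \<in> rspace (rep_dsum I R)"
    from x have fx: "finite {i. x i \<noteq> 0}" unfolding mem by blast
    have "finite {i. (if i \<in> I then ract (R i) g (x i) else 0) \<noteq> 0}"
      by (rule fin[OF fx fx]) (simp add: s g)
    then show "ract (rep_dsum I R) g x \<in> rspace (rep_dsum I R)" using x g unfolding mem act by (simp add: s)
  next
    show "ract (rep_dsum I R) g 0 = 0" if "g \<in> carrier G" for g
      unfolding act by (simp add: fun_eq_iff s that)
  qed
qed

lemma rep_isoI: "bij_betw \<phi> (rspace R) (rspace S) \<Longrightarrow> rep_hom G R S \<phi> \<Longrightarrow> rep_iso G R S"
  unfolding rep_iso_def rep_hom_def by blast

text \<open>One homomorphism is followed by the inverse of another with the same target. Injectivity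
  of \<open>\<phi>\<close> turns each law for the inverse into an equation in \<open>S\<close>, so
  no formula for the inverse is required.\<close>

lemma rep_iso_via:
  assumes \<psi>: "bij_betw \<psi> (rspace R) (rspace S)" "rep_hom G R S \<psi>" and R: "rep_closed G R"
    and \<phi>: "bij_betw \<phi> (rspace Q) (rspace S)" "rep_hom G Q S \<phi>" and Q: "rep_closed G Q"
  shows "rep_iso G R Q"
proof -
  define \<theta> where "\<theta> x = inv_into (rspace Q) \<phi> (\<psi> x)" for x
  have \<theta>: "\<theta> x \<in> rspace Q" "\<phi> (\<theta> x) = \<psi> x" if "x \<in> rspace R" for x
    using that bij_betw_apply[OF \<psi>(1) that] bij_betw_imp_surj_on[OF \<phi>(1)]
    by (auto simp: \<theta>_def inv_into_into f_inv_into_f)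
  have eq: "\<theta> x = y" if "x \<in> rspace R" "y \<in> rspace Q" "\<phi> y = \<psi> x" for x y
    using that \<theta> bij_betw_imp_inj_on[OF \<phi>(1)] by (metis inj_onD)
  have bij: "bij_betw \<theta> (rspace R) (rspace Q)"
    using bij_betw_trans[OF \<psi>(1) bij_betw_inv_into[OF \<phi>(1)]] by (simp add: \<theta>_def[abs_def] comp_def)
  have "rep_hom G R Q \<theta>"
    using \<psi>(2) \<phi>(2) R Q \<theta> unfolding rep_hom_def rep_closed_def complex_vector.subspace_def
    by (auto intro!: eq)
  then show ?thesis by (rule rep_isoI[OF bij])
qed

lemma dim_linear_image:
  fixes f :: "'v::complex_vector \<Rightarrow> 'w::complex_vector"
  assumes f: "\<And>x y. f (x + y) = f x + f y" "\<And>c x. f (c *\<^sub>C x) = c *\<^sub>C f x"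
    and V: "complex_vector.subspace V" "inj_on f V"
  shows "complex_vector.dim (f ` V) = complex_vector.dim V"
proof -
  interpret L: Vector_Spaces.linear "(*\<^sub>C) :: complex \<Rightarrow> 'v \<Rightarrow> 'v" "(*\<^sub>C) :: complex \<Rightarrow> 'w \<Rightarrow> 'w" f
    by unfold_locales (use f in auto)
  obtain B where B: "B \<subseteq> V" "complex_vector.independent B" "V \<subseteq> complex_vector.span B" "card B = complex_vector.dim V"
    using complex_vector.basis_exists by blast
  have sB: "complex_vector.span B = V" using B V complex_vector.span_minimal by blast
  have iB: "complex_vector.independent (f ` B)" using B V sB by (intro L.independent_injective_image) auto
  have "f ` V = complex_vector.span (f ` B)" using L.span_image sB by blast
  then have "complex_vector.dim (f ` V) = card (f ` B)" using complex_vector.dim_eq_card[OF _ iB, of "f ` V"]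
    by (simp add: complex_vector.span_span)
  also have "\<dots> = card B" using card_image inj_on_subset[OF V(2) B(1)] by blast
  finally show ?thesis using B by simp
qed

section \<open>Multiplication in the cover\<close>

context tame_field
begin

text \<open>The product of \<open>tilde v n H\<close> does not involve \<open>H\<close>; a name
  without it lets the covers of different subgroups share all rules.\<close>

definition cov_mult :: "'a cov \<Rightarrow> 'a cov \<Rightarrow> 'a cov" where
  "cov_mult x y = (fst x ** fst y, coc (fst x) (fst y) * snd x * snd y)"

lemma tilde_mult [simp]: "x \<otimes>\<^bsub>tilde v n H\<^esub> y = cov_mult x y"
  by (simp add: tilde_def cov_mult_def split: prod.splits)

lemma tilde_carrier [simp]: "carrier (tilde v n H) = H \<times> mu n" by (simp add: tilde_def)
lemma tilde_one [simp]: "\<one>\<^bsub>tilde v n H\<^esub> = (mat 1, 1)" by (simp add: tilde_def)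

lemma coc_mu: "g \<in> SL2 \<Longrightarrow> h \<in> SL2 \<Longrightarrow> coc g h \<in> mu n"
  unfolding cocycle_def by (intro hil(1)) (auto simp: Xf_nz SL2_mult)

lemma cov_mult_SL2: "x \<in> SL2 \<times> mu n \<Longrightarrow> y \<in> SL2 \<times> mu n \<Longrightarrow> cov_mult x y \<in> SL2 \<times> mu n"
  using SL2_mult coc_mu mu_mult by (auto simp: cov_mult_def)

lemma cov_mult_assoc: "x \<in> SL2 \<times> mu n \<Longrightarrow> y \<in> SL2 \<times> mu n \<Longrightarrow> z \<in> SL2 \<times> mu n \<Longrightarrow> cov_mult (cov_mult x y) z = cov_mult x (cov_mult y z)"
proof -
  assume a: "x \<in> SL2 \<times> mu n" "y \<in> SL2 \<times> mu n" "z \<in> SL2 \<times> mu n"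
  then have "coc (fst x) (fst y) * coc (fst x ** fst y) (fst z) = coc (fst x) (fst y ** fst z) * coc (fst y) (fst z)"
    by (intro cocycle_identity) auto
  then show ?thesis by (simp add: cov_mult_def matrix_mul_assoc) algebra
qed

lemma coc_one_left [simp]: "g \<in> SL2 \<Longrightarrow> coc (mat 1) g = 1"
  using Xf_nz[of g] by (simp add: cocycle_def) (simp add: mat_1_mat2 Xf_mat2)

lemma coc_one_right [simp]: "g \<in> SL2 \<Longrightarrow> coc g (mat 1) = 1"
  using Xf_nz[of g] by (simp add: cocycle_def) (simp add: mat_1_mat2 Xf_mat2)

lemma cov_mult_K1: "x \<in> K1 v \<times> mu n \<Longrightarrow> y \<in> K1 v \<times> mu n \<Longrightarrow> cov_mult x y \<in> K1 v \<times> mu n"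
  using coc_mu mu_mult by (auto simp: cov_mult_def K1_mult SL2_K1)

lemma coc_splitting: "g \<in> K1 v \<Longrightarrow> h \<in> K1 v \<Longrightarrow> coc g h = splitting (g ** h) / (splitting g * splitting h)"
  using splitting_mult[of g h] mu_nz[OF splitting_mu] by simp

end

section \<open>Genuine functions over the maximal compact subgroup\<close>

locale genuine_field = tame_field v n \<pi> for v :: "'a::field \<Rightarrow> int" and n \<pi> +
  fixes \<epsilon> :: "'a \<Rightarrow> complex"
  assumes eps: "faithful_char n \<epsilon>"
begin

lemma eps_nz: "z \<in> mu n \<Longrightarrow> \<epsilon> z \<noteq> 0" using eps by (simp add: faithful_char_def)
lemma eps_mult: "z \<in> mu n \<Longrightarrow> w \<in> mu n \<Longrightarrow> \<epsilon> (z * w) = \<epsilon> z * \<epsilon> w" using eps by (simp add: faithful_char_def)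
lemma eps_one [simp]: "\<epsilon> 1 = 1" using eps_mult[of 1 1] eps_nz[of 1] by simp
lemma eps_inj: "z \<in> mu n \<Longrightarrow> w \<in> mu n \<Longrightarrow> \<epsilon> z = \<epsilon> w \<Longrightarrow> z = w"
  using eps by (auto simp: faithful_char_def inj_on_def)
lemma eps_power: "z \<in> mu n \<Longrightarrow> \<epsilon> (z ^ k) = \<epsilon> z ^ k"
  by (induction k) (auto simp: eps_mult mu_power)
lemma mu_divide: "z \<in> mu n \<Longrightarrow> w \<in> mu n \<Longrightarrow> z / w \<in> mu n" for z :: 'a
  by (simp add: divide_inverse mu_mult mu_inverse)
lemma eps_inverse: "z \<in> mu n \<Longrightarrow> \<epsilon> (inverse z) = inverse (\<epsilon> z)"
  using eps_mult[of z "inverse z"] mu_nz[of z] by (simp add: mu_inverse) (metis inverse_unique)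

abbreviation KT where "KT \<equiv> tilde v n (K1 v)"

text \<open>\<open>F\<close> gives the values on the section k -> (k, splitting k); genuineness
  dictates the extension along the fibres by \<open>\<epsilon>\<close>.\<close>

definition Lift :: "('a^2^2 \<Rightarrow> complex) \<Rightarrow> 'a cov \<Rightarrow> complex" where
  "Lift F = (\<lambda>x. if x \<in> K1 v \<times> mu n then \<epsilon> (snd x / splitting (fst x)) * F (fst x) else 0)"

definition unLift :: "('a cov \<Rightarrow> complex) \<Rightarrow> 'a^2^2 \<Rightarrow> complex" where
  "unLift f = (\<lambda>k. if k \<in> K1 v then f (k, splitting k) else 0)"

lemma Lift_add: "Lift (F + G) = Lift F + Lift G" by (auto simp: Lift_def fun_eq_iff distrib_left)
lemma Lift_scale: "Lift (c *\<^sub>C F) = c *\<^sub>C Lift F" by (auto simp: Lift_def fun_eq_iff)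
lemma Lift_0 [simp]: "Lift 0 = 0" by (auto simp: Lift_def fun_eq_iff)
lemma unLift_add: "unLift (F + G) = unLift F + unLift G" by (auto simp: unLift_def fun_eq_iff)
lemma unLift_scale: "unLift (c *\<^sub>C F) = c *\<^sub>C unLift F" by (auto simp: unLift_def fun_eq_iff)

lemma unLift_0: "unLift 0 = 0" using unLift_scale[of 0 0] by simp

lemma unLift_Lift: "(\<And>g. g \<notin> K1 v \<Longrightarrow> F g = 0) \<Longrightarrow> unLift (Lift F) = F"
proof
  fix g :: "'a^2^2" assume a: "\<And>g. g \<notin> K1 v \<Longrightarrow> F g = 0"
  show "unLift (Lift F) g = F g"
    using a mu_nz[OF splitting_mu] by (auto simp: unLift_def Lift_def splitting_mu)
qed

lemma unLift_Lift_stab: "stab M \<Longrightarrow> F \<in> M \<Longrightarrow> unLift (Lift F) = F"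
  using unLift_Lift stab_supp by blast

lemma Lift_inj: "stab M \<Longrightarrow> inj_on Lift M" by (metis inj_on_inverseI unLift_Lift_stab)

definition kact :: "'a cov \<Rightarrow> ('a cov \<Rightarrow> complex) \<Rightarrow> 'a cov \<Rightarrow> complex" where
  "kact g f = (\<lambda>x. if x \<in> K1 v \<times> mu n then f (cov_mult x g) else 0)"

text \<open>On the section the action is plain right translation, and the rest of the fibre acts by
  scalars. Hence invariant subspaces over the cover are exactly the lifts of stable subspaces of the
  model.\<close>

lemma kact_Lift: "g \<in> K1 v \<times> mu n \<Longrightarrow> kact g (Lift F) = \<epsilon> (snd g / splitting (fst g)) *\<^sub>C Lift (Rt (fst g) F)"
proof
  fix x assume g: "g \<in> K1 v \<times> mu n"
  show "kact g (Lift F) x = (\<epsilon> (snd g / splitting (fst g)) *\<^sub>C Lift (Rt (fst g) F)) x"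
  proof (cases "x \<in> K1 v \<times> mu n")
    case True
    obtain k z h w where e: "g = (k, z)" "x = (h, w)" by fastforce
    have k: "k \<in> K1 v" "z \<in> mu n" "h \<in> K1 v" "w \<in> mu n" using g True by (auto simp: e)
    have nz: "splitting k \<noteq> 0" "splitting h \<noteq> 0" "splitting (h ** k) \<noteq> 0" using k mu_nz[OF splitting_mu] K1_mult by auto
    have "snd (cov_mult x g) / splitting (h ** k) = (z / splitting k) * (w / splitting h)"
      using nz coc_splitting[OF k(3,1)] by (simp add: cov_mult_def e mult.commute)
    then have "\<epsilon> (snd (cov_mult x g) / splitting (h ** k)) = \<epsilon> (z / splitting k) * \<epsilon> (w / splitting h)"
      using eps_mult[of "z / splitting k" "w / splitting h"] mu_divide splitting_mu k by metis
    moreover have "cov_mult x g \<in> K1 v \<times> mu n" using cov_mult_K1 g True by blast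
    ultimately show ?thesis using True k by (simp add: kact_def Lift_def Rt_def) (simp add: cov_mult_def e)
  qed (simp add: kact_def Lift_def)
qed

lemma kact_Lift_splitting: "k \<in> K1 v \<Longrightarrow> kact (k, splitting k) (Lift F) = Lift (Rt k F)"
  using kact_Lift[of "(k, splitting k)" F] splitting_mu mu_nz[OF splitting_mu, of k] by (simp add: scaleC_one)

lemma kact_Lift_mem: "stab M \<Longrightarrow> g \<in> K1 v \<times> mu n \<Longrightarrow> f \<in> Lift ` M \<Longrightarrow> kact g f \<in> Lift ` M"
proof -
  assume a: "stab M" "g \<in> K1 v \<times> mu n" "f \<in> Lift ` M"
  then obtain F where F: "F \<in> M" "f = Lift F" by blast
  have "kact g f = Lift (\<epsilon> (snd g / splitting (fst g)) *\<^sub>C Rt (fst g) F)"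
    using kact_Lift[OF a(2)] by (simp add: F Lift_scale)
  moreover have "\<epsilon> (snd g / splitting (fst g)) *\<^sub>C Rt (fst g) F \<in> M" using a F by (intro stab_scale stab_Rt) auto
  ultimately show ?thesis by blast
qed

lemma subspace_Lift: "stab M \<Longrightarrow> complex_vector.subspace (Lift ` M)"
  unfolding complex_vector.subspace_def
proof (intro conjI ballI allI)
  assume M: "stab M"
  show "0 \<in> Lift ` M" using stab_0[OF M] Lift_0 by (metis imageI)
  show "x + y \<in> Lift ` M" if "x \<in> Lift ` M" "y \<in> Lift ` M" for x y
    using that stab_add[OF M] by (auto simp flip: Lift_add)
  show "c *\<^sub>C x \<in> Lift ` M" if "x \<in> Lift ` M" for c x
    using that stab_scale[OF M] by (auto simp flip: Lift_scale)
qed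

definition model_rep :: "('a^2^2 \<Rightarrow> complex) set \<Rightarrow> ('a cov, 'a cov \<Rightarrow> complex) rep" where
  "model_rep M = \<lparr>rspace = Lift ` M, ract = kact\<rparr>"

lemma model_rep_simps [simp]: "rspace (model_rep M) = Lift ` M" "ract (model_rep M) = kact" by (simp_all add: model_rep_def)

lemma kact_add: "kact g (x + y) = kact g x + kact g y" by (auto simp: kact_def fun_eq_iff)
lemma kact_scale: "kact g (c *\<^sub>C x) = c *\<^sub>C kact g x" by (auto simp: kact_def fun_eq_iff)

lemma kact_kact: "g \<in> K1 v \<times> mu n \<Longrightarrow> h \<in> K1 v \<times> mu n \<Longrightarrow> kact (cov_mult g h) f = kact g (kact h f)"
proof
  fix x assume gh: "g \<in> K1 v \<times> mu n" "h \<in> K1 v \<times> mu n"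
  have "cov_mult (cov_mult x g) h = cov_mult x (cov_mult g h)" "cov_mult x g \<in> K1 v \<times> mu n" if "x \<in> K1 v \<times> mu n"
    using cov_mult_assoc[of x g h] cov_mult_K1[of x g] that gh by (auto simp: SL2_K1)
  then show "kact (cov_mult g h) f x = kact g (kact h f) x" by (simp add: kact_def)
qed

lemma rep_closed_model_rep: "stab M \<Longrightarrow> rep_closed KT (model_rep M)"
  using subspace_Lift kact_Lift_mem by (auto simp: rep_closed_def kact_def)

lemma representation_model_rep: assumes M: "stab M" shows "representation KT (model_rep M)"
proof -
  have "kact (mat 1, 1) f = f" if "f \<in> Lift ` M" for f
  proof -
    have "splitting (mat 1) = 1" by (rule splitting_upper) (simp add: mat_1_mat2)
    then show ?thesis using that kact_Lift_splitting[OF K1_one] Rt_one stab_supp[OF M] by auto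
  qed
  then show ?thesis
    using subspace_Lift[OF M] kact_Lift_mem[OF M] kact_kact unfolding representation_def
    by (auto simp: kact_add kact_scale)
qed

lemma stab_of_invariant:
  assumes M: "stab M" and U: "complex_vector.subspace U" "U \<subseteq> Lift ` M"
    "\<And>g x. g \<in> K1 v \<times> mu n \<Longrightarrow> x \<in> U \<Longrightarrow> kact g x \<in> U"
  shows "stab {F \<in> M. Lift F \<in> U}" "Lift ` {F \<in> M. Lift F \<in> U} = U"
proof -
  have "Lift (Rt k F) \<in> U" if "k \<in> K1 v" "F \<in> M" "Lift F \<in> U" for k F
    using U(3)[of "(k, splitting k)" "Lift F"] that kact_Lift_splitting splitting_mu by simp
  then show "stab {F \<in> M. Lift F \<in> U}"
    using M U(1) unfolding stab_def complex_vector.subspace_def by (auto simp: Lift_add Lift_scale)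
  show "Lift ` {F \<in> M. Lift F \<in> U} = U" using U by blast
qed

lemma irreducible_model_rep: assumes "irr_model M" shows "irreducible_rep KT (model_rep M)" "\<not> reducible KT (model_rep M)"
proof -
  have M: "stab M" "M \<noteq> {0}" "\<And>U. stab U \<Longrightarrow> U \<subseteq> M \<Longrightarrow> U \<noteq> {0} \<Longrightarrow> U = M"
    using assms unfolding irr_model_def by blast+
  show nr: "\<not> reducible KT (model_rep M)"
    unfolding reducible_def
  proof
    assume "\<exists>U. complex_vector.subspace U \<and> U \<subseteq> rspace (model_rep M) \<and>
      (\<forall>g\<in>carrier KT. \<forall>x\<in>U. ract (model_rep M) g x \<in> U) \<and> U \<noteq> {0} \<and> U \<noteq> rspace (model_rep M)"
    then obtain U where U: "complex_vector.subspace U" "U \<subseteq> Lift ` M"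
      "\<And>g x. g \<in> K1 v \<times> mu n \<Longrightarrow> x \<in> U \<Longrightarrow> kact g x \<in> U" "U \<noteq> {0}" "U \<noteq> Lift ` M"
      unfolding model_rep_simps tilde_carrier by blast
    note s = stab_of_invariant[OF M(1) U(1-3)]
    have "{F \<in> M. Lift F \<in> U} = M"
    proof (rule M(3)[OF s(1)])
      show "{F \<in> M. Lift F \<in> U} \<noteq> {0}"
      proof
        assume "{F \<in> M. Lift F \<in> U} = {0}"
        then have "Lift ` {F \<in> M. Lift F \<in> U} = Lift ` {0}" by (rule arg_cong)
        then show False using s(2) U by simp
      qed
    qed auto
    then show False using s(2) U(5) by simp
  qed
  have "rspace (model_rep M) \<noteq> {0}"
  proof
    assume a: "rspace (model_rep M) = {0}"
    have "F = 0" if "F \<in> M" for F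
    proof -
      have "Lift F = Lift 0" using a that by auto
      then show ?thesis using inj_onD[OF Lift_inj[OF M(1)]] that stab_0[OF M(1)] by blast
    qed
    then show False using M(2) stab_0[OF M(1)] by blast
  qed
  then show "irreducible_rep KT (model_rep M)" using nr representation_model_rep[OF M(1)] by (simp add: irreducible_rep_def)
qed

lemma reducible_model_rep: assumes "stab M" "stab U" "U \<subseteq> M" "U \<noteq> {0}" "U \<noteq> M" shows "reducible KT (model_rep M)"
proof -
  have inj: "inj_on Lift M" using Lift_inj assms by blast
  have "Lift ` U \<noteq> Lift ` M" using inj_on_image_eq_iff[OF inj assms(3) order_refl] assms by simp
  moreover have "Lift ` U \<noteq> {0}"
  proof
    assume "Lift ` U = {0}"
    then have "Lift ` U = Lift ` {0}" by simp
    then show False using inj_on_image_eq_iff[OF inj assms(3), of "{0}"] stab_0[OF assms(1)] assms by simp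
  qed
  ultimately show ?thesis
    unfolding reducible_def using subspace_Lift[OF assms(2)] kact_Lift_mem[OF assms(2)] assms
    by (intro exI[of _ "Lift ` U"]) auto
qed

lemma bij_Lift:
  assumes M: "stab M" "stab M'" and \<phi>: "bij_betw \<phi> M M'"
  shows "bij_betw (\<lambda>f. Lift (\<phi> (unLift f))) (Lift ` M) (Lift ` M')"
proof -
  have L: "bij_betw Lift M (Lift ` M)" "bij_betw Lift M' (Lift ` M')"
    using Lift_inj M by (auto simp: bij_betw_def)
  have "bij_betw (Lift \<circ> \<phi> \<circ> inv_into M Lift) (Lift ` M) (Lift ` M')"
    by (rule bij_betw_trans[OF bij_betw_inv_into[OF L(1)] bij_betw_trans[OF \<phi> L(2)]])
  moreover have "(Lift \<circ> \<phi> \<circ> inv_into M Lift) f = Lift (\<phi> (unLift f))" if "f \<in> Lift ` M" for f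
    using that unLift_Lift_stab[OF M(1)] inv_into_f_f[OF Lift_inj[OF M(1)]] by auto
  ultimately show ?thesis by (subst bij_betw_cong[where g = "Lift \<circ> \<phi> \<circ> inv_into M Lift"]) simp_all
qed

lemma rep_iso_model_rep:
  assumes M: "stab M" "stab M'" and \<phi>: "equivariant M \<phi>" "bij_betw \<phi> M M'" shows "rep_iso KT (model_rep M) (model_rep M')"
proof (rule rep_isoI)
  let ?\<psi> = "\<lambda>f. Lift (\<phi> (unLift f))"
  show "bij_betw ?\<psi> (rspace (model_rep M)) (rspace (model_rep M'))" using bij_Lift[OF M \<phi>(2)] by simp
  have in': "\<phi> F \<in> M'" if "F \<in> M" for F using that \<phi>(2) bij_betw_apply by metis
  show "rep_hom KT (model_rep M) (model_rep M') ?\<psi>"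
    unfolding rep_hom_def
  proof (intro conjI ballI allI)
    fix x assume "x \<in> rspace (model_rep M)"
    then obtain F where F: "F \<in> M" "x = Lift F" by auto
    then show "?\<psi> x \<in> rspace (model_rep M')" using in' unLift_Lift_stab[OF M(1)] by auto
    show "?\<psi> (c *\<^sub>C x) = c *\<^sub>C ?\<psi> x" for c
      using F unLift_Lift_stab[OF M(1)] equivariant_scale[OF \<phi>(1)] by (simp add: unLift_scale Lift_scale)
    fix y assume "y \<in> rspace (model_rep M)"
    then obtain G where G: "G \<in> M" "y = Lift G" by auto
    show "?\<psi> (x + y) = ?\<psi> x + ?\<psi> y"
      using F G unLift_Lift_stab[OF M(1)] equivariant_add[OF \<phi>(1)] by (simp add: unLift_add Lift_add)
  next
    fix g x assume g: "g \<in> carrier KT" and "x \<in> rspace (model_rep M)"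
    then obtain F where F: "F \<in> M" "x = Lift F" by auto
    have g': "g \<in> K1 v \<times> mu n" using g by simp
    have R: "Rt (fst g) F \<in> M" using F M g' by (intro stab_Rt) auto
    show "?\<psi> (ract (model_rep M) g x) = ract (model_rep M') g (?\<psi> x)"
      using F g' R unLift_Lift_stab[OF M(1)] equivariant_scale[OF \<phi>(1)] equivariant_Rt[OF \<phi>(1) F(1), of "fst g"]
      by (auto simp: kact_Lift unLift_scale Lift_scale)
  qed
qed

text \<open>Extracts what is needed to refute an isomorphism: an injective equivariant map, which is
  then shown to vanish.\<close>

lemma rep_iso_model_rep_D:
  assumes M: "stab M" "stab M'" and iso: "rep_iso KT (model_rep M) (model_rep M')"
  shows "\<exists>\<phi>. equivariant M \<phi> \<and> (\<forall>F\<in>M. \<phi> F \<in> M') \<and> (\<forall>F\<in>M. \<phi> F = 0 \<longrightarrow> F = 0)"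
proof -
  obtain \<psi> where \<psi>: "bij_betw \<psi> (Lift ` M) (Lift ` M')"
    "\<forall>x\<in>Lift ` M. \<forall>y\<in>Lift ` M. \<psi> (x + y) = \<psi> x + \<psi> y" "\<forall>c. \<forall>x\<in>Lift ` M. \<psi> (c *\<^sub>C x) = c *\<^sub>C \<psi> x"
    "\<forall>g\<in>K1 v \<times> mu n. \<forall>x\<in>Lift ` M. \<psi> (kact g x) = kact g (\<psi> x)"
    using iso unfolding rep_iso_def by auto
  let ?\<phi> = "\<lambda>F. unLift (\<psi> (Lift F))"
  have in': "\<exists>G\<in>M'. \<psi> (Lift F) = Lift G" if "F \<in> M" for F
    using bij_betw_apply[OF \<psi>(1), of "Lift F"] that by blast
  have "equivariant M ?\<phi>"
    unfolding equivariant_def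
  proof (intro conjI ballI allI)
    show "?\<phi> (x + y) = ?\<phi> x + ?\<phi> y" if "x \<in> M" "y \<in> M" for x y using that \<psi>(2) by (simp add: Lift_add unLift_add)
    show "?\<phi> (c *\<^sub>C x) = c *\<^sub>C ?\<phi> x" if "x \<in> M" for c x using that \<psi>(3) by (simp add: Lift_scale unLift_scale)
    show "?\<phi> (Rt k x) = Rt k (?\<phi> x)" if k: "k \<in> K1 v" and x: "x \<in> M" for k x
    proof -
      obtain G where G: "G \<in> M'" "\<psi> (Lift x) = Lift G" using in'[OF x] by blast
      have "\<psi> (Lift (Rt k x)) = kact (k, splitting k) (\<psi> (Lift x))"
        using \<psi>(4) k x splitting_mu by (simp flip: kact_Lift_splitting)
      then show ?thesis using G kact_Lift_splitting[OF k] unLift_Lift_stab[OF M(2)] stab_Rt[OF M(2) G(1) k] by simp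
    qed
  qed
  moreover have "?\<phi> F \<in> M'" if "F \<in> M" for F using in'[OF that] unLift_Lift_stab[OF M(2)] by auto
  moreover have "F = 0" if F: "F \<in> M" "?\<phi> F = 0" for F
  proof -
    obtain G where G: "G \<in> M'" "\<psi> (Lift F) = Lift G" using in'[OF F(1)] by blast
    then have "\<psi> (Lift F) = 0" using F unLift_Lift_stab[OF M(2)] by simp
    moreover have "\<psi> 0 = 0" using \<psi>(3) stab_0[OF M(1)] by (metis Lift_0 complex_vector.scale_zero_left imageI)
    moreover have "0 \<in> Lift ` M" using stab_0[OF M(1)] Lift_0 by (metis imageI)
    ultimately have "Lift F = 0" using bij_betw_imp_inj_on[OF \<psi>(1)] F by (metis imageI inj_onD)
    then have "unLift 0 = F" using unLift_Lift_stab[OF M(1) F(1)] by simp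
    then show ?thesis using unLift_0 by simp
  qed
  ultimately show ?thesis by blast
qed

lemma sum_bij:
  assumes M: "stab M" "stab P" "stab Q" "P \<subseteq> M" "Q \<subseteq> M" "P \<inter> Q = {0}" "\<And>F. F \<in> M \<Longrightarrow> \<exists>A\<in>P. \<exists>B\<in>Q. F = A + B"
  shows "bij_betw (\<lambda>(p, q). p + q) (Lift ` P \<times> Lift ` Q) (Lift ` M)"
  unfolding bij_betw_def
proof
  show "inj_on (\<lambda>(p, q). p + q) (Lift ` P \<times> Lift ` Q)"
  proof (rule inj_onI, clarsimp)
    fix A B A' B' assume a: "A \<in> P" "B \<in> Q" "A' \<in> P" "B' \<in> Q" "Lift A + Lift B = Lift A' + Lift B'"
    then have "Lift (A + B) = Lift (A' + B')" by (simp only: Lift_add)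
    moreover have "A + B \<in> M" "A' + B' \<in> M" using a M stab_add[OF M(1)] by blast+
    ultimately have "A + B = A' + B'" using inj_onD[OF Lift_inj[OF M(1)]] by blast
    then have e: "A - A' = B' - B" by (simp add: algebra_simps)
    moreover have "A - A' \<in> P" "B' - B \<in> Q" using a stab_diff[OF M(2)] stab_diff[OF M(3)] by auto
    ultimately have "A - A' \<in> P \<inter> Q" by simp
    then have "A - A' = 0" "B' - B = 0" using M e by auto
    then show "Lift A = Lift A' \<and> Lift B = Lift B'" by simp
  qed
  show "(\<lambda>(p, q). p + q) ` (Lift ` P \<times> Lift ` Q) = Lift ` M"
  proof (intro equalityI subsetI)
    fix x assume "x \<in> (\<lambda>(p, q). p + q) ` (Lift ` P \<times> Lift ` Q)"
    then obtain A B where "A \<in> P" "B \<in> Q" "x = Lift (A + B)" by (auto simp: Lift_add)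
    then show "x \<in> Lift ` M" using M stab_add[OF M(1)] by blast
  next
    fix x assume "x \<in> Lift ` M"
    then obtain A B where "A \<in> P" "B \<in> Q" "x = Lift A + Lift B" using M(7) by (metis Lift_add imageE)
    then show "x \<in> (\<lambda>(p, q). p + q) ` (Lift ` P \<times> Lift ` Q)" by force
  qed
qed

lemma two_constituents_model_rep:
  assumes M: "stab M" "P \<subseteq> M" "Q \<subseteq> M" "P \<inter> Q = {0}" "\<And>F. F \<in> M \<Longrightarrow> \<exists>A\<in>P. \<exists>B\<in>Q. F = A + B"
    and PQ: "irr_model P" "irr_model Q"
  shows "two_irreducible_constituents KT (model_rep M)" "reducible KT (model_rep M)"
proof -
  have s: "stab P" "stab Q" "P \<noteq> {0}" "Q \<noteq> {0}" using PQ by (auto simp: irr_model_def)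
  have "rep_iso KT (model_rep M) (model_rep P \<oplus>\<^sub>R model_rep Q)"
  proof (rule rep_iso_via)
    show "bij_betw (\<lambda>x. x) (rspace (model_rep M)) (rspace (model_rep M))" by (simp add: bij_betw_def)
    show "bij_betw (\<lambda>(p, q). p + q) (rspace (model_rep P \<oplus>\<^sub>R model_rep Q)) (rspace (model_rep M))"
      using sum_bij[OF M(1) s(1,2) M(2-5)] by (simp add: rep_sum_def)
    show "rep_hom KT (model_rep M) (model_rep M) (\<lambda>x. x)" by (simp add: rep_hom_def)
    show "rep_closed KT (model_rep M)" "rep_closed KT (model_rep P \<oplus>\<^sub>R model_rep Q)"
      by (intro rep_closed_sum rep_closed_model_rep M(1) s)+
    have "Lift A + Lift B \<in> Lift ` M" if "A \<in> P" "B \<in> Q" for A B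
      using that M stab_add[OF M(1)] by (metis Lift_add imageI subsetD)
    then show "rep_hom KT (model_rep P \<oplus>\<^sub>R model_rep Q) (model_rep M) (\<lambda>(p, q). p + q)"
      by (auto simp: rep_hom_def rep_sum_def scaleC_prod_def kact_add complex_vector.scale_right_distrib)
  qed
  then show "two_irreducible_constituents KT (model_rep M)"
    using irreducible_model_rep(1) PQ unfolding two_irreducible_constituents_def by blast
  have "P \<noteq> M"
  proof
    assume "P = M"
    then have "Q = {0}" using M stab_0[OF s(2)] by blast
    then show False using s by simp
  qed
  then show "reducible KT (model_rep M)" by (rule reducible_model_rep[OF M(1) s(1) M(2) s(3)])
qed

text \<open>Everything about a character that matters over \<open>K1 v\<close>: it is genuine on the
  integral torus and equals \<open>u\<close> on the units.\<close>

definition restricts_to :: "('a cov \<Rightarrow> complex) \<Rightarrow> ('a \<Rightarrow> complex) \<Rightarrow> bool" where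
  "restricts_to \<psi> u \<longleftrightarrow> (\<forall>t z. runit t \<longrightarrow> z \<in> mu n \<longrightarrow> \<psi> (dg t, z) = \<epsilon> z * u t)"

lemma B1_K1: "h \<in> B1 \<inter> K1 v \<longleftrightarrow> (\<exists>t x. runit t \<and> x \<in> fpow v 0 \<and> h = nu x ** dg t)"
proof
  assume h: "h \<in> B1 \<inter> K1 v"
  obtain a b c d where H: "h = mat2 a b c d" using mat2_cases .
  have c: "c = 0" "a * d = 1" "a \<in> fpow v 0" "d \<in> fpow v 0" "b \<in> fpow v 0" using h by (auto simp: H B1_def K1_mat2)
  have a: "runit a" using c(2-4) fpow_mult_right[of a 1 d] runit_one by (auto simp: runit_iff)
  have "d = inverse a" using c(2) inverse_unique by metis
  then have "h = nu (b * a) ** dg a" using runit_nz[OF a] c by (simp add: H nu_def dg_mat2)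
  then show "\<exists>t x. runit t \<and> x \<in> fpow v 0 \<and> h = nu x ** dg t" using a c fpow_mult_left by blast
next
  assume "\<exists>t x. runit t \<and> x \<in> fpow v 0 \<and> h = nu x ** dg t"
  then show "h \<in> B1 \<inter> K1 v" using K1_mult dg_K1
    by (auto simp: B1_def SL2_K1) (auto simp: nu_def dg_mat2)
qed

lemma V_ract: "ract (V_ind v n \<psi>) = kact" "ract (V_fixed v n \<psi> l) = kact"
proof -
  show "ract (V_ind v n \<psi>) = kact" by (intro ext) (simp add: V_ind_def ind_def kact_def)
  then show "ract (V_fixed v n \<psi> l) = kact" by (simp add: V_fixed_def rep_fixed_def)
qed

text \<open>Multiplication on the section involves no cocycle, and \<open>splitting\<close> is 1 on
  the integral Borel and on \<open>Kc v l\<close>. So equivariance and invariance carry over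
  unchanged between functions on the cover and functions on \<open>K1 v\<close>.\<close>

lemma V_ind_space:
  assumes \<psi>: "restricts_to \<psi> u" and u: "unit_hom u m"
  shows "rspace (V_ind v n \<psi>) = Lift ` {F. \<exists>j\<ge>1. F \<in> level_space u j}"
    "l \<ge> 1 \<Longrightarrow> rspace (V_fixed v n \<psi> l) = Lift ` level_space u l"
proof -
  have inK: "k \<in> K1 v" if "k \<in> Kc v l" for k l using that by (simp add: Kc_iff)
  have A: "f \<in> Lift ` level_space u l"
    if f0: "\<And>x. x \<notin> K1 v \<times> mu n \<Longrightarrow> f x = 0"
      and fB: "\<And>h x. h \<in> (B1 \<inter> K1 v) \<times> mu n \<Longrightarrow> x \<in> K1 v \<times> mu n \<Longrightarrow> f (cov_mult h x) = \<psi> (torus_part h) * f x"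
      and fK: "\<And>k x. k \<in> Kc v l \<Longrightarrow> x \<in> K1 v \<times> mu n \<Longrightarrow> f (cov_mult x (k, 1)) = f x" and l: "l \<ge> 1" for f l
  proof -
    have split: "cov_mult (g, splitting g) (h, splitting h) = (g ** h, splitting (g ** h))" if "g \<in> K1 v" "h \<in> K1 v" for g h
      using splitting_mult[OF that] by (simp add: cov_mult_def)
    have s1: "(k, splitting k) \<in> K1 v \<times> mu n" if "k \<in> K1 v" for k using that splitting_mu by simp
    have h1: "f (h ** g, splitting (h ** g)) = \<psi> (dg (h$1$1), 1) * f (g, splitting g)" if "h \<in> B1 \<inter> K1 v" "g \<in> K1 v" for h g
    proof -
      have "splitting h = 1" using that by (intro splitting_upper) (simp add: B1_def)
      then show ?thesis using fB[of "(h, 1)" "(g, splitting g)"] split[of h g] that s1[of g] by (simp add: torus_part_def)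
    qed
    have "unLift f \<in> level_space u l"
      unfolding level_space_def
    proof (intro CollectI conjI ballI allI impI)
      show "unLift f g = 0" if "g \<notin> K1 v" for g using that by (simp add: unLift_def)
    next
      fix g x assume g: "g \<in> K1 v" and x: "x \<in> fpow v 0"
      have "nu x \<in> B1 \<inter> K1 v" using x by (simp add: B1_def SL2_K1) (simp add: nu_def)
      moreover have "\<psi> (dg 1, 1) = 1" using \<psi> unit_hom_one[OF u] by (simp add: restricts_to_def)
      moreover have "nu x$1$1 = 1" by (simp add: nu_def)
      ultimately show "unLift f (nu x ** g) = unLift f g" using h1[of "nu x" g] g x by (simp add: unLift_def K1_mult)
    next
      fix g t assume g: "g \<in> K1 v" and t: "runit t"
      have "dg t \<in> B1 \<inter> K1 v" using dg_K1[OF t] by (simp add: B1_def SL2_K1) (simp add: dg_mat2)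
      moreover have "dg t$1$1 = t" by (simp add: dg_mat2)
      moreover have "\<psi> (dg t, 1) = u t" using \<psi> t by (simp add: restricts_to_def)
      ultimately show "unLift f (dg t ** g) = u t * unLift f g" using h1[of "dg t" g] g t by (simp add: unLift_def K1_mult)
    next
      fix g k assume g: "g \<in> K1 v" and k: "k \<in> Kc v l"
      show "unLift f (g ** k) = unLift f g"
        using fK[OF k s1[OF g]] split[OF g inK[OF k]] splitting_Kc[OF k l] g inK[OF k] by (simp add: unLift_def K1_mult)
    qed
    moreover have "f = Lift (unLift f)"
    proof
      fix x show "f x = Lift (unLift f) x"
      proof (cases "x \<in> K1 v \<times> mu n")
        case True
        obtain k z where x: "x = (k, z)" "k \<in> K1 v" "z \<in> mu n" using True by blast
        \<comment> \<open>The point is a point of the section times a central element, and left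
          equivariance under that element recovers the value on the whole fibre.\<close>
        let ?w = "z / splitting k"
        have w: "?w \<in> mu n" using mu_divide x splitting_mu by blast
        have b: "(mat 1, ?w) \<in> (B1 \<inter> K1 v) \<times> mu n" using w K1_one by (simp add: B1_def SL2_one) (simp add: mat_1_mat2)
        have "cov_mult (mat 1, ?w) (k, splitting k) = x" using x mu_nz[OF splitting_mu[OF x(2)]] by (simp add: cov_mult_def SL2_K1)
        moreover have "torus_part (mat 1, ?w) = (dg 1, ?w)" by (simp add: torus_part_def mat_def)
        moreover have "\<psi> (dg 1, ?w) = \<epsilon> ?w" using \<psi> w unit_hom_one[OF u] by (simp add: restricts_to_def)
        ultimately show ?thesis using fB[OF b s1[OF x(2)]] x by (simp add: Lift_def unLift_def)
      qed (use f0 in \<open>auto simp: Lift_def\<close>)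
    qed
    ultimately show ?thesis by blast
  qed
  have B: "Lift F (cov_mult h x) = \<psi> (torus_part h) * Lift F x"
    if F: "F \<in> level_space u l" and h: "h \<in> (B1 \<inter> K1 v) \<times> mu n" and x: "x \<in> K1 v \<times> mu n" for F l h x
  proof -
    obtain b z where hz: "h = (b, z)" "b \<in> B1 \<inter> K1 v" "z \<in> mu n" using h by blast
    obtain g w where xw: "x = (g, w)" "g \<in> K1 v" "w \<in> mu n" using x by blast
    obtain t y where ty: "runit t" "y \<in> fpow v 0" "b = nu y ** dg t" using hz B1_K1 by blast
    have sb: "splitting b = 1" using hz by (intro splitting_upper) (simp add: B1_def)
    have b11: "b$1$1 = t" by (simp add: ty nu_def dg_mat2)
    have "coc b g = splitting (b ** g) / splitting g" using coc_splitting[of b g] hz xw sb by simp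
    then have "snd (cov_mult h x) / splitting (b ** g) = z * (w / splitting g)"
      using mu_nz[OF splitting_mu] K1_mult hz xw by (simp add: cov_mult_def)
    moreover have "F (b ** g) = u t * F g"
      using ty xw F dg_K1[of t] by (simp add: mpsD(2,3)[OF F] K1_mult flip: matrix_mul_assoc)
    moreover have "cov_mult h x \<in> K1 v \<times> mu n" using cov_mult_K1 hz xw by simp
    moreover have "fst (cov_mult h x) = b ** g" by (simp add: cov_mult_def hz xw)
    moreover have "\<psi> (torus_part h) = \<epsilon> z * u t"
      using \<psi> ty(1) hz(3) b11 unfolding hz(1) torus_part_def restricts_to_def by simp
    ultimately show ?thesis using x eps_mult[OF hz(3) mu_divide[OF xw(3) splitting_mu[OF xw(2)]]] by (simp add: Lift_def xw)
  qed
  have C: "Lift F (cov_mult x (k, 1)) = Lift F x" if F: "F \<in> level_space u l" and k: "k \<in> Kc v l" and l: "l \<ge> 1" and x: "x \<in> K1 v \<times> mu n" for F l k x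
  proof -
    have "kact (k, 1) (Lift F) = Lift F"
    proof -
      have "Rt k F = F" using mpsD(1,4)[OF F] k by (auto simp: Rt_def fun_eq_iff)
      then show ?thesis using kact_Lift_splitting[OF inK[OF k]] splitting_Kc[OF k l] by metis
    qed
    then show ?thesis using x by (metis kact_def)
  qed
  have D: "Lift F x = 0" if "x \<notin> K1 v \<times> mu n" for F x using that by (auto simp: Lift_def)
  have sp: "f \<in> rspace (V_ind v n \<psi>) \<longleftrightarrow> (\<forall>x. x \<notin> K1 v \<times> mu n \<longrightarrow> f x = 0) \<and>
      (\<forall>h\<in>(B1 \<inter> K1 v) \<times> mu n. \<forall>x\<in>K1 v \<times> mu n. f (cov_mult h x) = \<psi> (torus_part h) * f x) \<and>
      (\<exists>j\<ge>1. \<forall>k\<in>K1 v \<inter> Kc v j. \<forall>x\<in>K1 v \<times> mu n. f (cov_mult x (k, 1)) = f x)" for f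
    unfolding V_ind_def ind_def inflate_def char_rep_def by simp
  have KK: "K1 v \<inter> Kc v j = Kc v j" for j using inK by blast
  show E: "rspace (V_ind v n \<psi>) = Lift ` {F. \<exists>j\<ge>1. F \<in> level_space u j}"
  proof (intro equalityI subsetI)
    fix f assume "f \<in> rspace (V_ind v n \<psi>)"
    then obtain j where "j \<ge> 1" "\<forall>k\<in>Kc v j. \<forall>x\<in>K1 v \<times> mu n. f (cov_mult x (k, 1)) = f x"
      "\<forall>x. x \<notin> K1 v \<times> mu n \<longrightarrow> f x = 0"
      "\<forall>h\<in>(B1 \<inter> K1 v) \<times> mu n. \<forall>x\<in>K1 v \<times> mu n. f (cov_mult h x) = \<psi> (torus_part h) * f x"
      unfolding sp KK by blast
    then have "f \<in> Lift ` level_space u j" by (intro A) blast+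
    then show "f \<in> Lift ` {F. \<exists>j\<ge>1. F \<in> level_space u j}" using \<open>j \<ge> 1\<close> by blast
  next
    fix f assume "f \<in> Lift ` {F. \<exists>j\<ge>1. F \<in> level_space u j}"
    then obtain F j where "F \<in> level_space u j" "j \<ge> 1" "f = Lift F" by blast
    then show "f \<in> rspace (V_ind v n \<psi>)" unfolding sp KK using B C D by blast
  qed
  show "rspace (V_fixed v n \<psi> l) = Lift ` level_space u l" if l: "l \<ge> 1"
  proof -
    have "rspace (V_fixed v n \<psi> l) = {f \<in> rspace (V_ind v n \<psi>). \<forall>k\<in>Kc v l. kact (k, 1) f = f}"
      unfolding V_ract(1)[of \<psi>, symmetric] by (simp add: V_fixed_def rep_fixed_def)
    also have "\<dots> = Lift ` level_space u l"
    proof (intro equalityI subsetI)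
      fix f assume f: "f \<in> {f \<in> rspace (V_ind v n \<psi>). \<forall>k\<in>Kc v l. kact (k, 1) f = f}"
      have fk: "f (cov_mult x (k, 1)) = f x" if "k \<in> Kc v l" "x \<in> K1 v \<times> mu n" for k x
      proof -
        have "kact (k, 1) f x = f x" using f that by simp
        then show ?thesis using that by (simp only: kact_def if_True)
      qed
      have "f \<in> rspace (V_ind v n \<psi>)" using f by blast
      then show "f \<in> Lift ` level_space u l" unfolding sp using fk l by (intro A) blast+
    next
      fix f assume "f \<in> Lift ` level_space u l"
      then obtain F where F: "F \<in> level_space u l" "f = Lift F" by blast
      have "kact (k, 1) f = f" if "k \<in> Kc v l" for k
        using C[OF F(1) that l] D by (auto simp: kact_def F fun_eq_iff)
      then show "f \<in> {f \<in> rspace (V_ind v n \<psi>). \<forall>k\<in>Kc v l. kact (k, 1) f = f}"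
        using F E l by blast
    qed
    finally show ?thesis .
  qed
qed

lemma V_eq_model_rep:
  assumes "restricts_to \<psi> u" "unit_hom u m"
  shows "V_ind v n \<psi> = model_rep {F. \<exists>j\<ge>1. F \<in> level_space u j}" "l \<ge> 1 \<Longrightarrow> V_fixed v n \<psi> l = model_rep (level_space u l)"
  using V_ind_space[OF assms] V_ract by (auto intro!: rep.equality)

end

text \<open>Explains the range of the index k: only even powers of \<open>theta\<close>, which has
  order n, occur, and its square has order \<open>nbar n\<close>.\<close>

lemma dvd_double_nbar: "n dvd 2 * e \<longleftrightarrow> nbar n dvd e"
proof (cases "odd n")
  case True
  then have "coprime n 2" by simp
  then show ?thesis using True by (simp add: nbar_def coprime_dvd_mult_right_iff)
next
  case False
  then obtain k where "n = 2 * k" by auto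
  then show ?thesis by (simp add: nbar_def)
qed

lemma nbar_pos: "n \<ge> 2 \<Longrightarrow> nbar n > 0" by (auto simp: nbar_def elim: oddE)

section \<open>The symbol with the uniformizer and the order of \<open>theta\<close>\<close>

context tame_field
begin

lemma hil_powi_left: "a \<noteq> 0 \<Longrightarrow> b \<noteq> 0 \<Longrightarrow> hil (a powi j) b = hil a b powi j"
proof -
  assume a: "a \<noteq> 0" "b \<noteq> 0"
  have p: "hil (c ^ k) b = hil c b ^ k" if "c \<noteq> 0" for c k
    by (induction k) (use a that hil_mult_left[of c "c ^ _" b] in auto)
  have "hil (inverse a) b = inverse (hil a b)"
    using hil_mult_left[of "inverse a" a b] a by simp (metis inverse_unique mult.commute)
  then show ?thesis using p a by (simp add: power_int_def)
qed

lemma hil_powi_right: "a \<noteq> 0 \<Longrightarrow> b \<noteq> 0 \<Longrightarrow> hil b (a powi j) = hil b a powi j"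
proof -
  assume a: "a \<noteq> 0" "b \<noteq> 0"
  have i: "hil b c = inverse (hil c b)" if "c \<noteq> 0" for c
    using hil_swap[of c b] a that by (metis inverse_unique)
  show ?thesis using i[of a] i[of "a powi j"] a hil_powi_left[of a b j] by (simp add: power_int_inverse)
qed

lemma mu_powi_period: "z \<in> mu n \<Longrightarrow> int n dvd j \<Longrightarrow> z powi j = 1" for z :: 'a
  by (auto simp: power_int_mult mu_def elim!: dvdE)

lemma unit_decomp: "t \<noteq> 0 \<Longrightarrow> \<exists>a. runit a \<and> t = a * \<pi> powi v t"
  using pi_nz by (intro exI[of _ "t / \<pi> powi v t"]) (simp add: runit_def val_divide val_powi val_pi)

end

context genuine_field
begin

definition theta :: "'a \<Rightarrow> complex" where "theta t = \<epsilon> (hil \<pi> t)"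

lemma unit_hom_theta: "unit_hom theta 1"
  unfolding unit_hom_def theta_def
  using pi_nz by (auto simp: hil_mult_right runit_nz eps_mult hil(1) eps_nz hil_principal_right)

lemma theta_pow: "runit t \<Longrightarrow> theta t ^ k = \<epsilon> (hil \<pi> t ^ k)"
  using pi_nz by (simp add: theta_def eps_power hil(1) runit_nz)

lemma theta_pow_eq1: "runit t \<Longrightarrow> theta t ^ k = 1 \<longleftrightarrow> hil \<pi> t ^ k = 1"
  using pi_nz eps_inj[of "hil \<pi> t ^ k" 1] by (auto simp: theta_pow mu_power hil(1) runit_nz)

text \<open>Modulo p the symbol of the uniformizer with a unit x is the inverse of x to the power
  \<open>tame_exp\<close>. A trivial e-th power for all x would make \<open>tame_exp * e\<close>,
  which is less than q - 1, an exponent of the residue units.\<close>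

lemma theta_nontrivial: assumes "0 < e" "e < n" shows "\<exists>a. runit a \<and> theta a ^ e \<noteq> 1"
proof -
  have tp: "tame_exp > 0" "n * tame_exp = residue_card v - 1"
  proof -
    show e: "n * tame_exp = residue_card v - 1" using n_dvd by simp
    show "tame_exp > 0" using e residue_card_ge2 by (metis One_nat_def diff_is_0_eq gr0I mult_0_right not_less_eq_eq numeral_2_eq_2)
  qed
  then have "0 < tame_exp * e" "tame_exp * e < residue_card v - 1"
    using assms mult_strict_left_mono[OF assms(2) tp(1)] by (simp_all only: mult.commute[of n]) simp
  then obtain x where x: "runit x" "x ^ (tame_exp * e) - 1 \<notin> fpow v 1" using ex_unit_power_nontrivial by blast
  have "hil \<pi> x ^ e \<noteq> 1"
  proof
    assume h: "hil \<pi> x ^ e = 1"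
    have "tame \<pi> x = inverse x" using x by (simp add: tame_def runit_def val_pi divide_inverse)
    then have "hil \<pi> x - inverse x ^ tame_exp \<in> fpow v 1" using hil(2)[of \<pi> x] pi_nz x runit_nz by simp
    then have "hil \<pi> x ^ e - (inverse x ^ tame_exp) ^ e \<in> fpow v 1"
      using x mu_fpow[OF hil(1)] pi_nz runit_nz n_ge2
      by (intro fpow_cong_power) (auto intro!: runit_fpow runit_power runit_inverse)
    then have "1 - inverse (x ^ (tame_exp * e)) \<in> fpow v 1" by (simp add: h power_mult power_inverse)
    then have "x ^ (tame_exp * e) * (1 - inverse (x ^ (tame_exp * e))) \<in> fpow v 1"
      using x fpow_unit_cancel runit_power by blast
    then show False using x runit_nz[OF x(1)] by (simp add: right_diff_distrib)
  qed
  then show ?thesis using x theta_pow_eq1 by blast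
qed

lemma theta_pow_n: "runit t \<Longrightarrow> theta t ^ n = 1"
  using hil(1)[of \<pi> t] pi_nz by (simp add: theta_pow_eq1 runit_nz mu_def)

lemma theta_trivial_iff: "(\<forall>t. runit t \<longrightarrow> theta t ^ e = 1) \<longleftrightarrow> n dvd e"
proof
  assume a: "\<forall>t. runit t \<longrightarrow> theta t ^ e = 1"
  have "theta t ^ (e mod n) = 1" if "runit t" for t
  proof -
    have "theta t ^ e = (theta t ^ n) ^ (e div n) * theta t ^ (e mod n)"
      by (simp flip: power_mult power_add)
    then show ?thesis using a that theta_pow_n by simp
  qed
  then have "e mod n = 0" using theta_nontrivial[of "e mod n"] n_ge2 by (metis gr0I mod_less_divisor not_numeral_le_zero)
  then show "n dvd e" by (simp add: dvd_eq_mod_eq_0)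
qed (auto simp: power_mult theta_pow_n)

abbreviation nb where "nb \<equiv> nbar n"

end

section \<open>The inducing representation and its characters on units\<close>

locale principal_datum = genuine_field v n \<pi> \<epsilon> for v :: "'a::field \<Rightarrow> int" and n \<pi> \<epsilon> +
  fixes \<rho> :: "('a cov, 'v::complex_vector) rep" and chi chi0 :: "'a cov \<Rightarrow> complex" and m :: nat
  assumes irr: "irreducible_rep (tilde v n T1) \<rho>" and gen: "genuine n \<epsilon> \<rho>"
    and central: "has_central_char v n \<rho> chi"
    and prim: "primitive_mod v n chi m" and extends: "extends_to_A1 v n chi chi0"
begin

abbreviation V where "V \<equiv> rspace \<rho>"

lemma m1: "m \<ge> 1" using prim by (simp add: primitive_mod_def)

lemma rep_\<rho>: "representation (tilde v n T1) \<rho>" "V \<noteq> {0}" "\<not> reducible (tilde v n T1) \<rho>"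
  using irr by (auto simp: irreducible_rep_def)

lemma V_sub: "complex_vector.subspace V" using rep_\<rho> by (simp add: representation_def)

lemma dg_T1: "t \<noteq> 0 \<Longrightarrow> dg t \<in> T1" by (simp add: T1_def dg_mat2)

lemma T1_dg: "g \<in> T1 \<Longrightarrow> \<exists>t. t \<noteq> 0 \<and> g = dg t"
proof -
  assume g: "g \<in> T1"
  obtain a b c d where G: "g = mat2 a b c d" using mat2_cases .
  have e: "b = 0" "c = 0" "a * d = 1" using g by (auto simp: G T1_def)
  then have "a \<noteq> 0" "d = inverse a" by (auto simp: inverse_unique)
  then show ?thesis using e by (intro exI[of _ a]) (simp add: G dg_mat2)
qed

lemma dg_one: "dg 1 = mat 1" by (simp add: dg_mat2 mat_1_mat2)

lemma Xf_dg: "Xf (dg t) = inverse t" by (simp add: dg_mat2 Xf_mat2)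

lemma dg_mult: "dg t ** dg s = dg (t * s)" by (simp add: dg_mat2 mult.commute)

lemma coc_dg: "t \<noteq> 0 \<Longrightarrow> s \<noteq> 0 \<Longrightarrow> coc (dg t) (dg s) = hil s t"
proof -
  assume a: "t \<noteq> 0" "s \<noteq> 0"
  have "coc (dg t) (dg s) = hil (1 / s) (1 / t)"
    using a unfolding cocycle_def dg_mult Xf_dg by (simp add: field_simps)
  then show ?thesis using a hil_divide_left[of 1 s "1 / t"] hil_divide_right[of 1 t s] hil_divide_left[of 1 t s]
    hil_swap[of s t] hil_swap[of t s]
    by simp
qed

lemma cov_mult_dg: "t \<noteq> 0 \<Longrightarrow> s \<noteq> 0 \<Longrightarrow> cov_mult (dg t, z) (dg s, w) = (dg (t * s), hil s t * z * w)"
  by (simp add: cov_mult_def dg_mult coc_dg)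

text \<open>The commutator of the lifts of \<open>dg s\<close> and \<open>dg c\<close> is the square
  of the symbol of s and c.\<close>

lemma center_dg:
  assumes c: "c \<noteq> 0" "z \<in> mu n" and s: "\<And>s. s \<noteq> 0 \<Longrightarrow> hil s c * hil s c = 1"
  shows "(dg c, z) \<in> group_center (tilde v n T1)"
proof -
  have "cov_mult (dg c, z) (dg t, w) = cov_mult (dg t, w) (dg c, z)" if t: "t \<noteq> 0" for t w
  proof -
    have "hil t c = hil c t" using s[OF t] hil_swap[OF t c(1)] hil_nz[OF t c(1)] by (metis mult_cancel_left)
    then show ?thesis using c t by (simp add: cov_mult_dg mult_ac)
  qed
  then have "cov_mult (dg c, z) (g, w) = cov_mult (g, w) (dg c, z)" if "g \<in> T1" for g w using T1_dg[OF that] by auto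
  then show ?thesis using c dg_T1 by (auto simp: group_center_def)
qed

lemma chi0_mult: "x \<in> A1 v n \<Longrightarrow> y \<in> A1 v n \<Longrightarrow> chi0 (cov_mult x y) = chi0 x * chi0 y"
  using extends by (simp add: extends_to_A1_def group_char_def)

lemma chi0_nz: "x \<in> A1 v n \<Longrightarrow> chi0 x \<noteq> 0"
  using extends by (simp add: extends_to_A1_def group_char_def)

lemma chi0_chi: "x \<in> group_center (tilde v n T1) \<Longrightarrow> chi0 x = chi x"
  using extends by (simp add: extends_to_A1_def)

lemma A1_dg: "t \<noteq> 0 \<Longrightarrow> int nb dvd v t \<Longrightarrow> z \<in> mu n \<Longrightarrow> (dg t, z) \<in> A1 v n"
  unfolding A1_def by blast

text \<open>The extension inherits genuineness from the representation: both descriptions of the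
  action of the central fibre are compared on one nonzero vector.\<close>

lemma chi0_mu: assumes z: "z \<in> mu n" shows "chi0 (dg 1, z) = \<epsilon> z"
proof -
  obtain x where x: "x \<in> V" "x \<noteq> 0" using rep_\<rho>(2) V_sub by (auto simp: complex_vector.subspace_def)
  have c: "(dg 1, z) \<in> group_center (tilde v n T1)" using z by (intro center_dg) auto
  have "ract \<rho> (dg 1, z) x = chi (dg 1, z) *\<^sub>C x" using central c x by (simp add: has_central_char_def)
  moreover have "ract \<rho> (dg 1, z) x = \<epsilon> z *\<^sub>C x" using gen x z by (simp add: genuine_def dg_one)
  ultimately have "chi (dg 1, z) *\<^sub>C x = \<epsilon> z *\<^sub>C x" by metis
  then have "chi (dg 1, z) = \<epsilon> z" using x(2) complex_vector.scale_right_imp_eq by blast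
  then show ?thesis using chi0_chi[OF c] by simp
qed

lemma chi0_dg: assumes "t \<noteq> 0" "int nb dvd v t" "z \<in> mu n" shows "chi0 (dg t, z) = \<epsilon> z * chi0 (dg t, 1)"
  using chi0_mult[of "(dg 1, z)" "(dg t, 1)"] assms A1_dg[of t 1] A1_dg[of 1 z]
  by (simp add: cov_mult_dg chi0_mu)

text \<open>The k-th extension on units. The index is not reduced modulo \<open>nb\<close>, so that
  changing the base extension to \<open>k0\<close> becomes the shift to k0 + k.\<close>

definition unit_char :: "nat \<Rightarrow> 'a \<Rightarrow> complex" where "unit_char k t = chi0 (dg t, 1) * theta t ^ (2 * k)"

lemma center_principal: "t - 1 \<in> fpow v 1 \<Longrightarrow> z \<in> mu n \<Longrightarrow> (dg t, z) \<in> group_center (tilde v n T1)"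
  using runit_one_plus[of "t - 1"] runit_nz by (intro center_dg) (auto simp: hil_principal_right)

lemma dg_Kc: "t - 1 \<in> fpow v (int j) \<Longrightarrow> j \<ge> 1 \<Longrightarrow> dg t \<in> Kc v j"
proof -
  assume t: "t - 1 \<in> fpow v (int j)" "j \<ge> 1"
  then have "t - 1 \<in> fpow v 1" using fpow_mono by force
  then have r: "runit t" using runit_one_plus[of "t - 1"] by simp
  have "inverse t - inverse 1 \<in> fpow v (int j)" using r t by (intro inverse_cong) auto
  then show ?thesis using t dg_K1[OF r] by (simp add: Kc_iff) (simp add: dg_mat2 mat_1_mat2 gcong_mat2)
qed

text \<open>Principal units give central torus elements, and \<open>theta\<close> is trivial on
  them. So there every \<open>unit_char k\<close> coincides with \<open>chi\<close> and inherits its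
  conductor.\<close>

lemma primitive_hom_unit_char: "primitive_hom (unit_char k) m"
proof -
  have 1: "unit_hom (unit_char k) m"
    unfolding unit_hom_def
  proof (intro conjI allI impI)
    show "unit_char k (s * t) = unit_char k s * unit_char k t" if st: "runit s" "runit t" for s t
    proof -
      have "chi0 (dg (s * t), 1) = chi0 (dg s, 1) * chi0 (dg t, 1)"
        using chi0_mult[of "(dg s, 1)" "(dg t, 1)"] st A1_dg[of s 1] A1_dg[of t 1]
        by (simp add: cov_mult_dg hil_units) (simp add: runit_def cov_mult_dg hil_units)
      then show ?thesis using unit_hom_mult[OF unit_hom_theta st] by (simp add: unit_char_def power_mult_distrib)
    qed
    show "unit_char k t \<noteq> 0" if "runit t" for t
      using that chi0_nz[OF A1_dg[of t 1]] unit_hom_nz[OF unit_hom_theta that] by (simp add: unit_char_def runit_def)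
    show "unit_char k t = 1" if t: "t - 1 \<in> fpow v (int m)" for t
    proof -
      have p: "t - 1 \<in> fpow v 1" using t m1 fpow_mono by force
      have "chi (dg t, 1) = 1"
        using prim center_principal[OF p] dg_Kc[OF t m1] by (simp add: primitive_mod_def trivial_on_level_def)
      then show ?thesis using chi0_chi[OF center_principal[OF p]] unit_hom_principal[OF unit_hom_theta, of t] p by (simp add: unit_char_def)
    qed
  qed
  moreover have "\<exists>y\<in>fpow v (int m - 1). unit_char k (1 + y) \<noteq> 1" if m2: "m \<ge> 2"
  proof -
    have "\<not> trivial_on_level v n chi (m - 1)" using prim m2 by (simp add: primitive_mod_def)
    then obtain g where g: "g \<in> Kc v (m - 1)" "(g, 1) \<in> group_center (tilde v n T1)" "chi (g, 1) \<noteq> 1"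
      by (auto simp: trivial_on_level_def)
    have "g \<in> T1" using g by (simp add: group_center_def)
    then obtain t where t: "t \<noteq> 0" "g = dg t" using T1_dg by blast
    have y: "t - 1 \<in> fpow v (int m - 1)"
      using g(1) m2 by (simp add: t Kc_iff dg_mat2 mat_1_mat2 gcong_mat2 of_nat_diff)
    then have "theta t = 1" using m2 fpow_mono[of "t - 1" "int m - 1" 1] by (intro unit_hom_principal[OF unit_hom_theta]) simp
    then show ?thesis using y g chi0_chi[OF g(2)] by (intro bexI[of _ "t - 1"]) (simp_all add: unit_char_def t)
  qed
  ultimately show ?thesis by (simp add: primitive_hom_def)
qed

lemma unit_hom_unit_char: "unit_hom (unit_char k) m" using primitive_hom_unit_char by (simp add: primitive_hom_def)

lemma unit_char_principal: "t - 1 \<in> fpow v 1 \<Longrightarrow> unit_char k t = unit_char j t"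
  using unit_hom_principal[OF unit_hom_theta, of t] by (simp add: unit_char_def)

lemma unit_char_distinct: assumes "i < nb" "k < nb" "i \<noteq> k" shows "\<exists>t. runit t \<and> unit_char i t \<noteq> unit_char k t"
proof -
  have *: "\<exists>t. runit t \<and> unit_char i t \<noteq> unit_char k t" if "i < k" "k < nb" for i k
  proof -
    have "\<not> nb dvd (k - i)" using that by (auto dest: dvd_imp_le)
    then have "\<not> n dvd 2 * (k - i)" by (simp add: dvd_double_nbar)
    then obtain t where t: "runit t" "theta t ^ (2 * (k - i)) \<noteq> 1" using theta_trivial_iff by blast
    have "unit_char k t = unit_char i t * theta t ^ (2 * (k - i))"
    proof -
      have "2 * k = 2 * i + 2 * (k - i)" using that by simp
      then show ?thesis by (metis unit_char_def mult.assoc power_add)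
    qed
    then show ?thesis using t unit_hom_nz[OF unit_hom_unit_char t(1)] by (intro exI[of _ t]) (metis mult_cancel_left1)
  qed
  show ?thesis using *[of i k] *[of k i] assms by (cases "i < k") force+
qed

subsection \<open>The inducing representation as a sum of lines\<close>

text \<open>A projective action only: the lifts (dg t, 1) multiply up to the symbol, as recorded in
  \<open>r_mult\<close>. On units it is an honest action.\<close>

definition r :: "'a \<Rightarrow> 'v \<Rightarrow> 'v" where "r t = ract \<rho> (dg t, 1)"

lemma T_act:
  "g \<in> carrier (tilde v n T1) \<Longrightarrow> x \<in> V \<Longrightarrow> ract \<rho> g x \<in> V"
  "g \<in> carrier (tilde v n T1) \<Longrightarrow> x \<in> V \<Longrightarrow> y \<in> V \<Longrightarrow> ract \<rho> g (x + y) = ract \<rho> g x + ract \<rho> g y"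
  "g \<in> carrier (tilde v n T1) \<Longrightarrow> x \<in> V \<Longrightarrow> ract \<rho> g (c *\<^sub>C x) = c *\<^sub>C ract \<rho> g x"
  "x \<in> V \<Longrightarrow> ract \<rho> (mat 1, 1) x = x"
  "g \<in> carrier (tilde v n T1) \<Longrightarrow> h \<in> carrier (tilde v n T1) \<Longrightarrow> x \<in> V \<Longrightarrow> ract \<rho> (cov_mult g h) x = ract \<rho> g (ract \<rho> h x)"
  using rep_\<rho>(1) unfolding representation_def tilde_mult tilde_one by blast+

lemma dg_carrier: "t \<noteq> 0 \<Longrightarrow> z \<in> mu n \<Longrightarrow> (dg t, z) \<in> carrier (tilde v n T1)"
  by (simp add: dg_T1)

lemma r_mem: "t \<noteq> 0 \<Longrightarrow> x \<in> V \<Longrightarrow> r t x \<in> V"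
  unfolding r_def by (rule T_act(1)[OF dg_carrier]) auto

lemma r_add: "t \<noteq> 0 \<Longrightarrow> x \<in> V \<Longrightarrow> y \<in> V \<Longrightarrow> r t (x + y) = r t x + r t y"
  unfolding r_def by (rule T_act(2)[OF dg_carrier]) auto

lemma r_scale: "t \<noteq> 0 \<Longrightarrow> x \<in> V \<Longrightarrow> r t (c *\<^sub>C x) = c *\<^sub>C r t x"
  unfolding r_def by (rule T_act(3)[OF dg_carrier]) auto

lemma V_0: "0 \<in> V" using V_sub by (simp add: complex_vector.subspace_def)

lemma r_0: "t \<noteq> 0 \<Longrightarrow> r t 0 = 0" using r_scale[OF _ V_0, of t 0] by simp

lemma r_sum: "t \<noteq> 0 \<Longrightarrow> (\<And>i. i \<in> A \<Longrightarrow> f i \<in> V) \<Longrightarrow> r t (sum f A) = (\<Sum>i\<in>A. r t (f i))"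
  by (induction A rule: infinite_finite_induct)
    (auto simp: r_0 r_add complex_vector.subspace_sum[OF V_sub])

lemma r_one: "x \<in> V \<Longrightarrow> r 1 x = x"
  unfolding r_def dg_one by (rule T_act(4))

lemma act_mult:
  "t \<noteq> 0 \<Longrightarrow> s \<noteq> 0 \<Longrightarrow> z \<in> mu n \<Longrightarrow> w \<in> mu n \<Longrightarrow> x \<in> V \<Longrightarrow>
    ract \<rho> (dg t, z) (ract \<rho> (dg s, w) x) = ract \<rho> (dg (t * s), hil s t * z * w) x"
  using T_act(5)[OF dg_carrier dg_carrier, of t z s w x] by (simp add: cov_mult_dg)

lemma act_z: "t \<noteq> 0 \<Longrightarrow> z \<in> mu n \<Longrightarrow> x \<in> V \<Longrightarrow> ract \<rho> (dg t, z) x = \<epsilon> z *\<^sub>C r t x"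
  using act_mult[of 1 t z 1 x] gen r_mem[of t x] by (simp add: genuine_def dg_one r_def)

lemma r_mult: "t \<noteq> 0 \<Longrightarrow> s \<noteq> 0 \<Longrightarrow> x \<in> V \<Longrightarrow> r t (r s x) = \<epsilon> (hil s t) *\<^sub>C r (t * s) x"
  using act_mult[of t s 1 1 x] act_z[of "t * s" "hil s t" x] hil(1) by (simp add: r_def)

lemma r_units: "runit t \<Longrightarrow> runit s \<Longrightarrow> x \<in> V \<Longrightarrow> r t (r s x) = r (t * s) x"
  by (simp add: r_mult runit_nz hil_units scaleC_one)

lemma r_central:
  assumes "c \<noteq> 0" "\<And>s. s \<noteq> 0 \<Longrightarrow> hil s c * hil s c = 1" "x \<in> V"
  shows "r c x = chi0 (dg c, 1) *\<^sub>C x"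
  using center_dg[OF assms(1) one_in_mu assms(2)] central assms(3) chi0_chi by (simp add: has_central_char_def r_def)

text \<open>Up to the factor q - 1 the projection onto the eigenspace of \<open>unit_char i\<close>
  under the integral torus. Residue representatives suffice, because principal units act by the same
  scalar that the coefficient removes.\<close>

definition E :: "nat \<Rightarrow> 'v \<Rightarrow> 'v" where
  "E i x = (\<Sum>a\<in>reps. if runit a then inverse (unit_char i a) *\<^sub>C r a x else 0)"

lemma V_scale: "x \<in> V \<Longrightarrow> c *\<^sub>C x \<in> V" using V_sub by (simp add: complex_vector.subspace_def)

lemma E_mem: "x \<in> V \<Longrightarrow> E i x \<in> V"
  unfolding E_def by (rule complex_vector.subspace_sum[OF V_sub]) (auto simp: V_0 V_scale r_mem runit_nz)

lemma E_residue_invariant: assumes "x \<in> V" shows "residue_invariant (\<lambda>a. if runit a then inverse (unit_char i a) *\<^sub>C r a x else 0)"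
  unfolding residue_invariant_def
proof (intro ballI impI)
  fix a b assume ab: "a - b \<in> fpow v 1"
  show "(if runit a then inverse (unit_char i a) *\<^sub>C r a x else 0) = (if runit b then inverse (unit_char i b) *\<^sub>C r b x else 0)"
  proof (cases "runit a")
    case True
    then have b: "runit b" using runit_cong ab by blast
    define c where "c = a / b"
    have c: "runit c" "a = c * b" using True b runit_nz[OF b] by (auto simp: c_def runit_divide)
    have "c - 1 = (a - b) / b" using runit_nz[OF b] by (simp add: c_def diff_divide_distrib)
    then have c1: "c - 1 \<in> fpow v 1" using ab b by (simp add: fpow_divide_unit)
    have "r a x = r c (r b x)" using c b assms by (simp add: r_units)
    also have "\<dots> = chi0 (dg c, 1) *\<^sub>C r b x"
      using c1 c b assms r_mem runit_nz by (intro r_central) (auto simp: hil_principal_right)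
    finally have "r a x = unit_char i c *\<^sub>C r b x" using unit_hom_principal[OF unit_hom_theta, of c] c1 by (simp add: unit_char_def)
    moreover have "unit_char i a = unit_char i c * unit_char i b" using c b unit_hom_mult[OF unit_hom_unit_char] by blast
    ultimately show ?thesis using True b unit_hom_nz[OF unit_hom_unit_char c(1)] by (simp add: scaleC_scaleC)
  next
    case False
    then show ?thesis using runit_cong[of b a] ab fpow_diff_commute by auto
  qed
qed

lemma E_eigen: assumes t: "runit t" and x: "x \<in> V" shows "r t (E i x) = unit_char i t *\<^sub>C E i x"
proof -
  have "r t (E i x) = (\<Sum>a\<in>reps. r t (if runit a then inverse (unit_char i a) *\<^sub>C r a x else 0))"
    unfolding E_def using t x by (intro r_sum) (auto simp: V_0 V_scale r_mem runit_nz)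
  also have "\<dots> = (\<Sum>a\<in>reps. unit_char i t *\<^sub>C (if runit (t * a) then inverse (unit_char i (t * a)) *\<^sub>C r (t * a) x else 0))"
  proof (rule sum.cong[OF refl])
    fix a assume a: "a \<in> reps"
    have ru: "runit (t * a) \<longleftrightarrow> runit a" using t by (simp add: runit_iff fpow_unit_cancel)
    show "r t (if runit a then inverse (unit_char i a) *\<^sub>C r a x else 0) =
      unit_char i t *\<^sub>C (if runit (t * a) then inverse (unit_char i (t * a)) *\<^sub>C r (t * a) x else 0)"
    proof (cases "runit a")
      case True
      then show ?thesis
        using t x ru unit_hom_mult[OF unit_hom_unit_char t True] unit_hom_nz[OF unit_hom_unit_char t]
        by (simp add: r_scale r_mem runit_nz r_units scaleC_scaleC)
    next
      case False
      then show ?thesis using ru t by (simp add: r_0 runit_nz)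
    qed
  qed
  also have "\<dots> = unit_char i t *\<^sub>C E i x"
    unfolding complex_vector.scale_sum_right[symmetric] E_def
    by (rule arg_cong[where f = "(*\<^sub>C) _"], rule sum_reps_scale[OF E_residue_invariant[OF x] t])
  finally show ?thesis .
qed

lemma nb_pos: "nb > 0" using nbar_pos n_ge2 by blast

lemma n_dvd_2nb: "n dvd 2 * nb" by (simp add: dvd_double_nbar)

text \<open>Summing over i gives a geometric series in the inverse square of theta(a). It vanishes
  unless that square is 1, and then \<open>dg a\<close> is central and acts by the scalar that its
  coefficient cancels. So the sum is a nonzero multiple of x, and some \<open>E i x\<close>
  survives.\<close>

lemma sum_E: assumes x: "x \<in> V" shows "\<exists>c. c \<noteq> 0 \<and> (\<Sum>i<nb. E i x) = c *\<^sub>C x"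
proof -
  let ?S = "{a \<in> reps. runit a \<and> theta a ^ 2 = 1}"
  have "(\<Sum>i<nb. E i x) = (\<Sum>a\<in>reps. \<Sum>i<nb. if runit a then inverse (unit_char i a) *\<^sub>C r a x else 0)"
    unfolding E_def by (rule sum.swap)
  also have "\<dots> = (\<Sum>a\<in>reps. if a \<in> ?S then of_nat nb *\<^sub>C x else 0)"
  proof (rule sum.cong[OF refl])
    fix a assume a: "a \<in> reps"
    show "(\<Sum>i<nb. if runit a then inverse (unit_char i a) *\<^sub>C r a x else 0) = (if a \<in> ?S then of_nat nb *\<^sub>C x else 0)"
    proof (cases "runit a")
      case True
      define \<omega> where "\<omega> = inverse (theta a ^ 2)"
      have tha: "theta a \<noteq> 0" using unit_hom_nz[OF unit_hom_theta True] .
      have "inverse (unit_char i a) = inverse (chi0 (dg a, 1)) * \<omega> ^ i" for i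
        by (simp add: unit_char_def \<omega>_def power_mult power_inverse)
      then have e: "(\<Sum>i<nb. if runit a then inverse (unit_char i a) *\<^sub>C r a x else 0) =
          (inverse (chi0 (dg a, 1)) * (\<Sum>i<nb. \<omega> ^ i)) *\<^sub>C r a x"
        using True by (simp add: complex_vector.scale_sum_left sum_distrib_left)
      show ?thesis
      proof (cases "theta a ^ 2 = 1")
        case th1: True
        then have h2: "hil \<pi> a * hil \<pi> a = 1" using theta_pow_eq1[OF True, of 2] by (simp add: power2_eq_square)
        have "hil s a * hil s a = 1" if s: "s \<noteq> 0" for s
        proof -
          obtain c where c: "runit c" "s = c * \<pi> powi v s" using unit_decomp[OF s] by blast
          have "hil s a = hil c a * hil (\<pi> powi v s) a"
            using hil_mult_left[of c "\<pi> powi v s" a] c pi_nz runit_nz True by simp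
          also have "\<dots> = hil \<pi> a powi v s" using c True pi_nz by (simp add: hil_units hil_powi_left runit_nz)
          finally show ?thesis using h2 by (simp flip: power_int_mult_distrib)
        qed
        then have "r a x = chi0 (dg a, 1) *\<^sub>C x" using x runit_nz[OF True] by (intro r_central)
        moreover have "\<omega> = 1" using th1 by (simp add: \<omega>_def)
        moreover have "chi0 (dg a, 1) \<noteq> 0" using chi0_nz[OF A1_dg[of a 1]] True by (simp add: runit_def)
        ultimately show ?thesis unfolding e using True a th1 by (simp add: scaleC_scaleC)
      next
        case False
        have "\<omega> \<noteq> 1" using False by (auto simp: \<omega>_def)
        moreover have "\<omega> ^ nb = 1"
        proof -
          have "theta a ^ (2 * nb) = 1" using theta_trivial_iff[of "2 * nb"] n_dvd_2nb True by blast
          then show ?thesis by (simp add: \<omega>_def power_inverse flip: power_mult)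
        qed
        ultimately have "(\<Sum>i<nb. \<omega> ^ i) = 0" using geometric_sum[of \<omega> nb] by simp
        then show ?thesis unfolding e using False by simp
      qed
    qed simp
  qed
  also have "\<dots> = (of_nat (card ?S) * of_nat nb) *\<^sub>C x"
    by (simp add: sum.If_cases Int_absorb1 scaleC_scaleC flip: complex_vector.scale_sum_left sum_constant_scaleR)
      (simp add: Collect_conj_eq Int_absorb1 complex_vector.sum_constant_scale scaleC_scaleC)
  finally have "(\<Sum>i<nb. E i x) = (of_nat (card ?S) * of_nat nb) *\<^sub>C x" .
  moreover have "rep 1 \<in> ?S"
    using rep[OF one_in_fpow_0] runit_cong[OF runit_one] unit_hom_cong[OF unit_hom_theta runit_one, of "rep 1"] unit_hom_one[OF unit_hom_theta]
    by auto
  then have "card ?S \<noteq> 0" by auto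
  ultimately show ?thesis using nb_pos by (intro exI[of _ "of_nat (card ?S) * of_nat nb"]) auto
qed

lemma unit_char_powi: "unit_char i t * (theta t powi (int k - int i))\<^sup>2 = unit_char k t" if "runit t"
proof -
  have "theta t powi (2 * int i) * theta t powi (2 * (int k - int i)) = theta t powi (2 * int k)"
    using unit_hom_nz[OF unit_hom_theta that] by (simp flip: power_int_add)
  moreover have "(theta t powi (int k - int i))\<^sup>2 = theta t powi (2 * (int k - int i))"
    by (metis mult.commute of_nat_numeral power_int_mult power_int_of_nat)
  moreover have "theta t powi (2 * int j) = theta t ^ (2 * j)" for j
    by (metis of_nat_mult of_nat_numeral power_int_of_nat)
  ultimately show ?thesis by (simp add: unit_char_def mult.assoc)
qed

lemma eps_powi: "z \<in> mu n \<Longrightarrow> \<epsilon> (z powi j) = \<epsilon> z powi j"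
  by (simp add: power_int_def eps_power eps_inverse mu_inverse)

text \<open>Powers of the uniformizer carry one eigenvector to eigenvectors of the other indices, a
  step of one in the exponent multiplying the character by the square of \<open>theta\<close>. The
  \<open>nb\<close>-th power is central, so \<open>nb\<close> lines span a stable subspace, which is
  everything by irreducibility.\<close>

lemma ex_lines:
  "\<exists>eigenvec. (\<forall>k<nb. eigenvec k \<in> V \<and> eigenvec k \<noteq> 0 \<and> (\<forall>t. runit t \<longrightarrow> r t (eigenvec k) = unit_char k t *\<^sub>C eigenvec k)) \<and>
     (\<forall>x\<in>V. \<exists>c. x = (\<Sum>k<nb. c k *\<^sub>C eigenvec k))"
proof -
  obtain x where x: "x \<in> V" "x \<noteq> 0" using rep_\<rho>(2) V_0 by auto
  obtain c where c: "c \<noteq> 0" "(\<Sum>i<nb. E i x) = c *\<^sub>C x" using sum_E[OF x(1)] by blast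
  have "\<exists>i<nb. E i x \<noteq> 0"
  proof (rule ccontr)
    assume "\<not> ?thesis"
    then have "c *\<^sub>C x = 0" unfolding c(2)[symmetric] by (intro sum.neutral) auto
    then show False using c x by simp
  qed
  then obtain i where i: "i < nb" "E i x \<noteq> 0" by blast
  define y where "y = E i x"
  have y: "y \<in> V" "y \<noteq> 0" "\<And>t. runit t \<Longrightarrow> r t y = unit_char i t *\<^sub>C y" using i E_mem E_eigen x by (auto simp: y_def)
  define P where "P j = \<pi> powi j" for j
  have P: "P j \<noteq> 0" "P (j + k) = P j * P k" "v (P j) = j" for j k
    using pi_nz by (auto simp: P_def power_int_add val_powi val_pi)
  \<comment> \<open>The shift by k - i is chosen so that the k-th vector has character
    \<open>unit_char k\<close>, starting from the index i of y.\<close>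
  define eigenvec where "eigenvec k = r (P (int k - int i)) y" for k
  have yV: "eigenvec k \<in> V" for k using r_mem P y by (simp add: eigenvec_def)
  have y0: "eigenvec k \<noteq> 0" for k
  proof
    let ?p = "P (int k - int i)"
    assume "eigenvec k = 0"
    then have "r (inverse ?p) (eigenvec k) = 0" using P by (simp add: r_0)
    moreover have "r (inverse ?p) (eigenvec k) = \<epsilon> (hil ?p (inverse ?p)) *\<^sub>C y"
      using r_mult[of "inverse ?p" ?p y] P y(1) by (simp add: eigenvec_def r_one)
    moreover have "\<epsilon> (hil ?p (inverse ?p)) \<noteq> 0" using P by (intro eps_nz hil(1)) auto
    ultimately show False using y by simp
  qed
  have yeig: "r t (eigenvec k) = unit_char k t *\<^sub>C eigenvec k" if t: "runit t" for t k
  proof -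
    let ?p = "P (int k - int i)"
    have t0: "t \<noteq> 0" using runit_nz t by blast
    have h: "hil ?p t \<in> mu n" "hil t ?p \<in> mu n" using hil(1) P t0 by auto
    have sw: "\<epsilon> (hil t ?p) * \<epsilon> (hil ?p t) = 1" using hil_swap[of t ?p] P t0 eps_mult[OF h(2,1)] by simp
    have A: "\<epsilon> (hil t ?p) *\<^sub>C r (?p * t) y = unit_char i t *\<^sub>C eigenvec k"
      using r_mult[of ?p t y] P t0 y t by (simp add: r_scale eigenvec_def)
    have "(\<epsilon> (hil ?p t) * \<epsilon> (hil t ?p)) *\<^sub>C r (?p * t) y = (\<epsilon> (hil ?p t) * unit_char i t) *\<^sub>C eigenvec k"
      by (simp only: scaleC_scaleC[symmetric] A)
    then have 1: "r (t * ?p) y = (\<epsilon> (hil ?p t) * unit_char i t) *\<^sub>C eigenvec k" using sw by (simp add: scaleC_one mult.commute)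
    have "r t (eigenvec k) = \<epsilon> (hil ?p t) *\<^sub>C r (t * ?p) y" using r_mult[of t ?p y] P t0 y by (simp add: eigenvec_def)
    also have "\<dots> = (unit_char i t * (\<epsilon> (hil ?p t))\<^sup>2) *\<^sub>C eigenvec k" by (simp add: 1 scaleC_scaleC power2_eq_square mult_ac)
    also have "\<epsilon> (hil ?p t) = theta t powi (int k - int i)"
      using pi_nz t0 by (simp add: P_def hil_powi_left eps_powi hil(1) theta_def)
    finally show ?thesis by (simp add: unit_char_powi[OF t])
  qed
  have move: "\<exists>c k'. k' < nb \<and> r t (eigenvec k) = c *\<^sub>C eigenvec k'" if t: "t \<noteq> 0" for t k
  proof -
    \<comment> \<open>The exponent of the uniformizer that t and the k-th vector together apply to
      y. Division by \<open>nb\<close> separates a central power from the new index k'.\<close>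
    define J where "J = int k - int i + v t"
    define s where "s = (J + int i) div int nb"
    define k' where "k' = nat ((J + int i) mod int nb)"
    have k': "k' < nb" "int k' = (J + int i) mod int nb" using nb_pos by (simp_all add: k'_def nat_less_iff)
    have J: "J = int nb * s + (int k' - int i)"
      unfolding k' s_def using mult_div_mod_eq[of "int nb" "J + int i"] by linarith
    obtain a where a: "runit a" "t = a * P (v t)" using unit_decomp[OF t] by (auto simp: P_def)
    have a0: "a \<noteq> 0" using runit_nz a by blast
    have cen: "hil s' (P (int nb * s)) * hil s' (P (int nb * s)) = 1" if s': "s' \<noteq> 0" for s'
    proof -
      have "hil s' (P (int nb * s)) = hil s' \<pi> powi (int nb * s)" using s' pi_nz by (simp add: P_def hil_powi_right)
      then have "hil s' (P (int nb * s)) * hil s' (P (int nb * s)) = hil s' \<pi> powi (int nb * s + int nb * s)"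
        using power_int_add[of "hil s' \<pi>" "int nb * s" "int nb * s"] hil_nz[OF s' pi_nz] by argo
      also have "\<dots> = 1"
      proof (rule mu_powi_period)
        show "hil s' \<pi> \<in> mu n" using hil(1) s' pi_nz by blast
        have "int n dvd int (2 * nb)" using n_dvd_2nb by presburger
        then show "int n dvd int nb * s + int nb * s" by (metis distrib_right dvd_mult2 mult_2 of_nat_add)
      qed
      finally show ?thesis .
    qed
    have "r (P (int nb * s)) (r (P (int k' - int i)) (r a y)) = (chi0 (dg (P (int nb * s)), 1) * unit_char i a) *\<^sub>C eigenvec k'"
      using r_central[OF P(1) cen, of "r (P (int k' - int i)) (r a y)"] y(3)[OF a(1)] y(1) P(1)
      by (simp add: r_mem a0 r_scale eigenvec_def scaleC_scaleC V_scale)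
    moreover have "\<exists>d. d \<noteq> 0 \<and> r (P (int nb * s)) (r (P (int k' - int i)) (r a y)) = d *\<^sub>C r (t * P (int k - int i)) y"
    proof -
      have e: "P (int nb * s) * (P (int k' - int i) * a) = t * P (int k - int i)"
      proof -
        have "P (int nb * s) * P (int k' - int i) = P (int k - int i + v t)" by (simp only: P(2)[symmetric] J[symmetric] J_def)
        then have "P (int nb * s) * (P (int k' - int i) * a) = P (int k - int i) * P (v t) * a" by (simp only: P(2) mult.assoc[symmetric])
        then show ?thesis by (subst a(2)) (simp add: mult_ac)
      qed
      have "r (P (int k' - int i)) (r a y) = \<epsilon> (hil a (P (int k' - int i))) *\<^sub>C r (P (int k' - int i) * a) y"
        using r_mult P a0 y by blast
      then have "r (P (int nb * s)) (r (P (int k' - int i)) (r a y)) =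
          (\<epsilon> (hil a (P (int k' - int i))) * \<epsilon> (hil (P (int k' - int i) * a) (P (int nb * s)))) *\<^sub>C r (t * P (int k - int i)) y"
        using r_mult[of "P (int nb * s)" "P (int k' - int i) * a" y] P(1) a0 y e
        by (simp add: r_scale r_mem scaleC_scaleC)
      moreover have "\<epsilon> (hil a (P (int k' - int i))) * \<epsilon> (hil (P (int k' - int i) * a) (P (int nb * s))) \<noteq> 0"
        using P a0 by (auto intro!: eps_nz hil(1))
      ultimately show ?thesis by blast
    qed
    ultimately obtain d where d: "d \<noteq> 0" "d *\<^sub>C r (t * P (int k - int i)) y = (chi0 (dg (P (int nb * s)), 1) * unit_char i a) *\<^sub>C eigenvec k'"
      by metis
    then have "r (t * P (int k - int i)) y = (inverse d * (chi0 (dg (P (int nb * s)), 1) * unit_char i a)) *\<^sub>C eigenvec k'"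
      by (metis left_inverse scaleC_one scaleC_scaleC)
    moreover have "r t (eigenvec k) = \<epsilon> (hil (P (int k - int i)) t) *\<^sub>C r (t * P (int k - int i)) y"
      unfolding eigenvec_def using r_mult t P y by blast
    ultimately show ?thesis using k' by (metis scaleC_scaleC)
  qed
  define U where "U = range (\<lambda>c. \<Sum>k<nb. c k *\<^sub>C eigenvec k)"
  have Usub: "complex_vector.subspace U"
    unfolding complex_vector.subspace_def
  proof (intro conjI ballI allI)
    show "0 \<in> U" unfolding U_def by (rule range_eqI[of _ _ "\<lambda>_. 0"]) simp
    show "a + b \<in> U" if ab: "a \<in> U" "b \<in> U" for a b
    proof -
      obtain f g where fg: "a = (\<Sum>k<nb. f k *\<^sub>C eigenvec k)" "b = (\<Sum>k<nb. g k *\<^sub>C eigenvec k)" using ab unfolding U_def by blast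
      show ?thesis unfolding U_def
        by (rule range_eqI[of _ _ "\<lambda>k. f k + g k"]) (simp add: fg sum.distrib scaleC_add_left)
    qed
    show "d *\<^sub>C a \<in> U" if aU: "a \<in> U" for a d
    proof -
      obtain f where f: "a = (\<Sum>k<nb. f k *\<^sub>C eigenvec k)" using aU unfolding U_def by blast
      show ?thesis unfolding U_def
        by (rule range_eqI[of _ _ "\<lambda>k. d * f k"]) (simp add: f complex_vector.scale_sum_right scaleC_scaleC)
    qed
  qed
  have yU: "eigenvec k \<in> U" if "k < nb" for k
    unfolding U_def
    by (rule range_eqI[of _ _ "\<lambda>j. if j = k then 1 else 0"])
      (use that in \<open>simp add: if_distrib[of "\<lambda>c. c *\<^sub>C _"] scaleC_one cong: if_cong\<close>)
  have UV: "U \<subseteq> V" unfolding U_def by (auto intro!: complex_vector.subspace_sum[OF V_sub] V_scale yV)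
  have inv: "ract \<rho> g a \<in> U" if g: "g \<in> carrier (tilde v n T1)" and a: "a \<in> U" for g a
  proof -
    obtain t z where tz: "g = (dg t, z)" "t \<noteq> 0" "z \<in> mu n"
    proof -
      obtain t0 z0 where "g = (t0, z0)" "t0 \<in> T1" "z0 \<in> mu n" using g by auto
      then show ?thesis using T1_dg[of t0] that by blast
    qed
    obtain f where f: "a = (\<Sum>k<nb. f k *\<^sub>C eigenvec k)" using a unfolding U_def by blast
    have "r t a = (\<Sum>k<nb. f k *\<^sub>C r t (eigenvec k))"
      unfolding f using tz yV by (simp add: r_sum V_scale r_scale)
    moreover have "f k *\<^sub>C r t (eigenvec k) \<in> U" for k
    proof -
      obtain c k' where "k' < nb" "r t (eigenvec k) = c *\<^sub>C eigenvec k'" using move[OF tz(2)] by blast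
      then show ?thesis using yU Usub by (simp add: complex_vector.subspace_def)
    qed
    ultimately have "r t a \<in> U" by (simp add: complex_vector.subspace_sum[OF Usub])
    then show ?thesis using act_z[of t z a] tz a UV Usub by (auto simp: complex_vector.subspace_def)
  qed
  have "U \<noteq> {0}" using yU[OF i(1)] y0 by blast
  then have "U = V" using rep_\<rho>(3) Usub UV inv unfolding reducible_def by blast
  then have "\<forall>x\<in>V. \<exists>c. x = (\<Sum>k<nb. c k *\<^sub>C eigenvec k)" unfolding U_def by blast
  then show ?thesis using yV y0 yeig by blast
qed

definition eigenvec :: "nat \<Rightarrow> 'v" where
  "eigenvec = (SOME eigenvec. (\<forall>k<nb. eigenvec k \<in> V \<and> eigenvec k \<noteq> 0 \<and> (\<forall>t. runit t \<longrightarrow> r t (eigenvec k) = unit_char k t *\<^sub>C eigenvec k)) \<and>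
     (\<forall>x\<in>V. \<exists>c. x = (\<Sum>k<nb. c k *\<^sub>C eigenvec k)))"

lemma eigenvec: "k < nb \<Longrightarrow> eigenvec k \<in> V" "k < nb \<Longrightarrow> eigenvec k \<noteq> 0"
  "k < nb \<Longrightarrow> runit t \<Longrightarrow> r t (eigenvec k) = unit_char k t *\<^sub>C eigenvec k" "x \<in> V \<Longrightarrow> \<exists>c. x = (\<Sum>k<nb. c k *\<^sub>C eigenvec k)"
  using someI_ex[OF ex_lines] unfolding eigenvec_def[symmetric] by blast+

text \<open>The unnormalized projection for j is applied. The ratio of two distinct characters
  factors through the residue field, so orthogonality leaves (q - 1) c j.\<close>

lemma eigenvec_indep: assumes "(\<Sum>k<nb. c k *\<^sub>C eigenvec k) = 0" "j < nb" shows "c j = 0"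
proof -
  have "(\<Sum>a\<in>reps. if runit a then inverse (unit_char j a) *\<^sub>C r a (\<Sum>k<nb. c k *\<^sub>C eigenvec k) else 0) = 0"
    unfolding assms(1) by (intro sum.neutral) (auto simp: r_0 runit_nz)
  moreover have "(\<Sum>a\<in>reps. if runit a then inverse (unit_char j a) *\<^sub>C r a (\<Sum>k<nb. c k *\<^sub>C eigenvec k) else 0) =
      (\<Sum>a\<in>reps. \<Sum>k<nb. (ext0 (\<lambda>t. unit_char k t * inverse (unit_char j t)) a * c k) *\<^sub>C eigenvec k)"
  proof (rule sum.cong[OF refl])
    fix a
    show "(if runit a then inverse (unit_char j a) *\<^sub>C r a (\<Sum>k<nb. c k *\<^sub>C eigenvec k) else 0) =
      (\<Sum>k<nb. (ext0 (\<lambda>t. unit_char k t * inverse (unit_char j t)) a * c k) *\<^sub>C eigenvec k)"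
    proof (cases "runit a")
      case True
      have "r a (\<Sum>k<nb. c k *\<^sub>C eigenvec k) = (\<Sum>k<nb. (c k * unit_char k a) *\<^sub>C eigenvec k)"
        using True eigenvec by (subst r_sum) (auto simp: V_scale r_scale runit_nz scaleC_scaleC)
      then show ?thesis using True by (simp add: complex_vector.scale_sum_right scaleC_scaleC ext0_def mult_ac)
    qed (simp add: ext0_def)
  qed
  also have "\<dots> = (\<Sum>k<nb. ((\<Sum>a\<in>reps. ext0 (\<lambda>t. unit_char k t * inverse (unit_char j t)) a) * c k) *\<^sub>C eigenvec k)"
    by (subst sum.swap) (simp add: complex_vector.scale_sum_left sum_distrib_right)
  also have "\<dots> = (\<Sum>k<nb. (if k = j then ((qc - 1) * c j) *\<^sub>C eigenvec j else 0))"
  proof (rule sum.cong[OF refl])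
    fix k assume k: "k \<in> {..<nb}"
    show "((\<Sum>a\<in>reps. ext0 (\<lambda>t. unit_char k t * inverse (unit_char j t)) a) * c k) *\<^sub>C eigenvec k =
      (if k = j then ((qc - 1) * c j) *\<^sub>C eigenvec j else 0)"
    proof (cases "k = j")
      case True
      have "ext0 (\<lambda>t. unit_char j t * inverse (unit_char j t)) a = (if runit a then 1 else 0)" for a
        using unit_hom_nz[OF unit_hom_unit_char] by (simp add: ext0_def)
      then show ?thesis using True by (simp add: sum_units)
    next
      case False
      let ?\<eta> = "\<lambda>t. unit_char k t * inverse (unit_char j t)"
      obtain t where t: "runit t" "unit_char k t \<noteq> unit_char j t" using unit_char_distinct[of k j] False k assms by auto
      have "unit_hom ?\<eta> 1"
        unfolding unit_hom_def
      proof (intro conjI allI impI)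
        show "?\<eta> (s * t) = ?\<eta> s * ?\<eta> t" if "runit s" "runit t" for s t
          using unit_hom_mult[OF unit_hom_unit_char that] by simp
        show "?\<eta> t \<noteq> 0" if "runit t" for t using unit_hom_nz[OF unit_hom_unit_char that] by simp
        show "?\<eta> t = 1" if "t - 1 \<in> fpow v (int 1)" for t
        proof -
          have "runit t" using that runit_one_plus[of "t - 1"] by simp
          then show ?thesis using unit_char_principal[of t k j] unit_hom_nz[OF unit_hom_unit_char] that by simp
        qed
      qed
      moreover have "?\<eta> t \<noteq> 1" using t unit_hom_nz[OF unit_hom_unit_char t(1)] by (simp add: field_simps)
      ultimately show ?thesis using False sum_ext0[OF _ t(1)] by simp
    qed
  qed
  also have "\<dots> = ((qc - 1) * c j) *\<^sub>C eigenvec j" using assms(2) by simp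
  finally show ?thesis using eigenvec(2)[OF assms(2)] qc_nz by simp
qed

end

section \<open>Iwasawa decomposition and the filtration by levels\<close>

context tame_field
begin

text \<open>The integral factor gets a lower row proportional to that of g, divided by an entry of
  least valuation; then g times its inverse is upper triangular.\<close>

lemma iwasawa: assumes "g \<in> SL2" shows "\<exists>b\<in>B1. \<exists>k\<in>K1 v. g = b ** k"
proof -
  obtain a b c d where G: "g = mat2 a b c d" using mat2_cases .
  have det: "a * d - b * c = 1" using assms by (simp add: G)
  have "\<exists>k\<in>K1 v. (g ** adj2 k)$2$1 = 0"
  proof (cases "c \<noteq> 0 \<and> (d = 0 \<or> v c \<le> v d)")
    case True
    then have "d / c \<in> fpow v 0" by (cases "d = 0") (auto simp: fpow_def val_divide)
    then show ?thesis using True by (intro bexI[of _ "mat2 0 (-1) 1 (d / c)"]) (auto simp: G K1_mat2)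
  next
    case False
    then have "d \<noteq> 0" using det by auto
    moreover have "c / d \<in> fpow v 0" using False \<open>d \<noteq> 0\<close> by (cases "c = 0") (auto simp: fpow_def val_divide)
    ultimately show ?thesis by (intro bexI[of _ "mat2 1 0 (c / d) 1"]) (auto simp: G K1_mat2)
  qed
  then obtain k where k: "k \<in> K1 v" "(g ** adj2 k)$2$1 = 0" by blast
  have "g ** adj2 k \<in> B1" using k assms adj2(3)[OF SL2_K1[OF k(1)]] by (simp add: B1_def SL2_mult)
  moreover have "g = (g ** adj2 k) ** k" using adj2(2)[OF SL2_K1[OF k(1)]] by (simp flip: matrix_mul_assoc)
  ultimately show ?thesis using k by blast
qed

text \<open>The top layer equals minus a vector of lower level, and \<open>new_layer_inter\<close>
  shows that such a vector is zero; the induction peels off layers from above.\<close>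

lemma model_indep:
  assumes "finite L" "L \<subseteq> {m<..}" "m \<ge> 1" "A \<in> level_space u m" "\<And>l. l \<in> L \<Longrightarrow> F l \<in> new_layer u l" "A + (\<Sum>l\<in>L. F l) = 0"
  shows "A = 0 \<and> (\<forall>l\<in>L. F l = 0)"
  using assms
proof (induction L rule: finite_linorder_max_induct)
  case (insert b L)
  have b: "b \<ge> 2" "b > m" using insert by auto
  have S: "A + (\<Sum>l\<in>L. F l) \<in> level_space u (b - 1)"
  proof (intro stab_add[OF stab_level_space] stab_sum[OF stab_level_space])
    show "A \<in> level_space u (b - 1)" using insert.prems(3) b by (auto intro: level_space_mono)
    show "F l \<in> level_space u (b - 1)" if "l \<in> L" for l
    proof -
      have "F l \<in> level_space u l" using insert.prems(4)[of l] that by (simp add: new_layer_def)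
      then show ?thesis using insert.hyps(2) that by (elim level_space_mono) fastforce
    qed
  qed
  have bL: "b \<notin> L" using insert.hyps by auto
  have "A + (F b + (\<Sum>l\<in>L. F l)) = 0" using insert.prems(5) unfolding sum.insert[OF insert.hyps(1) bL] .
  then have Fb: "F b = 0 - (A + (\<Sum>l\<in>L. F l))" unfolding eq_diff_eq by (simp only: add_ac)
  have "F b \<in> level_space u (b - 1)" unfolding Fb by (intro stab_diff[OF stab_level_space] stab_0[OF stab_level_space] S)
  then have F0: "F b = 0" using new_layer_inter insert.prems(4) b by blast
  then have e: "A + (\<Sum>l\<in>L. F l) = 0" using Fb by (metis diff_0 neg_equal_0_iff_equal)
  have "A = 0 \<and> (\<forall>l\<in>L. F l = 0)"
    by (rule insert.IH[OF _ insert.prems(2,3) _ e]) (use insert.prems in blast)+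
  then show ?case using F0 by blast
qed simp

lemma model_span:
  assumes u: "unit_hom u m" and m: "m \<ge> 1" and F: "F \<in> level_space u L" and L: "L \<ge> m"
  shows "\<exists>A\<in>level_space u m. \<exists>f. (\<forall>l\<in>{m<..L}. f l \<in> new_layer u l) \<and> F = A + (\<Sum>l\<in>{m<..L}. f l)"
  using L F
proof (induction L arbitrary: F rule: dec_induct)
  case base
  then show ?case by (intro bexI[of _ F]) auto
next
  case (step L)
  have "unit_hom u (Suc L - 1)" using unit_hom_mono[OF u] step by simp
  then obtain F' B where B: "F' \<in> level_space u L" "B \<in> new_layer u (Suc L)" "F = F' + B"
    using level_space_decomp[of u "Suc L" F] step m by auto
  obtain A f where A: "A \<in> level_space u m" "\<forall>l\<in>{m<..L}. f l \<in> new_layer u l" "F' = A + (\<Sum>l\<in>{m<..L}. f l)"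
    using step.IH[OF B(1)] by blast
  have e: "{m<..Suc L} = insert (Suc L) {m<..L}" using step by auto
  have "(\<Sum>l\<in>{m<..L}. (f(Suc L := B)) l) = (\<Sum>l\<in>{m<..L}. f l)" by (rule sum.cong) auto
  then have "F = A + (\<Sum>l\<in>{m<..Suc L}. (f(Suc L := B)) l)" unfolding e B(3) A(3) by (simp add: add_ac)
  moreover have "\<forall>l\<in>{m<..Suc L}. (f(Suc L := B)) l \<in> new_layer u l" using A(2) B(2) by auto
  ultimately show ?case using A(1) by blast
qed

lemma stab_union: "stab {F. \<exists>j\<ge>1. F \<in> level_space u j}"
  unfolding stab_def complex_vector.subspace_def
proof (intro conjI ballI allI impI)
  show "0 \<in> {F. \<exists>j\<ge>1. F \<in> level_space u j}" using stab_0[OF stab_level_space] by blast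
  show "F + G \<in> {F. \<exists>j\<ge>1. F \<in> level_space u j}" if FG: "F \<in> {F. \<exists>j\<ge>1. F \<in> level_space u j}" "G \<in> {F. \<exists>j\<ge>1. F \<in> level_space u j}" for F G
  proof -
    obtain i j where ij: "i \<ge> 1" "F \<in> level_space u i" "G \<in> level_space u j" using FG by auto
    have "F + G \<in> level_space u (max i j)"
      using level_space_mono[OF ij(2), of "max i j"] level_space_mono[OF ij(3), of "max i j"] by (intro stab_add[OF stab_level_space]) auto
    then show ?thesis using ij by (intro CollectI exI[of _ "max i j"]) auto
  qed
  show "c *\<^sub>C F \<in> {F. \<exists>j\<ge>1. F \<in> level_space u j}" if "F \<in> {F. \<exists>j\<ge>1. F \<in> level_space u j}" for c F
    using that stab_scale[OF stab_level_space] by blast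
  show "F g = 0" if "F \<in> {F. \<exists>j\<ge>1. F \<in> level_space u j}" "g \<notin> K1 v" for F g using that mpsD(1) by blast
  show "Rt k F \<in> {F. \<exists>j\<ge>1. F \<in> level_space u j}" if "k \<in> K1 v" "F \<in> {F. \<exists>j\<ge>1. F \<in> level_space u j}" for k F
    using that stab_Rt[OF stab_level_space] by blast
qed

end

context genuine_field
begin

lemma V_ind_iff: "f \<in> rspace (V_ind v n \<psi>) \<longleftrightarrow> (\<forall>x. x \<notin> K1 v \<times> mu n \<longrightarrow> f x = 0) \<and>
    (\<forall>h\<in>(B1 \<inter> K1 v) \<times> mu n. \<forall>x\<in>K1 v \<times> mu n. f (cov_mult h x) = \<psi> (torus_part h) * f x) \<and>
    (\<exists>j\<ge>1. \<forall>k\<in>Kc v j. \<forall>x\<in>K1 v \<times> mu n. f (cov_mult x (k, 1)) = f x)"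
proof -
  have KK: "K1 v \<inter> Kc v j = Kc v j" for j by (auto simp: Kc_iff)
  show ?thesis unfolding V_ind_def ind_def inflate_def char_rep_def by (simp add: KK)
qed

lemma restricts_to_char_ext:
  assumes "restricts_to \<psi> u"
  shows "restricts_to (char_ext v \<pi> n \<psi> k) (\<lambda>t. u t * theta t ^ (2 * k))"
  unfolding restricts_to_def
proof (intro allI impI)
  fix t z :: 'a assume t: "runit t" and z: "z \<in> mu n"
  have h: "hil \<pi> t ^ (2 * k) \<in> mu n" using t pi_nz by (simp add: mu_power hil(1) runit_nz)
  have "char_ext v \<pi> n \<psi> k (dg t, z) = \<psi> (dg t, hil \<pi> t ^ (2 * k) * z)"
    using t by (simp add: char_ext_def Let_def dg_mat2 runit_def)
  also have "\<dots> = \<epsilon> (hil \<pi> t ^ (2 * k) * z) * u t"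
    using assms t mu_mult[OF h z] by (simp add: restricts_to_def)
  also have "\<epsilon> (hil \<pi> t ^ (2 * k) * z) = theta t ^ (2 * k) * \<epsilon> z" using eps_mult[OF h z] theta_pow[OF t] by simp
  finally show "char_ext v \<pi> n \<psi> k (dg t, z) = \<epsilon> z * (u t * theta t ^ (2 * k))" by simp
qed

lemma restricts_to_unit: "restricts_to \<psi> u \<Longrightarrow> runit t \<Longrightarrow> \<psi> (dg t, 1) = u t"
  by (simp add: restricts_to_def)

lemma T1_K1: "h \<in> T1 \<inter> K1 v \<longleftrightarrow> (\<exists>t. runit t \<and> h = dg t)"
proof
  assume h: "h \<in> T1 \<inter> K1 v"
  then have "h \<in> B1 \<inter> K1 v" by (simp add: T1_def B1_def)
  then obtain t x where t: "runit t" "h = nu x ** dg t" using B1_K1 by blast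
  then have "x * inverse t = 0" using h by (simp add: T1_def nu_def dg_mat2)
  then show "\<exists>t. runit t \<and> h = dg t" using t runit_nz[OF t(1)] by (intro exI[of _ t]) (simp add: nu_def dg_mat2)
next
  assume "\<exists>t. runit t \<and> h = dg t"
  then obtain t where t: "runit t" "h = dg t" by blast
  then show "h \<in> T1 \<inter> K1 v" using dg_K1[OF t(1)] by (simp add: T1_def SL2_K1) (simp add: dg_mat2)
qed

lemma quadratic_iff: "restricts_to \<psi> u \<Longrightarrow> quadratic_on_units v \<psi> \<longleftrightarrow> (\<forall>t. runit t \<longrightarrow> u t * u t = 1)"
  unfolding quadratic_on_units_def Ball_def T1_K1 power2_eq_square by (auto simp: restricts_to_unit)

lemma inverse_iff: "restricts_to \<phi> u \<Longrightarrow> restricts_to \<psi> u' \<Longrightarrow> inverse_on_units v \<phi> \<psi> \<longleftrightarrow> (\<forall>t. runit t \<longrightarrow> u t * u' t = 1)"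
  unfolding inverse_on_units_def Ball_def T1_K1 by (auto simp: restricts_to_unit)

lemma theta_mod: "runit t \<Longrightarrow> x mod nb = y mod nb \<Longrightarrow> theta t ^ (2 * x) = theta t ^ (2 * y)"
proof -
  assume t: "runit t" and xy: "x mod nb = y mod nb"
  have "n dvd 2 * nb" by (simp add: dvd_double_nbar)
  then have p: "theta t ^ (2 * nb) = 1" using theta_trivial_iff t by blast
  have "theta t ^ (2 * x) = theta t ^ (2 * (x mod nb))" for x
  proof -
    have "2 * x = 2 * nb * (x div nb) + 2 * (x mod nb)" by (metis distrib_left mult.assoc mult_div_mod_eq)
    then have "theta t ^ (2 * x) = (theta t ^ (2 * nb)) ^ (x div nb) * theta t ^ (2 * (x mod nb))"
      by (simp only: power_add power_mult)
    then show ?thesis by (simp add: p)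
  qed
  then show ?thesis using xy by metis
qed

lemma theta_double_trivial: "(\<forall>t. runit t \<longrightarrow> theta t ^ (2 * e) = 1) \<longleftrightarrow> nb dvd e"
  by (simp add: theta_trivial_iff dvd_double_nbar)

end

context principal_datum
begin

abbreviation ch where "ch k \<equiv> char_ext v \<pi> n chi0 k"

lemma restricts_chi0: "restricts_to chi0 (unit_char 0)"
  unfolding restricts_to_def
proof (intro allI impI)
  fix t z :: 'a assume "runit t" "z \<in> mu n"
  then show "chi0 (dg t, z) = \<epsilon> z * unit_char 0 t" using chi0_dg[of t z] by (simp add: unit_char_def runit_def)
qed

lemma restricts_ch: "restricts_to (ch k) (unit_char k)"
  using restricts_to_char_ext[OF restricts_chi0, of k] by (simp add: unit_char_def[abs_def])

abbreviation smooth_model where "smooth_model k \<equiv> {F. \<exists>j\<ge>1. F \<in> level_space (unit_char k) j}"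

lemma V_ch: "V_ind v n (ch k) = model_rep (smooth_model k)" "l \<ge> 1 \<Longrightarrow> V_fixed v n (ch k) l = model_rep (level_space (unit_char k) l)"
  using V_eq_model_rep[OF restricts_ch unit_hom_unit_char] by auto

subsection \<open>Restriction of the induced representation to the maximal compact subgroup\<close>

abbreviation Ind where "Ind \<equiv> ind v n SL2 B1 (inflate \<rho>)"

lemma Kc_SL2: "SL2 \<inter> Kc v j = Kc v j" by (auto simp: Kc_iff SL2_K1)

lemma Ind_iff: "f \<in> rspace Ind \<longleftrightarrow> (\<forall>x. x \<notin> SL2 \<times> mu n \<longrightarrow> f x = 0) \<and> (\<forall>x\<in>SL2 \<times> mu n. f x \<in> V) \<and>
    (\<forall>h\<in>B1 \<times> mu n. \<forall>x\<in>SL2 \<times> mu n. f (cov_mult h x) = ract \<rho> (torus_part h) (f x)) \<and>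
    (\<exists>j\<ge>1. \<forall>k\<in>Kc v j. \<forall>x\<in>SL2 \<times> mu n. f (cov_mult x (k, 1)) = f x)"
  unfolding ind_def inflate_def by (simp add: Kc_SL2)

lemma Ind_act: "ract Ind g f = (\<lambda>x. if x \<in> SL2 \<times> mu n then f (cov_mult x g) else 0)"
  by (rule ext) (simp add: ind_def)

lemma B1_form: "h \<in> B1 \<times> mu n \<Longrightarrow> \<exists>a b z. h = (mat2 a b 0 (inverse a), z) \<and> a \<noteq> 0 \<and> z \<in> mu n"
proof -
  assume h: "h \<in> B1 \<times> mu n"
  obtain a b c d where G: "fst h = mat2 a b c d" using mat2_cases .
  have "mat2 a b c d \<in> B1" "snd h \<in> mu n" using h by (auto simp flip: G)
  then have e: "c = 0" "a * d = 1" "snd h \<in> mu n" by (auto simp: B1_def)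
  then have "a \<noteq> 0" "d = inverse a" by (auto simp: inverse_unique)
  then show ?thesis using e G by (intro exI[of _ a] exI[of _ b] exI[of _ "snd h"]) (auto simp: prod_eq_iff)
qed

lemma torus_part_mem: "h \<in> B1 \<times> mu n \<Longrightarrow> torus_part h \<in> carrier (tilde v n T1)"
  by (drule B1_form) (auto simp: torus_part_def dg_T1)

text \<open>On upper triangular matrices \<open>Xf\<close> is the lower right entry, so the cocycle
  depends on the diagonals only.\<close>

lemma torus_part_mult: "h \<in> B1 \<times> mu n \<Longrightarrow> k \<in> B1 \<times> mu n \<Longrightarrow> torus_part (cov_mult h k) = cov_mult (torus_part h) (torus_part k)"
  by (drule B1_form, drule B1_form) (auto simp: torus_part_def cov_mult_def cocycle_def dg_mat2 Xf_mat2 mult.commute)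

lemma B1_mult: "h \<in> B1 \<times> mu n \<Longrightarrow> k \<in> B1 \<times> mu n \<Longrightarrow> cov_mult h k \<in> B1 \<times> mu n"
proof -
  assume a: "h \<in> B1 \<times> mu n" "k \<in> B1 \<times> mu n"
  then have "cov_mult h k \<in> SL2 \<times> mu n" by (intro cov_mult_SL2) (auto simp: B1_def)
  moreover have "(fst h ** fst k)$2$1 = 0" using B1_form[OF a(1)] B1_form[OF a(2)] by auto
  ultimately show ?thesis by (auto simp: B1_def cov_mult_def)
qed

lemma iwasawa_cover: "x \<in> SL2 \<times> mu n \<Longrightarrow> \<exists>h\<in>B1 \<times> mu n. \<exists>\<kappa>\<in>K1 v \<times> mu n. x = cov_mult h \<kappa>"
proof -
  assume x: "x \<in> SL2 \<times> mu n"
  obtain b k where bk: "b \<in> B1" "k \<in> K1 v" "fst x = b ** k" using iwasawa[of "fst x"] x by auto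
  have c: "coc b k \<in> mu n" using bk by (intro coc_mu) (auto simp: B1_def SL2_K1)
  have "x = cov_mult (b, snd x / coc b k) (k, 1)" using bk mu_nz[OF c] by (simp add: cov_mult_def prod_eq_iff)
  moreover have "snd x / coc b k \<in> mu n" using x c mu_divide by auto
  ultimately show ?thesis using bk by (intro bexI[of _ "(b, snd x / coc b k)"] bexI[of _ "(k, 1)"]) auto
qed

definition co :: "'v \<Rightarrow> nat \<Rightarrow> complex" where "co x = (SOME c. x = (\<Sum>k<nb. c k *\<^sub>C eigenvec k))"

lemma co: "x \<in> V \<Longrightarrow> x = (\<Sum>k<nb. co x k *\<^sub>C eigenvec k)"
  unfolding co_def by (rule someI_ex[OF eigenvec(4)])

lemma co_eq: assumes "x \<in> V" "x = (\<Sum>k<nb. c k *\<^sub>C eigenvec k)" "k < nb" shows "co x k = c k"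
proof -
  have "(\<Sum>k<nb. (co x k - c k) *\<^sub>C eigenvec k) = x - x"
    using co[OF assms(1)] assms(2) by (simp add: complex_vector.scale_left_diff_distrib sum_subtractf)
  then show ?thesis using eigenvec_indep[of "\<lambda>k. co x k - c k" k] assms by simp
qed

lemma co_add: "x \<in> V \<Longrightarrow> y \<in> V \<Longrightarrow> k < nb \<Longrightarrow> co (x + y) k = co x k + co y k"
proof -
  assume a: "x \<in> V" "y \<in> V" "k < nb"
  have "x + y = (\<Sum>k<nb. co x k *\<^sub>C eigenvec k) + (\<Sum>k<nb. co y k *\<^sub>C eigenvec k)" using co a by metis
  then have "x + y = (\<Sum>k<nb. (co x k + co y k) *\<^sub>C eigenvec k)" by (simp add: sum.distrib scaleC_add_left)
  then show ?thesis by (rule co_eq[OF complex_vector.subspace_add[OF V_sub a(1,2)] _ a(3)])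
qed

lemma co_scale: "x \<in> V \<Longrightarrow> k < nb \<Longrightarrow> co (c *\<^sub>C x) k = c * co x k"
proof -
  assume a: "x \<in> V" "k < nb"
  have "c *\<^sub>C x = c *\<^sub>C (\<Sum>k<nb. co x k *\<^sub>C eigenvec k)" using co a by metis
  then have "c *\<^sub>C x = (\<Sum>k<nb. (c * co x k) *\<^sub>C eigenvec k)" by (simp add: complex_vector.scale_sum_right scaleC_scaleC)
  then show ?thesis by (rule co_eq[OF V_scale[OF a(1)] _ a(2)])
qed

lemma lines_mem: "(\<Sum>k<nb. c k *\<^sub>C eigenvec k) \<in> V"
  by (intro complex_vector.subspace_sum[OF V_sub] V_scale eigenvec) auto

lemma torus_lines:
  assumes h: "h \<in> (B1 \<inter> K1 v) \<times> mu n"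
  shows "ract \<rho> (torus_part h) (\<Sum>k<nb. c k *\<^sub>C eigenvec k) = (\<Sum>k<nb. (ch k (torus_part h) * c k) *\<^sub>C eigenvec k)"
proof -
  obtain b z where hz: "h = (b, z)" "b \<in> B1 \<inter> K1 v" "z \<in> mu n" using h by blast
  obtain t y where ty: "runit t" "b = nu y ** dg t" using hz B1_K1 by blast
  have tp: "torus_part h = (dg t, z)" by (simp add: hz torus_part_def ty) (simp add: nu_def dg_mat2)
  have "r t (\<Sum>k<nb. c k *\<^sub>C eigenvec k) = (\<Sum>k<nb. (c k * unit_char k t) *\<^sub>C eigenvec k)"
    using ty eigenvec by (subst r_sum) (auto simp: V_scale r_scale runit_nz scaleC_scaleC)
  moreover have "ch k (dg t, z) = \<epsilon> z * unit_char k t" for k using restricts_ch ty hz by (simp add: restricts_to_def)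
  ultimately show ?thesis unfolding tp using act_z[OF runit_nz[OF ty(1)] hz(3) lines_mem]
    by (simp add: complex_vector.scale_sum_right scaleC_scaleC mult_ac)
qed

text \<open>Restriction to the compact part followed by coordinates in the eigenlines; by
  \<open>torus_lines\<close> the k-th coordinate transforms under the integral Borel through
  \<open>ch k\<close>.\<close>

definition split_lines :: "('a cov \<Rightarrow> 'v) \<Rightarrow> nat \<Rightarrow> 'a cov \<Rightarrow> complex" where
  "split_lines f = (\<lambda>k. if k < nb then (\<lambda>x. if x \<in> K1 v \<times> mu n then co (f x) k else 0) else 0)"

abbreviation SV where "SV \<equiv> rep_dsum {..<nb} (\<lambda>k. V_ind v n (ch k))"

lemma SV_iff: "F \<in> rspace SV \<longleftrightarrow> (\<forall>k<nb. F k \<in> rspace (V_ind v n (ch k))) \<and> (\<forall>k. \<not> k < nb \<longrightarrow> F k = 0)"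
proof -
  have "finite {k. F k \<noteq> 0}" if "\<forall>k. \<not> k < nb \<longrightarrow> F k = 0"
    by (rule finite_subset[of _ "{..<nb}"]) (use that in auto)
  then show ?thesis by (auto simp: rep_dsum_def)
qed

lemma SV_act: "ract SV g F = (\<lambda>k. if k < nb then kact g (F k) else 0)"
  by (simp add: rep_dsum_def V_ract fun_eq_iff)

lemma K_SL2: "x \<in> K1 v \<times> mu n \<Longrightarrow> x \<in> SL2 \<times> mu n" using SL2_K1 by auto

lemma B_SL2: "x \<in> B1 \<times> mu n \<Longrightarrow> x \<in> SL2 \<times> mu n" by (auto simp: B1_def)

lemma rep_hom_split_lines: "rep_hom KT Ind SV split_lines"
  unfolding rep_hom_def
proof (intro conjI ballI allI)
  fix f assume f: "f \<in> rspace Ind"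
  note f' = f[unfolded Ind_iff]
  have fV: "f x \<in> V" if "x \<in> SL2 \<times> mu n" for x using f' that by blast
  show "split_lines f \<in> rspace SV"
    unfolding SV_iff V_ind_iff
  proof (intro conjI allI impI ballI)
    fix k assume k: "k < nb"
    show "split_lines f k x = 0" if "x \<notin> K1 v \<times> mu n" for x using that by (auto simp: split_lines_def)
    show "split_lines f k (cov_mult h x) = ch k (torus_part h) * split_lines f k x"
      if h: "h \<in> (B1 \<inter> K1 v) \<times> mu n" and x: "x \<in> K1 v \<times> mu n" for h x
    proof -
      have hK: "h \<in> K1 v \<times> mu n" "h \<in> B1 \<times> mu n" using h by auto
      have "f (cov_mult h x) = ract \<rho> (torus_part h) (f x)" using f' hK K_SL2[OF x] by blast
      also have "\<dots> = ract \<rho> (torus_part h) (\<Sum>k<nb. co (f x) k *\<^sub>C eigenvec k)" using co[OF fV[OF K_SL2[OF x]]] by simp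
      also have "\<dots> = (\<Sum>k<nb. (ch k (torus_part h) * co (f x) k) *\<^sub>C eigenvec k)" by (rule torus_lines[OF h])
      finally have "co (f (cov_mult h x)) k = ch k (torus_part h) * co (f x) k"
        using fV[OF K_SL2[OF cov_mult_K1[OF hK(1) x]]] k by (intro co_eq) auto
      then show ?thesis using k x cov_mult_K1[OF hK(1) x] by (simp add: split_lines_def)
    qed
    obtain j where j: "j \<ge> 1" "\<forall>k\<in>Kc v j. \<forall>x\<in>SL2 \<times> mu n. f (cov_mult x (k, 1)) = f x" using f' by blast
    have "split_lines f k (cov_mult x (k', 1)) = split_lines f k x" if "k' \<in> Kc v j" "x \<in> K1 v \<times> mu n" for k' x
    proof -
      have "(k', 1) \<in> K1 v \<times> mu n" using that by (simp add: Kc_iff)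
      then have "cov_mult x (k', 1) \<in> K1 v \<times> mu n" by (rule cov_mult_K1[OF that(2)])
      moreover have "f (cov_mult x (k', 1)) = f x" using j(2) that K_SL2 by blast
      ultimately show ?thesis using that(2) by (simp add: split_lines_def)
    qed
    then show "\<exists>j\<ge>1. \<forall>k'\<in>Kc v j. \<forall>x\<in>K1 v \<times> mu n. split_lines f k (cov_mult x (k', 1)) = split_lines f k x" using j by blast
  qed (simp add: split_lines_def)
  show "split_lines (c *\<^sub>C f) = c *\<^sub>C split_lines f" for c
    using fV[OF K_SL2] by (auto simp: split_lines_def fun_eq_iff co_scale scaleC_fun_def[of c f] scaleC_fun_def[of c "\<lambda>k. _ k"] scaleC_complex_def)
  fix f' assume g: "f' \<in> rspace Ind"
  have "f' x \<in> V" if "x \<in> K1 v \<times> mu n" for x using g[unfolded Ind_iff] K_SL2[OF that] by blast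
  then have "co (f x + f' x) k = co (f x) k + co (f' x) k" if "x \<in> K1 v \<times> mu n" "k < nb" for x k
    using that fV[OF K_SL2] by (intro co_add) auto
  then show "split_lines (f + f') = split_lines f + split_lines f'" by (auto simp: split_lines_def fun_eq_iff)
next
  fix g f assume g: "g \<in> carrier KT" and f: "f \<in> rspace Ind"
  have "g \<in> K1 v \<times> mu n" using g by simp
  then show "split_lines (ract Ind g f) = ract SV g (split_lines f)"
    using cov_mult_K1[of _ g] K_SL2 unfolding SV_act Ind_act by (auto simp: split_lines_def kact_def fun_eq_iff)
qed

text \<open>The coordinates determine the function over \<open>K1 v\<close>, and the Iwasawa
  decomposition with Borel equivariance determines it everywhere else.\<close>

lemma split_lines_inj: "inj_on split_lines (rspace Ind)"
proof (rule inj_onI)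
  fix f f' assume a: "f \<in> rspace Ind" "f' \<in> rspace Ind" "split_lines f = split_lines f'"
  note F = a(1)[unfolded Ind_iff] and F' = a(2)[unfolded Ind_iff]
  have K: "f \<kappa> = f' \<kappa>" if \<kappa>: "\<kappa> \<in> K1 v \<times> mu n" for \<kappa>
  proof -
    have "co (f \<kappa>) k = co (f' \<kappa>) k" if "k < nb" for k
      using fun_cong[OF fun_cong[OF a(3), of k], of \<kappa>] that \<kappa> by (simp add: split_lines_def)
    then have "(\<Sum>k<nb. co (f \<kappa>) k *\<^sub>C eigenvec k) = (\<Sum>k<nb. co (f' \<kappa>) k *\<^sub>C eigenvec k)" by (intro sum.cong) auto
    then show ?thesis using co[of "f \<kappa>"] co[of "f' \<kappa>"] F F' K_SL2[OF \<kappa>] by metis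
  qed
  show "f = f'"
  proof
    fix x show "f x = f' x"
    proof (cases "x \<in> SL2 \<times> mu n")
      case True
      obtain h \<kappa> where hk: "h \<in> B1 \<times> mu n" "\<kappa> \<in> K1 v \<times> mu n" "x = cov_mult h \<kappa>" using iwasawa_cover[OF True] by blast
      have "f x = ract \<rho> (torus_part h) (f \<kappa>)" "f' x = ract \<rho> (torus_part h) (f' \<kappa>)"
        using F F' hk K_SL2[OF hk(2)] by blast+
      then show ?thesis using K[OF hk(2)] by simp
    qed (use F F' in metis)
  qed
qed

lemma cover_left_cancel:
  assumes "h \<in> SL2 \<times> mu n" shows "\<exists>h'\<in>SL2 \<times> mu n. cov_mult h' h = (mat 1, 1) \<and> cov_mult h h' = (mat 1, 1) \<and> fst h' = adj2 (fst h)"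
proof -
  let ?g = "fst h" let ?g' = "adj2 (fst h)"
  have g: "?g \<in> SL2" "?g' \<in> SL2" "?g ** ?g' = mat 1" "?g' ** ?g = mat 1" using assms adj2 by auto
  have c: "coc ?g ?g' \<in> mu n" "coc ?g' ?g \<in> mu n" using coc_mu g by auto
  have e: "coc ?g ?g' = coc ?g' ?g"
    using cocycle_identity[OF g(1) g(2) g(1)] g by simp
  let ?h = "(?g', inverse (coc ?g ?g' * snd h))"
  have s: "snd h \<noteq> 0" "coc ?g ?g' \<noteq> 0" using mu_nz c assms by auto
  have "coc ?g' ?g * inverse (coc ?g ?g' * snd h) * snd h = 1" "coc ?g ?g' * snd h * inverse (coc ?g ?g' * snd h) = 1"
    using s by (simp_all add: e[symmetric] field_simps)
  then have "cov_mult ?h h = (mat 1, 1)" "cov_mult h ?h = (mat 1, 1)" using g by (auto simp: cov_mult_def)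
  moreover have "?h \<in> SL2 \<times> mu n" using g c assms by (auto intro!: mu_inverse mu_mult)
  ultimately show ?thesis by (intro bexI[of _ ?h]) auto
qed

lemma B1_inverse: "h \<in> B1 \<times> mu n \<Longrightarrow> fst h' = adj2 (fst h) \<Longrightarrow> h' \<in> SL2 \<times> mu n \<Longrightarrow> h' \<in> B1 \<times> mu n"
  by (auto simp: B1_def adj2_def mem_Times_iff)

text \<open>The coordinates are put together to \<open>S\<close> over \<open>K1 v\<close> and
  extended by Borel equivariance. Iwasawa decompositions are not unique, but two of them differ by
  an element of the integral Borel, under which \<open>S\<close> already transforms
  correctly.\<close>

lemma split_lines_surj: "rspace SV \<subseteq> split_lines ` rspace Ind"
proof
  fix F assume "F \<in> rspace SV"
  then have F: "\<And>k. k < nb \<Longrightarrow> F k \<in> rspace (V_ind v n (ch k))" "\<And>k. \<not> k < nb \<Longrightarrow> F k = 0" unfolding SV_iff by blast+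
  note F1 = F(1)[unfolded V_ind_iff]
  define S where "S \<kappa> = (\<Sum>k<nb. F k \<kappa> *\<^sub>C eigenvec k)" for \<kappa>
  have SV: "S \<kappa> \<in> V" for \<kappa> unfolding S_def by (rule lines_mem)
  have SB: "S (cov_mult h \<kappa>) = ract \<rho> (torus_part h) (S \<kappa>)" if h: "h \<in> (B1 \<inter> K1 v) \<times> mu n" and \<kappa>: "\<kappa> \<in> K1 v \<times> mu n" for h \<kappa>
    unfolding S_def torus_lines[OF h] using F1 h \<kappa> by (intro sum.cong) auto
  obtain J where J: "\<And>k. k < nb \<Longrightarrow> J k \<ge> 1 \<and> (\<forall>k'\<in>Kc v (J k). \<forall>x\<in>K1 v \<times> mu n. F k (cov_mult x (k', 1)) = F k x)"
    using F1 by metis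
  \<comment> \<open>A common level for the finitely many components: the sum dominates each
    \<open>J k\<close>.\<close>
  define j where "j = 1 + (\<Sum>k<nb. J k)"
  have SK: "S (cov_mult \<kappa> (k', 1)) = S \<kappa>" if k': "k' \<in> Kc v j" and \<kappa>: "\<kappa> \<in> K1 v \<times> mu n" for k' \<kappa>
    unfolding S_def
  proof (rule sum.cong[OF refl])
    fix k assume k: "k \<in> {..<nb}"
    have "J k \<le> j" using member_le_sum[of k "{..<nb}" J] k by (simp add: j_def)
    then have "F k (cov_mult \<kappa> (k', 1)) = F k \<kappa>" using J[of k] k Kc_mono[OF k'] \<kappa> by blast
    then show "F k (cov_mult \<kappa> (k', 1)) *\<^sub>C eigenvec k = F k \<kappa> *\<^sub>C eigenvec k" by simp
  qed
  define dec where "dec x = (SOME p. fst p \<in> B1 \<times> mu n \<and> snd p \<in> K1 v \<times> mu n \<and> x = cov_mult (fst p) (snd p))" for x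
  have dec: "fst (dec x) \<in> B1 \<times> mu n \<and> snd (dec x) \<in> K1 v \<times> mu n \<and> x = cov_mult (fst (dec x)) (snd (dec x))"
    if "x \<in> SL2 \<times> mu n" for x
    unfolding dec_def by (rule someI_ex) (use iwasawa_cover[OF that] in fastforce)
  define f where "f x = (if x \<in> SL2 \<times> mu n then ract \<rho> (torus_part (fst (dec x))) (S (snd (dec x))) else 0)" for x
  \<comment> \<open>Independence of the decomposition picked by \<open>dec\<close>. The comparison
    element \<open>b\<close> lies in the Borel by construction and in \<open>K1 v\<close> as a
    quotient of the two compact parts.\<close>
  have f: "f (cov_mult h \<kappa>) = ract \<rho> (torus_part h) (S \<kappa>)" if h: "h \<in> B1 \<times> mu n" and \<kappa>: "\<kappa> \<in> K1 v \<times> mu n" for h \<kappa>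
  proof -
    have x: "cov_mult h \<kappa> \<in> SL2 \<times> mu n" using h \<kappa> cov_mult_SL2 B_SL2 K_SL2 by blast
    obtain h' \<kappa>' where hk: "h' \<in> B1 \<times> mu n" "\<kappa>' \<in> K1 v \<times> mu n" "cov_mult h \<kappa> = cov_mult h' \<kappa>'" "dec (cov_mult h \<kappa>) = (h', \<kappa>')"
      using dec[OF x] by (metis prod.collapse)
    obtain i where i: "i \<in> SL2 \<times> mu n" "cov_mult i h' = (mat 1, 1)" "cov_mult h' i = (mat 1, 1)" "fst i = adj2 (fst h')"
      using cover_left_cancel[OF B_SL2[OF hk(1)]] by blast
    have iB: "i \<in> B1 \<times> mu n" using B1_inverse[OF hk(1) i(4,1)] .
    define b where "b = cov_mult i h"
    have bB: "b \<in> B1 \<times> mu n" using B1_mult[OF iB h] by (simp add: b_def)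
    have one: "cov_mult (mat 1, 1) y = y" if "y \<in> SL2 \<times> mu n" for y using that by (auto simp: cov_mult_def)
    have "cov_mult b \<kappa> = cov_mult i (cov_mult h \<kappa>)" unfolding b_def by (rule cov_mult_assoc[OF i(1) B_SL2[OF h] K_SL2[OF \<kappa>]])
    also have "\<dots> = cov_mult (cov_mult i h') \<kappa>'" unfolding hk(3) by (rule cov_mult_assoc[OF i(1) B_SL2[OF hk(1)] K_SL2[OF hk(2)], symmetric])
    finally have b\<kappa>: "cov_mult b \<kappa> = \<kappa>'" using one K_SL2[OF hk(2)] by (simp add: i(2))
    have "cov_mult h' b = cov_mult (cov_mult h' i) h" unfolding b_def by (rule cov_mult_assoc[OF B_SL2[OF hk(1)] i(1) B_SL2[OF h], symmetric])
    then have hb: "h = cov_mult h' b" using one B_SL2[OF h] by (simp add: i(3))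
    have bK: "b \<in> (B1 \<inter> K1 v) \<times> mu n"
    proof -
      have "fst b ** fst \<kappa> = fst \<kappa>'" using b\<kappa> by (auto simp: cov_mult_def)
      then have "fst b ** fst \<kappa> ** adj2 (fst \<kappa>) = fst \<kappa>' ** adj2 (fst \<kappa>)" by simp
      then have "fst b = fst \<kappa>' ** adj2 (fst \<kappa>)" using adj2(1)[of "fst \<kappa>"] \<kappa> by (auto simp: SL2_K1 simp flip: matrix_mul_assoc)
      then have "fst b \<in> K1 v" using \<kappa> hk K1_mult K1_adj2 by auto
      then show ?thesis using bB by (auto simp: mem_Times_iff)
    qed
    have "f (cov_mult h \<kappa>) = ract \<rho> (torus_part h') (S (cov_mult b \<kappa>))" using x by (simp add: f_def hk(4) b\<kappa>)
    also have "\<dots> = ract \<rho> (torus_part h') (ract \<rho> (torus_part b) (S \<kappa>))" using SB[OF bK \<kappa>] by simp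
    also have "\<dots> = ract \<rho> (torus_part h) (S \<kappa>)"
      using T_act(5)[OF torus_part_mem[OF hk(1)] torus_part_mem[OF bB] SV] torus_part_mult[OF hk(1) bB] hb by simp
    finally show ?thesis .
  qed
  have fK: "f \<kappa> = S \<kappa>" if \<kappa>: "\<kappa> \<in> K1 v \<times> mu n" for \<kappa>
  proof -
    have o: "(mat 1, 1) \<in> B1 \<times> mu n" by (simp add: B1_def SL2_one) (simp add: mat_1_mat2)
    have "cov_mult (mat 1, 1) \<kappa> = \<kappa>" using K_SL2[OF \<kappa>] by (auto simp: cov_mult_def)
    moreover have "(mat 1 :: 'a^2^2)$1$1 = 1" by (simp add: mat_def)
    then have "torus_part (mat 1, 1) = (mat 1, 1 :: 'a)" by (simp add: torus_part_def dg_one)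
    ultimately show ?thesis using f[OF o \<kappa>] T_act(4)[OF SV] by simp
  qed
  have "f \<in> rspace Ind"
    unfolding Ind_iff
  proof (intro conjI allI impI ballI)
    show "f x = 0" if "x \<notin> SL2 \<times> mu n" for x using that by (auto simp: f_def)
    show "f x \<in> V" if "x \<in> SL2 \<times> mu n" for x
      using T_act(1)[OF torus_part_mem SV] dec[OF that] that by (simp add: f_def)
    show "f (cov_mult h x) = ract \<rho> (torus_part h) (f x)" if h: "h \<in> B1 \<times> mu n" and x: "x \<in> SL2 \<times> mu n" for h x
    proof -
      obtain b \<kappa> where bk: "b \<in> B1 \<times> mu n" "\<kappa> \<in> K1 v \<times> mu n" "x = cov_mult b \<kappa>" using iwasawa_cover[OF x] by blast
      have "cov_mult h x = cov_mult (cov_mult h b) \<kappa>" unfolding bk(3) by (rule cov_mult_assoc[OF B_SL2[OF h] B_SL2[OF bk(1)] K_SL2[OF bk(2)], symmetric])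
      then have "f (cov_mult h x) = ract \<rho> (torus_part (cov_mult h b)) (S \<kappa>)" using f[OF B1_mult[OF h bk(1)] bk(2)] by simp
      also have "\<dots> = ract \<rho> (torus_part h) (ract \<rho> (torus_part b) (S \<kappa>))"
        unfolding torus_part_mult[OF h bk(1)] by (rule T_act(5)[OF torus_part_mem[OF h] torus_part_mem[OF bk(1)] SV])
      finally show ?thesis using f[OF bk(1,2)] bk(3) by simp
    qed
    have "f (cov_mult x (k', 1)) = f x" if k': "k' \<in> Kc v j" and x: "x \<in> SL2 \<times> mu n" for k' x
    proof -
      obtain b \<kappa> where bk: "b \<in> B1 \<times> mu n" "\<kappa> \<in> K1 v \<times> mu n" "x = cov_mult b \<kappa>" using iwasawa_cover[OF x] by blast
      have kK: "(k', 1) \<in> K1 v \<times> mu n" using k' by (simp add: Kc_iff)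
      have "cov_mult x (k', 1) = cov_mult b (cov_mult \<kappa> (k', 1))" unfolding bk(3) by (rule cov_mult_assoc[OF B_SL2[OF bk(1)] K_SL2[OF bk(2)] K_SL2[OF kK]])
      then show ?thesis using f[OF bk(1) cov_mult_K1[OF bk(2) kK]] f[OF bk(1,2)] SK[OF k' bk(2)] bk(3) by simp
    qed
    then show "\<exists>j\<ge>1. \<forall>k\<in>Kc v j. \<forall>x\<in>SL2 \<times> mu n. f (cov_mult x (k, 1)) = f x"
      by (intro exI[of _ j]) (auto simp: j_def)
  qed
  moreover have "split_lines f = F"
  proof (intro ext)
    fix k x show "split_lines f k x = F k x"
    proof (cases "k < nb \<and> x \<in> K1 v \<times> mu n")
      case True
      then have "co (f x) k = F k x" using fK[of x] SV[of x] by (intro co_eq) (auto simp: S_def)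
      then show ?thesis using True by (simp add: split_lines_def)
    next
      case False
      then consider "\<not> k < nb" | "k < nb" "x \<notin> K1 v \<times> mu n" by blast
      then show ?thesis
      proof cases
        case 2
        then have "F k x = 0" using F1 by blast
        then show ?thesis using 2 by (simp add: split_lines_def)
      qed (simp add: split_lines_def F(2))
    qed
  qed
  ultimately show "F \<in> split_lines ` rspace Ind" by blast
qed

lemma bij_split_lines: "bij_betw split_lines (rspace Ind) (rspace SV)"
  using split_lines_inj split_lines_surj rep_hom_split_lines unfolding bij_betw_def rep_hom_def by blast

lemma rep_closed_Ind: "rep_closed KT Ind"
  unfolding rep_closed_def complex_vector.subspace_def
proof (intro conjI ballI allI)
  show "ract Ind g 0 = 0" for g unfolding Ind_act by (simp add: fun_eq_iff)
  have tp: "ract \<rho> (torus_part h) (x + y) = ract \<rho> (torus_part h) x + ract \<rho> (torus_part h) y"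
    "ract \<rho> (torus_part h) (c *\<^sub>C x) = c *\<^sub>C ract \<rho> (torus_part h) x"
    if "h \<in> B1 \<times> mu n" "x \<in> V" "y \<in> V" for h x y c
    using T_act(2,3)[OF torus_part_mem[OF that(1)]] that by auto
  show "0 \<in> rspace Ind"
    unfolding Ind_iff using tp(2)[OF _ V_0 V_0, of _ 0] V_0 by auto
  show "f + g \<in> rspace Ind" if fg: "f \<in> rspace Ind" "g \<in> rspace Ind" for f g
  proof -
    obtain i where i: "i \<ge> 1" "\<forall>k\<in>Kc v i. \<forall>x\<in>SL2 \<times> mu n. f (cov_mult x (k, 1)) = f x" using fg(1)[unfolded Ind_iff] by blast
    obtain j where j: "j \<ge> 1" "\<forall>k\<in>Kc v j. \<forall>x\<in>SL2 \<times> mu n. g (cov_mult x (k, 1)) = g x" using fg(2)[unfolded Ind_iff] by blast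
    have "\<exists>j\<ge>1. \<forall>k\<in>Kc v j. \<forall>x\<in>SL2 \<times> mu n. (f + g) (cov_mult x (k, 1)) = (f + g) x"
      using i j Kc_mono[of _ "max i j" i] Kc_mono[of _ "max i j" j] by (intro exI[of _ "max i j"]) auto
    moreover have "(f + g) (cov_mult h x) = ract \<rho> (torus_part h) ((f + g) x)" if "h \<in> B1 \<times> mu n" "x \<in> SL2 \<times> mu n" for h x
    proof -
      have "f (cov_mult h x) = ract \<rho> (torus_part h) (f x)" "g (cov_mult h x) = ract \<rho> (torus_part h) (g x)" "f x \<in> V" "g x \<in> V"
        using fg[unfolded Ind_iff] that by blast+
      then show ?thesis using tp(1)[OF that(1)] by simp
    qed
    ultimately show ?thesis using fg[unfolded Ind_iff] V_sub unfolding Ind_iff complex_vector.subspace_def by simp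
  qed
  show "c *\<^sub>C f \<in> rspace Ind" if f: "f \<in> rspace Ind" for c f
  proof -
    have sc: "(c *\<^sub>C f) x = c *\<^sub>C f x" for x by (simp add: scaleC_fun_def)
    have "(c *\<^sub>C f) (cov_mult h x) = ract \<rho> (torus_part h) ((c *\<^sub>C f) x)" if "h \<in> B1 \<times> mu n" "x \<in> SL2 \<times> mu n" for h x
    proof -
      have "f (cov_mult h x) = ract \<rho> (torus_part h) (f x)" "f x \<in> V" using f[unfolded Ind_iff] that by blast+
      then show ?thesis using tp(2)[OF that(1)] by (simp add: sc)
    qed
    moreover have "\<exists>j\<ge>1. \<forall>k\<in>Kc v j. \<forall>x\<in>SL2 \<times> mu n. (c *\<^sub>C f) (cov_mult x (k, 1)) = (c *\<^sub>C f) x"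
      using f[unfolded Ind_iff] unfolding sc by metis
    ultimately show ?thesis using f[unfolded Ind_iff] unfolding Ind_iff by (simp add: sc V_scale)
  qed
  fix g f assume g: "g \<in> carrier KT" and f: "f \<in> rspace Ind"
  have gK: "g \<in> K1 v \<times> mu n" using g by simp
  have gS: "g \<in> SL2 \<times> mu n" by (rule K_SL2[OF gK])
  note f' = f[unfolded Ind_iff]
  obtain j where j: "j \<ge> 1" "\<forall>k\<in>Kc v j. \<forall>x\<in>SL2 \<times> mu n. f (cov_mult x (k, 1)) = f x" using f' by blast
  \<comment> \<open>Smoothness survives translation by g at the same level: \<open>Kc v j\<close> is
    normalized by \<open>K1 v\<close>, and the conjugation also holds for the lifts (k, 1), since
    \<open>splitting\<close> is 1 on \<open>Kc v j\<close>.\<close>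
  have "f (cov_mult (cov_mult x (k, 1)) g) = f (cov_mult x g)" if k: "k \<in> Kc v j" and x: "x \<in> SL2 \<times> mu n" for k x
  proof -
    let ?k = "adj2 (fst g) ** k ** fst g"
    have g1: "fst g \<in> K1 v" using gK by auto
    have kc: "?k \<in> Kc v j" by (rule Kc_conj[OF k g1])
    have K: "k \<in> K1 v" "?k \<in> K1 v" using k kc by (auto simp: Kc_iff)
    have kS: "(k, 1) \<in> SL2 \<times> mu n" "(?k, 1) \<in> SL2 \<times> mu n" using K by (auto simp: SL2_K1)
    have m: "fst g ** ?k = k ** fst g" using adj2(1)[OF SL2_K1[OF g1]] by (simp add: matrix_mul_assoc)
    have "coc k (fst g) = coc (fst g) ?k"
      using coc_splitting[OF K(1) g1] coc_splitting[OF g1 K(2)] splitting_Kc[OF k j(1)] splitting_Kc[OF kc j(1)] by (simp add: m)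
    then have "cov_mult (k, 1) g = cov_mult g (?k, 1)" using m by (simp add: cov_mult_def)
    then have "cov_mult (cov_mult x (k, 1)) g = cov_mult (cov_mult x g) (?k, 1)"
      using cov_mult_assoc[OF x kS(1) gS] cov_mult_assoc[OF x gS kS(2)] by simp
    moreover have "f (cov_mult (cov_mult x g) (?k, 1)) = f (cov_mult x g)" by (rule bspec[OF bspec[OF j(2) kc] cov_mult_SL2[OF x gS]])
    ultimately show ?thesis by simp
  qed
  then have "\<exists>j\<ge>1. \<forall>k\<in>Kc v j. \<forall>x\<in>SL2 \<times> mu n. ract Ind g f (cov_mult x (k, 1)) = ract Ind g f x"
    using j cov_mult_SL2[of _ "(_, 1)"] unfolding Ind_act by (intro exI[of _ j]) (auto simp: Kc_iff SL2_K1)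
  moreover have "ract Ind g f (cov_mult h x) = ract \<rho> (torus_part h) (ract Ind g f x)"
    if h: "h \<in> B1 \<times> mu n" and x: "x \<in> SL2 \<times> mu n" for h x
  proof -
    have "f (cov_mult h (cov_mult x g)) = ract \<rho> (torus_part h) (f (cov_mult x g))"
      by (rule bspec[OF bspec[OF f'[THEN conjunct2, THEN conjunct2, THEN conjunct1] h] cov_mult_SL2[OF x gS]])
    then show ?thesis using cov_mult_assoc[OF B_SL2[OF h] x gS] cov_mult_SL2[OF B_SL2[OF h] x] x unfolding Ind_act by simp
  qed
  moreover have "ract Ind g f x \<in> V" if "x \<in> SL2 \<times> mu n" for x
    unfolding Ind_act using bspec[OF f'[THEN conjunct2, THEN conjunct1] cov_mult_SL2[OF that gS]] that
    by (simp only: if_True)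
  moreover have "ract Ind g f x = 0" if "x \<notin> SL2 \<times> mu n" for x using that unfolding Ind_act by (simp only: if_False)
  ultimately show "ract Ind g f \<in> rspace Ind" unfolding Ind_iff[of "ract Ind g f"] by blast
qed

end

lemma set_plus_coset_eq:
  fixes U :: "'w::complex_vector set"
  assumes "complex_vector.subspace U" shows "x +o U = y +o U \<longleftrightarrow> x - y \<in> U"
proof
  have m: "z \<in> w +o U \<longleftrightarrow> z - w \<in> U" for z w :: 'w
    by (auto simp: elt_set_plus_def) (metis add.commute diff_add_cancel)
  { assume "x +o U = y +o U"
    moreover have "x \<in> x +o U" using complex_vector.subspace_0[OF assms] by (simp add: m)
    ultimately show "x - y \<in> U" using m by blast }
  assume xy: "x - y \<in> U"
  have "z - x \<in> U \<longleftrightarrow> z - y \<in> U" for z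
    using complex_vector.subspace_add[OF assms, of "z - x" "x - y"]
      complex_vector.subspace_diff[OF assms, of "z - y" "x - y"] xy by auto
  then show "x +o U = y +o U" by (auto simp: set_eq_iff m)
qed

section \<open>Assembling the lowest level and the layers\<close>

context principal_datum
begin

lemma Lift_sum: "Lift (\<Sum>l\<in>M. F l) = (\<Sum>l\<in>M. Lift (F l))"
  by (induction M rule: infinite_finite_induct) (simp_all only: sum.infinite sum.empty sum.insert Lift_0 Lift_add not_False_eq_True)

text \<open>Up to sign the quadratic Gauss sum of the residue field. The choice of the root does not
  matter, as both signs are used.\<close>

definition \<sigma>0 :: complex where "\<sigma>0 = csqrt (quad_char (- 1) * qc)"

lemma \<sigma>0: "\<sigma>0 * \<sigma>0 = quad_char (- 1) * qc" "(- \<sigma>0) * (- \<sigma>0) = quad_char (- 1) * qc" "\<sigma>0 \<noteq> 0"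
proof -
  show 1: "\<sigma>0 * \<sigma>0 = quad_char (- 1) * qc" using power2_csqrt[of "quad_char (- 1) * qc"] by (simp add: \<sigma>0_def power2_eq_square)
  then show "(- \<sigma>0) * (- \<sigma>0) = quad_char (- 1) * qc" by simp
  show "\<sigma>0 \<noteq> 0" using 1 qc_nz quad_char_sq[of "-1"] by auto
qed

abbreviation Wp where "Wp l \<equiv> half_layer (unit_char 0) l \<sigma>0"
abbreviation Wm where "Wm l \<equiv> half_layer (unit_char 0) l (- \<sigma>0)"
abbreviation layer_pair where "layer_pair l \<equiv> Lift ` Wp l \<times> Lift ` Wm l"

text \<open>Above the conductor m each layer satisfies l - 1 >= m, which is the hypothesis under
  which the analysis of a new layer was made.\<close>

lemma level: "l > m \<Longrightarrow> l \<ge> 2 \<and> l \<ge> 1 \<and> unit_hom (unit_char k) (l - 1)"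
  using m1 unit_hom_mono[OF unit_hom_unit_char, of "l - 1" k] by auto

lemma Wpm_decomp: assumes "l > m"
  shows "Wp l \<subseteq> new_layer (unit_char 0) l" "Wm l \<subseteq> new_layer (unit_char 0) l" "Wp l \<inter> Wm l = {0}"
    "F \<in> new_layer (unit_char 0) l \<Longrightarrow> \<exists>A\<in>Wp l. \<exists>B\<in>Wm l. F = A + B"
proof -
  show "Wp l \<subseteq> new_layer (unit_char 0) l" "Wm l \<subseteq> new_layer (unit_char 0) l" by (auto simp: half_layer_def)
  show "Wp l \<inter> Wm l = {0}" using half_layer_inter[OF \<sigma>0(3)] stab_0[OF stab_half_layer] by blast
  show "F \<in> new_layer (unit_char 0) l \<Longrightarrow> \<exists>A\<in>Wp l. \<exists>B\<in>Wm l. F = A + B"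
    using new_layer_decomp[OF _ _ \<sigma>0(1)] level[OF assms] by blast
qed

lemma zero_layer_pair: "0 \<in> layer_pair l"
  unfolding zero_prod_def using imageI[OF stab_0[OF stab_half_layer], of Lift] by (simp only: Lift_0 mem_Sigma_iff simp_thms)

lemma layer_pair_bij: "l > m \<Longrightarrow> bij_betw (\<lambda>(p, q). p + q) (layer_pair l) (Lift ` new_layer (unit_char 0) l)"
  using Wpm_decomp by (intro sum_bij[OF stab_new_layer stab_half_layer stab_half_layer])

text \<open>The inverse of \<open>\<theta>\<^sup>k\<close> appears since \<open>layer_conv\<close> with kernel \<open>\<eta>\<close> multiplies the character by \<open>\<eta>\<^sup>-\<^sup>2\<close>.\<close>
definition layer_map :: "nat \<Rightarrow> nat \<Rightarrow> ('a^2^2 \<Rightarrow> complex) \<Rightarrow> 'a^2^2 \<Rightarrow> complex" where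
  "layer_map l k = (if k = 0 then (\<lambda>F. F) else layer_conv l (ext0 (\<lambda>t. inverse (theta t ^ k))))"

lemma equivariant_layer_map: "equivariant UNIV (layer_map l k)"
  by (simp add: layer_map_def equivariant_id equivariant_layer_conv)

text \<open>For 0 < k < \<open>nb\<close> the k-th power of \<open>theta\<close> is nontrivial,
  because \<open>nb \<le> n\<close>. The case k = 0 is separate: convolution with the trivial
  character is not of the kind that \<open>layer_conv_iso\<close> inverts.\<close>

lemma layer_map_bij: assumes l: "l > m" and k: "k < nb" shows "bij_betw (layer_map l k) (new_layer (unit_char 0) l) (new_layer (unit_char k) l)"
proof (cases "k = 0")
  case True
  then show ?thesis by (simp add: layer_map_def bij_betw_def)
next
  case False
  have "nb \<le> n" by (simp add: nbar_def)
  then obtain a where a: "runit a" "theta a ^ k \<noteq> 1" using theta_nontrivial[of k] k False by auto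
  have c: "unit_hom (\<lambda>t. theta t ^ k) 1" using unit_hom_theta by (simp add: unit_hom_def power_mult_distrib)
  have "bij_betw (layer_conv l (ext0 (\<lambda>t. inverse (theta t ^ k)))) (new_layer (unit_char 0) l) (new_layer (unit_char k) l)"
  proof (rule layer_conv_iso[where \<eta>' = "\<lambda>t. theta t ^ k"])
    show "inverse (theta a ^ k) \<noteq> 1" using a by simp
    fix t assume t: "runit t"
    have "theta (t * t) ^ k = theta t ^ (2 * k)" using unit_hom_mult[OF unit_hom_theta t t] by (simp add: power_mult power2_eq_square)
    then show "unit_char 0 t = unit_char k t * inverse (theta (t * t) ^ k)" using unit_hom_nz[OF unit_hom_theta t] by (simp add: unit_char_def)
  qed (use level[OF l] c unit_hom_inv[OF c] a in auto)
  then show ?thesis using False by (simp add: layer_map_def)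
qed

definition layer_rep_map :: "nat \<Rightarrow> nat \<Rightarrow> ('a cov \<Rightarrow> complex) \<times> ('a cov \<Rightarrow> complex) \<Rightarrow> 'a cov \<Rightarrow> complex" where
  "layer_rep_map l k w = Lift (layer_map l k (unLift (fst w + snd w)))"

lemma layer_rep_map_add: "layer_rep_map l k (w + w') = layer_rep_map l k w + layer_rep_map l k w'"
proof -
  have "fst (w + w') + snd (w + w') = (fst w + snd w) + (fst w' + snd w')" by (simp only: fst_add snd_add add_ac)
  then show ?thesis
    unfolding layer_rep_map_def by (simp only: unLift_add[of "fst w + snd w"] equivariant_add[OF equivariant_layer_map UNIV_I UNIV_I] Lift_add)
qed

lemma layer_rep_map_scale: "layer_rep_map l k (c *\<^sub>C w) = c *\<^sub>C layer_rep_map l k w"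
proof -
  have "fst (c *\<^sub>C w) + snd (c *\<^sub>C w) = c *\<^sub>C (fst w + snd w)" by (simp add: scaleC_prod_def scaleC_add_right)
  then show ?thesis unfolding layer_rep_map_def by (simp only: unLift_scale equivariant_scale[OF equivariant_layer_map UNIV_I] Lift_scale)
qed

lemma layer_rep_map_0: "layer_rep_map l k 0 = 0" using layer_rep_map_scale[of l k 0 0] by simp

lemma layer_rep_map_bij: "l > m \<Longrightarrow> k < nb \<Longrightarrow> bij_betw (layer_rep_map l k) (layer_pair l) (Lift ` new_layer (unit_char k) l)"
proof -
  assume l: "l > m" and k: "k < nb"
  have "bij_betw ((\<lambda>f. Lift (layer_map l k (unLift f))) \<circ> (\<lambda>(p, q). p + q)) (layer_pair l) (Lift ` new_layer (unit_char k) l)"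
    by (rule bij_betw_trans[OF layer_pair_bij[OF l] bij_Lift[OF stab_new_layer stab_new_layer layer_map_bij[OF l k]]])
  moreover have "(\<lambda>f. Lift (layer_map l k (unLift f))) \<circ> (\<lambda>(p, q). p + q) = layer_rep_map l k"
    by (simp add: layer_rep_map_def fun_eq_iff split_beta)
  ultimately show ?thesis by simp
qed

lemma layer_rep_map_act:
  assumes "l > m" and w: "w \<in> layer_pair l" and g: "g \<in> K1 v \<times> mu n"
  shows "layer_rep_map l k (kact g (fst w), kact g (snd w)) = kact g (layer_rep_map l k w)"
proof -
  have "(case w of (p, q) \<Rightarrow> p + q) \<in> Lift ` new_layer (unit_char 0) l" using bij_betw_apply[OF layer_pair_bij[OF assms(1)] w] by simp
  then obtain F where F: "F \<in> new_layer (unit_char 0) l" "fst w + snd w = Lift F" by (auto simp: split_beta)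
  have R: "Rt (fst g) F \<in> new_layer (unit_char 0) l" using F g by (intro stab_Rt[OF stab_new_layer]) auto
  have k: "fst g \<in> K1 v" using g by auto
  have "layer_rep_map l k (kact g (fst w), kact g (snd w)) = Lift (layer_map l k (unLift (kact g (Lift F))))"
    by (simp add: layer_rep_map_def F(2)[symmetric] kact_add)
  also have "\<dots> = \<epsilon> (snd g / splitting (fst g)) *\<^sub>C Lift (Rt (fst g) (layer_map l k F))"
    by (simp only: kact_Lift[OF g] unLift_scale unLift_Lift_stab[OF stab_new_layer R] equivariant_scale[OF equivariant_layer_map UNIV_I]
      equivariant_Rt[OF equivariant_layer_map UNIV_I k] Lift_scale)
  also have "\<dots> = kact g (layer_rep_map l k w)"
    by (simp only: layer_rep_map_def F(2) unLift_Lift_stab[OF stab_new_layer F(1)] kact_Lift[OF g])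
  finally show ?thesis .
qed

abbreviation decomp_rep where "decomp_rep \<equiv> rep_dsum {..<nb} (\<lambda>k. V_fixed v n (ch k) m) \<oplus>\<^sub>R
  rep_dsum {m<..} (\<lambda>l. rep_dsum {..<nb} (\<lambda>_. model_rep (Wp l) \<oplus>\<^sub>R model_rep (Wm l)))"

lemma rep_closed_decomp_rep: "rep_closed KT decomp_rep"
  using V_ch(2)[OF m1]
  by (intro rep_closed_sum rep_closed_dsum) (auto intro!: rep_closed_model_rep stab_level_space stab_half_layer rep_closed_sum)

lemma decomp_rep_iff: "x \<in> rspace decomp_rep \<longleftrightarrow> (\<forall>k<nb. fst x k \<in> Lift ` level_space (unit_char k) m) \<and> (\<forall>k. \<not> k < nb \<longrightarrow> fst x k = 0) \<and>
    (\<forall>l>m. \<forall>k<nb. snd x l k \<in> layer_pair l) \<and> (\<forall>l k. \<not> (m < l \<and> k < nb) \<longrightarrow> snd x l k = 0) \<and> finite {l. snd x l \<noteq> 0}"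
  (is "?A \<longleftrightarrow> ?B")
proof -
  have f: "finite {k. h k \<noteq> 0}" if "\<forall>k. \<not> k < nb \<longrightarrow> h k = 0" for h :: "nat \<Rightarrow> 'e::zero"
    by (rule finite_subset[of _ "{..<nb}"]) (use that in auto)
  have A: "?A \<longleftrightarrow> ((\<forall>k<nb. fst x k \<in> Lift ` level_space (unit_char k) m) \<and> (\<forall>k. \<not> k < nb \<longrightarrow> fst x k = 0) \<and> finite {k. fst x k \<noteq> 0}) \<and>
     (\<forall>l>m. (\<forall>k<nb. snd x l k \<in> layer_pair l) \<and> (\<forall>k. \<not> k < nb \<longrightarrow> snd x l k = 0) \<and> finite {k. snd x l k \<noteq> 0}) \<and>
     (\<forall>l. \<not> m < l \<longrightarrow> snd x l = 0) \<and> finite {l. snd x l \<noteq> 0}"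
    using V_ch(2)[OF m1] by (cases x) (simp add: rep_sum_def rep_dsum_def Ball_def)
  show ?thesis
  proof
    assume ?A
    note a = this[unfolded A]
    have "snd x l k = 0" if "\<not> (m < l \<and> k < nb)" for l k
    proof (cases "m < l")
      case True
      then show ?thesis using a that by blast
    next
      case False
      then have "snd x l = 0" using a by blast
      then show ?thesis by simp
    qed
    then show ?B using a by blast
  next
    assume B: ?B
    then have "\<forall>l k. \<not> m < l \<longrightarrow> snd x l k = 0" by blast
    then have "\<forall>l. \<not> m < l \<longrightarrow> snd x l = 0" by (simp add: fun_eq_iff)
    moreover have "finite {k. snd x l k \<noteq> 0}" for l using B by (intro f) blast
    moreover have "finite {k. fst x k \<noteq> 0}" using B by (intro f) blast
    ultimately show ?A unfolding A using B by blast
  qed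
qed

definition assemble :: "(nat \<Rightarrow> 'a cov \<Rightarrow> complex) \<times> (nat \<Rightarrow> nat \<Rightarrow> ('a cov \<Rightarrow> complex) \<times> ('a cov \<Rightarrow> complex))
    \<Rightarrow> nat \<Rightarrow> 'a cov \<Rightarrow> complex" where
  "assemble x = (\<lambda>k. if k < nb then fst x k + (\<Sum>l\<in>{l. snd x l \<noteq> 0}. layer_rep_map l k (snd x l k)) else 0)"

text \<open>The summation range in \<open>assemble\<close> depends on x. Enlarging it allows two
  elements to be treated over a common range.\<close>

lemma assemble_sum:
  assumes "finite L" "{l. snd x l \<noteq> 0} \<subseteq> L" "k < nb"
  shows "assemble x k = fst x k + (\<Sum>l\<in>L. layer_rep_map l k (snd x l k))"
proof -
  have "(\<Sum>l\<in>{l. snd x l \<noteq> 0}. layer_rep_map l k (snd x l k)) = (\<Sum>l\<in>L. layer_rep_map l k (snd x l k))"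
    by (rule sum.mono_neutral_left[OF assms(1,2)]) (auto simp: layer_rep_map_0)
  then show ?thesis using assms(3) by (simp add: assemble_def)
qed

lemma decomp_rep_act: "x \<in> rspace decomp_rep \<Longrightarrow> ract decomp_rep g x = (\<lambda>k. if k < nb then kact g (fst x k) else 0,
    \<lambda>l. if l > m then (\<lambda>k. if k < nb then (kact g (fst (snd x l k)), kact g (snd (snd x l k))) else 0) else 0)"
  by (cases x) (auto simp: rep_sum_def rep_dsum_def V_ract fun_eq_iff split_beta)

lemma rep_hom_assemble: "rep_hom KT decomp_rep SV assemble"
  unfolding rep_hom_def
proof (intro conjI ballI allI)
  fix x assume x: "x \<in> rspace decomp_rep"
  note X = x[unfolded decomp_rep_iff]
  have xa: "fst x k \<in> Lift ` level_space (unit_char k) m" if "k < nb" for k using X that by blast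
  have xb: "snd x l k \<in> layer_pair l" if "l > m" "k < nb" for l k using X that by blast
  have x0: "snd x l k = 0" if "\<not> (m < l \<and> k < nb)" for l k using X that by blast
  have fin: "finite {l. snd x l \<noteq> 0}" using X by blast
  have JV: "layer_rep_map l k (snd x l k) \<in> Lift ` smooth_model k" if k: "k < nb" for l k
  proof (cases "l > m")
    case True
    have "layer_rep_map l k (snd x l k) \<in> Lift ` new_layer (unit_char k) l" by (rule bij_betw_apply[OF layer_rep_map_bij[OF True k] xb[OF True k]])
    moreover have "new_layer (unit_char k) l \<subseteq> smooth_model k" using level[OF True] by (auto simp: new_layer_def)
    ultimately show ?thesis by blast
  next
    case False
    then have "layer_rep_map l k (snd x l k) = Lift 0" using x0[of l k] by (simp add: layer_rep_map_0)
    then show ?thesis by (simp only: imageI[OF stab_0[OF stab_union]])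
  qed
  show "assemble x \<in> rspace SV"
    unfolding SV_iff
  proof (intro conjI allI impI)
    fix k assume k: "k < nb"
    have "fst x k \<in> Lift ` smooth_model k" using xa[OF k] m1 by blast
    then have "assemble x k \<in> Lift ` smooth_model k"
      unfolding assemble_sum[OF fin order_refl k]
      by (rule complex_vector.subspace_add[OF subspace_Lift[OF stab_union]])
        (rule complex_vector.subspace_sum[OF subspace_Lift[OF stab_union] JV[OF k]])
    then show "assemble x k \<in> rspace (V_ind v n (ch k))" by (simp add: V_ch)
  qed (simp add: assemble_def)
  show "assemble (c *\<^sub>C x) = c *\<^sub>C assemble x" for c
  proof
    fix k
    have sn: "snd (c *\<^sub>C x) l = c *\<^sub>C snd x l" "snd (c *\<^sub>C x) l k = c *\<^sub>C snd x l k" "fst (c *\<^sub>C x) k = c *\<^sub>C fst x k" for l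
      by (simp_all add: scaleC_prod_def[of c x] scaleC_fun_def)
    show "assemble (c *\<^sub>C x) k = (c *\<^sub>C assemble x) k"
    proof (cases "k < nb")
      case True
      have "assemble (c *\<^sub>C x) k = c *\<^sub>C fst x k + (\<Sum>l\<in>{l. snd x l \<noteq> 0}. c *\<^sub>C layer_rep_map l k (snd x l k))"
      proof (subst assemble_sum[OF fin _ True])
        show "{l. snd (c *\<^sub>C x) l \<noteq> 0} \<subseteq> {l. snd x l \<noteq> 0}" by (auto simp: sn)
      qed (simp only: sn(2,3) layer_rep_map_scale)
      also have "\<dots> = c *\<^sub>C assemble x k"
        by (simp only: assemble_sum[OF fin order_refl True] scaleC_add_right complex_vector.scale_sum_right)
      finally show ?thesis by (simp only: scaleC_fun_def[of c "assemble x"])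
    qed (simp add: assemble_def scaleC_fun_def fun_eq_iff)
  qed
  fix y assume y: "y \<in> rspace decomp_rep"
  have finy: "finite {l. snd y l \<noteq> 0}" using y[unfolded decomp_rep_iff] by blast
  show "assemble (x + y) = assemble x + assemble y"
  proof
    fix k
    let ?L = "{l. snd x l \<noteq> 0} \<union> {l. snd y l \<noteq> 0}"
    show "assemble (x + y) k = (assemble x + assemble y) k"
    proof (cases "k < nb")
      case True
      have L: "finite ?L" using fin finy by simp
      have "{l. snd (x + y) l \<noteq> 0} \<subseteq> ?L" by auto
      then have "assemble (x + y) k = fst x k + fst y k + ((\<Sum>l\<in>?L. layer_rep_map l k (snd x l k)) + (\<Sum>l\<in>?L. layer_rep_map l k (snd y l k)))"
        by (subst assemble_sum[OF L _ True]) (auto simp: layer_rep_map_add sum.distrib)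
      then show ?thesis using assemble_sum[OF L _ True, of x] assemble_sum[OF L _ True, of y] by (simp add: add_ac)
    qed (simp add: assemble_def)
  qed
next
  fix g x assume g: "g \<in> carrier KT" and x: "x \<in> rspace decomp_rep"
  note X = x[unfolded decomp_rep_iff]
  have gK: "g \<in> K1 v \<times> mu n" using g by simp
  have fin: "finite {l. snd x l \<noteq> 0}" using X by blast
  have k0: "kact g 0 = 0" by (auto simp: kact_def fun_eq_iff)
  have ks: "kact g (sum h A) = (\<Sum>i\<in>A. kact g (h i))" for h :: "nat \<Rightarrow> _" and A
    by (induction A rule: infinite_finite_induct) (simp_all only: sum.infinite sum.empty sum.insert k0 kact_add not_False_eq_True)
  show "assemble (ract decomp_rep g x) = ract SV g (assemble x)"
  proof
    fix k
    show "assemble (ract decomp_rep g x) k = ract SV g (assemble x) k"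
    proof (cases "k < nb")
      case True
      have sup: "{l. snd (ract decomp_rep g x) l \<noteq> 0} \<subseteq> {l. snd x l \<noteq> 0}"
      proof (rule subsetI, rule CollectI, rule notI)
        fix l assume "l \<in> {l. snd (ract decomp_rep g x) l \<noteq> 0}" "snd x l = 0"
        then show False unfolding decomp_rep_act[OF x] by (simp add: k0 zero_prod_def[symmetric] zero_fun_def[symmetric] cong: if_cong split: if_splits)
      qed
      have "layer_rep_map l k (snd (ract decomp_rep g x) l k) = kact g (layer_rep_map l k (snd x l k))" if l: "l \<in> {l. snd x l \<noteq> 0}" for l
      proof -
        have "snd x l \<noteq> 0" using l by simp
        moreover have "snd x l = 0" if "\<not> m < l" using X that by (auto simp: fun_eq_iff)
        ultimately have lm: "l > m" by blast
        have "snd x l k \<in> layer_pair l" using X lm True by blast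
        then show ?thesis using layer_rep_map_act[OF lm _ gK] True lm unfolding decomp_rep_act[OF x] by simp
      qed
      then have "assemble (ract decomp_rep g x) k = kact g (fst x k) + (\<Sum>l\<in>{l. snd x l \<noteq> 0}. kact g (layer_rep_map l k (snd x l k)))"
        using assemble_sum[OF fin sup True] True unfolding decomp_rep_act[OF x] by simp
      then show ?thesis using True unfolding SV_act by (simp add: assemble_def kact_add ks)
    qed (simp add: assemble_def SV_act)
  qed
qed

text \<open>For each k the equation says that a vector of level m and vectors of distinct new layers
  add up to zero. By \<open>model_indep\<close> all of them vanish, and the layer maps are
  injective.\<close>

lemma assemble_kernel: assumes x: "x \<in> rspace decomp_rep" and p: "assemble x = 0" shows "x = 0"
proof -
  note X = x[unfolded decomp_rep_iff]
  let ?L = "{l. snd x l \<noteq> 0}"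
  have L: "finite ?L" using X by blast
  have Lm: "?L \<subseteq> {m<..}"
  proof
    fix l assume l: "l \<in> ?L"
    have "snd x l = 0" if "\<not> m < l" using X that by (auto simp: fun_eq_iff)
    then show "l \<in> {m<..}" using l by auto
  qed
  have key: "fst x k = 0 \<and> (\<forall>l\<in>?L. snd x l k = 0)" if k: "k < nb" for k
  proof -
    obtain A where A: "A \<in> level_space (unit_char k) m" "fst x k = Lift A" using X k by blast
    have "\<forall>l\<in>?L. \<exists>F. F \<in> new_layer (unit_char k) l \<and> layer_rep_map l k (snd x l k) = Lift F"
    proof
      fix l assume "l \<in> ?L"
      then have lm: "l > m" using Lm by auto
      then have "snd x l k \<in> layer_pair l" using X[THEN conjunct2, THEN conjunct2, THEN conjunct1] k by blast
      then have "layer_rep_map l k (snd x l k) \<in> Lift ` new_layer (unit_char k) l" by (rule bij_betw_apply[OF layer_rep_map_bij[OF lm k]])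
      then show "\<exists>F. F \<in> new_layer (unit_char k) l \<and> layer_rep_map l k (snd x l k) = Lift F" by (simp only: image_iff Bex_def)
    qed
    then obtain F where F: "\<And>l. l \<in> ?L \<Longrightarrow> F l \<in> new_layer (unit_char k) l \<and> layer_rep_map l k (snd x l k) = Lift (F l)" by metis
    have "Lift (A + (\<Sum>l\<in>?L. F l)) = assemble x k"
      using assemble_sum[OF L order_refl k] F A by (simp add: Lift_add Lift_sum)
    then have 0: "Lift (A + (\<Sum>l\<in>?L. F l)) = Lift 0" using p by simp
    have AV: "A + (\<Sum>l\<in>?L. F l) \<in> smooth_model k"
    proof (intro stab_add[OF stab_union] stab_sum[OF stab_union])
      show "A \<in> smooth_model k" using A m1 by blast
      show "F l \<in> smooth_model k" if "l \<in> ?L" for l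
      proof -
        have "l > m" using Lm that by auto
        then have "l \<ge> 1" by simp
        moreover have "F l \<in> level_space (unit_char k) l" using F[OF that] by (simp add: new_layer_def)
        ultimately show ?thesis by blast
      qed
    qed
    have "A + (\<Sum>l\<in>?L. F l) = 0" by (rule inj_onD[OF Lift_inj[OF stab_union] 0 AV stab_0[OF stab_union]])
    then have z: "A = 0 \<and> (\<forall>l\<in>?L. F l = 0)" using F by (intro model_indep[OF L Lm m1 A(1)]) auto
    have "snd x l k = 0" if l: "l \<in> ?L" for l
    proof -
      have lm: "l > m" using Lm l by auto
      have "layer_rep_map l k (snd x l k) = layer_rep_map l k 0" using F[OF l] z l by (simp add: layer_rep_map_0)
      moreover have "snd x l k \<in> layer_pair l" using X lm k by blast
      moreover have "0 \<in> layer_pair l" by (rule zero_layer_pair)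
      ultimately show ?thesis using bij_betw_imp_inj_on[OF layer_rep_map_bij[OF lm k]] by (meson inj_onD)
    qed
    then show ?thesis using z A by simp
  qed
  have "fst x k = 0" for k using key X by blast
  moreover have "snd x l k = 0" for l k
  proof (cases "k < nb \<and> l \<in> ?L")
    case False
    have "snd x l k = 0" if "\<not> k < nb" using X that by blast
    then show ?thesis using False by auto
  qed (use key in blast)
  ultimately show ?thesis by (simp add: prod_eq_iff fun_eq_iff)
qed

lemma assemble_inj: "inj_on assemble (rspace decomp_rep)"
proof (rule inj_onI)
  fix x y assume xy: "x \<in> rspace decomp_rep" "y \<in> rspace decomp_rep" "assemble x = assemble y"
  have s: "complex_vector.subspace (rspace decomp_rep)" using rep_closed_decomp_rep by (simp add: rep_closed_def)
  have ym: "(- 1) *\<^sub>C y \<in> rspace decomp_rep" using s xy(2) by (rule complex_vector.subspace_scale)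
  have "assemble (x + (- 1) *\<^sub>C y) = assemble x + (- 1) *\<^sub>C assemble y"
  proof -
    have "assemble (x + (- 1) *\<^sub>C y) = assemble x + assemble ((- 1) *\<^sub>C y)"
      using rep_hom_assemble[unfolded rep_hom_def, THEN conjunct2, THEN conjunct1] xy(1) ym by blast
    moreover have "assemble ((- 1) *\<^sub>C y) = (- 1) *\<^sub>C assemble y"
      using rep_hom_assemble[unfolded rep_hom_def, THEN conjunct2, THEN conjunct2, THEN conjunct1] xy(2) by blast
    ultimately show ?thesis by (simp only:)
  qed
  then have "assemble (x + (- 1) *\<^sub>C y) = 0" using xy by simp
  then have "x + (- 1) *\<^sub>C y = 0" using assemble_kernel complex_vector.subspace_add[OF s xy(1) ym] by blast
  then show "x = y" by (simp add: complex_vector.scale_minus_left scaleC_one)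
qed

lemma assemble_surj: "rspace SV \<subseteq> assemble ` rspace decomp_rep"
proof
  fix F assume F: "F \<in> rspace SV"
  define T where "T k A N w \<longleftrightarrow> A \<in> Lift ` level_space (unit_char k) m \<and> (\<forall>l\<in>{m<..N}. w l \<in> layer_pair l) \<and>
    F k = A + (\<Sum>l\<in>{m<..N}. layer_rep_map l k (w l))" for k A and N :: nat and w
  have "\<exists>A N w. T k A N w" if k: "k < nb" for k
  proof -
    obtain G j where G: "G \<in> level_space (unit_char k) j" "F k = Lift G" using F[unfolded SV_iff] k V_ch(1) by auto
    have "G \<in> level_space (unit_char k) (max j m)" using G by (auto intro: level_space_mono)
    then obtain A f where A: "A \<in> level_space (unit_char k) m" "\<forall>l\<in>{m<..max j m}. f l \<in> new_layer (unit_char k) l" "G = A + (\<Sum>l\<in>{m<..max j m}. f l)"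
      using model_span[OF unit_hom_unit_char m1] by (metis max.cobounded2)
    have "\<forall>l\<in>{m<..max j m}. \<exists>w. w \<in> layer_pair l \<and> layer_rep_map l k w = Lift (f l)"
    proof
      fix l assume l: "l \<in> {m<..max j m}"
      then have lm: "l > m" by simp
      have "Lift (f l) \<in> Lift ` new_layer (unit_char k) l" using A l by blast
      then show "\<exists>w. w \<in> layer_pair l \<and> layer_rep_map l k w = Lift (f l)" unfolding bij_betw_imp_surj_on[OF layer_rep_map_bij[OF lm k], symmetric] by (force elim: imageE)
    qed
    then obtain w where w: "\<And>l. l \<in> {m<..max j m} \<Longrightarrow> w l \<in> layer_pair l \<and> layer_rep_map l k (w l) = Lift (f l)" by metis
    have "F k = Lift A + (\<Sum>l\<in>{m<..max j m}. layer_rep_map l k (w l))" using w by (simp add: G A(3) Lift_add Lift_sum)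
    then show ?thesis using A(1) w unfolding T_def by blast
  qed
  then obtain A N w where "\<And>k. k < nb \<Longrightarrow> T k (A k) (N k) (w k)" by metis
  then have H: "k < nb \<Longrightarrow> A k \<in> Lift ` level_space (unit_char k) m \<and> (\<forall>l\<in>{m<..N k}. w k l \<in> layer_pair l) \<and>
      F k = A k + (\<Sum>l\<in>{m<..N k}. layer_rep_map l k (w k l))" for k
    unfolding T_def by blast
  define x where "x = (\<lambda>k. if k < nb then A k else 0, \<lambda>l k. if k < nb \<and> l \<in> {m<..N k} then w k l else 0)"
  \<comment> \<open>The bounds \<open>N k\<close> vary with k; their sum bounds the support for all
    k at once.\<close>
  have sup: "{l. snd x l \<noteq> 0} \<subseteq> {..\<Sum>k<nb. N k}"
  proof
    fix l assume "l \<in> {l. snd x l \<noteq> 0}"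
    then obtain k where k: "k < nb" "l \<le> N k" by (auto simp: x_def fun_eq_iff split: if_splits)
    then show "l \<in> {..\<Sum>k<nb. N k}" using member_le_sum[of k "{..<nb}" N] by auto
  qed
  have "x \<in> rspace decomp_rep"
    unfolding decomp_rep_iff using H zero_layer_pair finite_subset[OF sup] by (auto simp: x_def)
  moreover have "assemble x = F"
  proof
    fix k show "assemble x k = F k"
    proof (cases "k < nb")
      case True
      have "assemble x k = A k + (\<Sum>l\<in>{..\<Sum>k<nb. N k}. layer_rep_map l k (snd x l k))"
        using assemble_sum[OF _ sup True] True by (simp add: x_def)
      also have "(\<Sum>l\<in>{..\<Sum>k<nb. N k}. layer_rep_map l k (snd x l k)) = (\<Sum>l\<in>{m<..N k}. layer_rep_map l k (w k l))"
      proof (rule sum.mono_neutral_cong_right)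
        show "{m<..N k} \<subseteq> {..\<Sum>k<nb. N k}" using member_le_sum[of k "{..<nb}" N] True by auto
      qed (use True in \<open>auto simp: x_def layer_rep_map_0\<close>)
      finally show ?thesis using H[OF True] by (simp only:)
    qed (use F[unfolded SV_iff] in \<open>simp add: assemble_def\<close>)
  qed
  ultimately show "F \<in> assemble ` rspace decomp_rep" by blast
qed

text \<open>Both sides are mapped bijectively onto the sum \<open>SV\<close> of the full induced
  spaces, so \<open>assemble\<close> is inverted only abstractly.\<close>

lemma Ind_iso: "rep_iso KT Ind decomp_rep"
proof (rule rep_iso_via[OF bij_split_lines rep_hom_split_lines rep_closed_Ind _ rep_hom_assemble rep_closed_decomp_rep])
  show "bij_betw assemble (rspace decomp_rep) (rspace SV)"
    using assemble_inj assemble_surj rep_hom_assemble unfolding bij_betw_def rep_hom_def by blast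
qed

text \<open>The two halves add up to the new layer, which is a complement of level l - 1 inside
  level l, so it meets every coset exactly once.\<close>

lemma layer_quotient:
  assumes l: "l > m"
  shows "rep_iso_quotient KT (model_rep (Wp l) \<oplus>\<^sub>R model_rep (Wm l)) (V_fixed v n (ch 0) l) (rspace (V_fixed v n (ch 0) (l - 1)))"
proof -
  let ?U = "Lift ` level_space (unit_char 0) (l - 1)" and ?V = "Lift ` level_space (unit_char 0) l"
  have e: "V_fixed v n (ch 0) l = model_rep (level_space (unit_char 0) l)" "rspace (V_fixed v n (ch 0) (l - 1)) = ?U"
    using V_ch(2)[of l 0] V_ch(2)[of "l - 1" 0] l m1 by auto
  have U: "complex_vector.subspace ?U" and V: "complex_vector.subspace ?V" using subspace_Lift stab_level_space by auto
  note ce = set_plus_coset_eq[OF U]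
  define \<phi> where "\<phi> w = (fst w + snd w) +o ?U" for w :: "('a cov \<Rightarrow> complex) \<times> ('a cov \<Rightarrow> complex)"
  have lev: "l \<ge> 2" "unit_hom (unit_char 0) (l - 1)" using level[OF l] by auto
  have pq: "\<exists>S\<in>new_layer (unit_char 0) l. fst w + snd w = Lift S" if "w \<in> layer_pair l" for w
    using bij_betw_apply[OF layer_pair_bij[OF l] that] by (auto simp: split_beta)
  have UV: "?U \<subseteq> ?V" using level_space_mono[of _ "unit_char 0" "l - 1" l] by auto
  have act: "kact g x \<in> ?U" if "g \<in> K1 v \<times> mu n" "x \<in> ?U" for g x using kact_Lift_mem[OF stab_level_space that] .
  show ?thesis
    unfolding rep_iso_quotient_def e
  proof (intro exI[of _ \<phi>] conjI ballI allI impI)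
    show "bij_betw \<phi> (rspace (model_rep (Wp l) \<oplus>\<^sub>R model_rep (Wm l))) ((\<lambda>v. v +o ?U) ` rspace (model_rep (level_space (unit_char 0) l)))"
      unfolding bij_betw_def
    proof
      show "inj_on \<phi> (rspace (model_rep (Wp l) \<oplus>\<^sub>R model_rep (Wm l)))"
      proof (rule inj_onI)
        fix w w' assume w: "w \<in> rspace (model_rep (Wp l) \<oplus>\<^sub>R model_rep (Wm l))" "w' \<in> rspace (model_rep (Wp l) \<oplus>\<^sub>R model_rep (Wm l))" "\<phi> w = \<phi> w'"
        then have wW: "w \<in> layer_pair l" "w' \<in> layer_pair l" by (auto simp: rep_sum_def)
        obtain S S' where S: "S \<in> new_layer (unit_char 0) l" "fst w + snd w = Lift S" "S' \<in> new_layer (unit_char 0) l" "fst w' + snd w' = Lift S'"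
          using pq wW by metis
        have "Lift S - Lift S' \<in> ?U" using w(3) unfolding \<phi>_def S ce .
        then obtain A where A: "A \<in> level_space (unit_char 0) (l - 1)" "Lift S - Lift S' = Lift A" by blast
        have D: "S - S' \<in> new_layer (unit_char 0) l" using S stab_diff[OF stab_new_layer] by blast
        have "Lift S = Lift (S' + A)" using A(2) by (simp add: Lift_add algebra_simps)
        moreover have "S \<in> level_space (unit_char 0) l" "S' + A \<in> level_space (unit_char 0) l"
          using S A level_space_mono[OF A(1), of l] stab_add[OF stab_level_space] by (auto simp: new_layer_def)
        ultimately have "S = S' + A" using inj_onD[OF Lift_inj[OF stab_level_space]] by blast
        then have "S - S' = A" by simp
        then have "S - S' = 0" using new_layer_inter[OF D] A(1) lev by simp
        then have "fst w + snd w = fst w' + snd w'" using S by simp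
        then show "w = w'" using inj_onD[OF bij_betw_imp_inj_on[OF layer_pair_bij[OF l]], of w w'] wW by (simp add: split_beta)
      qed
      show "\<phi> ` rspace (model_rep (Wp l) \<oplus>\<^sub>R model_rep (Wm l)) = (\<lambda>v. v +o ?U) ` rspace (model_rep (level_space (unit_char 0) l))"
      proof (intro equalityI subsetI)
        fix c assume "c \<in> \<phi> ` rspace (model_rep (Wp l) \<oplus>\<^sub>R model_rep (Wm l))"
        then obtain w where w: "w \<in> layer_pair l" "c = \<phi> w" by (auto simp: rep_sum_def)
        then obtain S where "S \<in> new_layer (unit_char 0) l" "fst w + snd w = Lift S" using pq by blast
        then have "fst w + snd w \<in> ?V" by (auto simp: new_layer_def)
        then show "c \<in> (\<lambda>v. v +o ?U) ` rspace (model_rep (level_space (unit_char 0) l))" using w by (auto simp: \<phi>_def)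
      next
        fix c assume "c \<in> (\<lambda>v. v +o ?U) ` rspace (model_rep (level_space (unit_char 0) l))"
        then obtain G where G: "G \<in> level_space (unit_char 0) l" "c = Lift G +o ?U" by auto
        obtain A B where AB: "A \<in> level_space (unit_char 0) (l - 1)" "B \<in> new_layer (unit_char 0) l" "G = A + B" using level_space_decomp[OF lev(2,1) G(1)] by blast
        obtain C D where CD: "C \<in> Wp l" "D \<in> Wm l" "B = C + D" using Wpm_decomp(4)[OF l AB(2)] by blast
        have "Lift G - (Lift C + Lift D) \<in> ?U" using AB CD by (simp add: Lift_add)
        then have "c = \<phi> (Lift C, Lift D)" unfolding G(2) \<phi>_def fst_conv snd_conv ce .
        then show "c \<in> \<phi> ` rspace (model_rep (Wp l) \<oplus>\<^sub>R model_rep (Wm l))" using CD by (auto simp: rep_sum_def)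
      qed
    qed
  next
    fix x y a b assume "\<phi> x = a +o ?U" "\<phi> y = b +o ?U"
    then have "(fst x + snd x - a) + (fst y + snd y - b) \<in> ?U"
      unfolding \<phi>_def ce by (rule complex_vector.subspace_add[OF U])
    moreover have "(fst x + snd x - a) + (fst y + snd y - b) = fst (x + y) + snd (x + y) - (a + b)" by (simp add: algebra_simps)
    ultimately show "\<phi> (x + y) = (a + b) +o ?U" unfolding \<phi>_def ce by (simp only:)
  next
    fix c x a assume "\<phi> x = a +o ?U"
    then have "c *\<^sub>C (fst x + snd x - a) \<in> ?U" unfolding \<phi>_def ce by (rule complex_vector.subspace_scale[OF U])
    moreover have "c *\<^sub>C (fst x + snd x - a) = fst (c *\<^sub>C x) + snd (c *\<^sub>C x) - c *\<^sub>C a"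
      by (simp add: scaleC_prod_def scaleC_add_right complex_vector.scale_right_diff_distrib)
    ultimately show "\<phi> (c *\<^sub>C x) = (c *\<^sub>C a) +o ?U" unfolding \<phi>_def ce by (simp only:)
  next
    fix g x a assume g: "g \<in> carrier KT" and x: "x \<in> rspace (model_rep (Wp l) \<oplus>\<^sub>R model_rep (Wm l))" "\<phi> x = a +o ?U"
    have "kact g (fst x + snd x - a) \<in> ?U" using g x(2) unfolding \<phi>_def ce by (intro act) simp_all
    moreover have "kact g (fst x + snd x - a) = kact g (fst x) + kact g (snd x) - kact g a" by (auto simp: kact_def fun_eq_iff)
    moreover have "ract (model_rep (Wp l) \<oplus>\<^sub>R model_rep (Wm l)) g x = (kact g (fst x), kact g (snd x))"
      by (simp add: rep_sum_def split_beta)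
    ultimately show "\<phi> (ract (model_rep (Wp l) \<oplus>\<^sub>R model_rep (Wm l)) g x) = ract (model_rep (level_space (unit_char 0) l)) g a +o ?U"
      unfolding \<phi>_def ce by simp
  qed
qed

text \<open>The exchange of the halves by \<open>conj_fn\<close> is linear but twists the group
  action by an outer conjugation. So it equates dimensions and does not conflict with
  \<open>W_not_iso\<close>.\<close>

lemma W_dim: assumes l: "l > m" shows "complex_vector.dim (Lift ` Wp l) = complex_vector.dim (Lift ` Wm l)"
proof -
  obtain a where a: "runit a" "quad_char a = - 1" using ex_quad_char_minus by blast
  let ?f = "\<lambda>f. Lift (conj_fn a (unLift f))"
  have b: "bij_betw ?f (Lift ` Wp l) (Lift ` Wm l)"
    using level[OF l] by (intro bij_Lift[OF stab_half_layer stab_half_layer] bij_conj_fn[OF _ a]) auto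
  have c: "conj_fn a (F + G) = conj_fn a F + conj_fn a G" "conj_fn a (d *\<^sub>C F) = d *\<^sub>C conj_fn a F" for F G d by (auto simp: conj_fn_def fun_eq_iff)
  have "complex_vector.dim (?f ` Lift ` Wp l) = complex_vector.dim (Lift ` Wp l)"
    by (rule dim_linear_image)
      (simp_all only: unLift_add unLift_scale c Lift_add Lift_scale subspace_Lift[OF stab_half_layer] bij_betw_imp_inj_on[OF b])
  then show ?thesis using bij_betw_imp_surj_on[OF b] by simp
qed

lemma W_not_iso: assumes l: "l > m" shows "\<not> rep_iso KT (model_rep (Wp l)) (model_rep (Wm l))"
proof
  assume "rep_iso KT (model_rep (Wp l)) (model_rep (Wm l))"
  then obtain \<phi> where \<phi>: "equivariant (Wp l) \<phi>" "\<And>F. F \<in> Wp l \<Longrightarrow> \<phi> F \<in> Wm l" "\<And>F. F \<in> Wp l \<Longrightarrow> \<phi> F = 0 \<Longrightarrow> F = 0"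
    using rep_iso_model_rep_D[OF stab_half_layer stab_half_layer] by blast
  have lv: "unit_hom (unit_char 0) (l - 1)" "l \<ge> 2" using level[OF l] by auto
  have "F = 0" if "F \<in> Wp l" for F using half_layer_hom_zero[OF lv \<sigma>0(1) \<phi>(1,2) that] \<phi>(3) that by blast
  moreover have "Wp l \<noteq> {0}" using irr_half_layer[OF lv \<sigma>0(1)] by (simp add: irr_model_def)
  ultimately show False using stab_0[OF stab_half_layer] by blast
qed

section \<open>Irreducibility and isomorphisms at the lowest level\<close>

lemma depth_zero_not_iso:
  assumes t: "runit t" "unit_char k t * unit_char i t \<noteq> 1" and s: "runit s" "unit_char k s \<noteq> unit_char i s"
  shows "\<not> rep_iso KT (model_rep (level_space (unit_char i) m)) (model_rep (level_space (unit_char k) m))"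
proof
  assume "rep_iso KT (model_rep (level_space (unit_char i) m)) (model_rep (level_space (unit_char k) m))"
  then obtain \<phi> where \<phi>: "equivariant (level_space (unit_char i) m) \<phi>" "\<And>F. F \<in> level_space (unit_char i) m \<Longrightarrow> \<phi> F \<in> level_space (unit_char k) m"
    "\<And>F. F \<in> level_space (unit_char i) m \<Longrightarrow> \<phi> F = 0 \<Longrightarrow> F = 0"
    using rep_iso_model_rep_D[OF stab_level_space stab_level_space] by blast
  have d: "delta_fn (unit_char i) m \<in> level_space (unit_char i) m" using delta_fn_level_space[OF unit_hom_unit_char m1] by simp
  have "delta_fn (unit_char i) m = 0"
    using level_space_hom_zero[OF primitive_hom_unit_char unit_hom_unit_char m1 t s \<phi>(1,2) d] \<phi>(3)[OF d] by blast
  moreover have "delta_fn (unit_char i) m (mat 1) = 1"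
    using unit_hom_one[OF unit_hom_unit_char] by (simp add: delta_fn_def K1_one) (simp add: mat_1_mat2)
  ultimately show False by simp
qed

lemma unit_char_prod: "unit_char k t * unit_char i t = (unit_char 0 t * unit_char 0 t) * theta t ^ (2 * (i + k))"
  by (simp add: unit_char_def distrib_left power_add mult_ac)

text \<open>The pairs set aside in the second part do become isomorphic, by
  \<open>intertwine_iso\<close>, and they occur even without a quadratic member: if
  \<open>unit_char 0\<close> is \<open>theta\<close> and \<open>nb\<close> is even, then i + k + 1 =
  \<open>nb\<close> makes two members inverse, while no member is quadratic. For odd
  \<open>nb\<close> such a pair would yield a quadratic member halfway between its indices.\<close>

lemma generic_case:
  assumes ne: "\<not> (m = 1 \<and> (\<exists>k<nb. quadratic_on_units v (ch k)))"
  shows "k < nb \<Longrightarrow> irreducible_rep KT (V_fixed v n (ch k) m)"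
    "i < nb \<Longrightarrow> k < nb \<Longrightarrow> i \<noteq> k \<Longrightarrow> \<not> (m = 1 \<and> 4 dvd n \<and> inverse_on_units v (ch i) (ch k)) \<Longrightarrow>
      \<not> rep_iso KT (V_fixed v n (ch i) m) (V_fixed v n (ch k) m)"
proof -
  note Q = quadratic_iff[OF restricts_ch]
  have big: "\<exists>t. runit t \<and> unit_char k t * unit_char i t \<noteq> 1" if "m \<ge> 2" for k i
    using primitive_hom_square[OF primitive_hom_unit_char that] unit_char_principal by blast
  show "irreducible_rep KT (V_fixed v n (ch k) m)" if k: "k < nb"
  proof -
    have "\<exists>t. runit t \<and> unit_char k t * unit_char k t \<noteq> 1"
    proof (cases "m = 1")
      case True
      then show ?thesis using ne k Q by blast
    next
      case False
      then show ?thesis using big m1 by simp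
    qed
    then show ?thesis using irreducible_model_rep(1)[OF irr_level_space[OF primitive_hom_unit_char m1]] V_ch(2)[OF m1] by metis
  qed
  show "\<not> rep_iso KT (V_fixed v n (ch i) m) (V_fixed v n (ch k) m)"
    if ik: "i < nb" "k < nb" "i \<noteq> k" and ni: "\<not> (m = 1 \<and> 4 dvd n \<and> inverse_on_units v (ch i) (ch k))"
  proof -
    have "\<exists>t. runit t \<and> unit_char k t * unit_char i t \<noteq> 1"
    proof (cases "m = 1")
      case m: True
      show ?thesis
      proof (rule ccontr)
        assume "\<not> ?thesis"
        then have all: "\<And>t. runit t \<Longrightarrow> unit_char k t * unit_char i t = 1" by blast
        then have "inverse_on_units v (ch i) (ch k)"
          using inverse_iff[OF restricts_ch restricts_ch] by (simp add: mult.commute)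
        then have n4: "\<not> 4 dvd n" using ni m by blast
        have odd: "odd nb"
        proof (cases "odd n")
          case False
          then obtain j where j: "n = 2 * j" by auto
          then show ?thesis using n4 by (auto simp: nbar_def elim!: evenE)
        qed (simp add: nbar_def)
        \<comment> \<open>The inverse of 2 modulo the odd number \<open>nb\<close>. Then s is half
          of i + k, and the square of the s-th character is the product of the i-th and the k-th
          one, hence trivial, against the assumption that no member is quadratic.\<close>
        define h where "h = (nb + 1) div 2"
        have h: "2 * h = nb + 1" using odd by (simp add: h_def)
        define s where "s = ((i + k) * h) mod nb"
        have "(s + s) mod nb = (2 * ((i + k) * h)) mod nb" by (simp add: s_def mod_add_eq mult_2)
        also have "2 * ((i + k) * h) = (i + k) * (2 * h)" by simp
        also have "(i + k) * (2 * h) = (i + k) + nb * (i + k)" by (simp add: h)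
        finally have sm: "(s + s) mod nb = (i + k) mod nb" by simp
        have "unit_char s t * unit_char s t = 1" if t: "runit t" for t
          using unit_char_prod[of s t s] unit_char_prod[of k t i] all[OF t] theta_mod[OF t sm] by simp
        moreover have "s < nb" using nb_pos by (simp add: s_def)
        ultimately show False using ne m Q by blast
      qed
    next
      case False
      then show ?thesis using big m1 by simp
    qed
    then obtain t where t: "runit t" "unit_char k t * unit_char i t \<noteq> 1" by blast
    obtain s where s: "runit s" "unit_char k s \<noteq> unit_char i s" using unit_char_distinct[OF ik(2,1)] ik(3) by auto
    show ?thesis using depth_zero_not_iso[OF t s] V_ch(2)[OF m1] by simp
  qed
qed

text \<open>With a quadratic base the product of the i-th and k-th characters on units is the power
  2(i + k) of \<open>theta\<close>, trivial exactly if \<open>nb\<close> divides i + k. Taking i = k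
  gives the reducible members, taking i and k distinct the isomorphic pairs.\<close>

lemma exceptional_case:
  assumes m: "m = 1" and k0: "k0 < nb" and q: "quadratic_on_units v (ch k0)"
  defines "W \<equiv> \<lambda>k. V_fixed v n (char_ext v \<pi> n (ch k0) k) 1"
  shows "k < nb \<Longrightarrow> reducible KT (W k) \<longleftrightarrow> nb dvd 2 * k"
    "k < nb \<Longrightarrow> nb dvd 2 * k \<Longrightarrow> two_irreducible_constituents KT (W k)"
    "i < nb \<Longrightarrow> k < nb \<Longrightarrow> i \<noteq> k \<Longrightarrow> rep_iso KT (W i) (W k) \<longleftrightarrow> i + k = nb"
proof -
  have rs: "restricts_to (char_ext v \<pi> n (ch k0) k) (unit_char (k0 + k))" for k
  proof -
    have "(\<lambda>t. unit_char k0 t * theta t ^ (2 * k)) = unit_char (k0 + k)" by (simp add: unit_char_def fun_eq_iff distrib_left power_add mult.assoc)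
    then show ?thesis using restricts_to_char_ext[OF restricts_ch, of k0 k] by simp
  qed
  have W: "W k = model_rep (level_space (unit_char (k0 + k)) 1)" for k unfolding W_def using V_eq_model_rep(2)[OF rs unit_hom_unit_char] by simp
  have uc: "unit_hom (unit_char j) 1" and pc: "primitive_hom (unit_char j) 1" for j using unit_hom_unit_char primitive_hom_unit_char m by auto
  have qq: "unit_char k0 t * unit_char k0 t = 1" if "runit t" for t using q quadratic_iff[OF restricts_ch] that by blast
  have pr: "unit_char (k0 + k) t * unit_char (k0 + i) t = theta t ^ (2 * (i + k))" if "runit t" for k i t
  proof -
    have "unit_char (k0 + k) t * unit_char (k0 + i) t = (unit_char k0 t * unit_char k0 t) * theta t ^ (2 * (i + k))"
      by (simp add: unit_char_def distrib_left power_add mult_ac)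
    then show ?thesis using qq[OF that] by simp
  qed
  have pr1: "(\<forall>t. runit t \<longrightarrow> unit_char (k0 + k) t * unit_char (k0 + i) t = 1) \<longleftrightarrow> nb dvd i + k" for k i
    using pr[of _ k i] theta_double_trivial[of "i + k"] by auto
  have two: "two_irreducible_constituents KT (W k) \<and> reducible KT (W k)" if d: "nb dvd 2 * k" for k
  proof -
    have "\<And>t. runit t \<Longrightarrow> unit_char (k0 + k) t * unit_char (k0 + k) t = 1" using pr1[of k k] d by (simp add: mult_2)
    then obtain P Q where PQ: "irr_model P" "irr_model Q" "P \<subseteq> level_space (unit_char (k0 + k)) 1" "Q \<subseteq> level_space (unit_char (k0 + k)) 1" "P \<inter> Q = {0}"
      "\<forall>F\<in>level_space (unit_char (k0 + k)) 1. \<exists>A\<in>P. \<exists>B\<in>Q. F = A + B"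
      using quadratic_decomp[OF uc, of "k0 + k"] by blast
    then show ?thesis unfolding W using two_constituents_model_rep[OF stab_level_space PQ(3-5) _ PQ(1,2)] by blast
  qed
  show "two_irreducible_constituents KT (W k)" if "nb dvd 2 * k" using two[OF that] by blast
  show "reducible KT (W k) \<longleftrightarrow> nb dvd 2 * k" if k: "k < nb"
  proof
    assume r: "reducible KT (W k)"
    show "nb dvd 2 * k"
    proof (rule ccontr)
      assume "\<not> nb dvd 2 * k"
      then obtain t where "runit t" "unit_char (k0 + k) t * unit_char (k0 + k) t \<noteq> 1" using pr1[of k k] by (auto simp: mult_2)
      then show False using r irreducible_model_rep(2)[OF irr_level_space[OF pc]] W by simp
    qed
  qed (use two in blast)
  show "rep_iso KT (W i) (W k) \<longleftrightarrow> i + k = nb" if ik: "i < nb" "k < nb" "i \<noteq> k"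
  proof -
    \<comment> \<open>Distinct indices below \<open>nb\<close> have a sum strictly between 0 and 2
      \<open>nb\<close>, so \<open>nb\<close> itself is the only multiple available.\<close>
    have dv: "nb dvd i + k \<longleftrightarrow> i + k = nb"
    proof
      assume "nb dvd i + k"
      then obtain c where c: "i + k = nb * c" by (elim dvdE)
      have "c \<noteq> 0" using c ik by (cases c) auto
      moreover have "nb * c < nb * 2" using c ik by linarith
      then have "c < 2" using nb_pos by simp
      ultimately show "i + k = nb" using c by (cases "c = 1") auto
    qed simp
    obtain s where s: "runit s" "unit_char (k0 + k) s \<noteq> unit_char (k0 + i) s"
    proof -
      obtain s where s: "runit s" "unit_char k s \<noteq> unit_char i s" using unit_char_distinct[OF ik(2,1)] ik(3) by auto
      then have "theta s ^ (2 * k) \<noteq> theta s ^ (2 * i)" by (auto simp: unit_char_def)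
      moreover have "unit_char (k0 + j) s = unit_char k0 s * theta s ^ (2 * j)" for j by (simp add: unit_char_def distrib_left power_add)
      ultimately have "unit_char (k0 + k) s \<noteq> unit_char (k0 + i) s" using unit_hom_nz[OF unit_hom_unit_char s(1)] by simp
      then show ?thesis using that s by blast
    qed
    show ?thesis
    proof
      assume iso: "rep_iso KT (W i) (W k)"
      show "i + k = nb"
      proof (rule ccontr)
        assume "i + k \<noteq> nb"
        then obtain t where t: "runit t" "unit_char (k0 + k) t * unit_char (k0 + i) t \<noteq> 1" using pr1[of k i] dv by blast
        show False using depth_zero_not_iso[OF t s] iso W m by simp
      qed
    next
      assume "i + k = nb"
      then have one: "unit_char (k0 + k) t * unit_char (k0 + i) t = 1" if "runit t" for t using pr1[of k i] dv that by blast
      have inv: "unit_char (k0 + k) t = inverse (unit_char (k0 + i) t)" if "runit t" for t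
        using one[OF that] by (metis inverse_unique mult.commute)
      \<comment> \<open>Two inverse characters that differ at s cannot be 1 there; this supplies the
        nontriviality needed for \<open>intertwine_iso\<close>.\<close>
      have "unit_char (k0 + i) s \<noteq> 1" using s inv[OF s(1)] by auto
      then show "rep_iso KT (W i) (W k)"
        unfolding W by (intro rep_iso_model_rep[OF stab_level_space stab_level_space equivariant_intertwine] intertwine_iso[OF uc uc inv s(1)])
    qed
  qed
qed

end

theorem theorem2:
  fixes v :: "'a::field \<Rightarrow> int" and \<pi> :: 'a and n m :: nat
    and \<epsilon> :: "'a \<Rightarrow> complex"
    and \<rho> :: "('a cov, 'v::complex_vector) rep"
    and chi chi0 :: "'a cov \<Rightarrow> complex"
  assumes "nonarch_local_field v"
    and "odd (residue_card v)"
    and "\<pi> \<noteq> 0" and "v \<pi> = 1"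
    and "n \<ge> 2" and "n dvd residue_card v - 1"
    and "faithful_char n \<epsilon>"
    and "irreducible_rep (tilde v n T1) \<rho>" and "smooth_rep v T1 \<rho>" and "genuine n \<epsilon> \<rho>"
    and "has_central_char v n \<rho> chi"
    and "primitive_mod v n chi m"
    and "extends_to_A1 v n chi chi0"
  shows
    "(\<exists>(Wp :: nat \<Rightarrow> ('a cov, 'a cov \<Rightarrow> complex) rep)
       (Wm :: nat \<Rightarrow> ('a cov, 'a cov \<Rightarrow> complex) rep).
        (\<forall>l>m.
           irreducible_rep (tilde v n (K1 v)) (Wp l) \<and>
           irreducible_rep (tilde v n (K1 v)) (Wm l) \<and>
           \<not> rep_iso (tilde v n (K1 v)) (Wp l) (Wm l) \<and>
           complex_vector.dim (rspace (Wp l)) = complex_vector.dim (rspace (Wm l)) \<and>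
           rep_iso_quotient (tilde v n (K1 v)) (Wp l \<oplus>\<^sub>R Wm l)
             (V_fixed v n (char_ext v \<pi> n chi0 0) l)
             (rspace (V_fixed v n (char_ext v \<pi> n chi0 0) (l - 1)))) \<and>
        rep_iso (tilde v n (K1 v))
          (ind v n SL2 B1 (inflate \<rho>))
          (rep_dsum {..<nbar n} (\<lambda>k. V_fixed v n (char_ext v \<pi> n chi0 k) m) \<oplus>\<^sub>R
           rep_dsum {m<..} (\<lambda>l. rep_dsum {..<nbar n} (\<lambda>_. Wp l \<oplus>\<^sub>R Wm l))))
     \<and>
     (\<not> (m = 1 \<and> (\<exists>k<nbar n. quadratic_on_units v (char_ext v \<pi> n chi0 k))) \<longrightarrow>
        (\<forall>k<nbar n.
           irreducible_rep (tilde v n (K1 v)) (V_fixed v n (char_ext v \<pi> n chi0 k) m)) \<and>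
        (\<forall>i<nbar n. \<forall>k<nbar n. i \<noteq> k \<longrightarrow>
           \<not> (m = 1 \<and> 4 dvd n \<and>
              inverse_on_units v (char_ext v \<pi> n chi0 i) (char_ext v \<pi> n chi0 k)) \<longrightarrow>
           \<not> rep_iso (tilde v n (K1 v))
               (V_fixed v n (char_ext v \<pi> n chi0 i) m)
               (V_fixed v n (char_ext v \<pi> n chi0 k) m)))
     \<and>
     (\<forall>k\<^sub>0<nbar n. m = 1 \<and> quadratic_on_units v (char_ext v \<pi> n chi0 k\<^sub>0) \<longrightarrow>
        (let V = (\<lambda>k. V_fixed v n (char_ext v \<pi> n (char_ext v \<pi> n chi0 k\<^sub>0) k) 1) in
           (\<not> 4 dvd n \<longrightarrow>
              (\<forall>k<nbar n.
                 (reducible (tilde v n (K1 v)) (V k) \<longleftrightarrow> k = 0) \<and>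
                 (k = 0 \<longrightarrow> two_irreducible_constituents (tilde v n (K1 v)) (V k))) \<and>
              (\<forall>i<nbar n. \<forall>k<nbar n. i \<noteq> k \<longrightarrow>
                 (rep_iso (tilde v n (K1 v)) (V i) (V k) \<longleftrightarrow> i + k = nbar n))) \<and>
           (4 dvd n \<longrightarrow>
              (\<forall>k<nbar n.
                 (reducible (tilde v n (K1 v)) (V k) \<longleftrightarrow> k = 0 \<or> k = n div 4) \<and>
                 (k = 0 \<or> k = n div 4 \<longrightarrow>
                    two_irreducible_constituents (tilde v n (K1 v)) (V k))) \<and>
              (\<forall>i<nbar n. \<forall>k<nbar n. i \<noteq> k \<longrightarrow>
                 (rep_iso (tilde v n (K1 v)) (V i) (V k) \<longleftrightarrow> i + k = nbar n)))))"
proof -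
  interpret nonarch_local_field v by fact
  interpret principal_datum v n \<pi> \<epsilon> \<rho> chi chi0 m
    by unfold_locales (use assms in auto)
  let ?Wp = "\<lambda>l. model_rep (Wp l)" and ?Wm = "\<lambda>l. model_rep (Wm l)"
  have layers: "irreducible_rep KT (?Wp l) \<and> irreducible_rep KT (?Wm l) \<and> \<not> rep_iso KT (?Wp l) (?Wm l) \<and>
      complex_vector.dim (rspace (?Wp l)) = complex_vector.dim (rspace (?Wm l)) \<and>
      rep_iso_quotient KT (?Wp l \<oplus>\<^sub>R ?Wm l) (V_fixed v n (ch 0) l) (rspace (V_fixed v n (ch 0) (l - 1)))"
    if l: "l > m" for l
  proof -
    have lv: "unit_hom (unit_char 0) (l - 1)" "l \<ge> 2" using level[OF l] by auto
    show ?thesis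
      using irreducible_model_rep(1)[OF irr_half_layer[OF lv \<sigma>0(1)]] irreducible_model_rep(1)[OF irr_half_layer[OF lv \<sigma>0(2)]]
        W_not_iso[OF l] W_dim[OF l] layer_quotient[OF l] by simp
  qed
  \<comment> \<open>Translates the uniform criterion into the two cases of the statement. As k is
    below \<open>nbar n\<close>, the quotient of 2k by it is 0 or 1, and 1 means that
    \<open>nbar n\<close> is even, that is, 4 divides n and k is a quarter of n.\<close>
  have even_half: "nbar n dvd 2 * k \<longleftrightarrow> k = 0 \<or> (4 dvd n \<and> k = n div 4)" if k: "k < nbar n" for k
  proof
    assume "nbar n dvd 2 * k"
    then obtain c where c: "2 * k = nbar n * c" by (elim dvdE)
    have "nbar n * c < nbar n * 2" using c k by linarith
    then have c2: "c < 2" using nb_pos by simp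
    show "k = 0 \<or> (4 dvd n \<and> k = n div 4)"
    proof (cases "c = 0")
      case False
      then have e: "2 * k = nbar n" using c c2 by (cases "c = 1") auto
      then have "even (nbar n)" by (metis dvd_triv_left)
      then have "even n" by (auto simp: nbar_def split: if_splits)
      then have "n = 4 * k" using e by (auto simp: nbar_def elim!: evenE)
      then show ?thesis by simp
    qed (use c in simp)
  qed (auto simp: nbar_def elim!: dvdE)
  have all_layers: "\<forall>l>m. irreducible_rep KT (?Wp l) \<and> irreducible_rep KT (?Wm l) \<and> \<not> rep_iso KT (?Wp l) (?Wm l) \<and>
      complex_vector.dim (rspace (?Wp l)) = complex_vector.dim (rspace (?Wm l)) \<and>
      rep_iso_quotient KT (?Wp l \<oplus>\<^sub>R ?Wm l) (V_fixed v n (ch 0) l) (rspace (V_fixed v n (ch 0) (l - 1)))"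
    by (intro allI impI layers)
  show ?thesis
  proof (intro conjI)
    show "\<exists>(Wp :: nat \<Rightarrow> ('a cov, 'a cov \<Rightarrow> complex) rep) (Wm :: nat \<Rightarrow> ('a cov, 'a cov \<Rightarrow> complex) rep).
        (\<forall>l>m. irreducible_rep KT (Wp l) \<and> irreducible_rep KT (Wm l) \<and> \<not> rep_iso KT (Wp l) (Wm l) \<and>
           complex_vector.dim (rspace (Wp l)) = complex_vector.dim (rspace (Wm l)) \<and>
           rep_iso_quotient KT (Wp l \<oplus>\<^sub>R Wm l) (V_fixed v n (ch 0) l) (rspace (V_fixed v n (ch 0) (l - 1)))) \<and>
        rep_iso KT (ind v n SL2 B1 (inflate \<rho>))
          (rep_dsum {..<nbar n} (\<lambda>k. V_fixed v n (ch k) m) \<oplus>\<^sub>R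
           rep_dsum {m<..} (\<lambda>l. rep_dsum {..<nbar n} (\<lambda>_. Wp l \<oplus>\<^sub>R Wm l)))"
      by (rule exI[of _ ?Wp], rule exI[of _ ?Wm], rule conjI[OF all_layers Ind_iso])
    show "\<not> (m = 1 \<and> (\<exists>k<nbar n. quadratic_on_units v (ch k))) \<longrightarrow>
        (\<forall>k<nbar n. irreducible_rep KT (V_fixed v n (ch k) m)) \<and>
        (\<forall>i<nbar n. \<forall>k<nbar n. i \<noteq> k \<longrightarrow> \<not> (m = 1 \<and> 4 dvd n \<and> inverse_on_units v (ch i) (ch k)) \<longrightarrow>
           \<not> rep_iso KT (V_fixed v n (ch i) m) (V_fixed v n (ch k) m))"
      using generic_case by blast
  qed (use exceptional_case even_half in \<open>auto simp: Let_def\<close>)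
qed

end
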